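(* Let $\alpha\in(0,1]$, let $c,\varepsilon\in\mathbb{R}$ with $|\varepsilon|<1$, and let $0<\delta<1$. Let $\Omega=\{(x,y)\in\mathbb{R}^2: 0<x<1,\ -\pi<y<\pi\}$. Let $\varphi\in C^{2+\delta}[-\pi,\pi]$ and $\psi\in C^{1+\delta}[-\pi,\pi]$ satisfy $\varphi(-\pi)=\varphi(\pi)=0$ and $\psi(-\pi)=\psi(\pi)=0$. Then there exists a unique regular solution $u$ of $$D_x^\alpha D_x^\alpha u(x,y)+u_{yy}(x,y)-\varepsilon u_{yy}(x,-y)-c^2u(x,y)=0,\quad (x,y)\in\Omega,$$ satisfying $$u(0,y)=\varphi(y),\quad u(1,y)=\psi(y),\quad -\pi\le y\le\pi,$$ $$u(x,-\pi)=u(x,\pi)=0,\quad 0\le x\le 1,$$ and it can be written in the form $$u(x,y)=\sum_{k=1}^\infty\left[\varphi_{2k-1}C_{\mu_{2k-1}}(x)+\psi_{2k-1}S_{\mu_{2k-1}}(x)\right]Y_{2k-1}(y)+\sum_{k=1}^\infty\left[\varphi_{2k}C_{\mu_{2k}}(x)+\psi_{2k}S_{\mu_{2k}}(x)\right]Y_{2k}(y).$$ Here, for $k=1,2,\dots$, $Y_{2k-1}(y)=\sin ky$, $Y_{2k}(y)=\cos\left(k-\tfrac12\right)y$, $\lambda_{2k-1}=(1+\varepsilon)k^2$, $\lambda_{2k}=(1-\varepsilon)\left(k-\tfrac12\right)^2$; and for every index $n\geq 1$, $\mu_n=\sqrt{\lambda_n+c^2}$, while $\varphi_n,\psi_n$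 are the Fourier coefficients of $\varphi,\psi$ with respect to $Y_n$.
   Context: $D_x^\alpha$ is the Caputo derivative in $x$ of order $\alpha$: for $0<\alpha<1$, $D_x^\alpha u(x,y)=\frac{1}{\Gamma(1-\alpha)}\int_0^x (x-s)^{-\alpha}\frac{\partial u}{\partial s}(s,y)\,ds$, and $D_x^1=\partial/\partial x$. A regular solution of the equation is a function $u\in C(\bar\Omega)$ such that $D_x^\alpha u,\ D_x^\alpha D_x^\alpha u,\ u_{yy}\in C(\Omega)$ and the equation holds in $\Omega$. $C^{m+\delta}[-\pi,\pi]$ is the Hölder space of $m$ times continuously differentiable functions whose $m$-th derivative is Hölder continuous with exponent $\delta$. The Fourier coefficient of $f$ with respect to $Y_n$ is $f_n=\left(\int_{-\pi}^{\pi}f(y)Y_n(y)\,dy\right)\big/\left(\int_{-\pi}^{\pi}Y_n(y)^2\,dy\right)$. The Mittag-Leffler type function is $E_{\alpha,\beta}(z)=\sum_{k=0}^\infty\frac{z^k}{\Gamma(\alpha k+\beta)}$. For $\mu>0$ and $t\in[0,1]$, $$C_\mu(t)=\frac{E_{\alpha,1}(\mu)E_{\alpha,1}(-\mu t^\alpha)-E_{\alpha,1}(-\mu)E_{\alpha,1}(\mu t^\alpha)}{2\mu E_{2\alpha,\alpha+1}(\mu^2)},\qquad S_\mu(t)=\frac{t^\alpha E_{2\alpha,\alpha+1}(\mu^2t^{2\alpha})}{E_{2\alpha,\alpha+1}(\mu^2)}.$$ *)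

theory Defs
  imports "HOL-Analysis.Analysis"
begin

definition Omega :: "(real \<times> real) set" where
  "Omega = {0<..<1} \<times> {-pi<..<pi}"

text \<open>
  The Caputo derivative with base point 0, on functions of one variable. For order below 1 it
  exists at \<open>x\<close> if the function is differentiable on \<open>(0, x)\<close> and the defining integral converges
  as a Lebesgue integral; order 1 is the ordinary derivative.
\<close>

definition caputo_exists :: "real \<Rightarrow> (real \<Rightarrow> real) \<Rightarrow> real \<Rightarrow> bool" where
  "caputo_exists \<alpha> g x \<longleftrightarrow>
     (if \<alpha> = 1 then g differentiable (at x)
      else (\<forall>s\<in>{0<..<x}. g differentiable (at s)) \<and>
           set_integrable lborel {0<..<x} (\<lambda>s. (x - s) powr (-\<alpha>) * deriv g s))"

definition caputo :: "real \<Rightarrow> (real \<Rightarrow> real) \<Rightarrow> real \<Rightarrow> real" where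
  "caputo \<alpha> g x =
     (if \<alpha> = 1 then deriv g x
      else 1 / Gamma (1 - \<alpha>) * (LBINT s:{0<..<x}. (x - s) powr (-\<alpha>) * deriv g s))"

definition caputo_x_exists :: "real \<Rightarrow> (real \<times> real \<Rightarrow> real) \<Rightarrow> real \<times> real \<Rightarrow> bool" where
  "caputo_x_exists \<alpha> u = (\<lambda>(x, y). caputo_exists \<alpha> (\<lambda>s. u (s, y)) x)"

definition caputo_x :: "real \<Rightarrow> (real \<times> real \<Rightarrow> real) \<Rightarrow> real \<times> real \<Rightarrow> real" where
  "caputo_x \<alpha> u = (\<lambda>(x, y). caputo \<alpha> (\<lambda>s. u (s, y)) x)"

definition partial_yy_exists :: "(real \<times> real \<Rightarrow> real) \<Rightarrow> real \<times> real \<Rightarrow> bool" where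
  "partial_yy_exists u = (\<lambda>(x, y). (\<lambda>t. u (x, t)) differentiable (at y) \<and>
                                   deriv (\<lambda>t. u (x, t)) differentiable (at y))"

definition partial_yy :: "(real \<times> real \<Rightarrow> real) \<Rightarrow> real \<times> real \<Rightarrow> real" where
  "partial_yy u = (\<lambda>(x, y). deriv (deriv (\<lambda>t. u (x, t))) y)"

definition regular_solution :: "real \<Rightarrow> real \<Rightarrow> real \<Rightarrow> (real \<times> real \<Rightarrow> real) \<Rightarrow> bool" where
  "regular_solution \<alpha> \<epsilon> c u \<longleftrightarrow>
     continuous_on (closure Omega) u \<and>
     (\<forall>p\<in>Omega. caputo_x_exists \<alpha> u p) \<and>
     continuous_on Omega (caputo_x \<alpha> u) \<and>
     (\<forall>p\<in>Omega. caputo_x_exists \<alpha> (caputo_x \<alpha> u) p) \<and>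
     continuous_on Omega (caputo_x \<alpha> (caputo_x \<alpha> u)) \<and>
     (\<forall>p\<in>Omega. partial_yy_exists u p) \<and>
     continuous_on Omega (partial_yy u) \<and>
     (\<forall>(x, y)\<in>Omega.
        caputo_x \<alpha> (caputo_x \<alpha> u) (x, y) + partial_yy u (x, y)
          - \<epsilon> * partial_yy u (x, - y) - c\<^sup>2 * u (x, y) = 0)"

definition boundary_conditions ::
    "(real \<Rightarrow> real) \<Rightarrow> (real \<Rightarrow> real) \<Rightarrow> (real \<times> real \<Rightarrow> real) \<Rightarrow> bool" where
  "boundary_conditions \<phi> \<psi> u \<longleftrightarrow>
     (\<forall>y\<in>{-pi..pi}. u (0, y) = \<phi> y \<and> u (1, y) = \<psi> y) \<and>
     (\<forall>x\<in>{0..1}. u (x, -pi) = 0 \<and> u (x, pi) = 0)"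

text \<open>
  The Hoelder space \<open>C\<close> with exponent \<open>m + \<delta>\<close> on \<open>[a, b]\<close>; derivatives are one-sided at the
  endpoints, and \<open>D i\<close> is the \<open>i\<close>-th derivative. Values outside \<open>[a, b]\<close> are irrelevant.
\<close>

definition holder_space :: "nat \<Rightarrow> real \<Rightarrow> real \<Rightarrow> real \<Rightarrow> (real \<Rightarrow> real) set" where
  "holder_space m \<delta> a b =
     {f. \<exists>D :: nat \<Rightarrow> real \<Rightarrow> real.
        (\<forall>x\<in>{a..b}. D 0 x = f x) \<and>
        (\<forall>i<m. \<forall>x\<in>{a..b}. (D i has_real_derivative D (Suc i) x) (at x within {a..b})) \<and>
        continuous_on {a..b} (D m) \<and>
        (\<exists>K. \<forall>x\<in>{a..b}. \<forall>y\<in>{a..b}. \<bar>D m x - D m y\<bar> \<le> K * \<bar>x - y\<bar> powr \<delta>)}"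

definition mittag_leffler :: "real \<Rightarrow> real \<Rightarrow> real \<Rightarrow> real" where
  "mittag_leffler \<alpha> \<beta> z = (\<Sum>k. z ^ k / Gamma (\<alpha> * real k + \<beta>))"

definition C_fun :: "real \<Rightarrow> real \<Rightarrow> real \<Rightarrow> real" where
  "C_fun \<alpha> \<mu> t =
     (mittag_leffler \<alpha> 1 \<mu> * mittag_leffler \<alpha> 1 (- \<mu> * t powr \<alpha>)
        - mittag_leffler \<alpha> 1 (- \<mu>) * mittag_leffler \<alpha> 1 (\<mu> * t powr \<alpha>))
     / (2 * \<mu> * mittag_leffler (2 * \<alpha>) (\<alpha> + 1) (\<mu>\<^sup>2))"

definition S_fun :: "real \<Rightarrow> real \<Rightarrow> real \<Rightarrow> real" where
  "S_fun \<alpha> \<mu> t =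
     t powr \<alpha> * mittag_leffler (2 * \<alpha>) (\<alpha> + 1) (\<mu>\<^sup>2 * t powr (2 * \<alpha>))
     / mittag_leffler (2 * \<alpha>) (\<alpha> + 1) (\<mu>\<^sup>2)"

text \<open>
  The families below are used for indices \<open>n \<ge> 1\<close>: \<open>n = 2 * k - 1\<close> and \<open>n = 2 * k\<close> with
  \<open>k \<ge> 1\<close>. The lemmas after the definitions give the values in terms of \<open>k\<close>.
\<close>

definition Y :: "nat \<Rightarrow> real \<Rightarrow> real" where
  "Y n y = (if odd n then sin (real ((n + 1) div 2) * y)
            else cos ((real (n div 2) - 1/2) * y))"

definition eigval :: "real \<Rightarrow> nat \<Rightarrow> real" where
  "eigval \<epsilon> n = (if odd n then (1 + \<epsilon>) * (real ((n + 1) div 2))\<^sup>2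
                 else (1 - \<epsilon>) * (real (n div 2) - 1/2)\<^sup>2)"

lemma Y_odd: "k \<ge> 1 \<Longrightarrow> Y (2 * k - 1) y = sin (real k * y)"
  by (simp add: Y_def)

lemma Y_even: "Y (2 * k) y = cos ((real k - 1/2) * y)"
  by (simp add: Y_def)

lemma eigval_odd: "k \<ge> 1 \<Longrightarrow> eigval \<epsilon> (2 * k - 1) = (1 + \<epsilon>) * (real k)\<^sup>2"
  by (simp add: eigval_def)

lemma eigval_even: "eigval \<epsilon> (2 * k) = (1 - \<epsilon>) * (real k - 1/2)\<^sup>2"
  by (simp add: eigval_def)

definition mu :: "real \<Rightarrow> real \<Rightarrow> nat \<Rightarrow> real" where
  "mu \<epsilon> c n = sqrt (eigval \<epsilon> n + c\<^sup>2)"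

definition fourier_coeff :: "(real \<Rightarrow> real) \<Rightarrow> nat \<Rightarrow> real" where
  "fourier_coeff f n =
     integral {-pi..pi} (\<lambda>y. f y * Y n y) / integral {-pi..pi} (\<lambda>y. (Y n y)\<^sup>2)"

definition series_term ::
    "real \<Rightarrow> real \<Rightarrow> real \<Rightarrow> (real \<Rightarrow> real) \<Rightarrow> (real \<Rightarrow> real) \<Rightarrow> real \<Rightarrow> real \<Rightarrow> nat \<Rightarrow> real" where
  "series_term \<alpha> \<epsilon> c \<phi> \<psi> x y n =
     (fourier_coeff \<phi> n * C_fun \<alpha> (mu \<epsilon> c n) x + fourier_coeff \<psi> n * S_fun \<alpha> (mu \<epsilon> c n) x) * Y n y"

end

theory Submission
  imports Defs "HOL-Real_Asymp.Real_Asymp"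
begin

text \<open>
  Separation of variables in the basis \<open>Y\<close> turns the equation into the fractional equations
  \<open>D\<^sup>\<alpha> D\<^sup>\<alpha> X = \<mu>\<^sup>2 X\<close>, solved by the Mittag-Leffler functions of \<open>\<plusminus> \<mu> x\<^sup>\<alpha>\<close>. Their series may be
  differentiated termwise because \<open>E\<^sub>\<alpha>(- \<mu> x\<^sup>\<alpha>)\<close> decays and \<open>E\<^sub>\<alpha>(\<mu> x\<^sup>\<alpha>) / E\<^sub>\<alpha>(\<mu>)\<close> is small for \<open>x < 1\<close>.

  For uniqueness, the even and odd parts in \<open>y\<close> of a difference of two solutions decouple. Each
  part satisfies \<open>w = A(y) x\<^sup>\<alpha> / \<Gamma>(\<alpha> + 1) + I\<^sup>2\<^sup>\<alpha> D D w\<close>. A regular solution is controlled only inside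
  the domain, so neither \<open>w\<^sub>y\<close> on the boundary nor \<open>I\<^sup>2\<^sup>\<alpha> w\<^sub>y\<^sub>y\<close> can be used directly: the equation is
  tested against sine functions on \<open>[-b, b]\<close> and \<open>b\<close> tends to \<open>\<pi>\<close>, where a barrier in powers of \<open>x\<close>
  gives the needed uniform decay at \<open>x = 0\<close>. The limit is a homogeneous Volterra equation for each
  sine coefficient, with the condition at \<open>x = 1\<close> removing the term in \<open>x\<^sup>\<alpha>\<close>.
\<close>

section \<open>Fractional integrals\<close>

text \<open>For order below 1, E(-z) decays only like 1/z, so E(-\<mu> x^\<alpha>) gains a single
  power of the rate. The double Caputo derivative and the second y-derivative cost two powers, so
  the coefficients of \<phi> must stay summable after multiplication by the rate; two classical
  derivatives and Bessel's inequality give this. The quotient by E(\<mu>) absorbs two powers at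
  interior x, so plain summability of the coefficients of \<psi> suffices. In the uniqueness part
  order 1 is settled by a maximum principle. Below 1, fractional integration of order 2 - 2\<alpha>
  makes the equation second-order in x, which leaves an affine ambiguity; its linear term
  corresponds to x^(2\<alpha> - 1). For fixed y the bound O(x^\<alpha>) excludes it, but the
  constant depends on y, and integration over y needs a majorant. Hence the exponent 2\<alpha> - 1
  of the barrier. Second differences on [p, r] with p > 0 replace x-derivatives and keep all
  interchanges of integrals in compact subsets of the domain.\<close>

definition kern :: "real \<Rightarrow> real \<Rightarrow> real" where
  "kern a x = (if 0 < x then x powr (a - 1) / Gamma a else 0)"

text \<open>The Riemann-Liouville integral based at 0. As a Lebesgue integral it has the value 0
  when the integrand is not integrable, so integrability is tracked by a separate predicate.\<close>

definition frac_int :: "real \<Rightarrow> (real \<Rightarrow> real) \<Rightarrow> real \<Rightarrow> real" where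
  "frac_int a f x = (LBINT t:{0<..<x}. kern a (x - t) * f t)"

definition frac_intble :: "real \<Rightarrow> (real \<Rightarrow> real) \<Rightarrow> real \<Rightarrow> bool" where
  "frac_intble a f x \<longleftrightarrow> set_integrable lborel {0<..<x} (\<lambda>t. kern a (x - t) * f t)"

section \<open>Kernels of fractional integration and their semigroup law\<close>

lemma kern_measurable [measurable]: "kern a \<in> borel_measurable borel"
  unfolding kern_def by measurable

lemma kern_pos: "a > 0 \<Longrightarrow> x > 0 \<Longrightarrow> kern a x > 0"
  by (simp add: kern_def)

lemma kern_nonneg: "a > 0 \<Longrightarrow> kern a x \<ge> 0"
  by (simp add: kern_def)

lemma kern_nonpos_arg [simp]: "x \<le> 0 \<Longrightarrow> kern a x = 0"
  by (simp add: kern_def)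

lemma kern_1: "x > 0 \<Longrightarrow> kern 1 x = 1"
  by (simp add: kern_def)

lemma kern_2: "x > 0 \<Longrightarrow> kern 2 x = x"
  by (simp add: kern_def Gamma_numeral)

text \<open>The substitution s = t + (x - t) u reduces the convolution to a Beta integral. The
  nonnegative integral is used so that integrability and value follow together; as
  \<open>kern\<close> vanishes for nonpositive arguments, the integral may run over the whole
  line.\<close>

lemma kern_convolution:
  assumes a: "a > 0" and b: "b > 0"
  shows "(\<integral>\<^sup>+ s. ennreal (kern a (x - s) * kern b (s - t)) \<partial>lborel) = ennreal (kern (a + b) (x - t))"
proof (cases "t < x")
  case False
  have zero: "(\<lambda>s. kern a (x - s) * kern b (s - t)) = (\<lambda>s. 0)"
  proof
    show "kern a (x - s) * kern b (s - t) = 0" for s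
      using False by (cases "s < x") auto
  qed
  show ?thesis unfolding zero[THEN fun_cong] using False by simp
next
  case True
  define d where "d = x - t"
  have d: "d > 0" using True by (simp add: d_def)
  define C where "C = d powr (a + b - 2) / (Gamma a * Gamma b)"
  have C: "C \<ge> 0" using a b by (simp add: C_def)
  have beta: "((\<lambda>u. u powr (b - 1) * (1 - u) powr (a - 1)) has_integral Beta b a) {0..1}"
    by (rule has_integral_Beta_real[OF b a])
  have "((\<lambda>u. indicator {0..1} u * (u powr (b - 1) * (1 - u) powr (a - 1))) has_integral Beta b a) UNIV"
  proof -
    have *: "(\<lambda>u. indicator {0..1} u * (u powr (b - 1) * (1 - u) powr (a - 1)))
        = (\<lambda>u. if u \<in> {0..1} then u powr (b - 1) * (1 - u) powr (a - 1) else 0)"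
      by (auto simp: indicator_def)
    show ?thesis unfolding * using beta by (simp only: has_integral_restrict_UNIV)
  qed
  then have nb: "(\<integral>\<^sup>+ u. ennreal (indicator {0..1} u * (u powr (b - 1) * (1 - u) powr (a - 1))) \<partial>lborel) = ennreal (Beta b a)"
    by (intro nn_integral_has_integral_lborel) (auto simp: indicator_def)
  have eq: "kern a (x - (t + d * u)) * kern b (t + d * u - t)
     = C * (indicator {0..1} u * (u powr (b - 1) * (1 - u) powr (a - 1)))" for u
  proof (cases "0 < u \<and> u < 1")
    case True
    have 1: "x - (t + d * u) = d * (1 - u)" by (simp add: d_def algebra_simps)
    have "d powr (a - 1) * d powr (b - 1) = d powr (a + b - 2)"
      by (simp add: powr_add [symmetric] algebra_simps)
    moreover have "(d * (1 - u)) powr (a - 1) = d powr (a - 1) * (1 - u) powr (a - 1)"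
      "(d * u) powr (b - 1) = d powr (b - 1) * u powr (b - 1)"
      using True d by (auto intro!: powr_mult)
    ultimately show ?thesis using True d
      unfolding 1 C_def kern_def by (simp flip: \<open>d powr (a - 1) * d powr (b - 1) = d powr (a + b - 2)\<close>)
  next
    case False
    then consider "u \<le> 0" | "u \<ge> 1" by linarith
    then show ?thesis
    proof cases
      case 1
      then have "t + d * u - t \<le> 0" using d by (simp add: mult_nonneg_nonpos)
      then show ?thesis using 1 by (auto simp: indicator_def)
    next
      case 2
      have "d * 1 \<le> d * u" using 2 d by (intro mult_left_mono) auto
      then have "x - (t + d * u) \<le> 0" by (simp add: d_def)
      then show ?thesis using 2 by (auto simp: indicator_def)
    qed
  qed
  have "(\<integral>\<^sup>+ s. ennreal (kern a (x - s) * kern b (s - t)) \<partial>lborel)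
      = ennreal \<bar>d\<bar> * (\<integral>\<^sup>+ u. ennreal (kern a (x - (t + d * u)) * kern b (t + d * u - t)) \<partial>lborel)"
    by (rule nn_integral_real_affine) (use d in auto)
  also have "\<dots> = ennreal d * (\<integral>\<^sup>+ u. ennreal C * ennreal (indicator {0..1} u * (u powr (b - 1) * (1 - u) powr (a - 1))) \<partial>lborel)"
    unfolding eq using d C by (simp add: ennreal_mult' indicator_def)
  also have "\<dots> = ennreal d * (ennreal C * ennreal (Beta b a))"
    by (subst nn_integral_cmult) (auto simp: nb)
  also have "\<dots> = ennreal (d * (C * Beta b a))"
    using d C a b by (simp add: ennreal_mult' [symmetric] Beta_def)
  also have "d * (C * Beta b a) = kern (a + b) (x - t)"
  proof -
    have ga: "Gamma a \<noteq> 0" "Gamma b \<noteq> 0" using a b Gamma_real_pos[of a] Gamma_real_pos[of b] by linarith+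
    have "d * d powr (a + b - 2) = d powr (a + b - 1)"
      using d by (simp add: powr_mult_base)
    then show ?thesis using d ga
      by (simp add: kern_def d_def [symmetric] C_def Beta_def field_simps)
  qed
  finally show ?thesis .
qed

text \<open>Fubini: the inner fractional integral may be undefined on a null set, where it is 0.\<close>

lemma
  assumes a: "a > 0" and b: "b > 0" and f: "set_borel_measurable borel {0<..<x} f"
    and int: "frac_intble (a + b) f x"
  shows frac_intble_frac_int: "frac_intble a (frac_int b f) x"
    and frac_int_frac_int: "frac_int a (frac_int b f) x = frac_int (a + b) f x"
proof -
  define g where "g = (\<lambda>t. indicator {0<..<x} t * f t)"
  have g [measurable]: "g \<in> borel_measurable borel"
    using f by (simp add: set_borel_measurable_def g_def)
  define F where "F = (\<lambda>s t. kern a (x - s) * kern b (s - t) * g t)"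
  have F [measurable]: "case_prod F \<in> borel_measurable (lborel \<Otimes>\<^sub>M lborel)"
    unfolding F_def by measurable
  have ig: "integrable lborel (\<lambda>t. kern (a + b) (x - t) * g t)"
    using int unfolding frac_intble_def set_integrable_def g_def
    by (simp add: mult_ac)
  have inner: "has_bochner_integral lborel (\<lambda>s. kern a (x - s) * kern b (s - t)) (kern (a + b) (x - t))" for t
    using kern_convolution[OF a b, of x t] a b
    by (intro has_bochner_integral_nn_integral) (auto simp: kern_nonneg)
  have Fint: "integrable lborel (\<lambda>s. F s t)" for t
    unfolding F_def using inner[of t] by (auto simp: has_bochner_integral_iff)
  have Fval: "(\<integral>s. F s t \<partial>lborel) = kern (a + b) (x - t) * g t" for t
    unfolding F_def using inner[of t] by (auto simp: has_bochner_integral_iff)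
  have Fnorm: "(\<integral>s. norm (F s t) \<partial>lborel) = kern (a + b) (x - t) * norm (g t)" for t
  proof -
    have "norm (F s t) = kern a (x - s) * kern b (s - t) * norm (g t)" for s
      using a b by (simp add: F_def abs_mult kern_nonneg)
    then show ?thesis using inner[of t] by (auto simp: has_bochner_integral_iff)
  qed
  have "integrable lborel (\<lambda>t. norm (kern (a + b) (x - t) * g t))"
    using ig by simp
  then have i1: "integrable lborel (\<lambda>t. \<integral>s. norm (F s t) \<partial>lborel)"
    unfolding Fnorm using a b by (simp add: abs_mult kern_nonneg)
  have "integrable (lborel \<Otimes>\<^sub>M lborel) (\<lambda>(t, s). F s t)"
  proof (rule lborel_pair.Fubini_integrable)
    show "(\<lambda>(t, s). F s t) \<in> borel_measurable (lborel \<Otimes>\<^sub>M lborel)"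
      unfolding F_def by measurable
  qed (use i1 Fint in auto)
  from lborel_pair.integrable_product_swap[OF this] have ip: "integrable (lborel \<Otimes>\<^sub>M lborel) (case_prod F)"
    by (simp add: case_prod_unfold)
  have eq: "(\<integral>t. F s t \<partial>lborel) = indicator {0<..<x} s *\<^sub>R (kern a (x - s) * frac_int b f s)" for s
  proof (cases "s \<in> {0<..<x}")
    case True
    have "(\<integral>t. F s t \<partial>lborel) = (\<integral>t. kern a (x - s) * (indicator {0<..<s} t *\<^sub>R (kern b (s - t) * f t)) \<partial>lborel)"
      using True by (intro Bochner_Integration.integral_cong refl) (auto simp: F_def g_def indicator_def)
    then show ?thesis using True by (simp add: frac_int_def set_lebesgue_integral_def)
  next
    case False
    then have "F s t = 0" for t by (auto simp: F_def g_def indicator_def)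
    then show ?thesis using False by simp
  qed
  show "frac_intble a (frac_int b f) x"
    using lborel_pair.integrable_fst[OF ip] unfolding eq frac_intble_def set_integrable_def .
  have "frac_int a (frac_int b f) x = (\<integral>s. (\<integral>t. F s t \<partial>lborel) \<partial>lborel)"
    unfolding frac_int_def[of a] set_lebesgue_integral_def eq ..
  also have "\<dots> = (\<integral>t. (\<integral>s. F s t \<partial>lborel) \<partial>lborel)"
    by (rule lborel_pair.Fubini_integral[symmetric, OF ip])
  also have "\<dots> = frac_int (a + b) f x"
    unfolding Fval by (simp add: frac_int_def set_lebesgue_integral_def g_def mult_ac)
  finally show "frac_int a (frac_int b f) x = frac_int (a + b) f x" .
qed

lemma
  assumes "a > 0" "b > 0"
  shows frac_intble_kern: "frac_intble a (kern b) x"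
    and frac_int_kern: "frac_int a (kern b) x = kern (a + b) x"
proof -
  have "has_bochner_integral lborel (\<lambda>s. kern a (x - s) * kern b (s - 0)) (kern (a + b) (x - 0))"
    using kern_convolution[OF assms, of x 0] assms
    by (intro has_bochner_integral_nn_integral) (auto simp: kern_nonneg)
  moreover have "kern a (x - s) * kern b (s - 0) = indicator {0<..<x} s *\<^sub>R (kern a (x - s) * kern b s)" for s
    by (cases "0 < s"; cases "s < x") (auto simp: indicator_def)
  ultimately have "has_bochner_integral lborel (\<lambda>s. indicator {0<..<x} s *\<^sub>R (kern a (x - s) * kern b s)) (kern (a + b) x)"
    by (simp only: diff_0_right)
  then show "frac_intble a (kern b) x" "frac_int a (kern b) x = kern (a + b) x"
    by (auto simp: frac_intble_def frac_int_def set_integrable_def set_lebesgue_integral_def has_bochner_integral_iff)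
qed

section \<open>Linearity, comparison and change of order for fractional integrals\<close>

lemma frac_int_cong:
  "(\<And>t. 0 < t \<Longrightarrow> t < x \<Longrightarrow> f t = g t) \<Longrightarrow> frac_int a f x = frac_int a g x"
  unfolding frac_int_def by (intro set_lebesgue_integral_cong) auto

lemma frac_intble_cong:
  "(\<And>t. 0 < t \<Longrightarrow> t < x \<Longrightarrow> f t = g t) \<Longrightarrow> frac_intble a f x = frac_intble a g x"
  unfolding frac_intble_def by (intro set_integrable_cong) auto

lemma frac_int_add:
  "frac_intble a f x \<Longrightarrow> frac_intble a g x \<Longrightarrow> frac_int a (\<lambda>t. f t + g t) x = frac_int a f x + frac_int a g x"
  unfolding frac_int_def frac_intble_def by (simp add: algebra_simps set_integral_add)

lemma frac_intble_add:
  "frac_intble a f x \<Longrightarrow> frac_intble a g x \<Longrightarrow> frac_intble a (\<lambda>t. f t + g t) x"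
  unfolding frac_intble_def by (simp add: algebra_simps set_integral_add)

lemma frac_int_cmult: "frac_int a (\<lambda>t. c * f t) x = c * frac_int a f x"
  unfolding frac_int_def by (simp add: mult.left_commute[of _ c])

lemma frac_intble_cmult: "frac_intble a f x \<Longrightarrow> frac_intble a (\<lambda>t. c * f t) x"
  unfolding frac_intble_def by (simp add: mult.left_commute[of _ c])

lemma frac_int_diff:
  "frac_intble a f x \<Longrightarrow> frac_intble a g x \<Longrightarrow> frac_int a (\<lambda>t. f t - g t) x = frac_int a f x - frac_int a g x"
  using frac_int_add[of a f x "\<lambda>t. (-1) * g t"] frac_intble_cmult[of a g x "-1"] frac_int_cmult[of a "-1" g x] by simp

lemma frac_int_mono:
  assumes "a > 0" "frac_intble a f x" "frac_intble a g x" "\<And>t. 0 < t \<Longrightarrow> t < x \<Longrightarrow> f t \<le> g t"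
  shows "frac_int a f x \<le> frac_int a g x"
  unfolding frac_int_def using assms(2,3)[unfolded frac_intble_def]
  by (intro set_integral_mono) (auto intro!: mult_left_mono kern_nonneg assms)

lemma frac_int_nonneg:
  assumes "a > 0" "\<And>t. 0 < t \<Longrightarrow> t < x \<Longrightarrow> 0 \<le> f t"
  shows "0 \<le> frac_int a f x"
  unfolding frac_int_def set_lebesgue_integral_def
  using assms by (intro Bochner_Integration.integral_nonneg) (auto simp: indicator_def kern_nonneg)

lemma frac_intble_bound:
  assumes a: "a > 0" and g: "frac_intble a g x" and f: "set_borel_measurable borel {0<..<x} f"
    and le: "\<And>t. 0 < t \<Longrightarrow> t < x \<Longrightarrow> \<bar>f t\<bar> \<le> g t"
  shows "frac_intble a f x"
  unfolding frac_intble_def set_integrable_def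
proof (rule Bochner_Integration.integrable_bound)
  show "integrable lborel (\<lambda>t. indicator {0<..<x} t *\<^sub>R (kern a (x - t) * g t))"
    using g by (simp add: frac_intble_def set_integrable_def)
  have "(\<lambda>t. kern a (x - t) * (indicator {0<..<x} t *\<^sub>R f t)) \<in> borel_measurable borel"
    using f by (auto simp: set_borel_measurable_def)
  then show "(\<lambda>t. indicator {0<..<x} t *\<^sub>R (kern a (x - t) * f t)) \<in> borel_measurable lborel"
    by (simp add: mult_ac)
  show "AE t in lborel. norm (indicator {0<..<x} t *\<^sub>R (kern a (x - t) * f t))
      \<le> norm (indicator {0<..<x} t *\<^sub>R (kern a (x - t) * g t))"
    using le a by (auto simp: indicator_def abs_mult kern_nonneg intro!: mult_left_mono order.trans[OF le abs_ge_self] AE_I2)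
qed

text \<open>When f is not integrable its integral is 0, and the bound holds because g dominates |f|
  and is therefore nonnegative. This spares integrability checks in later estimates.\<close>

lemma frac_int_abs_le:
  assumes a: "a > 0" and g: "frac_intble a g x"
    and le: "\<And>t. 0 < t \<Longrightarrow> t < x \<Longrightarrow> \<bar>f t\<bar> \<le> g t"
  shows "\<bar>frac_int a f x\<bar> \<le> frac_int a g x"
proof (cases "frac_intble a f x")
  case True
  have "frac_int a f x \<le> frac_int a g x"
    by (rule frac_int_mono[OF a True g]) (use le in force)
  moreover have "frac_int a (\<lambda>t. (-1) * g t) x \<le> frac_int a f x"
  proof (rule frac_int_mono[OF a frac_intble_cmult[OF g] True])
    fix t assume "0 < t" "t < x"
    from le[OF this] show "(-1) * g t \<le> f t" by linarith
  qed
  ultimately show ?thesis unfolding frac_int_cmult by linarith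
next
  case False
  then have "frac_int a f x = 0"
    by (simp add: frac_intble_def frac_int_def set_integrable_def set_lebesgue_integral_def not_integrable_integral_eq)
  moreover have "0 \<le> frac_int a g x"
  proof (rule frac_int_nonneg[OF a])
    fix t assume "0 < t" "t < x"
    from le[OF this] show "0 \<le> g t" by linarith
  qed
  ultimately show ?thesis by simp
qed

lemma frac_intble_const: "a > 0 \<Longrightarrow> frac_intble a (\<lambda>t. c) x"
  using frac_intble_cmult[OF frac_intble_kern[of a 1 x], of c]
  by (auto simp: kern_1 cong: frac_intble_cong)

lemma frac_int_const: "a > 0 \<Longrightarrow> frac_int a (\<lambda>t. c) x = c * kern (a + 1) x"
  using frac_int_cmult[of a c "kern 1" x] frac_int_kern[of a 1 x]
  by (auto simp: kern_1 cong: frac_int_cong)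

lemma frac_int_1: "frac_int 1 f x = (LBINT t:{0<..<x}. f t)"
  unfolding frac_int_def by (intro set_lebesgue_integral_cong) (auto simp: kern_1)

lemma frac_intble_1: "frac_intble 1 f x = set_integrable lborel {0<..<x} f"
  unfolding frac_intble_def by (intro set_integrable_cong) (auto simp: kern_1)

text \<open>Division by the positive kernel recovers f on the interval. For derivatives known only
  through the existence of a Caputo derivative, this is the source of the measurability that Fubini
  needs.\<close>

lemma frac_intble_measurable:
  assumes "frac_intble a f x" "a > 0"
  shows "set_borel_measurable borel {0<..<x} f"
proof -
  have "(\<lambda>t. indicator {0<..<x} t *\<^sub>R (kern a (x - t) * f t)) \<in> borel_measurable borel"
    using assms by (simp add: frac_intble_def set_integrable_def borel_measurable_integrable)
  then have "(\<lambda>t. (indicator {0<..<x} t *\<^sub>R (kern a (x - t) * f t)) / kern a (x - t)) \<in> borel_measurable borel"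
    by measurable
  also have "(\<lambda>t. (indicator {0<..<x} t *\<^sub>R (kern a (x - t) * f t)) / kern a (x - t)) = (\<lambda>t. indicator {0<..<x} t *\<^sub>R f t)"
  proof
    fix t show "(indicator {0<..<x} t *\<^sub>R (kern a (x - t) * f t)) / kern a (x - t) = indicator {0<..<x} t *\<^sub>R f t"
    proof (cases "t \<in> {0<..<x}")
      case True
      then have "kern a (x - t) > 0" using assms by (auto intro: kern_pos)
      then show ?thesis using True by simp
    qed auto
  qed
  finally show ?thesis by (simp add: set_borel_measurable_def)
qed

lemma kern_le_kern:
  assumes "0 < a" "a \<le> b" "0 < s" "s \<le> x"
  shows "kern b s \<le> (Gamma a / Gamma b * x powr (b - a)) * kern a s"
proof -
  have "s powr (b - 1) = s powr (b - a) * s powr (a - 1)" by (simp add: powr_add [symmetric])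
  also have "\<dots> \<le> x powr (b - a) * s powr (a - 1)"
    using assms by (intro mult_right_mono powr_mono2) auto
  finally have "s powr (b - 1) \<le> x powr (b - a) * s powr (a - 1)" .
  moreover have "Gamma a > 0" "Gamma b > 0" using assms by auto
  ultimately show ?thesis using assms
    by (simp add: kern_def divide_right_mono order_less_imp_not_eq2)
qed

text \<open>On (0, x) a kernel of higher order is at most a constant times one of lower order, so
  raising the order preserves integrability.\<close>

lemma frac_intble_mono_order:
  assumes "0 < a" "a \<le> b" "frac_intble a f x"
  shows "frac_intble b f x"
  unfolding frac_intble_def set_integrable_def
proof (rule Bochner_Integration.integrable_bound)
  let ?C = "Gamma a / Gamma b * x powr (b - a)"
  have C: "?C \<ge> 0" using assms by simp
  show "integrable lborel (\<lambda>t. ?C * (indicator {0<..<x} t *\<^sub>R (kern a (x - t) * f t)))"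
    using assms by (intro integrable_mult_right) (simp add: frac_intble_def set_integrable_def)
  have "(\<lambda>t. kern b (x - t) * (indicator {0<..<x} t *\<^sub>R f t)) \<in> borel_measurable borel"
    using frac_intble_measurable[OF assms(3,1)] by (auto simp: set_borel_measurable_def)
  then show "(\<lambda>t. indicator {0<..<x} t *\<^sub>R (kern b (x - t) * f t)) \<in> borel_measurable lborel"
    by (simp add: mult_ac)
  have "\<bar>kern b (x - t) * f t\<bar> \<le> \<bar>?C * (kern a (x - t) * f t)\<bar>" if "0 < t" "t < x" for t
  proof -
    have "kern b (x - t) * \<bar>f t\<bar> \<le> ?C * kern a (x - t) * \<bar>f t\<bar>"
      using assms that by (intro mult_right_mono kern_le_kern) auto
    moreover have "kern a (x - t) \<ge> 0" "kern b (x - t) \<ge> 0" using assms by (auto intro: kern_nonneg)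
    ultimately have "\<bar>kern b (x - t) * f t\<bar> \<le> ?C * \<bar>kern a (x - t) * f t\<bar>"
      by (simp add: abs_mult mult_ac)
    then show ?thesis unfolding abs_mult[of ?C] abs_of_nonneg[OF C] .
  qed
  then show "AE t in lborel. norm (indicator {0<..<x} t *\<^sub>R (kern b (x - t) * f t))
      \<le> norm (?C * (indicator {0<..<x} t *\<^sub>R (kern a (x - t) * f t)))"
    by (auto simp: indicator_def)
qed

section \<open>Mittag-Leffler functions\<close>

text \<open>Log-convexity of Gamma between x and x + 1, combined with the functional
  equation.\<close>

lemma Gamma_add_le:
  assumes x: "(x::real) > 0" and s: "0 \<le> s" "s \<le> 1"
  shows "Gamma (x + s) \<le> x powr s * Gamma x"
proof -
  have "(ln \<circ> Gamma) ((1 - s) *\<^sub>R x + s *\<^sub>R (x + 1)) \<le> (1 - s) * (ln \<circ> Gamma) x + s * (ln \<circ> Gamma) (x + 1)"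
    by (rule convex_onD[OF log_convex_Gamma_real]) (use x s in auto)
  moreover have "(1 - s) *\<^sub>R x + s *\<^sub>R (x + 1) = x + s" by (simp add: algebra_simps)
  moreover have "Gamma (x + 1) = x * Gamma x" using x by (intro Gamma_plus1) auto
  moreover have gp: "Gamma x > 0" "Gamma (x + s) > 0" using x s by auto
  ultimately have "ln (Gamma (x + s)) \<le> (1 - s) * ln (Gamma x) + s * ln (x * Gamma x)"
    by simp
  also have "\<dots> = ln (x powr s * Gamma x)"
    using x gp by (simp add: ln_mult ln_powr algebra_simps)
  finally show ?thesis using x gp by (subst (asm) ln_le_cancel_iff) auto
qed

text \<open>\<open>Gamma_add_le\<close> is applied at x + s with increment 1 - s.\<close>

lemma Gamma_ratio_le:
  assumes x: "(x::real) > 0" and s: "0 \<le> s" "s \<le> 1"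
  shows "Gamma x / Gamma (x + s) \<le> (x + s) powr (1 - s) / x"
proof -
  have "Gamma (x + s + (1 - s)) \<le> (x + s) powr (1 - s) * Gamma (x + s)"
    by (rule Gamma_add_le) (use x s in auto)
  moreover have "Gamma (x + 1) = x * Gamma x" using x by (intro Gamma_plus1) auto
  moreover have "Gamma (x + s) > 0" using x s by auto
  ultimately show ?thesis using x by (simp add: field_simps)
qed

text \<open>Ratio test: with x = a k + b, the quotient of consecutive Gamma values is at most 2
  x^(-a) once x >= 1, and this tends to 0. The factor 2 absorbs the replacement of x + a by 2
  x.\<close>

lemma summable_mittag_leffler_abs_le1:
  assumes a: "0 < a" "a \<le> 1" and b: "b > 0" and z: "z \<ge> (0::real)"
  shows "summable (\<lambda>k. z ^ k / Gamma (a * real k + b))"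
proof -
  define c where "c = (\<lambda>k. z ^ k / Gamma (a * real k + b))"
  have "((\<lambda>k. (a * real k + b) powr (-a)) \<longlongrightarrow> 0) sequentially"
  proof (rule tendsto_neg_powr)
    show "filterlim (\<lambda>k. a * real k + b) at_top sequentially"
      using a by real_asymp
  qed (use a in auto)
  then have "((\<lambda>k. z * (2 * (a * real k + b) powr (-a))) \<longlongrightarrow> z * (2 * 0)) sequentially"
    by (intro tendsto_intros)
  then have "\<forall>\<^sub>F k in sequentially. z * (2 * (a * real k + b) powr (-a)) < 1/2"
    by (rule order_tendstoD) auto
  moreover have "\<forall>\<^sub>F k in sequentially. a * real k + b \<ge> 1"
    using a by real_asymp
  ultimately have "\<forall>\<^sub>F k in sequentially. norm (c (Suc k)) \<le> 1/2 * norm (c k)"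
  proof eventually_elim
    case (elim k)
    define x where "x = a * real k + b"
    have x: "x > 0" "x \<ge> 1" using elim by (auto simp: x_def)
    have gp: "Gamma x > 0" "Gamma (x + a) > 0" using x a by auto
    have "(x + a) powr (1 - a) \<le> (2 * x) powr (1 - a)"
      using x a by (intro powr_mono2) auto
    also have "\<dots> \<le> 2 * x powr (1 - a)"
      using x a powr_mono[of "1 - a" 1 2] by (simp add: powr_mult mult_right_mono)
    finally have "(x + a) powr (1 - a) / x \<le> 2 * (x powr (1 - a) / x)"
      using x by (simp add: field_simps)
    also have "x powr (1 - a) / x = x powr (- a)"
      using x by (simp add: powr_minus_divide powr_diff)
    finally have le: "Gamma x / Gamma (x + a) \<le> 2 * x powr (- a)"
      using Gamma_ratio_le[of x a] x a by linarith
    have "c (Suc k) = z ^ k / Gamma x * (z * (Gamma x / Gamma (x + a)))"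
      using gp by (simp add: c_def x_def algebra_simps)
    also have "\<dots> \<le> z ^ k / Gamma x * (z * (2 * x powr (- a)))"
      using le z gp by (intro mult_left_mono) auto
    also have "\<dots> \<le> z ^ k / Gamma x * (1/2)"
      using elim z gp by (intro mult_left_mono) (auto simp: x_def)
    finally have "c (Suc k) \<le> 1/2 * c k" by (simp add: c_def x_def)
    moreover have "c k \<ge> 0" "c (Suc k) \<ge> 0"
      using a b z by (auto simp: c_def intro!: divide_nonneg_pos Gamma_real_pos add_nonneg_pos)
    ultimately show ?case by simp
  qed
  then obtain N where "\<And>k. k \<ge> N \<Longrightarrow> norm (c (Suc k)) \<le> 1/2 * norm (c k)"
    by (auto simp: eventually_sequentially)
  then have "summable c" by (intro summable_ratio_test[of "1/2" N]) auto
  then show ?thesis by (simp add: c_def)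
qed

text \<open>Reduction to orders at most 1: the series of order a is the subseries over the multiples
  of m of the series of order a / m at \<open>root m z\<close>.\<close>

lemma summable_mittag_leffler_nonneg:
  assumes a: "0 < a" and b: "b > 0" and z: "z \<ge> (0::real)"
  shows "summable (\<lambda>k. z ^ k / Gamma (a * real k + b))"
proof -
  obtain m :: nat where m: "a \<le> real m" using real_arch_simple by blast
  with a have m0: "m > 0" by (cases m) auto
  define f where "f = (\<lambda>j. (root m z) ^ j / Gamma (a / real m * real j + b))"
  have "summable f" unfolding f_def
    by (rule summable_mittag_leffler_abs_le1) (use a b z m m0 in \<open>auto simp: real_root_ge_zero\<close>)
  moreover have "f j \<ge> 0" for j
    using a b z m0 by (auto simp: f_def intro!: divide_nonneg_pos Gamma_real_pos add_nonneg_pos zero_le_power real_root_ge_zero)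
  moreover have "inj (\<lambda>k. m * k)" using m0 by (auto simp: inj_on_def)
  ultimately have "summable (f \<circ> (\<lambda>k. m * k))" by (intro summable_reindex) auto
  moreover have "(f \<circ> (\<lambda>k. m * k)) k = z ^ k / Gamma (a * real k + b)" for k
    using m0 z by (simp add: f_def power_mult)
  ultimately show ?thesis by (metis (no_types, lifting) ext)
qed

lemma summable_mittag_leffler_norm:
  assumes a: "0 < a" and b: "b > 0"
  shows "summable (\<lambda>k. norm (z ^ k / Gamma (a * real k + b) :: real))"
proof -
  have "norm (z ^ k / Gamma (a * real k + b)) = \<bar>z\<bar> ^ k / Gamma (a * real k + b)" for k
    using a b by (simp add: power_abs abs_of_pos add_nonneg_pos)
  then show ?thesis using summable_mittag_leffler_nonneg[OF a b, of "\<bar>z\<bar>"] by simp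
qed

lemma mittag_leffler_sums:
  "0 < a \<Longrightarrow> b > 0 \<Longrightarrow> (\<lambda>k. z ^ k / Gamma (a * real k + b)) sums mittag_leffler a b z"
  unfolding mittag_leffler_def
  using summable_norm_cancel[OF summable_mittag_leffler_norm] by (rule summable_sums)

lemma mittag_leffler_zero [simp]: "mittag_leffler a b 0 = 1 / Gamma b"
proof -
  have "(\<lambda>k. 0 ^ k / Gamma (a * real k + b)) sums (0 ^ 0 / Gamma (a * real 0 + b))"
    by (rule sums_single[of 0, THEN sums_cong[THEN iffD1, rotated]]) auto
  then show ?thesis by (simp add: mittag_leffler_def sums_iff)
qed

lemma mittag_leffler_differentiable:
  assumes "0 < a" "b > 0"
  shows "mittag_leffler a b differentiable (at z)"
proof -
  have "((\<lambda>z. \<Sum>n. (1 / Gamma (a * real n + b)) * z ^ n) has_real_derivative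
      (\<Sum>n. diffs (\<lambda>n. 1 / Gamma (a * real n + b)) n * z ^ n)) (at z)"
    by (rule termdiffs_strong_converges_everywhere)
      (use summable_norm_cancel[OF summable_mittag_leffler_norm[OF assms]] in simp)
  then show ?thesis
    by (auto simp: mittag_leffler_def[abs_def] real_differentiable_def)
qed

lemma mittag_leffler_continuous [continuous_intros]:
  assumes "0 < a" "b > 0" "continuous_on S f"
  shows "continuous_on S (\<lambda>x. mittag_leffler a b (f x))"
proof -
  have "continuous_on UNIV (mittag_leffler a b)"
    using mittag_leffler_differentiable[OF assms(1,2)] differentiable_imp_continuous_within
    by (auto simp: continuous_on_eq_continuous_within)
  then show ?thesis using assms(3) by (rule continuous_on_compose2) auto
qed

text \<open>The functional equation of Gamma at a (n + 1) cancels the factor n + 1 produced by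
  differentiation; what remains is the series with second parameter a.\<close>

lemma mittag_leffler_1_deriv:
  assumes a: "0 < a"
  shows "(mittag_leffler a 1 has_real_derivative mittag_leffler a a z / a) (at z)"
proof -
  have "((\<lambda>z. \<Sum>n. (1 / Gamma (a * real n + 1)) * z ^ n) has_real_derivative
      (\<Sum>n. diffs (\<lambda>n. 1 / Gamma (a * real n + 1)) n * z ^ n)) (at z)"
    by (rule termdiffs_strong_converges_everywhere)
      (use summable_norm_cancel[OF summable_mittag_leffler_norm[of a 1]] a in simp)
  moreover have "diffs (\<lambda>n. 1 / Gamma (a * real n + 1)) n * z ^ n = (1/a) * (z ^ n / Gamma (a * real n + a))" for n
  proof -
    have p: "a * real (Suc n) > 0" using a by simp
    then have "Gamma (a * real (Suc n) + 1) = a * real (Suc n) * Gamma (a * real (Suc n))"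
      by (intro Gamma_plus1) auto
    moreover have "a * real (Suc n) = a * real n + a" by (simp add: algebra_simps)
    moreover have "Gamma (a * real (Suc n)) > 0" using p by auto
    moreover have "a + a * real n > 0" using a by (simp add: add_pos_nonneg)
    ultimately show ?thesis using a unfolding diffs_def
      by (simp add: divide_simps) (auto simp: algebra_simps)?
  qed
  moreover have "(\<Sum>n. (1/a) * (z ^ n / Gamma (a * real n + a))) = mittag_leffler a a z / a"
    using sums_unique[OF sums_mult[OF mittag_leffler_sums[of a a z], of "1/a"]] a by simp
  ultimately show ?thesis by (simp add: mittag_leffler_def[abs_def])
qed

lemma mittag_leffler_1_1: "mittag_leffler 1 1 z = exp z"
proof -
  have "z ^ k / Gamma (1 * real k + 1) = z ^ k /\<^sub>R fact k" for k
    using Gamma_fact[of k, where 'a = real] by (simp add: divide_inverse add.commute)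
  then have "(\<lambda>k. z ^ k / Gamma (1 * real k + 1)) sums exp z"
    using exp_converges[of z] by simp
  then show ?thesis by (simp add: mittag_leffler_def sums_iff)
qed

lemma mittag_leffler_pos:
  assumes "0 < a" "b > 0" "z \<ge> 0"
  shows "mittag_leffler a b z \<ge> 1 / Gamma b" "mittag_leffler a b z > 0"
proof -
  have s: "summable (\<lambda>k. z ^ k / Gamma (a * real k + b))"
    by (rule summable_mittag_leffler_nonneg[OF assms])
  have n: "z ^ k / Gamma (a * real k + b) \<ge> 0" for k
    using assms by (auto intro!: divide_nonneg_pos Gamma_real_pos add_nonneg_pos)
  have "(\<Sum>k<1. z ^ k / Gamma (a * real k + b)) \<le> mittag_leffler a b z"
    unfolding mittag_leffler_def by (rule sum_le_suminf[OF s]) (use n in auto)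
  then show "mittag_leffler a b z \<ge> 1 / Gamma b" by simp
  moreover have "1 / Gamma b > 0" using assms by auto
  ultimately show "mittag_leffler a b z > 0" by linarith
qed

section \<open>Mittag-Leffler kernels under fractional integration\<close>

definition ml_kern :: "real \<Rightarrow> real \<Rightarrow> real \<Rightarrow> real \<Rightarrow> real" where
  "ml_kern a b l x = (if 0 < x then x powr (b - 1) * mittag_leffler a b (l * x powr a) else 0)"

lemma ml_kern_term:
  assumes "x > 0"
  shows "l ^ k * kern (a * real k + b) x = x powr (b - 1) * ((l * x powr a) ^ k / Gamma (a * real k + b))"
proof -
  have "x powr (a * real k + b - 1) = x powr (b - 1) * (x powr a) ^ k"
    using assms by (simp add: powr_add [symmetric] powr_powr algebra_simps flip: powr_realpow)
  then show ?thesis using assms by (simp add: kern_def power_mult_distrib)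
qed

text \<open>Expansion into the kernels \<open>kern (a * real k + b)\<close>. This is why fractional
  integration of order g acts on \<open>ml_kern\<close> by replacing b with b + g.\<close>

lemma ml_kern_sums:
  assumes "0 < a" "b > 0" "x > 0"
  shows "(\<lambda>k. l ^ k * kern (a * real k + b) x) sums ml_kern a b l x"
  unfolding ml_kern_term[OF assms(3)]
  using sums_mult[OF mittag_leffler_sums[OF assms(1,2)], of "x powr (b - 1)" "l * x powr a"] assms
  by (simp add: ml_kern_def)

lemma ml_kern_summable_norm:
  assumes "0 < a" "b > 0"
  shows "summable (\<lambda>k. norm (l ^ k * kern (a * real k + b) x))"
proof (cases "x > 0")
  case True
  show ?thesis unfolding ml_kern_term[OF True] norm_mult
    using summable_mittag_leffler_norm[OF assms, of "l * x powr a"] by (intro summable_mult)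
qed auto

text \<open>Termwise integration by the semigroup law. The L1 norms of the terms form the same
  series with |l| in place of l, which converges for every l.\<close>

lemma
  assumes a: "0 < a" and b: "b > 0" and g: "g > 0" and x: "x > 0"
  shows frac_intble_ml_kern: "frac_intble g (ml_kern a b l) x"
    and frac_int_ml_kern: "frac_int g (ml_kern a b l) x = ml_kern a (b + g) l x"
proof -
  define F where "F = (\<lambda>k t. indicator {0<..<x} t *\<^sub>R (kern g (x - t) * (l ^ k * kern (a * real k + b) t)))"
  have p: "a * real k + b > 0" for k using a b by (simp add: add_nonneg_pos)
  have i: "integrable lborel (F k)" for k
    using frac_intble_cmult[OF frac_intble_kern[OF g p[of k], of x], of "l ^ k"]
    by (simp add: F_def frac_intble_def set_integrable_def)
  have v: "integral\<^sup>L lborel (F k) = l ^ k * kern (a * real k + (b + g)) x" for k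
    using frac_int_cmult[of g "l ^ k" "kern (a * real k + b)" x] frac_int_kern[OF g p[of k], of x]
    by (simp add: F_def frac_int_def set_lebesgue_integral_def algebra_simps)
  have n: "norm (F k t) = indicator {0<..<x} t *\<^sub>R (kern g (x - t) * (\<bar>l\<bar> ^ k * kern (a * real k + b) t))" for k t
    using g p[of k] by (simp add: F_def indicator_def abs_mult kern_nonneg power_abs)
  have nv: "(\<integral>t. norm (F k t) \<partial>lborel) = \<bar>l\<bar> ^ k * kern (a * real k + (b + g)) x" for k
    unfolding n
    using frac_int_cmult[of g "\<bar>l\<bar> ^ k" "kern (a * real k + b)" x] frac_int_kern[OF g p[of k], of x]
    by (simp add: frac_int_def set_lebesgue_integral_def algebra_simps)
  have s1: "AE t in lborel. summable (\<lambda>k. norm (F k t))"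
  proof (intro AE_I2)
    fix t
    show "summable (\<lambda>k. norm (F k t))"
      unfolding F_def norm_scaleR norm_mult[of "kern g (x - t)"]
      using ml_kern_summable_norm[OF a b, of l t] by (intro summable_mult)
  qed
  have "norm (\<bar>l\<bar> ^ k * kern (a * real k + (b + g)) x) = \<bar>l\<bar> ^ k * kern (a * real k + (b + g)) x" for k
    using p[of k] g by (simp add: abs_mult kern_nonneg)
  then have s2: "summable (\<lambda>k. (\<integral>t. norm (F k t) \<partial>lborel))"
    unfolding nv using ml_kern_summable_norm[of a "b + g" "\<bar>l\<bar>" x] a b g by simp
  have S: "(\<Sum>k. F k t) = indicator {0<..<x} t *\<^sub>R (kern g (x - t) * ml_kern a b l t)" for t
  proof (cases "t \<in> {0<..<x}")
    case True
    then show ?thesis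
      using sums_unique[OF sums_mult[OF ml_kern_sums[OF a b, of t l], of "kern g (x - t)"]]
      by (simp add: F_def)
  qed (simp add: F_def)
  show "frac_intble g (ml_kern a b l) x"
    using integrable_suminf[OF i s1 s2] unfolding S frac_intble_def set_integrable_def .
  have "(\<lambda>k. l ^ k * kern (a * real k + (b + g)) x) sums frac_int g (ml_kern a b l) x"
    using sums_integral[OF i s1 s2] unfolding S v frac_int_def set_lebesgue_integral_def .
  moreover have "(\<lambda>k. l ^ k * kern (a * real k + (b + g)) x) sums ml_kern a (b + g) l x"
    using ml_kern_sums[of a "b + g" x l] a b g x by simp
  ultimately show "frac_int g (ml_kern a b l) x = ml_kern a (b + g) l x"
    by (rule sums_unique2)
qed

text \<open>The term k = 0 is split off. Together with \<open>frac_int_ml_kern\<close> for g = a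
  this is the Volterra equation satisfied by the resolvent kernel.\<close>

lemma ml_kern_shift:
  assumes "0 < a" "b > 0" "x > 0"
  shows "ml_kern a b l x = kern b x + l * ml_kern a (b + a) l x"
proof -
  have "(\<lambda>k. l ^ Suc k * kern (a * real (Suc k) + b) x) sums (l * ml_kern a (b + a) l x)"
    using sums_mult[OF ml_kern_sums[of a "b + a" x l], of l] assms by (simp add: algebra_simps)
  then have "(\<lambda>k. l ^ k * kern (a * real k + b) x) sums (l * ml_kern a (b + a) l x + l ^ 0 * kern (a * real 0 + b) x)"
    by (subst (asm) sums_Suc_iff) simp
  with ml_kern_sums[OF assms, of l] show ?thesis by (simp add: sums_unique2 add.commute)
qed

lemma ml_kern_continuous:
  assumes "0 < a" "b > 0"
  shows "continuous_on {0<..} (ml_kern a b l)"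
proof -
  have "continuous_on {0<..} (\<lambda>x. x powr (b - 1) * mittag_leffler a b (l * x powr a))"
    using assms by (auto intro!: continuous_intros)
  then show ?thesis by (rule continuous_on_eq) (auto simp: ml_kern_def)
qed

lemma ml_kern_differentiable:
  assumes "0 < a" "b > 0" "x > 0"
  shows "ml_kern a b l differentiable (at x)"
proof -
  obtain D where D: "(mittag_leffler a b has_real_derivative D) (at (l * x powr a))"
    using mittag_leffler_differentiable[OF assms(1,2)] real_differentiable_def by blast
  have "((\<lambda>x. mittag_leffler a b (l * x powr a)) has_real_derivative D * (l * (a * x powr (a - 1)))) (at x)"
    by (rule DERIV_chain2[of "mittag_leffler a b" D "\<lambda>x. l * x powr a", OF D]) (use assms in \<open>auto intro!: derivative_eq_intros\<close>)
  then have "((\<lambda>x. x powr (b - 1) * mittag_leffler a b (l * x powr a)) has_real_derivative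
     (b - 1) * x powr (b - 2) * mittag_leffler a b (l * x powr a) + D * (l * (a * x powr (a - 1))) * x powr (b - 1)) (at x)"
    using assms by (auto intro!: derivative_eq_intros)
  then have "(ml_kern a b l has_real_derivative
     (b - 1) * x powr (b - 2) * mittag_leffler a b (l * x powr a) + D * (l * (a * x powr (a - 1))) * x powr (b - 1)) (at x)"
    by (rule has_field_derivative_transform_within_open[where S = "{0<..}"]) (use assms in \<open>auto simp: ml_kern_def\<close>)
  then show ?thesis by (auto simp: real_differentiable_def)
qed

text \<open>Agrees with \<open>ml_kern a 1 l\<close> for positive x, but has the value 1 at x = 0,
  where \<open>ml_kern\<close> is 0. It is therefore continuous up to 0.\<close>

definition mle :: "real \<Rightarrow> real \<Rightarrow> real \<Rightarrow> real" where
  "mle a l x = mittag_leffler a 1 (l * x powr a)"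

lemma mle_eq_ml_kern: "x > 0 \<Longrightarrow> mle a l x = ml_kern a 1 l x"
  by (simp add: mle_def ml_kern_def)

lemma mle_0 [simp]: "mle a l 0 = 1"
  by (simp add: mle_def)

lemma mle_continuous: "0 < a \<Longrightarrow> continuous_on {0..} (mle a l)"
  unfolding mle_def by (intro continuous_intros continuous_on_powr') auto

lemma mle_deriv:
  assumes "0 < a" "x > 0"
  shows "(mle a l has_real_derivative l * ml_kern a a l x) (at x)"
proof -
  have "((\<lambda>x. mittag_leffler a 1 (l * x powr a)) has_real_derivative
     mittag_leffler a a (l * x powr a) / a * (l * (a * x powr (a - 1)))) (at x)"
    by (rule DERIV_chain2[OF mittag_leffler_1_deriv]) (use assms in \<open>auto intro!: derivative_eq_intros\<close>)
  then show ?thesis using assms by (simp add: mle_def[abs_def] ml_kern_def mult_ac)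
qed

lemma mle_1: "x \<ge> 0 \<Longrightarrow> mle 1 l x = exp (l * x)"
  by (simp add: mle_def mittag_leffler_1_1)

section \<open>Bounds for Mittag-Leffler functions\<close>

text \<open>
  Positivity of the resolvent kernel: at a first zero \<open>x\<^sub>0\<close>, rewrite the resolvent equation as
  \<open>1 = m * N x\<^sub>0\<close> with \<open>N x\<close> the integral of \<open>(1 - t / x) powr (a - 1) * \<rho> t\<close>. The weight decreases
  in \<open>x\<close> at a linear rate while \<open>\<rho>\<close> is \<open>O(x\<^sub>0 - t)\<close> near \<open>x\<^sub>0\<close>, so \<open>N x > N x\<^sub>0\<close> for \<open>x\<close> just below \<open>x\<^sub>0\<close>.
\<close>

lemma ml_kern_pos_less_1:
  assumes a: "0 < a" "a < 1" and m: "m > 0" and x: "x > 0"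
  shows "ml_kern a a (-m) x > 0"
proof (rule ccontr)
  assume neg: "\<not> ml_kern a a (-m) x > 0"
  define \<rho> where "\<rho> = ml_kern a a (-m)"
  \<comment> \<open>The factor of \<open>\<rho>\<close> that is left after removing the singular
    power t^(a - 1). It is continuous at 0 and positive there, so a first zero exists.\<close>
  define g where "g = (\<lambda>x. mittag_leffler a a (- m * x powr a))"
  have g_cont: "continuous_on {0..} g"
    unfolding g_def using a by (intro continuous_intros continuous_on_powr') auto
  have g_rho: "\<rho> t = t powr (a - 1) * g t" if "t > 0" for t
    using that by (simp add: \<rho>_def g_def ml_kern_def)
  have g0: "g 0 > 0" using a by (simp add: g_def)
  have gx: "g x \<le> 0"
    using neg x g_rho[OF x] by (simp add: \<rho>_def[symmetric] not_less mult_le_0_iff)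
  define Z where "Z = {t \<in> {0..x}. g t \<le> 0}"
  have "compact Z"
  proof -
    \<comment> \<open>The condition g t <= 0 is read as max 0 (g t) = 0, which makes Z a level set
      of a continuous function.\<close>
    have "closed Z" unfolding Z_def
      by (rule continuous_closed_preimage_constant[where a = 0 and f = "\<lambda>t. max 0 (g t)" and S = "{0..x}", simplified, THEN subst[where P = closed, rotated]])
        (auto intro!: continuous_intros continuous_on_subset[OF g_cont])
    moreover have "bounded Z" unfolding Z_def by (rule bounded_subset[of "{0..x}"]) auto
    ultimately show ?thesis by (simp add: compact_eq_bounded_closed)
  qed
  moreover have "Z \<noteq> {}" using gx x by (auto simp: Z_def)
  ultimately obtain x0 where x0: "x0 \<in> Z" "\<And>t. t \<in> Z \<Longrightarrow> x0 \<le> t"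
    using compact_attains_inf[of Z] by auto
  have x0p: "x0 > 0" using x0(1) g0 by (cases "x0 = 0") (auto simp: Z_def)
  have rho0: "\<rho> x0 \<le> 0" using x0(1) g_rho[OF x0p] by (auto simp: Z_def mult_le_0_iff)
  have rhop: "\<rho> t > 0" if "0 < t" "t < x0" for t
  proof -
    have "t \<notin> Z" using x0(2)[of t] that by auto
    then have "g t > 0" using that x0(1) by (auto simp: Z_def)
    then show ?thesis using g_rho[of t] that by simp
  qed
  \<comment> \<open>The kernel normalised by its value at t = 0. For fixed t it decreases in its
    first argument, because a - 1 is negative.\<close>
  define w where "w = (\<lambda>x t. ((x - t) / x) powr (a - 1))"
  have kw: "kern a (y - t) = kern a y * w y t" if "0 < t" "t < y" for y t
  proof -
    have "y - t = y * ((y - t) / y)" using that by simp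
    then have "(y - t) powr (a - 1) = y powr (a - 1) * ((y - t) / y) powr (a - 1)"
      using that by (metis powr_mult less_imp_le diff_gt_0_iff_gt divide_pos_pos order.strict_trans)
    then show ?thesis using that by (simp add: kern_def w_def)
  qed
  have wint: "set_integrable lborel {0<..<y} (\<lambda>t. w y t * \<rho> t)"
    and wval: "frac_int a \<rho> y = kern a y * (LBINT t:{0<..<y}. w y t * \<rho> t)" if y: "y > 0" for y
  proof -
    have ky: "kern a y > 0" using a y by (intro kern_pos)
    have "frac_intble a \<rho> y" unfolding \<rho>_def by (rule frac_intble_ml_kern) (use a y in auto)
    then have "set_integrable lborel {0<..<y} (\<lambda>t. kern a y * (w y t * \<rho> t))"
      unfolding frac_intble_def by (rule set_integrable_cong[THEN iffD1, rotated -1]) (auto simp: kw)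
    then show "set_integrable lborel {0<..<y} (\<lambda>t. w y t * \<rho> t)" using ky by simp
    have "frac_int a \<rho> y = (LBINT t:{0<..<y}. kern a y * (w y t * \<rho> t))"
      unfolding frac_int_def by (rule set_lebesgue_integral_cong) (auto simp: kw)
    then show "frac_int a \<rho> y = kern a y * (LBINT t:{0<..<y}. w y t * \<rho> t)" by simp
  qed
  define N where "N = (\<lambda>y. LBINT t:{0<..<y}. w y t * \<rho> t)"
  have res: "\<rho> y = kern a y * (1 - m * N y)" if y: "y > 0" for y
  proof -
    have "\<rho> y = kern a y - m * frac_int a \<rho> y"
      unfolding \<rho>_def using a y by (simp add: ml_kern_shift[of a a y] frac_int_ml_kern)
    then show ?thesis using wval[OF y] by (simp add: N_def algebra_simps)
  qed
  \<comment> \<open>N is at least 1/m at x0 and below 1/m to the left of it. The rest of the proof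
    shows that N becomes larger when moving slightly to the left of x0.\<close>
  have N0: "m * N x0 \<ge> 1"
    using res[OF x0p] rho0 kern_pos[OF a(1) x0p] by (simp add: mult_le_0_iff)
  have Nx: "m * N y < 1" if "0 < y" "y < x0" for y
    using res[OF that(1)] rhop[OF that] kern_pos[OF a(1) that(1)] by (simp add: zero_less_mult_iff)
  obtain D where D: "(\<rho> has_real_derivative D) (at x0)"
    using ml_kern_differentiable[OF a(1) a(1) x0p] by (auto simp: \<rho>_def real_differentiable_def)
  \<comment> \<open>As \<open>\<rho> x0\<close> is nonpositive, differentiability gives
    \<open>\<rho> t\<close> <= L (x0 - t) just left of x0. This linear vanishing compensates the
    singularity of the weight at t = x0.\<close>
  define L where "L = \<bar>D\<bar> + 1"
  have "((\<lambda>t. (\<rho> t - \<rho> x0) / (t - x0)) \<longlongrightarrow> D) (at x0)"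
    using D by (simp add: has_field_derivative_iff)
  then have "\<forall>\<^sub>F t in at x0. dist ((\<rho> t - \<rho> x0) / (t - x0)) D < 1"
    by (rule tendstoD) simp
  then obtain d where d: "d > 0" "\<And>t. t \<noteq> x0 \<Longrightarrow> dist t x0 < d \<Longrightarrow> dist ((\<rho> t - \<rho> x0) / (t - x0)) D < 1"
    unfolding eventually_at by blast
  have lip: "\<rho> t \<le> L * (x0 - t)" if "t < x0" "x0 - t < d" for t
  proof -
    have "dist ((\<rho> t - \<rho> x0) / (t - x0)) D < 1"
      by (rule d(2)) (use that in \<open>auto simp: dist_real_def\<close>)
    then have "\<bar>(\<rho> t - \<rho> x0) / (t - x0)\<bar> < L" unfolding dist_real_def L_def by linarith
    then have "\<bar>\<rho> t - \<rho> x0\<bar> < L * (x0 - t)" using that by (simp add: abs_divide divide_less_eq)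
    then show ?thesis using rho0 by linarith
  qed
  have rc: "continuous_on {x0/4..x0/2} \<rho>"
    unfolding \<rho>_def by (rule continuous_on_subset[OF ml_kern_continuous]) (use a x0p in auto)
  have ne: "{x0/4..x0/2} \<noteq> {}" using x0p by simp
  obtain s0 where s0: "s0 \<in> {x0/4..x0/2}" "\<And>t. t \<in> {x0/4..x0/2} \<Longrightarrow> \<rho> s0 \<le> \<rho> t"
    using continuous_attains_inf[OF compact_Icc ne rc] by auto
  define r0 where "r0 = \<rho> s0"
  have r0: "r0 > 0" unfolding r0_def using s0(1) x0p by (intro rhop) auto
  \<comment> \<open>K h bounds from below the gain of the integrand on (x0/4, x0/2): the factor (1 -
    a) / (4 x0) is the rate found in \<open>wdiff\<close>, and r0 is the minimum of
    \<open>\<rho>\<close> there.\<close>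
  define K where "K = (1 - a) / (4 * x0) * r0"
  have K: "K > 0" unfolding K_def using a x0p r0 by auto
  \<comment> \<open>The part of the integral lost on (x0 - h, x0) is at most L x0^(1 - a) h^(1 + a),
    of smaller order than the gain K h x0 / 4. The step h is chosen to make this comparison
    strict.\<close>
  have "((\<lambda>h. L * x0 powr (1 - a) * h powr a) \<longlongrightarrow> L * x0 powr (1 - a) * 0) (at_right 0)"
    using a by real_asymp
  then have "\<forall>\<^sub>F h in at_right 0. L * x0 powr (1 - a) * h powr a < K * (x0 / 4)"
    by (rule order_tendstoD) (use K x0p in auto)
  moreover have "\<forall>\<^sub>F h in at_right (0::real). h < min d (x0 / 4)"
    using d x0p by (intro eventually_at_right_field[THEN iffD2] exI[of _ "min d (x0/4)"]) auto
  moreover have "\<forall>\<^sub>F h in at_right (0::real). h > 0"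
    by (simp add: eventually_at_right_less)
  ultimately have "\<forall>\<^sub>F h in at_right 0. L * x0 powr (1 - a) * h powr a < K * (x0 / 4) \<and> h < min d (x0 / 4) \<and> h > 0"
    by eventually_elim auto
  then obtain h where h: "L * x0 powr (1 - a) * h powr a < K * (x0 / 4)" "h < d" "h < x0 / 4" "h > 0"
    using eventually_happens' [OF trivial_limit_at_right_real] by fastforce
  define y where "y = x0 - h"
  have y: "y > 0" "y < x0" "y > x0 / 2" using h by (auto simp: y_def)
  have wle: "w x0 t \<le> w y t" if "0 < t" "t < y" for t
  proof -
    have "(y - t) / y \<le> (x0 - t) / x0" using that y by (simp add: field_simps)
    then show ?thesis unfolding w_def using a that y
      by (intro powr_mono2') auto
  qed
  \<comment> \<open>Mean value theorem for the power a - 1 between p and q. Both lie in (0, 1], so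
    the power a - 2 in the derivative is at least 1, and q - p = t h / (y x0).\<close>
  have wdiff: "(1 - a) / (4 * x0) * h \<le> w y t - w x0 t" if t: "x0/4 < t" "t < x0/2" for t
  proof -
    define p q where "p = (y - t) / y" and "q = (x0 - t) / x0"
    have pq: "0 < p" "p < q" "q \<le> 1" using t y x0p by (auto simp: p_def q_def field_simps)
    have "\<exists>z>p. z < q \<and> q powr (a - 1) - p powr (a - 1) = (q - p) * ((a - 1) * z powr (a - 2))"
      by (rule MVT2[OF pq(2)]) (use pq in \<open>auto intro!: derivative_eq_intros\<close>)
    then obtain z where z: "z > p" "z < q" "q powr (a - 1) - p powr (a - 1) = (q - p) * ((a - 1) * z powr (a - 2))"
      by blast
    have "1 \<le> z powr (a - 2)"
      using z pq a powr_mono2'[of "a - 2" z 1] by simp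
    then have "(q - p) * (1 - a) * 1 \<le> (q - p) * (1 - a) * z powr (a - 2)"
      using a pq by (intro mult_left_mono) auto
    also have "\<dots> = p powr (a - 1) - q powr (a - 1)" using z(3) by (simp add: algebra_simps)
    finally have 1: "(q - p) * (1 - a) \<le> w y t - w x0 t" by (simp add: w_def p_def q_def)
    have "q - p = t * h / (y * x0)" using y x0p by (simp add: p_def q_def y_def field_simps)
    also have "\<dots> \<ge> (x0 / 4) * h / (x0 * x0)"
      using t y x0p h by (intro frac_le mult_right_mono mult_pos_pos) auto
    also have "(x0 / 4) * h / (x0 * x0) = h / (4 * x0)" using x0p by simp
    finally have "h / (4 * x0) * (1 - a) \<le> (q - p) * (1 - a)" using a by (intro mult_right_mono) auto
    with 1 show ?thesis by (simp add: mult_ac)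
  qed
  have i0: "set_integrable lborel {0<..<x0} (\<lambda>t. w x0 t * \<rho> t)" by (rule wint[OF x0p])
  have i01: "set_integrable lborel {0<..<y} (\<lambda>t. w x0 t * \<rho> t)"
    by (rule set_integrable_subset[OF i0]) (use y in auto)
  have i02: "set_integrable lborel {y..<x0} (\<lambda>t. w x0 t * \<rho> t)"
    by (rule set_integrable_subset[OF i0]) (use y in auto)
  have split: "N x0 = (LBINT t:{0<..<y}. w x0 t * \<rho> t) + (LBINT t:{y..<x0}. w x0 t * \<rho> t)"
  proof -
    have "{0<..<x0} = {0<..<y} \<union> {y..<x0}" using y by auto
    moreover have "{0<..<y} \<inter> {y..<x0} = {}" by auto
    ultimately show ?thesis unfolding N_def using set_integral_Un[OF _ i01 i02] by (simp only:)
  qed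
  have part2: "(LBINT t:{y..<x0}. w x0 t * \<rho> t) \<le> (L * x0 powr (1 - a) * h powr a) * h"
  proof -
    have "(LBINT t:{y..<x0}. w x0 t * \<rho> t) \<le> (LBINT t:{y..<x0}. L * x0 powr (1 - a) * h powr a)"
    proof (rule set_integral_mono[OF i02])
      show "set_integrable lborel {y..<x0} (\<lambda>t. L * x0 powr (1 - a) * h powr a)"
      proof -
        have "integrable lborel (indicator {y..<x0} :: real \<Rightarrow> real)"
          using y by (simp add: integrable_indicator_iff)
        then show ?thesis unfolding set_integrable_def by simp
      qed
      fix t assume t: "t \<in> {y..<x0}"
      have "\<rho> t \<le> L * (x0 - t)"
      proof (rule lip)
        show "t < x0" using t by simp
        show "x0 - t < d" using t h(2) unfolding y_def by simp
      qed
      then have "w x0 t * \<rho> t \<le> w x0 t * (L * (x0 - t))"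
        unfolding w_def by (rule mult_left_mono) simp
      also have "\<dots> = ((x0 - t) powr (a - 1) * x0 powr (1 - a)) * (L * (x0 - t))"
      proof -
        have "x0 powr (- (a - 1)) = 1 / x0 powr (a - 1)" by (rule powr_minus_divide)
        then have e: "1 / x0 powr (a - 1) = x0 powr (1 - a)" by simp
        have "w x0 t = (x0 - t) powr (a - 1) * (1 / x0 powr (a - 1))"
          using t x0p unfolding w_def by (subst powr_divide) auto
        then show ?thesis unfolding e by (rule arg_cong)
      qed
      also have "\<dots> = L * x0 powr (1 - a) * ((x0 - t) * (x0 - t) powr (a - 1))"
        by (simp only: mult_ac)
      also have "(x0 - t) * (x0 - t) powr (a - 1) = (x0 - t) powr a"
        using t powr_mult_base[of "x0 - t" "a - 1"] by simp
      also have "L * x0 powr (1 - a) * (x0 - t) powr a \<le> L * x0 powr (1 - a) * h powr a"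
      proof (rule mult_left_mono)
        show "(x0 - t) powr a \<le> h powr a" by (rule powr_mono2) (use t a in \<open>auto simp: y_def\<close>)
      qed (simp add: L_def)
      finally show "w x0 t * \<rho> t \<le> L * x0 powr (1 - a) * h powr a" .
    qed
    also have "\<dots> = (L * x0 powr (1 - a) * h powr a) * h"
    proof -
      have "(LBINT t:{y..<x0}. L * x0 powr (1 - a) * h powr a) = (L * x0 powr (1 - a) * h powr a) * measure lborel {y..<x0}"
        by (simp add: set_lebesgue_integral_def)
      also have "measure lborel {y..<x0} = h" using h(4) by (simp add: y_def)
      finally show ?thesis .
    qed
    finally show ?thesis .
  qed
  have part1: "K * h * (x0 / 4) \<le> N y - (LBINT t:{0<..<y}. w x0 t * \<rho> t)"
  proof -
    have ind: "(\<lambda>t. indicator {0<..<y} t *\<^sub>R (K * h * indicator {x0/4<..<x0/2} t)) = (\<lambda>t. K * h * indicator {x0/4<..<x0/2} t)"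
      using y x0p by (auto simp: indicator_def fun_eq_iff)
    have "K * h * (x0 / 4) = (LBINT t:{0<..<y}. K * h * indicator {x0/4<..<x0/2} t)"
      unfolding set_lebesgue_integral_def ind using x0p by simp
    also have "\<dots> \<le> (LBINT t:{0<..<y}. w y t * \<rho> t - w x0 t * \<rho> t)"
    proof (rule set_integral_mono)
      show "set_integrable lborel {0<..<y} (\<lambda>t. w y t * \<rho> t - w x0 t * \<rho> t)"
        using wint[OF y(1)] i01 by (rule set_integral_diff)
      have "integrable lborel (indicator {x0/4<..<x0/2} :: real \<Rightarrow> real)"
        using x0p by (simp add: integrable_indicator_iff)
      then show "set_integrable lborel {0<..<y} (\<lambda>t. K * h * indicator {x0/4<..<x0/2} t)"
        unfolding set_integrable_def ind by (rule integrable_mult_right)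
      fix t assume t: "t \<in> {0<..<y}"
      have rp: "\<rho> t > 0" using t y by (intro rhop) auto
      show "K * h * indicator {x0/4<..<x0/2} t \<le> w y t * \<rho> t - w x0 t * \<rho> t"
      proof (cases "t \<in> {x0/4<..<x0/2}")
        case True
        have "K * h = ((1 - a) / (4 * x0) * h) * r0" by (simp add: K_def)
        also have "\<dots> \<le> (w y t - w x0 t) * \<rho> t"
        proof (rule mult_mono)
          show "(1 - a) / (4 * x0) * h \<le> w y t - w x0 t" by (rule wdiff) (use True in auto)
          show "r0 \<le> \<rho> t" unfolding r0_def by (rule s0(2)) (use True in auto)
          show "0 \<le> w y t - w x0 t" using wle[of t] t by simp
        qed (use r0 in simp)
        finally show ?thesis using True by (simp add: algebra_simps)
      next
        case False
        have "w x0 t * \<rho> t \<le> w y t * \<rho> t"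
          by (rule mult_right_mono) (use wle[of t] t rp in auto)
        then show ?thesis using False by simp
      qed
    qed
    also have "\<dots> = N y - (LBINT t:{0<..<y}. w x0 t * \<rho> t)"
      unfolding N_def using wint[OF y(1)] i01 by (rule set_integral_diff)
    finally show ?thesis .
  qed
  have "m * N y < m * N x0" using N0 Nx[OF y(1,2)] by linarith
  then have "N y < N x0" using m by (simp only: mult_less_cancel_left_pos)
  then have "K * h * (x0 / 4) < (L * x0 powr (1 - a) * h powr a) * h"
    using part1 part2 split by linarith
  moreover have "(L * x0 powr (1 - a) * h powr a) * h < (K * (x0 / 4)) * h"
    by (rule mult_strict_right_mono[OF h(1,4)])
  moreover have "(K * (x0 / 4)) * h = K * h * (x0 / 4)" by simp
  ultimately show False by linarith
qed

lemma ml_kern_nonneg: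
  assumes a: "0 < a" "a \<le> 1" and m: "m > 0"
  shows "ml_kern a a (-m) x \<ge> 0"
proof (cases "x > 0")
  case True
  show ?thesis
  proof (cases "a = 1")
    case True
    then show ?thesis by (simp add: ml_kern_def mittag_leffler_1_1)
  next
    case False
    then show ?thesis using ml_kern_pos_less_1[of a m x] a m True by auto
  qed
qed (simp add: ml_kern_def)

text \<open>The derivative is -m times the resolvent kernel, hence nonpositive. Continuity at 0 lets
  the mean value theorem start from x = 0, where differentiability may fail.\<close>

lemma mle_neg_antimono:
  assumes a: "0 < a" "a \<le> 1" and m: "m > 0" and x: "0 \<le> x" "x \<le> y"
  shows "mle a (-m) y \<le> mle a (-m) x"
proof (cases "x = y")
  case False
  then have xy: "x < y" using x by simp
  have "continuous_on {x..y} (mle a (-m))"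
    by (rule continuous_on_subset[OF mle_continuous]) (use a x in auto)
  moreover have "\<And>t. x < t \<Longrightarrow> t < y \<Longrightarrow> mle a (-m) differentiable (at t)"
  proof -
    fix t assume "x < t"
    then have "t > 0" using x by simp
    from mle_deriv[OF a(1) this, of "-m"] show "mle a (-m) differentiable (at t)"
      unfolding real_differentiable_def by blast
  qed
  ultimately obtain l z where z: "x < z" "z < y" "DERIV (mle a (-m)) z :> l" "mle a (-m) y - mle a (-m) x = (y - x) * l"
    using MVT[OF xy] by blast
  have "l = - m * ml_kern a a (-m) z"
  proof -
    have "z > 0" using x z(1) by simp
    from DERIV_unique[OF z(3) mle_deriv[OF a(1) this]] show ?thesis .
  qed
  then have "l \<le> 0" using ml_kern_nonneg[OF a m, of z] m by (simp add: mult_nonneg_nonneg)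
  then show ?thesis using z(4) xy mult_nonneg_nonpos[of "y - x" l] by simp
qed auto

lemma mle_neg_le_1: "0 < a \<Longrightarrow> a \<le> 1 \<Longrightarrow> m > 0 \<Longrightarrow> 0 \<le> x \<Longrightarrow> mle a (-m) x \<le> 1"
  using mle_neg_antimono[of a m 0 x] by simp

text \<open>For a < 1, \<open>mle a (-m)\<close> is the fractional integral of order 1 - a of the
  nonnegative resolvent kernel.\<close>

lemma mle_neg_nonneg:
  assumes a: "0 < a" "a \<le> 1" and m: "m > 0" and x: "0 \<le> x"
  shows "0 \<le> mle a (-m) x"
proof (cases "x = 0 \<or> a = 1")
  case False
  then have "mle a (-m) x = frac_int (1 - a) (ml_kern a a (-m)) x"
    using a x by (simp add: mle_eq_ml_kern frac_int_ml_kern)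
  also have "\<dots> \<ge> 0"
    by (rule frac_int_nonneg) (use a False ml_kern_nonneg[OF a m] in auto)
  finally show ?thesis .
qed (use x in \<open>auto simp: mle_1\<close>)

text \<open>By monotonicity, the fractional integral of order a at x is at least the value at x
  times x^a / Gamma(a + 1). Inserted into the Volterra equation E = 1 - m I^a E, with E nonnegative,
  this gives the bound.\<close>

lemma mle_neg_decay:
  assumes a: "0 < a" "a \<le> 1" and m: "m > 0" and x: "0 < x"
  shows "m * mle a (-m) x \<le> Gamma (a + 1) * x powr (-a)"
proof -
  have "mle a (-m) x = 1 - m * ml_kern a (1 + a) (-m) x"
    using ml_kern_shift[of a 1 x "-m"] a x by (simp add: mle_eq_ml_kern kern_1)
  also have "ml_kern a (1 + a) (-m) x = frac_int a (ml_kern a 1 (-m)) x"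
    using a x by (simp add: frac_int_ml_kern)
  also have "\<dots> \<ge> frac_int a (\<lambda>t. mle a (-m) x) x"
    by (rule frac_int_mono)
      (use a x mle_neg_antimono[OF a m] in \<open>auto intro!: frac_intble_const frac_intble_ml_kern simp flip: mle_eq_ml_kern\<close>)
  then have "1 - m * frac_int a (ml_kern a 1 (-m)) x \<le> 1 - m * frac_int a (\<lambda>t. mle a (-m) x) x"
    using m by simp
  also have "frac_int a (\<lambda>t. mle a (-m) x) x = mle a (-m) x * (x powr a / Gamma (a + 1))"
    using a x by (simp add: frac_int_const kern_def)
  finally have "m * (mle a (-m) x * (x powr a / Gamma (a + 1))) \<le> 1"
    using mle_neg_nonneg[OF a m, of x] x by linarith
  moreover have "Gamma (a + 1) > 0" "x powr a > 0" using a x by auto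
  ultimately show ?thesis by (simp add: field_simps powr_minus)
qed

text \<open>From s kern a s = a kern (a + 1) s and s <= x follows a I^(a+1) \<rho> <= x I^a \<rho>.
  Multiplying the Volterra equation by x and inserting this leaves a times
  \<open>ml_kern a (a + 1) (-m)\<close>, and m times that kernel is 1 - E <= 1.\<close>

lemma ml_kern_decay:
  assumes a: "0 < a" "a \<le> 1" and m: "m > 0" and x: "0 < x"
  shows "m * ml_kern a a (-m) x \<le> a / x"
proof -
  define \<rho> where "\<rho> = ml_kern a a (-m)"
  have ka: "s * kern a s = a * kern (a + 1) s" for s
  proof (cases "s > 0")
    case True
    have "Gamma (a + 1) = a * Gamma a" using a by (intro Gamma_plus1) auto
    moreover have "s * s powr (a - 1) = s powr a" using True powr_mult_base[of s "a - 1"] by simp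
    then have "s * kern a s = s powr a / Gamma a" using True by (simp add: kern_def)
    ultimately show ?thesis using True a by (simp add: kern_def)
  qed auto
  have i: "frac_intble g \<rho> x" if "g > 0" for g
    unfolding \<rho>_def using a x that by (intro frac_intble_ml_kern) auto
  have "a * frac_int (a + 1) \<rho> x = (LBINT t:{0<..<x}. a * (kern (a + 1) (x - t) * \<rho> t))"
    by (simp add: frac_int_def)
  also have "\<dots> \<le> (LBINT t:{0<..<x}. x * (kern a (x - t) * \<rho> t))"
  proof (rule set_integral_mono)
    show "set_integrable lborel {0<..<x} (\<lambda>t. a * (kern (a + 1) (x - t) * \<rho> t))"
      "set_integrable lborel {0<..<x} (\<lambda>t. x * (kern a (x - t) * \<rho> t))"
      using i[of "a + 1"] i[of a] a by (auto simp: frac_intble_def)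
    fix t assume t: "t \<in> {0<..<x}"
    have "a * (kern (a + 1) (x - t) * \<rho> t) = (x - t) * (kern a (x - t) * \<rho> t)"
      using ka[of "x - t"] by (simp add: mult.assoc[symmetric])
    also have "\<dots> \<le> x * (kern a (x - t) * \<rho> t)"
      using t a ml_kern_nonneg[OF a m, of t] by (intro mult_right_mono) (auto simp: \<rho>_def kern_nonneg)
    finally show "a * (kern (a + 1) (x - t) * \<rho> t) \<le> x * (kern a (x - t) * \<rho> t)" .
  qed
  also have "\<dots> = x * frac_int a \<rho> x" by (simp add: frac_int_def)
  finally have 1: "a * frac_int (a + 1) \<rho> x \<le> x * frac_int a \<rho> x" .
  have "\<rho> x = kern a x - m * frac_int a \<rho> x"
    unfolding \<rho>_def using a x by (simp add: ml_kern_shift[of a a x] frac_int_ml_kern)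
  then have "x * \<rho> x = x * kern a x - m * (x * frac_int a \<rho> x)"
    by (simp only:) (simp add: algebra_simps)
  also have "\<dots> = a * kern (a + 1) x - m * (x * frac_int a \<rho> x)"
    using ka[of x] by simp
  also have "\<dots> \<le> a * kern (a + 1) x - m * (a * frac_int (a + 1) \<rho> x)"
    using 1 m by simp
  also have "\<dots> = a * ml_kern a (a + 1) (-m) x"
  proof -
    have "frac_int (a + 1) \<rho> x = ml_kern a (a + 1 + a) (-m) x"
      unfolding \<rho>_def using a x by (simp add: frac_int_ml_kern add_ac)
    moreover have "ml_kern a (a + 1) (-m) x = kern (a + 1) x + (-m) * ml_kern a (a + 1 + a) (-m) x"
      using a x by (intro ml_kern_shift) auto
    ultimately have "a * ml_kern a (a + 1) (-m) x = a * (kern (a + 1) x - m * frac_int (a + 1) \<rho> x)"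
      by simp
    then show ?thesis by (simp only: right_diff_distrib mult.left_commute[of a m])
  qed
  finally have "m * (x * \<rho> x) \<le> m * (a * ml_kern a (a + 1) (-m) x)"
    using m by (intro mult_left_mono) auto
  also have "\<dots> = a * (1 - mle a (-m) x)"
    using ml_kern_shift[of a 1 x "-m"] a x by (simp add: mle_eq_ml_kern kern_1 add.commute)
  also have "\<dots> \<le> a" using mle_neg_nonneg[OF a m, of x] x a by (simp add: mult_le_cancel_left1 algebra_simps)
  finally show ?thesis using x by (simp add: \<rho>_def field_simps)
qed

section \<open>Growth for nonnegative parameters\<close>

lemma ml_kern_pos_nonneg:
  assumes "0 < a" "0 < b" "0 \<le> m"
  shows "0 \<le> ml_kern a b m x"
  using assms mittag_leffler_pos(2)[of a b "m * x powr a"] by (simp add: ml_kern_def)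

lemma mle_sums:
  assumes "0 < a" "0 \<le> x"
  shows "(\<lambda>k. l ^ k * (x powr a) ^ k / Gamma (a * real k + 1)) sums mle a l x"
  unfolding mle_def using mittag_leffler_sums[of a 1 "l * x powr a"] assms by (simp add: power_mult_distrib)

lemma mle_pos_mono:
  assumes a: "0 < a" and m: "m \<ge> 0" and x: "0 \<le> x" "x \<le> y"
  shows "mle a m x \<le> mle a m y"
proof (rule sums_le[OF _ mle_sums mle_sums])
  fix k
  have "(x powr a) ^ k \<le> (y powr a) ^ k"
    using x a by (intro power_mono powr_mono2) auto
  moreover have "Gamma (a * real k + 1) > 0" using a by (auto intro!: Gamma_real_pos add_nonneg_pos)
  ultimately show "m ^ k * (x powr a) ^ k / Gamma (a * real k + 1) \<le> m ^ k * (y powr a) ^ k / Gamma (a * real k + 1)"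
    using m by (intro divide_right_mono mult_left_mono) auto
qed (use assms in auto)

text \<open>The first two terms of the series. They keep the value at x = 1 away from 1, hence away
  from its counterpart with negative parameter, by a margin growing with m.\<close>

lemma mle_pos_ge:
  assumes a: "0 < a" and m: "m \<ge> 0"
  shows "mle a m 1 \<ge> 1 + m / Gamma (a + 1)"
proof -
  have n: "0 \<le> m ^ k * (1 powr a) ^ k / Gamma (a * real k + 1)" for k
    using a m by (auto intro!: divide_nonneg_pos Gamma_real_pos add_nonneg_pos)
  have "(\<Sum>k<2. m ^ k * (1 powr a) ^ k / Gamma (a * real k + 1)) \<le> (\<Sum>k. m ^ k * (1 powr a) ^ k / Gamma (a * real k + 1))"
    by (rule sum_le_suminf) (use n a mle_sums[OF a, of 1 m] in \<open>auto simp: sums_iff\<close>)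
  also have "\<dots> = mle a m 1" using mle_sums[OF a, of 1 m] by (simp add: sums_iff)
  finally show ?thesis by (simp add: numeral_2_eq_2)
qed

lemma mle_pos_ge_1: "0 < a \<Longrightarrow> m \<ge> 0 \<Longrightarrow> 0 \<le> x \<Longrightarrow> 1 \<le> mle a m x"
  using mle_pos_mono[of a m 0 x] by simp

text \<open>Comparison of terms: c ln(y/x) <= (y/x)^c with c = a (k + 1) trades the factor from
  differentiation for growth from x to y. The derivative at x is bounded by the value at a slightly
  larger point, uniformly in m.\<close>

lemma mle_pos_deriv_bound:
  assumes a: "0 < a" and m: "m \<ge> 0" and x: "0 < x" "x < y"
  shows "m * ml_kern a a m x \<le> mle a m y / (x * ln (y / x))"
proof -
  have lp: "ln (y / x) > 0" using x by simp
  have 1: "(\<lambda>k. m * (m ^ k * kern (a * real k + a) x)) sums (m * ml_kern a a m x)"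
    using ml_kern_sums[of a a x m] a x by (intro sums_mult) auto
  define f where "f = (\<lambda>k. m ^ k * (y powr a) ^ k / Gamma (a * real k + 1))"
  have f0: "f k \<ge> 0" for k
    using a m by (auto simp: f_def intro!: divide_nonneg_pos Gamma_real_pos add_nonneg_pos)
  have "f sums mle a m y" unfolding f_def using mle_sums[of a y m] a x by simp
  then have "(\<lambda>k. f (Suc k)) sums (mle a m y - f 0)" by (simp add: sums_Suc_iff)
  then have 2: "(\<lambda>k. f (Suc k) / (x * ln (y / x))) sums ((mle a m y - f 0) / (x * ln (y / x)))"
    by (rule sums_divide)
  have "m * ml_kern a a m x \<le> (mle a m y - f 0) / (x * ln (y / x))"
  proof (rule sums_le[OF _ 1 2])
    fix k
    define c where "c = a * real (Suc k)"
    have c: "c > 0" using a by (simp add: c_def)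
    have G: "Gamma (c + 1) = c * Gamma c" "Gamma c > 0" using c by (auto intro!: Gamma_plus1)
    have "c * ln (y / x) \<le> exp (c * ln (y / x))" using exp_ge_add_one_self[of "c * ln (y / x)"] by linarith
    also have "\<dots> = (y / x) powr c" using x by (simp add: powr_def)
    finally have "c * ln (y / x) * x powr c \<le> y powr c" using x by (simp add: powr_divide field_simps)
    then have ineq: "x powr c * c / (x * ln (y / x)) \<le> y powr c / (x * ln (y/x)) / ln (y / x)"
      using lp x by (simp add: field_simps)
    have "kern (a * real k + a) x = x powr c / (x * Gamma c)"
      using x by (simp add: kern_def c_def algebra_simps powr_diff)
    also have "\<dots> \<le> y powr c / (c * Gamma c) / (x * ln (y / x))"
      using \<open>c * ln (y / x) * x powr c \<le> y powr c\<close> lp x c G by (simp add: field_simps)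
    finally have "m ^ Suc k * kern (a * real k + a) x \<le> m ^ Suc k * (y powr c / (c * Gamma c) / (x * ln (y / x)))"
      using m by (intro mult_left_mono) auto
    also have "y powr c = (y powr a) ^ Suc k"
    proof -
      have "(y powr a) ^ Suc k = (y powr a) powr real (Suc k)"
        using x by (intro powr_realpow[symmetric]) auto
      then show ?thesis by (simp only: c_def powr_powr)
    qed
    finally show "m * (m ^ k * kern (a * real k + a) x) \<le> f (Suc k) / (x * ln (y / x))"
      using G by (simp add: f_def c_def mult.assoc)
  qed
  also have "\<dots> \<le> mle a m y / (x * ln (y / x))"
    using f0[of 0] lp x by (intro divide_right_mono) auto
  finally show ?thesis .
qed

text \<open>Term k at x is compared with term k + 2 at 1, and this shift yields the two extra powers
  of m. The ratio of Gamma values is at most (a k + 2)^2, which the geometric factor v^k with v < 1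
  absorbs.\<close>

lemma mle_pos_growth:
  assumes a: "0 < a" "a \<le> 1" and x: "0 \<le> x" "x < 1"
  obtains C where "C > 0" "\<And>m. m \<ge> 0 \<Longrightarrow> m\<^sup>2 * mle a m x \<le> C * mle a m 1"
proof -
  define v where "v = x powr a"
  have v: "0 \<le> v" "v < 1"
    using a x powr_less_mono2[of a x 1] by (auto simp: v_def)
  have "(\<lambda>k. v ^ k * (a * real k + 2)\<^sup>2) \<longlonglongrightarrow> 0"
  proof -
    have u: "norm (sqrt v) < 1" using v by simp
    have "(\<lambda>k. a * (real k * sqrt v ^ k) + 2 * sqrt v ^ k) \<longlonglongrightarrow> a * 0 + 2 * 0"
      by (intro tendsto_intros powser_times_n_limit_0[OF u] LIMSEQ_power_zero u)
    then have "(\<lambda>k. (a * (real k * sqrt v ^ k) + 2 * sqrt v ^ k)\<^sup>2) \<longlonglongrightarrow> (a * 0 + 2 * 0)\<^sup>2"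
      by (rule tendsto_power)
    moreover have "(a * (real k * sqrt v ^ k) + 2 * sqrt v ^ k)\<^sup>2 = v ^ k * (a * real k + 2)\<^sup>2" for k
    proof -
      have "(sqrt v ^ k)\<^sup>2 = v ^ k" using v by (simp flip: power_mult add: mult.commute[of k] power_mult)
      moreover have "a * (real k * sqrt v ^ k) + 2 * sqrt v ^ k = sqrt v ^ k * (a * real k + 2)"
        by (simp add: algebra_simps)
      ultimately show ?thesis by (simp only: power_mult_distrib)
    qed
    ultimately show ?thesis by simp
  qed
  then have "Bseq (\<lambda>k. v ^ k * (a * real k + 2)\<^sup>2)"
    by (intro convergent_imp_Bseq) (auto simp: convergent_def)
  then obtain C where C: "C > 0" "\<And>k. norm (v ^ k * (a * real k + 2)\<^sup>2) \<le> C"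
    by (auto simp: Bseq_def)
  have "m\<^sup>2 * mle a m x \<le> C * mle a m 1" if m: "m \<ge> 0" for m
  proof -
    define f where "f = (\<lambda>k. m ^ k / Gamma (a * real k + 1))"
    have f0: "f k \<ge> 0" for k
      using a m by (auto simp: f_def intro!: divide_nonneg_pos Gamma_real_pos add_nonneg_pos)
    have fs: "f sums mle a m 1" unfolding f_def using mle_sums[of a 1 m] a by simp
    then have f2: "(\<lambda>k. f (k + 2)) sums (mle a m 1 - (\<Sum>k<2. f k))" by (rule sums_split_initial_segment)
    have "m\<^sup>2 * mle a m x \<le> C * (mle a m 1 - (\<Sum>k<2. f k))"
    proof (rule sums_le[OF _ sums_mult[OF mle_sums] sums_mult[OF f2]])
      fix k
      define z where "z = a * real k + 1"
      have z: "z \<ge> 1" using a by (simp add: z_def)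
      \<comment> \<open>The Gamma inequality covers increments up to 1 only, hence two steps of
        length a.\<close>
      have "Gamma (z + a + a) \<le> (z + a) powr a * Gamma (z + a)"
        using z a by (intro Gamma_add_le) auto
      also have "\<dots> \<le> (z + a) powr a * (z powr a * Gamma z)"
        using z a by (intro mult_left_mono Gamma_add_le) auto
      also have "\<dots> \<le> (z + 1) powr 1 * ((z + 1) powr 1 * Gamma z)"
      proof -
        have "(z + a) powr a \<le> (z + a) powr 1" using z a by (intro powr_mono) auto
        also have "\<dots> \<le> (z + 1) powr 1" using z a by simp
        finally have 1: "(z + a) powr a \<le> (z + 1) powr 1" .
        have "z powr a \<le> z powr 1" using z a by (intro powr_mono) auto
        also have "\<dots> \<le> (z + 1) powr 1" using z by simp
        finally have 2: "z powr a \<le> (z + 1) powr 1" .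
        have "Gamma z > 0" using z by auto
        then show ?thesis using 1 2 by (intro mult_mono) auto
      qed
      finally have "Gamma (z + a + a) \<le> (z + 1)\<^sup>2 * Gamma z"
        using z by (simp add: power2_eq_square mult.assoc)
      then have "v ^ k * Gamma (z + a + a) \<le> v ^ k * ((z + 1)\<^sup>2 * Gamma z)"
        using v by (intro mult_left_mono) auto
      also have "\<dots> = (v ^ k * (a * real k + 2)\<^sup>2) * Gamma z" by (simp add: z_def add.commute)
      also have "\<dots> \<le> C * Gamma z"
        using C(2)[of k] z by (intro mult_right_mono) auto
      finally have "v ^ k * Gamma (z + a + a) \<le> C * Gamma z" .
      moreover have "Gamma z > 0" "Gamma (z + a + a) > 0" using z a by auto
      ultimately have "v ^ k / Gamma z \<le> C / Gamma (z + a + a)" by (simp add: field_simps)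
      then have "m ^ (k + 2) * (v ^ k / Gamma z) \<le> m ^ (k + 2) * (C / Gamma (z + a + a))"
        using m by (intro mult_left_mono) auto
      moreover have "z + a + a = a * real (k + 2) + 1" by (simp add: z_def algebra_simps)
      moreover have "m ^ (k + 2) * (v ^ k / Gamma z) = m\<^sup>2 * (m ^ k * (x powr a) ^ k / Gamma (a * real k + 1))"
        by (simp add: v_def z_def power_add power2_eq_square mult_ac)
      moreover have "m ^ (k + 2) * (C / Gamma (a * real (k + 2) + 1)) = C * f (k + 2)"
        by (simp only: f_def times_divide_eq_right mult.commute)
      ultimately show "m\<^sup>2 * (m ^ k * (x powr a) ^ k / Gamma (a * real k + 1)) \<le> C * f (k + 2)"
        by (simp only:)
    qed (use a x in auto)
    also have "\<dots> \<le> C * mle a m 1"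
      using C(1) f0 by (intro mult_left_mono) (auto intro: sum_nonneg)
    finally show ?thesis .
  qed
  with C(1) that show ?thesis by blast
qed

text \<open>Only the terms of odd index survive. Up to the factor 2 \<mu>, this identifies the
  common denominator of \<open>C_fun\<close> and \<open>S_fun\<close> with E(\<mu>) -
  E(-\<mu>).\<close>

lemma mittag_leffler_odd_part:
  assumes a: "0 < a"
  shows "mittag_leffler a 1 z - mittag_leffler a 1 (-z) = 2 * z * mittag_leffler (2 * a) (a + 1) (z\<^sup>2)"
proof -
  define f where "f = (\<lambda>k. z ^ k / Gamma (a * real k + 1) - (-z) ^ k / Gamma (a * real k + 1))"
  have 1: "f sums (mittag_leffler a 1 z - mittag_leffler a 1 (-z))"
    unfolding f_def using a by (intro sums_diff mittag_leffler_sums) auto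
  have 2: "(\<lambda>k. f (2 * k + 1)) sums (2 * z * mittag_leffler (2 * a) (a + 1) (z\<^sup>2))"
  proof -
    have "f (2 * k + 1) = 2 * z * ((z\<^sup>2) ^ k / Gamma (2 * a * real k + (a + 1)))" for k
    proof -
      have "z ^ (2 * k + 1) = z * (z\<^sup>2) ^ k" "(-z) ^ (2 * k + 1) = - (z * (z\<^sup>2) ^ k)"
        by (simp_all add: power_mult power2_eq_square)
      moreover have "a * real (2 * k + 1) + 1 = 2 * a * real k + (a + 1)" by (simp add: algebra_simps)
      ultimately have "f (2 * k + 1) = z * (z\<^sup>2) ^ k / Gamma (2 * a * real k + (a + 1))
          - (- (z * (z\<^sup>2) ^ k)) / Gamma (2 * a * real k + (a + 1))"
        unfolding f_def by (simp only:)
      then show ?thesis by simp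
    qed
    then show ?thesis using sums_mult[OF mittag_leffler_sums[of "2 * a" "a + 1" "z\<^sup>2"], of "2 * z"] a by simp
  qed
  have "(\<lambda>k. f (2 * k + 1)) sums c \<longleftrightarrow> f sums c" for c
  proof (rule sums_mono_reindex)
    show "strict_mono (\<lambda>k::nat. 2 * k + 1)" by (auto simp: strict_mono_def)
    fix n assume "n \<notin> range (\<lambda>k::nat. 2 * k + 1)"
    then have "even n" by (metis oddE rangeI)
    then show "f n = 0" by (simp add: f_def)
  qed
  with 1 2 show ?thesis using sums_unique2 by blast
qed

section \<open>The trigonometric system\<close>

definition freq :: "nat \<Rightarrow> real" where
  "freq n = (if odd n then real ((n + 1) div 2) else real (n div 2) - 1/2)"

definition dY :: "nat \<Rightarrow> real \<Rightarrow> real" where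
  "dY n y = (if odd n then freq n * cos (freq n * y) else - freq n * sin (freq n * y))"

lemma Y_freq: "Y n y = (if odd n then sin (freq n * y) else cos (freq n * y))"
  by (simp add: Y_def freq_def)

lemma eigval_freq: "eigval \<epsilon> n = (if odd n then 1 + \<epsilon> else 1 - \<epsilon>) * (freq n)\<^sup>2"
  by (simp add: eigval_def freq_def)

lemma freq_eq: "n \<ge> 1 \<Longrightarrow> freq n = (if odd n then real n + 1 else real n - 1) / 2"
  by (auto simp: freq_def real_of_nat_div elim!: oddE evenE)

lemma freq_bounds: "n \<ge> 1 \<Longrightarrow> real n / 4 \<le> freq n" "n \<ge> 1 \<Longrightarrow> freq n \<le> real n"
proof -
  assume n: "n \<ge> 1"
  show "real n / 4 \<le> freq n"
  proof (cases "odd n")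
    case False
    then have "n \<ge> 2" using n by (cases "n = 1") auto
    then show ?thesis using False n by (simp add: freq_eq)
  qed (use n in \<open>simp add: freq_eq\<close>)
  show "freq n \<le> real n" using n by (simp add: freq_eq)
qed

lemma freq_pos: "n \<ge> 1 \<Longrightarrow> freq n > 0"
  using freq_bounds(1)[of n] by simp

lemma freq_inj: "n \<ge> 1 \<Longrightarrow> m \<ge> 1 \<Longrightarrow> freq n = freq m \<Longrightarrow> n = m"
proof -
  assume nm: "n \<ge> 1" "m \<ge> 1" "freq n = freq m"
  show "n = m"
  proof (cases "odd n \<longleftrightarrow> odd m")
    case True
    then show ?thesis using nm by (auto simp: freq_eq split: if_splits)
  next
    case False
    then have "real n + 2 = real m \<or> real m + 2 = real n"
      using nm by (auto simp: freq_eq split: if_splits)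
    then have "n + 2 = m \<or> m + 2 = n" by linarith
    then show ?thesis using False by auto
  qed
qed

lemma Y_deriv: "(Y n has_real_derivative dY n y) (at y within S)"
  unfolding Y_freq[abs_def] dY_def by (cases "odd n") (auto intro!: derivative_eq_intros)

lemma dY_deriv: "(dY n has_real_derivative - (freq n)\<^sup>2 * Y n y) (at y within S)"
  unfolding Y_freq[abs_def] dY_def[abs_def] by (cases "odd n") (auto intro!: derivative_eq_intros simp: power2_eq_square)

lemma Y_continuous [continuous_intros]: "continuous_on S f \<Longrightarrow> continuous_on S (\<lambda>x. Y n (f x))"
  by (rule continuous_on_compose2[OF DERIV_continuous_on[where s = UNIV and f = "Y n"]]) (auto intro: Y_deriv)

lemma dY_continuous [continuous_intros]: "continuous_on S f \<Longrightarrow> continuous_on S (\<lambda>x. dY n (f x))"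
  by (rule continuous_on_compose2[OF DERIV_continuous_on[where s = UNIV and f = "dY n"]]) (auto intro: dY_deriv simp del: mult_minus_left)

lemma Y_abs_le: "\<bar>Y n y\<bar> \<le> 1"
  by (simp add: Y_freq)

lemma dY_abs_le: "n \<ge> 1 \<Longrightarrow> \<bar>dY n y\<bar> \<le> freq n"
  using freq_pos[of n] by (auto simp: dY_def abs_mult mult_left_le)

lemma Y_minus: "Y n (-y) = (if odd n then - Y n y else Y n y)"
  by (simp add: Y_freq)

lemma sin_add_npi: "sin (x + real k * pi) = (-1) ^ k * sin x"
  by (simp add: sin_add)

lemma cos_add_npi: "cos (x + real k * pi) = (-1) ^ k * cos x"
  by (simp add: cos_add)

text \<open>Dirichlet eigenfunctions of [-pi, pi] numbered by a single index: up to sign, even m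
  gives the sines and odd m the cosines among the \<open>Y\<close>. Boundary values and completeness
  are easier in this form.\<close>

definition sv :: "nat \<Rightarrow> real \<Rightarrow> real" where
  "sv m y = sin (real m * ((y + pi) / 2))"

lemma Y_odd_sv: "Y (2 * Suc k - 1) y = (-1) ^ Suc k * sv (2 * Suc k) y"
proof -
  have "real (2 * Suc k) * ((y + pi) / 2) = real (Suc k) * y + real (Suc k) * pi"
    by (simp add: field_simps)
  then have "sv (2 * Suc k) y = (-1) ^ Suc k * sin (real (Suc k) * y)"
    unfolding sv_def using sin_add_npi[of "real (Suc k) * y" "Suc k"] by (simp only:)
  moreover have "(-1) ^ Suc k * ((-1) ^ Suc k * z) = (z::real)" for z
    by (simp flip: mult.assoc power_mult_distrib)
  ultimately show ?thesis using Y_odd[of "Suc k" y] by simp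
qed

lemma Y_even_sv: "Y (2 * Suc k) y = - ((-1) ^ Suc k) * sv (2 * Suc k - 1) y"
proof -
  have "real (2 * Suc k - 1) * ((y + pi) / 2) = ((real (Suc k) - 1/2) * y + real (Suc k) * pi) - pi / 2"
    by (simp add: field_simps)
  then have "sv (2 * Suc k - 1) y = - cos ((real (Suc k) - 1/2) * y + real (Suc k) * pi)"
    unfolding sv_def by (simp only: sin_diff) simp
  also have "\<dots> = - ((-1) ^ Suc k * cos ((real (Suc k) - 1/2) * y))"
    by (simp only: cos_add_npi)
  finally have "sv (2 * Suc k - 1) y = - ((-1) ^ Suc k * cos ((real (Suc k) - 1/2) * y))" .
  moreover have "- ((-1) ^ Suc k) * - ((-1) ^ Suc k * z) = (z::real)" for z
    by (simp flip: mult.assoc power_mult_distrib)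
  ultimately show ?thesis unfolding Y_even by simp
qed

lemma Y_eq_sv:
  assumes "m \<ge> 1"
  obtains n s where "n \<ge> 1" "s \<noteq> 0" "\<And>y. sv m y = s * Y n y"
proof (cases "even m")
  case True
  then obtain k where k: "m = 2 * Suc k" using assms by (metis One_nat_def evenE gr0_implies_Suc less_eq_Suc_le mult_0_right neq0_conv)
  have "sv m y = (-1) ^ Suc k * Y (2 * Suc k - 1) y" for y
    unfolding Y_odd_sv k by (simp flip: mult.assoc power_mult_distrib)
  then show ?thesis by (intro that[of "2 * Suc k - 1" "(-1) ^ Suc k"]) auto
next
  case False
  then obtain k where k: "m = 2 * Suc k - 1" by (auto elim!: oddE)
  have "sv m y = - ((-1) ^ Suc k) * Y (2 * Suc k) y" for y
    unfolding Y_even_sv k by (simp flip: mult.assoc power_mult_distrib)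
  then show ?thesis by (intro that[of "2 * Suc k" "- ((-1) ^ Suc k)"]) auto
qed

lemma sv_ends: "sv m (-pi) = 0" "sv m pi = 0"
  using sin_npi[of m] by (simp_all add: sv_def)

lemma Y_ends:
  assumes "n \<ge> 1" shows "Y n (-pi) = 0" "Y n pi = 0"
proof -
  obtain k where "n = 2 * Suc k - 1 \<or> n = 2 * Suc k"
    using assms by (metis (no_types, lifting) Suc_1 Suc_eq_plus1 add_diff_cancel_right' evenE mult_Suc_right nat_mult_1_right not_one_le_zero oddE old.nat.exhaust plus_1_eq_Suc add_2_eq_Suc)
  then show "Y n (-pi) = 0" "Y n pi = 0"
    using Y_odd_sv[of k] Y_even_sv[of k] sv_ends by auto
qed

section \<open>Orthogonality and Bessel's inequality\<close>

lemma FTC_integral: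
  fixes F :: "real \<Rightarrow> real"
  assumes "a \<le> b" "\<And>x. x \<in> {a..b} \<Longrightarrow> (F has_real_derivative f x) (at x within {a..b})"
  shows "(f has_integral (F b - F a)) {a..b}"
  using assms by (intro fundamental_theorem_of_calculus) (auto simp: has_real_derivative_iff_has_vector_derivative)

text \<open>The Wronskian of two modes vanishes at both ends, and its derivative is their product
  times the difference of the squared frequencies.\<close>

lemma Y_orthogonal:
  assumes "n \<ge> 1" "m \<ge> 1" "n \<noteq> m"
  shows "integral {-pi..pi} (\<lambda>y. Y n y * Y m y) = 0"
proof -
  have "((\<lambda>y. ((freq n)\<^sup>2 - (freq m)\<^sup>2) * (Y n y * Y m y)) has_integral
     ((Y n pi * dY m pi - dY n pi * Y m pi) - (Y n (-pi) * dY m (-pi) - dY n (-pi) * Y m (-pi)))) {-pi..pi}"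
    by (rule FTC_integral) (auto intro!: derivative_eq_intros Y_deriv dY_deriv simp: algebra_simps)
  then have 0: "((\<lambda>y. ((freq n)\<^sup>2 - (freq m)\<^sup>2) * (Y n y * Y m y)) has_integral 0) {-pi..pi}"
    using assms by (simp add: Y_ends)
  have "(freq n)\<^sup>2 \<noteq> (freq m)\<^sup>2"
    using freq_inj[OF assms(1,2)] assms(3) freq_pos[OF assms(1)] freq_pos[OF assms(2)] by (auto simp: power2_eq_iff)
  then have "((\<lambda>y. Y n y * Y m y) has_integral 0) {-pi..pi}"
    using has_integral_mult_right[OF 0, of "1 / ((freq n)\<^sup>2 - (freq m)\<^sup>2)"] by simp
  then show ?thesis by (rule integral_unique)
qed

lemma dY_integral:
  assumes "n \<ge> 1" "m \<ge> 1"
  shows "integral {-pi..pi} (\<lambda>y. dY n y * dY m y) = (freq m)\<^sup>2 * integral {-pi..pi} (\<lambda>y. Y n y * Y m y)"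
proof -
  have "((\<lambda>y. dY n y * dY m y - (freq m)\<^sup>2 * (Y n y * Y m y)) has_integral
     (Y n pi * dY m pi - Y n (-pi) * dY m (-pi))) {-pi..pi}"
    by (rule FTC_integral) (auto intro!: derivative_eq_intros Y_deriv dY_deriv simp: algebra_simps)
  then have "integral {-pi..pi} (\<lambda>y. dY n y * dY m y - (freq m)\<^sup>2 * (Y n y * Y m y)) = 0"
    using assms by (simp add: Y_ends integral_unique)
  moreover have "integral {-pi..pi} (\<lambda>y. dY n y * dY m y - (freq m)\<^sup>2 * (Y n y * Y m y))
      = integral {-pi..pi} (\<lambda>y. dY n y * dY m y) - integral {-pi..pi} (\<lambda>y. (freq m)\<^sup>2 * (Y n y * Y m y))"
    by (intro integral_diff integrable_continuous_real continuous_intros)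
  ultimately show ?thesis by simp
qed

text \<open>Integration of sin^2 + cos^2 = 1: the squares of \<open>Y\<close> and of
  \<open>dY / freq\<close> have equal integrals by \<open>dY_integral\<close>, so each is half of 2
  pi.\<close>

lemma Y_norm:
  assumes "n \<ge> 1"
  shows "integral {-pi..pi} (\<lambda>y. (Y n y)\<^sup>2) = pi"
proof -
  have "(freq n)\<^sup>2 * (Y n y)\<^sup>2 + (dY n y)\<^sup>2 = (freq n)\<^sup>2" for y
  proof -
    have "(freq n)\<^sup>2 * (sin (freq n * y))\<^sup>2 + (freq n)\<^sup>2 * (cos (freq n * y))\<^sup>2 = (freq n)\<^sup>2"
      by (simp flip: distrib_left)
    then show ?thesis by (auto simp: Y_freq dY_def power_mult_distrib)
  qed
  then have "integral {-pi..pi} (\<lambda>y. (freq n)\<^sup>2 * (Y n y)\<^sup>2 + (dY n y)\<^sup>2) = (freq n)\<^sup>2 * (2 * pi)"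
    by simp
  moreover have "integral {-pi..pi} (\<lambda>y. (freq n)\<^sup>2 * (Y n y)\<^sup>2 + (dY n y)\<^sup>2)
     = integral {-pi..pi} (\<lambda>y. (freq n)\<^sup>2 * (Y n y)\<^sup>2) + integral {-pi..pi} (\<lambda>y. (dY n y)\<^sup>2)"
    by (intro integral_add integrable_continuous_real continuous_intros)
  moreover have "integral {-pi..pi} (\<lambda>y. (dY n y)\<^sup>2) = (freq n)\<^sup>2 * integral {-pi..pi} (\<lambda>y. (Y n y)\<^sup>2)"
    using dY_integral[OF assms assms] by (simp add: power2_eq_square)
  ultimately have "(freq n)\<^sup>2 * (2 * integral {-pi..pi} (\<lambda>y. (Y n y)\<^sup>2)) = (freq n)\<^sup>2 * (2 * pi)"
    by simp
  then show ?thesis using freq_pos[OF assms] by simp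
qed

lemma fourier_coeff_eq: "n \<ge> 1 \<Longrightarrow> fourier_coeff f n = integral {-pi..pi} (\<lambda>y. f y * Y n y) / pi"
  by (simp add: fourier_coeff_def Y_norm)

text \<open>Nonnegativity of the squared distance from f to its projection. The family is kept
  general because it is applied both to \<open>Y\<close> and to \<open>dY / freq\<close>.\<close>

lemma Bessel_inequality:
  fixes f :: "real \<Rightarrow> real" and e :: "nat \<Rightarrow> real \<Rightarrow> real"
  assumes fin: "finite F" and f: "continuous_on {a..b} f" and e: "\<And>i. continuous_on {a..b} (e i)"
    and orth: "\<And>i j. i \<noteq> j \<Longrightarrow> integral {a..b} (\<lambda>y. e i y * e j y) = 0"
    and norm: "\<And>i. integral {a..b} (\<lambda>y. (e i y)\<^sup>2) = N" and N: "N > 0"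
  shows "(\<Sum>i\<in>F. (integral {a..b} (\<lambda>y. f y * e i y))\<^sup>2) \<le> N * integral {a..b} (\<lambda>y. (f y)\<^sup>2)"
proof -
  define c where "c = (\<lambda>i. integral {a..b} (\<lambda>y. f y * e i y) / N)"
  define S where "S = (\<lambda>y. \<Sum>i\<in>F. c i * e i y)"
  have S: "continuous_on {a..b} S" unfolding S_def by (intro continuous_intros e)
  note ic = integrable_continuous_real
  have iS: "integral {a..b} (\<lambda>y. g y * S y) = (\<Sum>i\<in>F. c i * integral {a..b} (\<lambda>y. g y * e i y))"
    if g: "continuous_on {a..b} g" for g
  proof -
    have e1: "(\<lambda>y. g y * S y) = (\<lambda>y. \<Sum>i\<in>F. c i * (g y * e i y))"
      by (simp add: S_def sum_distrib_left mult_ac)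
    have "integral {a..b} (\<lambda>y. g y * S y) = (\<Sum>i\<in>F. integral {a..b} (\<lambda>y. c i * (g y * e i y)))"
      unfolding e1 by (rule integral_sum[OF fin]) (intro ic continuous_intros g e)
    then show ?thesis by simp
  qed
  have eS: "integral {a..b} (\<lambda>y. e i y * S y) = c i * N" if "i \<in> F" for i
  proof -
    have "integral {a..b} (\<lambda>y. e i y * S y) = (\<Sum>j\<in>F. c j * integral {a..b} (\<lambda>y. e i y * e j y))"
      by (rule iS[OF e])
    also have "\<dots> = (\<Sum>j\<in>F. if j = i then c i * N else 0)"
      by (rule sum.cong) (auto simp: orth norm simp flip: power2_eq_square)
    also have "\<dots> = c i * N" using fin that by simp
    finally show ?thesis .
  qed
  have fS: "integral {a..b} (\<lambda>y. f y * S y) = (\<Sum>i\<in>F. N * (c i)\<^sup>2)"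
    unfolding iS[OF f] using N by (intro sum.cong) (auto simp: c_def power2_eq_square)
  have "integral {a..b} (\<lambda>y. S y * S y) = (\<Sum>i\<in>F. c i * integral {a..b} (\<lambda>y. e i y * S y))"
    using iS[OF S] by (simp add: mult.commute)
  also have "\<dots> = (\<Sum>i\<in>F. N * (c i)\<^sup>2)"
    by (rule sum.cong) (auto simp: eS power2_eq_square)
  finally have SS: "integral {a..b} (\<lambda>y. S y * S y) = (\<Sum>i\<in>F. N * (c i)\<^sup>2)" .
  have "0 \<le> integral {a..b} (\<lambda>y. (f y - S y)\<^sup>2)"
    by (intro integral_nonneg ic continuous_intros f S) auto
  also have "(\<lambda>y. (f y - S y)\<^sup>2) = (\<lambda>y. ((f y)\<^sup>2 - 2 * (f y * S y)) + S y * S y)"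
    by (auto simp: power2_eq_square algebra_simps)
  also have "integral {a..b} \<dots> = integral {a..b} (\<lambda>y. (f y)\<^sup>2 - 2 * (f y * S y)) + integral {a..b} (\<lambda>y. S y * S y)"
    by (intro integral_add ic continuous_intros f S)
  also have "integral {a..b} (\<lambda>y. (f y)\<^sup>2 - 2 * (f y * S y))
     = integral {a..b} (\<lambda>y. (f y)\<^sup>2) - integral {a..b} (\<lambda>y. 2 * (f y * S y))"
    by (intro integral_diff ic continuous_intros f S)
  finally have "(\<Sum>i\<in>F. N * (c i)\<^sup>2) \<le> integral {a..b} (\<lambda>y. (f y)\<^sup>2)"
    using fS SS by simp
  then have "N * (\<Sum>i\<in>F. N * (c i)\<^sup>2) \<le> N * integral {a..b} (\<lambda>y. (f y)\<^sup>2)"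
    using N by simp
  moreover have "N * (\<Sum>i\<in>F. N * (c i)\<^sup>2) = (\<Sum>i\<in>F. (integral {a..b} (\<lambda>y. f y * e i y))\<^sup>2)"
    unfolding sum_distrib_left using N by (intro sum.cong) (auto simp: c_def power2_eq_square)
  ultimately show ?thesis by simp
qed

text \<open>The inequality p q <= p^2 + q^2 splits each term into a squared coefficient, summable by
  Bessel, and a squared 1 / freq, bounded by 16 / n^2 with n = i + 1 since freq >= n / 4.\<close>

lemma summable_Bessel:
  fixes f :: "real \<Rightarrow> real" and e :: "nat \<Rightarrow> real \<Rightarrow> real"
  assumes f: "continuous_on {a..b} f" and e: "\<And>i. continuous_on {a..b} (e i)"
    and orth: "\<And>i j. i \<noteq> j \<Longrightarrow> integral {a..b} (\<lambda>y. e i y * e j y) = 0"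
    and norm: "\<And>i. integral {a..b} (\<lambda>y. (e i y)\<^sup>2) = N" and N: "N > 0"
  shows "summable (\<lambda>i. \<bar>integral {a..b} (\<lambda>y. f y * e i y)\<bar> / freq (Suc i))"
proof (rule summable_comparison_test')
  have "summable (\<lambda>i. (integral {a..b} (\<lambda>y. f y * e i y))\<^sup>2)"
    by (rule bounded_imp_summable[where B = "N * integral {a..b} (\<lambda>y. (f y)\<^sup>2)"])
      (auto intro: Bessel_inequality[OF _ f e orth norm N])
  moreover have "summable (\<lambda>i. 16 * (1 / real (Suc i) ^ 2))"
    using inverse_power_summable[of 2, where 'a = real] summable_Suc_iff[of "\<lambda>n. inverse (real n ^ 2)"]
    by (intro summable_mult) (simp add: inverse_eq_divide)
  ultimately show "summable (\<lambda>i. (integral {a..b} (\<lambda>y. f y * e i y))\<^sup>2 + 16 * (1 / real (Suc i) ^ 2))"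
    by (rule summable_add)
  fix i :: nat
  define p q where "p = \<bar>integral {a..b} (\<lambda>y. f y * e i y)\<bar>" and "q = 1 / freq (Suc i)"
  have q: "q \<ge> 0" using freq_pos[of "Suc i"] by (simp add: q_def)
  have "q \<le> 4 / real (Suc i)"
    using freq_bounds(1)[of "Suc i"] freq_pos[of "Suc i"] by (simp add: q_def field_simps)
  then have "q\<^sup>2 \<le> (4 / real (Suc i))\<^sup>2" using q by (intro power_mono)
  then have "q\<^sup>2 \<le> 16 * (1 / real (Suc i) ^ 2)" by (simp add: power_divide)
  moreover have "p * q \<le> p\<^sup>2 + q\<^sup>2"
  proof -
    have "p * q \<ge> 0" using q by (simp add: p_def)
    then show ?thesis using sum_squares_bound[of p q] by linarith
  qed
  ultimately have "p * q \<le> (integral {a..b} (\<lambda>y. f y * e i y))\<^sup>2 + 16 * (1 / real (Suc i) ^ 2)"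
    by (simp add: p_def)
  moreover have "norm (\<bar>integral {a..b} (\<lambda>y. f y * e i y)\<bar> / freq (Suc i)) = p * q"
    using q by (simp add: p_def q_def)
  ultimately show "norm (\<bar>integral {a..b} (\<lambda>y. f y * e i y)\<bar> / freq (Suc i)) \<le> (integral {a..b} (\<lambda>y. f y * e i y))\<^sup>2 + 16 * (1 / real (Suc i) ^ 2)"
    by simp
qed

section \<open>Fourier coefficients of the data\<close>

lemma holder_space_derivs:
  assumes "f \<in> holder_space m \<delta> a b"
  obtains D where "\<And>x. x \<in> {a..b} \<Longrightarrow> D 0 x = f x"
    "\<And>i x. i < m \<Longrightarrow> x \<in> {a..b} \<Longrightarrow> (D i has_real_derivative D (Suc i) x) (at x within {a..b})"
    "\<And>i. i \<le> m \<Longrightarrow> continuous_on {a..b} (D i)"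
proof -
  from assms obtain D where D: "\<forall>x\<in>{a..b}. D 0 x = f x"
    "\<forall>i<m. \<forall>x\<in>{a..b}. (D i has_real_derivative D (Suc i) x) (at x within {a..b})" "continuous_on {a..b} (D m)"
    unfolding holder_space_def by blast
  have "continuous_on {a..b} (D i)" if "i \<le> m" for i
  proof (cases "i = m")
    case False
    then show ?thesis using D(2) that
      by (intro DERIV_continuous_on[where D = "D (Suc i)"]) auto
  qed (use D in simp)
  with D that show ?thesis by blast
qed

text \<open>Two integrations by parts; the boundary terms vanish because \<phi> and the modes do at
  both ends. One factor 1 / freq is left over and is spent in
  \<open>summable_Bessel\<close>.\<close>

lemma summable_fourier_C2:
  assumes "\<phi> \<in> holder_space 2 \<delta> (-pi) pi" "\<phi> (-pi) = 0" "\<phi> pi = 0"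
  shows "summable (\<lambda>n. \<bar>fourier_coeff \<phi> (Suc n)\<bar> * freq (Suc n))"
proof -
  obtain D where D: "\<And>x. x \<in> {-pi..pi} \<Longrightarrow> D 0 x = \<phi> x"
    "\<And>i x. i < 2 \<Longrightarrow> x \<in> {-pi..pi} \<Longrightarrow> (D i has_real_derivative D (Suc i) x) (at x within {-pi..pi})"
    "\<And>i. i \<le> 2 \<Longrightarrow> continuous_on {-pi..pi} (D i)"
    by (rule holder_space_derivs[OF assms(1)]) blast
  note D1 = D(2)[of 0, simplified] and D2 = D(2)[of 1, unfolded Suc_1, simplified]
  note c0 = D(3)[of 0, simplified] and c2 = D(3)[of 2, simplified]
  have "\<bar>fourier_coeff \<phi> (Suc n)\<bar> * freq (Suc n) = 1 / pi * (\<bar>integral {-pi..pi} (\<lambda>y. D 2 y * Y (Suc n) y)\<bar> / freq (Suc n))" for n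
  proof -
    let ?n = "Suc n"
    have f: "freq ?n > 0" by (rule freq_pos) simp
    have "((\<lambda>y. D 2 y * Y ?n y + (freq ?n)\<^sup>2 * (D 0 y * Y ?n y)) has_integral
      ((D 1 pi * Y ?n pi - D 0 pi * dY ?n pi) - (D 1 (-pi) * Y ?n (-pi) - D 0 (-pi) * dY ?n (-pi)))) {-pi..pi}"
      by (rule FTC_integral)
        (auto intro!: derivative_eq_intros Y_deriv dY_deriv D1 D2 simp: algebra_simps)
    then have "integral {-pi..pi} (\<lambda>y. D 2 y * Y ?n y + (freq ?n)\<^sup>2 * (D 0 y * Y ?n y)) = 0"
      using assms by (simp add: Y_ends D(1) integral_unique)
    moreover have "integral {-pi..pi} (\<lambda>y. D 2 y * Y ?n y + (freq ?n)\<^sup>2 * (D 0 y * Y ?n y))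
       = integral {-pi..pi} (\<lambda>y. D 2 y * Y ?n y) + integral {-pi..pi} (\<lambda>y. (freq ?n)\<^sup>2 * (D 0 y * Y ?n y))"
      by (intro integral_add integrable_continuous_real continuous_intros c0 c2)
    moreover have "integral {-pi..pi} (\<lambda>y. D 0 y * Y ?n y) = integral {-pi..pi} (\<lambda>y. \<phi> y * Y ?n y)"
      by (intro Henstock_Kurzweil_Integration.integral_cong) (simp add: D(1))
    ultimately have eq: "integral {-pi..pi} (\<lambda>y. D 2 y * Y ?n y) = - (freq ?n)\<^sup>2 * (pi * fourier_coeff \<phi> ?n)"
      by (simp add: fourier_coeff_eq)
    show ?thesis unfolding eq using f by (simp add: abs_mult power2_eq_square)
  qed
  moreover have "summable (\<lambda>n. 1 / pi * (\<bar>integral {-pi..pi} (\<lambda>y. D 2 y * Y (Suc n) y)\<bar> / freq (Suc n)))"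
    by (intro summable_mult summable_Bessel[where N = pi])
      (auto intro!: c2 continuous_intros Y_orthogonal Y_norm)
  ultimately show ?thesis by simp
qed

text \<open>One integration by parts against \<open>dY\<close>, with \<psi> vanishing at both ends.
  The functions \<open>dY / freq\<close> are again orthogonal with squared norm pi, so Bessel's
  inequality applies to the derivative of \<psi>.\<close>

lemma summable_fourier_C1:
  assumes "\<psi> \<in> holder_space 1 \<delta> (-pi) pi" "\<psi> (-pi) = 0" "\<psi> pi = 0"
  shows "summable (\<lambda>n. \<bar>fourier_coeff \<psi> (Suc n)\<bar>)"
proof -
  obtain D where D: "\<And>x. x \<in> {-pi..pi} \<Longrightarrow> D 0 x = \<psi> x"
    "\<And>i x. i < 1 \<Longrightarrow> x \<in> {-pi..pi} \<Longrightarrow> (D i has_real_derivative D (Suc i) x) (at x within {-pi..pi})"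
    "\<And>i. i \<le> 1 \<Longrightarrow> continuous_on {-pi..pi} (D i)"
    by (rule holder_space_derivs[OF assms(1)]) blast
  note D1 = D(2)[of 0, simplified]
  note c0 = D(3)[of 0, simplified] and c1 = D(3)[OF order_refl]
  have fr: "freq (Suc n) > 0" for n by (rule freq_pos) simp
  have "\<bar>fourier_coeff \<psi> (Suc n)\<bar> = 1 / pi * (\<bar>integral {-pi..pi} (\<lambda>y. D 1 y * (dY (Suc n) y / freq (Suc n)))\<bar> / freq (Suc n))" for n
  proof -
    let ?n = "Suc n"
    have "((\<lambda>y. D 1 y * dY ?n y - (freq ?n)\<^sup>2 * (D 0 y * Y ?n y)) has_integral
      (D 0 pi * dY ?n pi - D 0 (-pi) * dY ?n (-pi))) {-pi..pi}"
      by (rule FTC_integral)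
        (auto intro!: derivative_eq_intros Y_deriv dY_deriv D1 simp: algebra_simps)
    then have "integral {-pi..pi} (\<lambda>y. D 1 y * dY ?n y - (freq ?n)\<^sup>2 * (D 0 y * Y ?n y)) = 0"
      using assms by (simp add: D(1) integral_unique)
    moreover have "integral {-pi..pi} (\<lambda>y. D 1 y * dY ?n y - (freq ?n)\<^sup>2 * (D 0 y * Y ?n y))
       = integral {-pi..pi} (\<lambda>y. D 1 y * dY ?n y) - integral {-pi..pi} (\<lambda>y. (freq ?n)\<^sup>2 * (D 0 y * Y ?n y))"
      by (intro integral_diff integrable_continuous_real continuous_intros c0 c1)
    moreover have "integral {-pi..pi} (\<lambda>y. D 0 y * Y ?n y) = integral {-pi..pi} (\<lambda>y. \<psi> y * Y ?n y)"
      by (intro Henstock_Kurzweil_Integration.integral_cong) (simp add: D(1))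
    ultimately have eq: "integral {-pi..pi} (\<lambda>y. D 1 y * dY ?n y) = (freq ?n)\<^sup>2 * (pi * fourier_coeff \<psi> ?n)"
      by (simp add: fourier_coeff_eq)
    have "integral {-pi..pi} (\<lambda>y. D 1 y * (dY ?n y / freq ?n)) = integral {-pi..pi} (\<lambda>y. D 1 y * dY ?n y) / freq ?n"
      by simp
    then show ?thesis unfolding eq using fr[of n] by (simp add: abs_mult power2_eq_square)
  qed
  moreover have "summable (\<lambda>n. 1 / pi * (\<bar>integral {-pi..pi} (\<lambda>y. D 1 y * (dY (Suc n) y / freq (Suc n)))\<bar> / freq (Suc n)))"
  proof (intro summable_mult summable_Bessel[where N = pi])
    fix i j :: nat
    have *: "integral {-pi..pi} (\<lambda>y. dY (Suc i) y / freq (Suc i) * (dY (Suc j) y / freq (Suc j)))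
       = (freq (Suc j) / freq (Suc i)) * integral {-pi..pi} (\<lambda>y. Y (Suc i) y * Y (Suc j) y)" for i j
      using dY_integral[of "Suc i" "Suc j"] fr[of i] fr[of j]
      by (simp add: power2_eq_square)
    show "i \<noteq> j \<Longrightarrow> integral {-pi..pi} (\<lambda>y. dY (Suc i) y / freq (Suc i) * (dY (Suc j) y / freq (Suc j))) = 0"
      unfolding * by (simp add: Y_orthogonal)
    show "integral {-pi..pi} (\<lambda>y. (dY (Suc i) y / freq (Suc i))\<^sup>2) = pi"
      using *[of i i] Y_norm[of "Suc i"] fr[of i] by (simp add: power2_eq_square)
  next
    show "continuous_on {-pi..pi} (\<lambda>y. dY (Suc i) y / freq (Suc i))" for i
      using fr[of i] by (intro continuous_intros) auto
  qed (use c1 in auto)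
  ultimately show ?thesis by simp
qed

text \<open>With t = cos((y + pi) / 2), the product of \<open>sv m\<close> and t is a combination of
  the neighbours of \<open>sv m\<close>, so f is orthogonal to \<open>sv 1\<close> times every
  polynomial in t. By Weierstrass such polynomials approximate f uniformly; hence the integral of
  f^2 times \<open>sv 1\<close> vanishes, and \<open>sv 1\<close> is positive inside the
  interval.\<close>

lemma sv_complete:
  assumes f: "continuous_on {-pi..pi} f" and orth: "\<And>m. m \<ge> 1 \<Longrightarrow> integral {-pi..pi} (\<lambda>y. f y * sv m y) = 0"
    and y: "y \<in> {-pi..pi}"
  shows "f y = 0"
proof -
  define c where "c = (\<lambda>y::real. cos ((y + pi) / 2))"
  note ic = integrable_continuous_real
  have sv_cont: "continuous_on {-pi..pi} (sv m)" for m
    unfolding sv_def by (intro continuous_intros) auto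
  have c_cont: "continuous_on {-pi..pi} c"
    unfolding c_def by (intro continuous_intros) auto
  \<comment> \<open>The induction on the power j needs the claim for all m at once, since m moves to
    its neighbours. The case m = 0 is harmless because \<open>sv 0\<close> is zero.\<close>
  have z: "integral {-pi..pi} (\<lambda>y. f y * sv m y * c y ^ j) = 0" for m j
  proof (induction j arbitrary: m)
    case 0
    then show ?case using orth[of m] by (cases "m = 0") (auto simp: sv_def)
  next
    case (Suc j)
    show ?case
    proof (cases "m = 0")
      case False
      then obtain k where k: "m = Suc k" by (cases m) auto
      have "sv m y * c y = 1/2 * sv (Suc m) y + 1/2 * sv k y" for y
      proof -
        define t where "t = (y + pi) / 2"
        have "real (Suc m) * t = real m * t + t" "real k * t = real m * t - t"
          by (simp_all add: k algebra_simps)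
        then have "sv (Suc m) y = sin (real m * t + t)" "sv k y = sin (real m * t - t)"
          by (simp_all only: sv_def flip: t_def)
        moreover have "sv m y = sin (real m * t)" "c y = cos t"
          by (simp_all only: sv_def c_def flip: t_def)
        ultimately show ?thesis by (simp only: sin_add sin_diff) (simp add: field_simps)
      qed
      then have sc: "f y * sv m y * c y ^ Suc j = f y * (1/2 * sv (Suc m) y + 1/2 * sv k y) * c y ^ j" for y
        by (simp only: power_Suc mult.assoc flip: \<open>\<And>y. sv m y * c y = _\<close>)
      have "f y * sv m y * c y ^ Suc j = 1/2 * (f y * sv (Suc m) y * c y ^ j) + 1/2 * (f y * sv k y * c y ^ j)" for y
        unfolding sc by (simp add: algebra_simps)
      then have "integral {-pi..pi} (\<lambda>y. f y * sv m y * c y ^ Suc j)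
        = integral {-pi..pi} (\<lambda>y. 1/2 * (f y * sv (Suc m) y * c y ^ j)) + integral {-pi..pi} (\<lambda>y. 1/2 * (f y * sv k y * c y ^ j))"
        by (simp only:) (intro integral_add ic continuous_intros f sv_cont c_cont)
      then show ?thesis using Suc.IH[of "Suc m"] Suc.IH[of k] by simp
    qed (simp add: sv_def)
  qed
  have poly0: "integral {-pi..pi} (\<lambda>y. f y * sv 1 y * p (c y)) = 0" if rp: "real_polynomial_function p" for p
  proof -
    obtain a n where p: "p = (\<lambda>x. \<Sum>i\<le>n. a i * x ^ i)"
      using rp unfolding real_polynomial_function_iff_sum by blast
    have e1: "(\<lambda>y. f y * sv 1 y * p (c y)) = (\<lambda>y. \<Sum>i\<le>n. a i * (f y * sv 1 y * c y ^ i))"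
      by (simp add: p sum_distrib_left mult_ac)
    have "integral {-pi..pi} (\<lambda>y. f y * sv 1 y * p (c y)) = (\<Sum>i\<le>n. integral {-pi..pi} (\<lambda>y. a i * (f y * sv 1 y * c y ^ i)))"
      unfolding e1 by (rule integral_sum) (auto intro!: ic continuous_intros f sv_cont c_cont)
    then show ?thesis using z by simp
  qed
  have s1: "sv 1 y \<ge> 0" "sv 1 y \<le> 1" if "y \<in> {-pi..pi}" for y
    using that unfolding sv_def by (auto intro!: sin_ge_zero)
  obtain M where M: "\<And>y. y \<in> {-pi..pi} \<Longrightarrow> \<bar>f y\<bar> \<le> M"
    using compact_imp_bounded[OF compact_continuous_image[OF f compact_Icc]]
    unfolding bounded_iff by auto force
  have "integral {-pi..pi} (\<lambda>y. f y * f y * sv 1 y) \<le> e * (M * (2 * pi))" if e: "e > 0" for e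
  proof -
    \<comment> \<open>f as a function of t: y = 2 arccos t - pi inverts the substitution.\<close>
    define g where "g = (\<lambda>t. f (2 * arccos t - pi))"
    have "continuous_on {-1..1} g" unfolding g_def
    proof (rule continuous_on_compose2[OF f])
      show "(\<lambda>t. 2 * arccos t - pi) ` {-1..1} \<subseteq> {-pi..pi}"
        using arccos_bounded by fastforce
    qed (auto intro!: continuous_intros)
    then obtain p where p: "real_polynomial_function p" "\<And>t. t \<in> {-1..1} \<Longrightarrow> \<bar>g t - p t\<bar> < e"
      using Stone_Weierstrass_real_polynomial_function[OF compact_Icc _ e] by blast
    have gc: "g (c y) = f y" if "y \<in> {-pi..pi}" for y
    proof -
      have a: "arccos (cos ((y + pi) / 2)) = (y + pi) / 2"
        using that by (intro arccos_cos) auto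
      have e: "2 * ((y + pi) / 2) - pi = y" by (simp add: field_simps)
      show ?thesis unfolding g_def c_def a e ..
    qed
    have pc: "continuous_on {-pi..pi} (\<lambda>y. p (c y))"
      using continuous_on_compose2[OF continuous_on_polymonial_function[of p UNIV] c_cont] p(1)
      by (auto simp: real_polynomial_function_eq)
    have "integral {-pi..pi} (\<lambda>y. f y * f y * sv 1 y)
       = integral {-pi..pi} (\<lambda>y. f y * sv 1 y * (f y - p (c y)) + f y * sv 1 y * p (c y))"
      by (simp add: algebra_simps)
    also have "\<dots> = integral {-pi..pi} (\<lambda>y. f y * sv 1 y * (f y - p (c y))) + integral {-pi..pi} (\<lambda>y. f y * sv 1 y * p (c y))"
      by (intro integral_add ic continuous_intros f sv_cont pc)
    also have "\<dots> = integral {-pi..pi} (\<lambda>y. f y * sv 1 y * (f y - p (c y)))"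
      unfolding poly0[OF p(1)] by simp
    also have "\<dots> \<le> integral {-pi..pi} (\<lambda>y. M * e)"
    proof (intro integral_le ic continuous_intros f sv_cont pc)
      fix y assume y: "y \<in> {-pi..pi}"
      have "f y * sv 1 y * (f y - p (c y)) \<le> \<bar>f y\<bar> * \<bar>sv 1 y\<bar> * \<bar>f y - p (c y)\<bar>"
        by (simp flip: abs_mult)
      also have "\<dots> \<le> M * 1 * e"
        using M[OF y] s1[OF y] p(2)[of "c y"] gc[OF y] e by (intro mult_mono) (auto simp: c_def)
      finally show "f y * sv 1 y * (f y - p (c y)) \<le> M * e" by simp
    qed
    also have "\<dots> = e * (M * (2 * pi))" by simp
    finally show ?thesis .
  qed
  then have "integral {-pi..pi} (\<lambda>y. f y * f y * sv 1 y) \<le> 0"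
  proof -
    assume le: "\<And>e. e > 0 \<Longrightarrow> integral {-pi..pi} (\<lambda>y. f y * f y * sv 1 y) \<le> e * (M * (2 * pi))"
    have "((\<lambda>e. e * (M * (2 * pi))) \<longlongrightarrow> 0 * (M * (2 * pi))) (at_right 0)"
      by (intro tendsto_intros)
    then have "integral {-pi..pi} (\<lambda>y. f y * f y * sv 1 y) \<le> 0 * (M * (2 * pi))"
    proof (rule tendsto_lowerbound)
      show "\<forall>\<^sub>F e in at_right 0. integral {-pi..pi} (\<lambda>y. f y * f y * sv 1 y) \<le> e * (M * (2 * pi))"
        using eventually_at_right_less[of 0] by eventually_elim (rule le)
    qed simp
    then show ?thesis by simp
  qed
  moreover have "integral {-pi..pi} (\<lambda>y. f y * f y * sv 1 y) \<ge> 0"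
    by (intro integral_nonneg ic continuous_intros f sv_cont) (use s1 in auto)
  ultimately have "integral {-pi..pi} (\<lambda>y. f y * f y * sv 1 y) = 0" by simp
  then have all: "\<forall>y\<in>{-pi..pi}. f y * f y * sv 1 y = 0"
    by (subst (asm) integral_eq_0_iff) (use s1 in \<open>auto intro!: continuous_intros f sv_cont\<close>)
  have inner: "f y = 0" if "y \<in> {-pi<..<pi}" for y
  proof -
    have "sv 1 y > 0" using that unfolding sv_def by (intro sin_gt_zero) auto
    then show ?thesis using all that by auto
  qed
  have cl: "closure {-pi<..<pi} = {-pi..pi}" by (rule closure_greaterThanLessThan) simp
  show ?thesis
    by (rule continuous_constant_on_closure[of "{-pi<..<pi}" f 0 y]) (use f cl inner y in auto)
qed

text \<open>Absolute summability makes the convergence uniform, so the sum has the same coefficients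
  as f; completeness identifies the two.\<close>

lemma fourier_series_sums:
  assumes f: "continuous_on {-pi..pi} f" and s: "summable (\<lambda>n. \<bar>fourier_coeff f (Suc n)\<bar>)"
    and y: "y \<in> {-pi..pi}"
  shows "(\<Sum>n. fourier_coeff f (Suc n) * Y (Suc n) y) = f y"
proof -
  define g where "g = (\<lambda>y. \<Sum>n. fourier_coeff f (Suc n) * Y (Suc n) y)"
  have bd: "norm (fourier_coeff f (Suc n) * Y (Suc n) y) \<le> \<bar>fourier_coeff f (Suc n)\<bar>" for n y
    using Y_abs_le[of "Suc n" y] by (simp add: abs_mult mult_left_le)
  have ul: "uniform_limit {-pi..pi} (\<lambda>N y. \<Sum>n<N. fourier_coeff f (Suc n) * Y (Suc n) y) g sequentially"
    unfolding g_def by (rule Weierstrass_m_test[OF bd s])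
  have g: "continuous_on {-pi..pi} g"
    by (rule uniform_limit_theorem[OF _ ul]) (auto intro!: always_eventually continuous_intros)
  have coef: "integral {-pi..pi} (\<lambda>y. g y * Y m y) = pi * fourier_coeff f m" if m: "m \<ge> 1" for m
  proof -
    obtain m' where m': "m = Suc m'" using m by (cases m) auto
    have ul2: "uniform_limit {-pi..pi} (\<lambda>N y. (\<Sum>n<N. fourier_coeff f (Suc n) * Y (Suc n) y) * Y m y) (\<lambda>y. g y * Y m y) sequentially"
    proof (rule uniform_lim_mult[OF ul uniform_limit_const])
      show "bounded (g ` {-pi..pi})" "bounded (Y m ` {-pi..pi})"
        using compact_imp_bounded[OF compact_continuous_image[OF g compact_Icc]] Y_abs_le
        by (auto simp: bounded_iff intro!: exI[of _ 1])
    qed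
    obtain I J where IJ: "\<And>N. ((\<lambda>y. (\<Sum>n<N. fourier_coeff f (Suc n) * Y (Suc n) y) * Y m y) has_integral I N) {-pi..pi}"
      "((\<lambda>y. g y * Y m y) has_integral J) {-pi..pi}" "I \<longlonglongrightarrow> J"
      by (rule uniform_limit_integral[OF ul2]) (auto intro!: continuous_intros)
    have IN: "I N = pi * fourier_coeff f m" if "N > m'" for N
    proof -
      have "I N = integral {-pi..pi} (\<lambda>y. \<Sum>n<N. fourier_coeff f (Suc n) * (Y (Suc n) y * Y m y))"
        using integral_unique[OF IJ(1)[of N]] by (simp add: sum_distrib_right mult.assoc)
      also have "\<dots> = (\<Sum>n<N. integral {-pi..pi} (\<lambda>y. fourier_coeff f (Suc n) * (Y (Suc n) y * Y m y)))"
        by (rule integral_sum) (auto intro!: integrable_continuous_real continuous_intros)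
      also have "\<dots> = (\<Sum>n<N. if n = m' then pi * fourier_coeff f m else 0)"
        by (rule sum.cong) (use m Y_norm[of m] in \<open>auto simp: m' Y_orthogonal simp flip: power2_eq_square\<close>)
      also have "\<dots> = pi * fourier_coeff f m" using that by simp
      finally show ?thesis .
    qed
    have "I \<longlonglongrightarrow> pi * fourier_coeff f m"
      by (rule tendsto_eventually) (use IN in \<open>auto intro: eventually_mono[OF eventually_gt_at_top[of m']]\<close>)
    then show ?thesis using IJ LIMSEQ_unique integral_unique by metis
  qed
  have "f y - g y = 0"
  proof (rule sv_complete[of "\<lambda>y. f y - g y", OF _ _ y])
    show "continuous_on {-pi..pi} (\<lambda>y. f y - g y)" by (intro continuous_intros f g)
    fix m :: nat assume "m \<ge> 1"
    then obtain n s where n: "n \<ge> 1" "\<And>y. sv m y = s * Y n y" by (rule Y_eq_sv) blast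
    have "integral {-pi..pi} (\<lambda>y. (f y - g y) * sv m y) = integral {-pi..pi} (\<lambda>y. s * (f y * Y n y) - s * (g y * Y n y))"
      by (simp add: n(2) algebra_simps)
    also have "\<dots> = integral {-pi..pi} (\<lambda>y. s * (f y * Y n y)) - integral {-pi..pi} (\<lambda>y. s * (g y * Y n y))"
      by (intro integral_diff integrable_continuous_real continuous_intros f g)
    also have "\<dots> = 0" using coef[OF n(1)] by (simp add: fourier_coeff_eq[OF n(1)])
    finally show "integral {-pi..pi} (\<lambda>y. (f y - g y) * sv m y) = 0" .
  qed
  then show ?thesis by (simp add: g_def)
qed

lemma trig_series_deriv:
  assumes s: "summable (\<lambda>n. \<bar>b n\<bar> * (freq (Suc n))\<^sup>2)"
  shows "((\<lambda>y. \<Sum>n. b n * Y (Suc n) y) has_real_derivative (\<Sum>n. b n * dY (Suc n) y)) (at y)"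
    and "((\<lambda>y. \<Sum>n. b n * dY (Suc n) y) has_real_derivative (\<Sum>n. b n * (- (freq (Suc n))\<^sup>2 * Y (Suc n) y))) (at y)"
    and "summable (\<lambda>n. b n * (- (freq (Suc n))\<^sup>2 * Y (Suc n) y))"
proof -
  have f: "freq (Suc n) \<ge> 1/4" "freq (Suc n) > 0" for n
    using freq_bounds(1)[of "Suc n"] by auto
  \<comment> \<open>The frequencies are at least 1/4, so the square of the frequency dominates the
    lower powers up to the factors 16 and 4.\<close>
  have f1: "1 \<le> 16 * (freq (Suc n))\<^sup>2" "freq (Suc n) \<le> 4 * (freq (Suc n))\<^sup>2" for n
    using f[of n] power_mono[of "1/4" "freq (Suc n)" 2] mult_mono[of "1/4" "freq (Suc n)" "freq (Suc n)" "freq (Suc n)"]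
    by (auto simp: power2_eq_square)
  have b0: "norm (b n * Y (Suc n) y) \<le> 16 * (\<bar>b n\<bar> * (freq (Suc n))\<^sup>2)" for n y
  proof -
    have "\<bar>b n\<bar> * \<bar>Y (Suc n) y\<bar> \<le> \<bar>b n\<bar> * (16 * (freq (Suc n))\<^sup>2)"
      using f1(1)[of n] Y_abs_le[of "Suc n" y] by (intro mult_left_mono) linarith+
    then show ?thesis by (simp add: abs_mult mult_ac)
  qed
  have b1: "norm (b n * dY (Suc n) y) \<le> 4 * (\<bar>b n\<bar> * (freq (Suc n))\<^sup>2)" for n y
  proof -
    have "\<bar>b n\<bar> * \<bar>dY (Suc n) y\<bar> \<le> \<bar>b n\<bar> * (4 * (freq (Suc n))\<^sup>2)"
      using f1(2)[of n] dY_abs_le[of "Suc n" y] by (intro mult_left_mono) auto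
    then show ?thesis by (simp add: abs_mult mult_ac)
  qed
  have b2: "norm (b n * (- (freq (Suc n))\<^sup>2 * Y (Suc n) y)) \<le> \<bar>b n\<bar> * (freq (Suc n))\<^sup>2" for n y
    using Y_abs_le[of "Suc n" y] mult_left_mono[of "\<bar>Y (Suc n) y\<bar>" 1 "\<bar>b n\<bar> * (freq (Suc n))\<^sup>2"]
    by (simp add: abs_mult mult_ac)
  have s0: "summable (\<lambda>n. b n * Y (Suc n) y)" for y
    by (rule summable_comparison_test'[OF summable_mult[OF s, of 16]]) (rule b0)
  have s1: "summable (\<lambda>n. b n * dY (Suc n) y)" for y
    by (rule summable_comparison_test'[OF summable_mult[OF s, of 4]]) (rule b1)
  show "summable (\<lambda>n. b n * (- (freq (Suc n))\<^sup>2 * Y (Suc n) y))"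
    by (rule summable_comparison_test'[OF s]) (rule b2)
  show "((\<lambda>y. \<Sum>n. b n * Y (Suc n) y) has_real_derivative (\<Sum>n. b n * dY (Suc n) y)) (at y)"
    by (rule has_field_derivative_series'(2)[of UNIV "\<lambda>n y. b n * Y (Suc n) y" "\<lambda>n y. b n * dY (Suc n) y" 0 y])
      (auto intro!: DERIV_cmult Y_deriv Weierstrass_m_test'[OF b1 summable_mult[OF s]] s0)
  show "((\<lambda>y. \<Sum>n. b n * dY (Suc n) y) has_real_derivative (\<Sum>n. b n * (- (freq (Suc n))\<^sup>2 * Y (Suc n) y))) (at y)"
    by (rule has_field_derivative_series'(2)[of UNIV "\<lambda>n y. b n * dY (Suc n) y" "\<lambda>n y. b n * (- (freq (Suc n))\<^sup>2 * Y (Suc n) y)" 0 y])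
      (rule DERIV_cmult dY_deriv Weierstrass_m_test'[OF b2 s] s1 convex_UNIV UNIV_I | simp)+
qed

section \<open>Caputo derivatives of Mittag-Leffler series\<close>

lemma caputo_frac_int:
  assumes "a < 1"
  shows "caputo a g x = frac_int (1 - a) (deriv g) x"
proof -
  have "frac_int (1 - a) (deriv g) x = (LBINT t:{0<..<x}. (1 / Gamma (1 - a)) * ((x - t) powr (-a) * deriv g t))"
    unfolding frac_int_def by (rule set_lebesgue_integral_cong) (auto simp: kern_def)
  then show ?thesis using assms by (simp add: caputo_def)
qed

lemma caputo_exists_frac_int:
  assumes "a < 1"
  shows "caputo_exists a g x \<longleftrightarrow> (\<forall>s\<in>{0<..<x}. g differentiable (at s)) \<and> frac_intble (1 - a) (deriv g) x"
proof -
  have "Gamma (1 - a) > 0" using assms by auto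
  then have G: "1 / Gamma (1 - a) \<noteq> 0" by simp
  have "frac_intble (1 - a) (deriv g) x \<longleftrightarrow> set_integrable lborel {0<..<x} (\<lambda>t. (1 / Gamma (1 - a)) * ((x - t) powr (-a) * deriv g t))"
    unfolding frac_intble_def by (rule set_integrable_cong) (auto simp: kern_def)
  also have "\<dots> \<longleftrightarrow> set_integrable lborel {0<..<x} (\<lambda>t. (x - t) powr (-a) * deriv g t)"
    by (simp only: set_integrable_mult_right_iff[OF G])
  finally show ?thesis using assms by (simp add: caputo_exists_def)
qed

lemma
  fixes f g :: "real \<Rightarrow> real"
  assumes S: "open S" "x \<in> S" and eq: "\<And>t. t \<in> S \<Longrightarrow> f t = g t"
  shows differentiable_cong_open: "f differentiable (at x) \<longleftrightarrow> g differentiable (at x)"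
    and deriv_cong_open: "deriv f x = deriv g x"
proof -
  have "(f has_real_derivative D) (at x) \<longleftrightarrow> (g has_real_derivative D) (at x)" for D
    using has_field_derivative_transform_within_open[OF _ S, of f D g]
      has_field_derivative_transform_within_open[OF _ S, of g D f] eq by auto
  then show "f differentiable (at x) \<longleftrightarrow> g differentiable (at x)" "deriv f x = deriv g x"
    by (simp_all add: real_differentiable_def deriv_def)
qed

text \<open>A Caputo derivative at x depends only on values in (0, x) for order below 1 and near x
  for order 1; agreement on (0, b) with b > x covers both. Formulas valid only inside (0, 1) can
  thus be substituted under a further derivative.\<close>

lemma
  assumes x: "0 < x" "x < b" and eq: "\<And>t. 0 < t \<Longrightarrow> t < b \<Longrightarrow> f t = g t"
  shows caputo_exists_cong: "caputo_exists a f x \<longleftrightarrow> caputo_exists a g x"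
    and caputo_cong: "caputo a f x = caputo a g x"
proof -
  have d: "f differentiable (at s) \<longleftrightarrow> g differentiable (at s)" "deriv f s = deriv g s" if "0 < s" "s < b" for s
    using differentiable_cong_open[of "{0<..<b}" s f g] deriv_cong_open[of "{0<..<b}" s f g] that eq by auto
  have "set_integrable lborel {0<..<x} (\<lambda>s. (x - s) powr (-a) * deriv f s) \<longleftrightarrow>
    set_integrable lborel {0<..<x} (\<lambda>s. (x - s) powr (-a) * deriv g s)"
    by (rule set_integrable_cong) (use d x in auto)
  then show "caputo_exists a f x \<longleftrightarrow> caputo_exists a g x"
    using d x by (auto simp: caputo_exists_def)
  have "(LBINT s:{0<..<x}. (x - s) powr (-a) * deriv f s) = (LBINT s:{0<..<x}. (x - s) powr (-a) * deriv g s)"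
    by (rule set_lebesgue_integral_cong) (use d x in auto)
  then show "caputo a f x = caputo a g x"
    using d x by (simp add: caputo_def)
qed

section \<open>Series of modes and their Caputo derivatives\<close>

definition modes :: "real \<Rightarrow> (nat \<Rightarrow> real) \<Rightarrow> (nat \<Rightarrow> real) \<Rightarrow> (nat \<Rightarrow> real) \<Rightarrow> nat \<Rightarrow> real \<Rightarrow> real" where
  "modes a m P Q n x = P n * mle a (- m n) x + Q n * mle a (m n) x"

locale mode_rates =
  fixes a :: real and m :: "nat \<Rightarrow> real" and m0 :: real
  assumes a: "0 < a" "a \<le> 1" and m0: "m0 > 0" and m_ge: "\<And>n. m n \<ge> m0"
begin

lemma m_pos: "m n > 0"
  using m_ge[of n] m0 by linarith

lemma summable_Q:
  assumes "summable (\<lambda>n. \<bar>Q n\<bar> * m n * mle a (m n) q)" "0 \<le> q"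
  shows "summable (\<lambda>n. \<bar>Q n\<bar> * mle a (m n) q)"
proof (rule summable_comparison_test'[OF summable_mult[OF assms(1), of "1 / m0"]])
  fix n
  have E: "mle a (m n) q \<ge> 1" using a m_pos[of n] assms by (intro mle_pos_ge_1) auto
  have "\<bar>Q n\<bar> * mle a (m n) q * m0 \<le> \<bar>Q n\<bar> * mle a (m n) q * m n"
    using E m_ge[of n] by (intro mult_left_mono) auto
  then show "norm (\<bar>Q n\<bar> * mle a (m n) q) \<le> 1 / m0 * (\<bar>Q n\<bar> * m n * mle a (m n) q)"
    using m0 E by (simp add: field_simps)
qed

definition modes' :: "(nat \<Rightarrow> real) \<Rightarrow> (nat \<Rightarrow> real) \<Rightarrow> nat \<Rightarrow> real \<Rightarrow> real" where
  "modes' P Q n x = P n * (- m n * ml_kern a a (- m n) x) + Q n * (m n * ml_kern a a (m n) x)"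

lemma modes_deriv:
  "x > 0 \<Longrightarrow> (modes a m P Q n has_real_derivative modes' P Q n x) (at x)"
  unfolding modes_def[abs_def] modes'_def
  by (intro DERIV_add DERIV_cmult mle_deriv a) auto

lemma modes'_le:
  assumes "0 < x"
  shows "\<bar>modes' P Q n x\<bar> \<le> \<bar>P n\<bar> * (m n * ml_kern a a (- m n) x) + \<bar>Q n\<bar> * (m n * ml_kern a a (m n) x)"
proof -
  have "ml_kern a a (- m n) x \<ge> 0" using a m_pos by (intro ml_kern_nonneg) auto
  moreover have "ml_kern a a (m n) x \<ge> 0" using a m_pos[of n] by (intro ml_kern_pos_nonneg) auto
  ultimately show ?thesis unfolding modes'_def
    by (intro order.trans[OF abs_triangle_ineq]) (simp add: abs_mult m_pos less_imp_le)
qed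

text \<open>Majorant for local uniform convergence on [s, q]: the decay of the resolvent kernel
  controls the first term independently of the rate, and the second is controlled by the value of E
  at r > q.\<close>

lemma modes'_bound:
  assumes "0 < s" "s \<le> x" "x \<le> q" "q < r"
  shows "\<bar>P n\<bar> * (m n * ml_kern a a (- m n) x) + \<bar>Q n\<bar> * (m n * ml_kern a a (m n) x)
    \<le> \<bar>P n\<bar> * (a / s) + (1 / (s * ln (r / q))) * (\<bar>Q n\<bar> * mle a (m n) r)"
proof -
  have E: "mle a (m n) r \<ge> 0" using mle_pos_ge_1[of a "m n" r] a m_pos[of n] assms by simp
  have "m n * ml_kern a a (- m n) x \<le> a / x"
    using a m_pos assms by (intro ml_kern_decay) auto
  also have "\<dots> \<le> a / s" using a assms by (intro divide_left_mono) auto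
  finally have 1: "m n * ml_kern a a (- m n) x \<le> a / s" .
  have "m n * ml_kern a a (m n) x \<le> mle a (m n) r / (x * ln (r / x))"
    using a m_pos[of n] assms by (intro mle_pos_deriv_bound) auto
  also have "\<dots> \<le> mle a (m n) r / (s * ln (r / q))"
  proof (rule divide_left_mono[OF _ E])
    have "ln (r / q) \<le> ln (r / x)" using assms by (simp add: frac_le)
    moreover have "ln (r / q) > 0" using assms by simp
    ultimately show "s * ln (r / q) \<le> x * ln (r / x)" "0 < x * ln (r / x) * (s * ln (r / q))"
      using assms by (auto intro!: mult_mono mult_pos_pos)
  qed
  finally have 2: "m n * ml_kern a a (m n) x \<le> mle a (m n) r / (s * ln (r / q))" .
  show ?thesis
    using mult_left_mono[OF 1, of "\<bar>P n\<bar>"] mult_left_mono[OF 2, of "\<bar>Q n\<bar>"] by simp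
qed

context
  fixes P Q :: "nat \<Rightarrow> real"
  assumes P: "summable (\<lambda>n. \<bar>P n\<bar>)"
    and Q: "\<And>q. 0 < q \<Longrightarrow> q < 1 \<Longrightarrow> summable (\<lambda>n. \<bar>Q n\<bar> * m n * mle a (m n) q)"
begin

lemma summable_modes:
  assumes "0 < x" "x < 1"
  shows "summable (\<lambda>n. modes a m P Q n x)"
proof (rule summable_comparison_test'[OF summable_add[OF P summable_Q[OF Q[OF assms]]]])
  show "0 \<le> x" using assms by simp
  fix n
  have "mle a (m n) x \<ge> 1" "0 \<le> mle a (- m n) x" "mle a (- m n) x \<le> 1"
    using mle_pos_ge_1[of a "m n" x] mle_neg_nonneg[of a "m n" x] mle_neg_le_1[of a "m n" x] a m_pos[of n] assms by auto
  then show "norm (modes a m P Q n x) \<le> \<bar>P n\<bar> + \<bar>Q n\<bar> * mle a (m n) x"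
    unfolding modes_def
    by (intro order.trans[OF norm_triangle_ineq]) (auto simp: abs_mult intro!: mult_left_le)
qed

lemma modes_series_deriv:
  assumes "0 < x" "x < 1"
  shows "((\<lambda>x. \<Sum>n. modes a m P Q n x) has_real_derivative (\<Sum>n. modes' P Q n x)) (at x)"
proof -
  define s q r where "s = x / 2" and "q = (1 + x) / 2" and "r = (1 + q) / 2"
  have sqr: "0 < s" "s < x" "x < q" "q < r" "r < 1" using assms by (auto simp: s_def q_def r_def)
  have bound: "norm (modes' P Q n t) \<le> \<bar>P n\<bar> * (a / s) + (1 / (s * ln (r / q))) * (\<bar>Q n\<bar> * mle a (m n) r)"
    if "t \<in> {s<..<q}" for n t
    using modes'_le[of t P Q n] modes'_bound[of s t q r P n Q] that sqr by simp
  have summ: "summable (\<lambda>n. \<bar>P n\<bar> * (a / s) + (1 / (s * ln (r / q))) * (\<bar>Q n\<bar> * mle a (m n) r))"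
    by (intro summable_add summable_mult summable_mult2 P summable_Q Q) (use sqr in auto)
  show ?thesis
  proof (rule has_field_derivative_series'(2)[of "{s<..<q}" "modes a m P Q" "modes' P Q" x x])
    show "uniformly_convergent_on {s<..<q} (\<lambda>n t. \<Sum>i<n. modes' P Q i t)"
      by (rule Weierstrass_m_test'[OF bound summ])
    show "(modes a m P Q n has_real_derivative modes' P Q n t) (at t within {s<..<q})" if "t \<in> {s<..<q}" for n t
      by (rule has_field_derivative_at_within[OF modes_deriv]) (use that sqr in auto)
  qed (use sqr summable_modes[OF assms] in auto)
qed

text \<open>The defining integral is evaluated term by term. Pointwise bounds such as a / t are not
  integrable at 0, so the L1 norms are estimated by exact fractional integration of the nonnegative
  majorants \<open>B\<close>. By \<open>mle_neg_decay\<close>, m E(-m x^a) is bounded uniformly in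
  the index, so summability of |P| is enough for the decaying part.\<close>

lemma
  assumes x: "0 < x" "x < 1"
  shows caputo_exists_modes: "caputo_exists a (\<lambda>x. \<Sum>n. modes a m P Q n x) x"
    and caputo_modes: "caputo a (\<lambda>x. \<Sum>n. modes a m P Q n x) x
      = (\<Sum>n. modes a m (\<lambda>n. - m n * P n) (\<lambda>n. m n * Q n) n x)"
proof -
  define F where "F = (\<lambda>x. \<Sum>n. modes a m P Q n x)"
  have F_deriv: "(F has_real_derivative (\<Sum>n. modes' P Q n t)) (at t)" if "0 < t" "t < 1" for t
    unfolding F_def by (rule modes_series_deriv[OF that])
  then have F_diff: "F differentiable (at t)" if "0 < t" "t < 1" for t
    using that real_differentiable_def by blast
  have F_deriv': "deriv F t = (\<Sum>n. modes' P Q n t)" if "0 < t" "t < 1" for t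
    using F_deriv[OF that] by (rule DERIV_imp_deriv)
  have "caputo_exists a F x \<and> caputo a F x = (\<Sum>n. modes a m (\<lambda>n. - m n * P n) (\<lambda>n. m n * Q n) n x)"
  proof (cases "a = 1")
    case True
    have "ml_kern 1 1 l x = mle 1 l x" for l using x by (simp add: mle_eq_ml_kern)
    then have "modes' P Q n x = modes a m (\<lambda>n. - m n * P n) (\<lambda>n. m n * Q n) n x" for n
      unfolding modes'_def modes_def using True by simp
    then show ?thesis using True F_diff[OF x] F_deriv'[OF x] by (simp add: caputo_exists_def caputo_def)
  next
    case False
    then have a1: "1 - a > 0" using a by simp
    define f where "f = (\<lambda>n t. indicator {0<..<x} t *\<^sub>R (kern (1 - a) (x - t) * modes' P Q n t))"
    define B where "B = (\<lambda>n t. \<bar>P n\<bar> * (m n * ml_kern a a (- m n) t) + \<bar>Q n\<bar> * (m n * ml_kern a a (m n) t))"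
    have ib: "frac_intble (1 - a) (\<lambda>t. c * (d * ml_kern a a l t)) x" for c d l
      using a a1 x by (intro frac_intble_cmult frac_intble_ml_kern) auto
    have vb: "frac_int (1 - a) (\<lambda>t. c * (d * ml_kern a a l t)) x = c * (d * mle a l x)" for c d l
      using a a1 x by (simp add: frac_int_cmult frac_int_ml_kern mle_eq_ml_kern)
    have if': "frac_intble (1 - a) (modes' P Q n) x" for n
      unfolding modes'_def[abs_def] by (intro frac_intble_add ib)
    have vf': "frac_int (1 - a) (modes' P Q n) x = modes a m (\<lambda>n. - m n * P n) (\<lambda>n. m n * Q n) n x" for n
      unfolding modes'_def[abs_def] frac_int_add[OF ib ib] vb by (simp add: modes_def mult_ac)
    have iB: "frac_intble (1 - a) (B n) x" for n
      unfolding B_def by (intro frac_intble_add ib)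
    have vB: "frac_int (1 - a) (B n) x = \<bar>P n\<bar> * (m n * mle a (- m n) x) + \<bar>Q n\<bar> * (m n * mle a (m n) x)" for n
      unfolding B_def frac_int_add[OF ib ib] vb ..
    have i: "integrable lborel (f n)" for n
      using if'[of n] by (simp add: f_def frac_intble_def set_integrable_def)
    have s1: "AE t in lborel. summable (\<lambda>n. norm (f n t))"
    proof (intro AE_I2)
      fix t
      show "summable (\<lambda>n. norm (f n t))"
      proof (cases "t \<in> {0<..<x}")
        case True
        define r where "r = (1 + t) / 2"
        have r: "t < r" "r < 1" using True x by (auto simp: r_def)
        have "summable (\<lambda>n. \<bar>P n\<bar> * (a / t) + (1 / (t * ln (r / t))) * (\<bar>Q n\<bar> * mle a (m n) r))"
          by (intro summable_add summable_mult summable_mult2 P summable_Q Q) (use r True in auto)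
        moreover have "norm (norm (modes' P Q n t)) \<le> \<bar>P n\<bar> * (a / t) + (1 / (t * ln (r / t))) * (\<bar>Q n\<bar> * mle a (m n) r)" for n
          using modes'_le[of t P Q n] modes'_bound[of t t t r P n Q] r True by simp
        ultimately have "summable (\<lambda>n. norm (modes' P Q n t))"
          by (rule summable_comparison_test')
        then show ?thesis unfolding f_def norm_scaleR norm_mult by (intro summable_mult)
      qed (simp add: f_def)
    qed
    have le: "(\<integral>t. norm (f n t) \<partial>lborel) \<le> \<bar>P n\<bar> * (m n * mle a (- m n) x) + \<bar>Q n\<bar> * (m n * mle a (m n) x)" for n
    proof -
      have "(\<integral>t. norm (f n t) \<partial>lborel) \<le> (\<integral>t. indicator {0<..<x} t *\<^sub>R (kern (1 - a) (x - t) * B n t) \<partial>lborel)"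
      proof (rule integral_mono)
        show "integrable lborel (\<lambda>t. norm (f n t))" using i by simp
        show "integrable lborel (\<lambda>t. indicator {0<..<x} t *\<^sub>R (kern (1 - a) (x - t) * B n t))"
          using iB[of n] by (simp add: frac_intble_def set_integrable_def)
        fix t
        show "norm (f n t) \<le> indicator {0<..<x} t *\<^sub>R (kern (1 - a) (x - t) * B n t)"
          using modes'_le[of t P Q n] kern_nonneg[OF a1, of "x - t"]
          by (auto simp: f_def B_def indicator_def abs_mult intro!: mult_left_mono)
      qed
      then show ?thesis using vB[of n] by (simp add: frac_int_def set_lebesgue_integral_def)
    qed
    have s2: "summable (\<lambda>n. \<integral>t. norm (f n t) \<partial>lborel)"
    proof (rule summable_comparison_test')
      show "summable (\<lambda>n. \<bar>P n\<bar> * (Gamma (a + 1) * x powr (-a)) + \<bar>Q n\<bar> * m n * mle a (m n) x)"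
        by (intro summable_add summable_mult2 P Q x)
      fix n
      have "\<bar>P n\<bar> * (m n * mle a (- m n) x) \<le> \<bar>P n\<bar> * (Gamma (a + 1) * x powr (-a))"
        using mle_neg_decay[OF a m_pos[of n] x(1)] by (intro mult_left_mono) auto
      with le[of n] show "norm (\<integral>t. norm (f n t) \<partial>lborel) \<le> \<bar>P n\<bar> * (Gamma (a + 1) * x powr (-a)) + \<bar>Q n\<bar> * m n * mle a (m n) x"
        by (simp add: mult.assoc)
    qed
    have S: "(\<Sum>n. f n t) = indicator {0<..<x} t *\<^sub>R (kern (1 - a) (x - t) * deriv F t)" for t
    proof (cases "t \<in> {0<..<x}")
      case True
      define r where "r = (1 + t) / 2"
      have r: "t < r" "r < 1" using True x by (auto simp: r_def)
      have "summable (\<lambda>n. \<bar>P n\<bar> * (a / t) + (1 / (t * ln (r / t))) * (\<bar>Q n\<bar> * mle a (m n) r))"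
        by (intro summable_add summable_mult summable_mult2 P summable_Q Q) (use r True in auto)
      then have "summable (\<lambda>n. modes' P Q n t)"
      proof (rule summable_comparison_test')
        show "norm (modes' P Q n t) \<le> \<bar>P n\<bar> * (a / t) + (1 / (t * ln (r / t))) * (\<bar>Q n\<bar> * mle a (m n) r)" for n
          using modes'_le[of t P Q n] modes'_bound[of t t t r P n Q] r True by simp
      qed
      then show ?thesis using True x F_deriv'[of t] by (simp add: f_def suminf_mult)
    qed (simp add: f_def)
    have "frac_intble (1 - a) (deriv F) x"
      using integrable_suminf[OF i s1 s2] unfolding S frac_intble_def set_integrable_def .
    moreover have "frac_int (1 - a) (deriv F) x = (\<Sum>n. integral\<^sup>L lborel (f n))"
      using integral_suminf[OF i s1 s2] unfolding S frac_int_def set_lebesgue_integral_def .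
    moreover have "integral\<^sup>L lborel (f n) = modes a m (\<lambda>n. - m n * P n) (\<lambda>n. m n * Q n) n x" for n
      using vf'[of n] by (simp add: f_def frac_int_def set_lebesgue_integral_def)
    ultimately show ?thesis
      using False a x F_diff by (auto simp: caputo_exists_frac_int caputo_frac_int)
  qed
  then show "caputo_exists a (\<lambda>x. \<Sum>n. modes a m P Q n x) x"
    "caputo a (\<lambda>x. \<Sum>n. modes a m P Q n x) x = (\<Sum>n. modes a m (\<lambda>n. - m n * P n) (\<lambda>n. m n * Q n) n x)"
    by (simp_all add: F_def)
qed

end

text \<open>For x >= s the decaying solution is of order 1 / m, so P enters only through P /
  m.\<close>

lemma modes_decay_le:
  assumes "0 < s" "s \<le> x" "x \<le> q"
  shows "\<bar>modes a m P Q n x\<bar> \<le> (\<bar>P n\<bar> / m n) * (Gamma (a + 1) * s powr (-a)) + \<bar>Q n\<bar> * mle a (m n) q"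
proof -
  have "m n * mle a (- m n) x \<le> Gamma (a + 1) * x powr (-a)"
    by (rule mle_neg_decay[OF a m_pos]) (use assms in simp)
  also have "\<dots> \<le> Gamma (a + 1) * s powr (-a)"
  proof (rule mult_left_mono)
    show "x powr (-a) \<le> s powr (-a)" by (rule powr_mono2') (use a assms in auto)
    show "0 \<le> Gamma (a + 1)" using a by (simp add: less_imp_le Gamma_real_pos)
  qed
  finally have "mle a (- m n) x \<le> Gamma (a + 1) * s powr (-a) / m n"
    using m_pos[of n] by (simp add: field_simps)
  then have 1: "\<bar>P n\<bar> * mle a (- m n) x \<le> \<bar>P n\<bar> * (Gamma (a + 1) * s powr (-a) / m n)"
    by (intro mult_left_mono) auto
  have 2: "\<bar>Q n\<bar> * mle a (m n) x \<le> \<bar>Q n\<bar> * mle a (m n) q"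
    using a m_pos[of n] assms by (intro mult_left_mono mle_pos_mono) auto
  have "mle a (- m n) x \<ge> 0" "mle a (m n) x \<ge> 1"
    using mle_pos_ge_1[of a "m n" x] mle_neg_nonneg[of a "m n" x] a m_pos[of n] assms by auto
  then have "\<bar>modes a m P Q n x\<bar> \<le> \<bar>P n\<bar> * mle a (- m n) x + \<bar>Q n\<bar> * mle a (m n) x"
    unfolding modes_def by (intro order.trans[OF abs_triangle_ineq]) (simp add: abs_mult)
  with 1 2 show ?thesis by simp
qed

lemma modes_continuous_on: "continuous_on {0..} (modes a m P Q n)"
  unfolding modes_def by (intro continuous_intros mle_continuous a)

lemma modes_series_continuous:
  assumes P: "summable (\<lambda>n. \<bar>P n\<bar> / m n)"
    and Q: "\<And>q. 0 < q \<Longrightarrow> q < 1 \<Longrightarrow> summable (\<lambda>n. \<bar>Q n\<bar> * mle a (m n) q)"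
  shows "continuous_on ({0<..<1} \<times> UNIV) (\<lambda>p. \<Sum>n. modes a m P Q n (fst p) * Y (Suc n) (snd p))"
proof -
  have "isCont (\<lambda>p. \<Sum>n. modes a m P Q n (fst p) * Y (Suc n) (snd p)) p0" if p0: "p0 \<in> {0<..<1} \<times> UNIV" for p0
  proof -
    define s q where "s = fst p0 / 2" and "q = (1 + fst p0) / 2"
    have sq: "0 < s" "s < fst p0" "fst p0 < q" "q < 1" using p0 by (auto simp: s_def q_def)
    define U where "U = {s<..<q} \<times> (UNIV :: real set)"
    have "uniform_limit U (\<lambda>N p. \<Sum>n<N. modes a m P Q n (fst p) * Y (Suc n) (snd p))
       (\<lambda>p. \<Sum>n. modes a m P Q n (fst p) * Y (Suc n) (snd p)) sequentially"
    proof (rule Weierstrass_m_test)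
      show "summable (\<lambda>n. (\<bar>P n\<bar> / m n) * (Gamma (a + 1) * s powr (-a)) + \<bar>Q n\<bar> * mle a (m n) q)"
        by (intro summable_add summable_mult2 P Q) (use sq in auto)
      fix n p assume "p \<in> U"
      then have "\<bar>modes a m P Q n (fst p)\<bar> \<le> (\<bar>P n\<bar> / m n) * (Gamma (a + 1) * s powr (-a)) + \<bar>Q n\<bar> * mle a (m n) q"
        using sq by (intro modes_decay_le) (auto simp: U_def)
      moreover have "\<bar>modes a m P Q n (fst p)\<bar> * \<bar>Y (Suc n) (snd p)\<bar> \<le> \<bar>modes a m P Q n (fst p)\<bar>"
        using Y_abs_le[of "Suc n" "snd p"] by (simp add: mult_left_le)
      ultimately show "norm (modes a m P Q n (fst p) * Y (Suc n) (snd p)) \<le> (\<bar>P n\<bar> / m n) * (Gamma (a + 1) * s powr (-a)) + \<bar>Q n\<bar> * mle a (m n) q"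
        by (simp add: abs_mult)
    qed
    then have "continuous_on U (\<lambda>p. \<Sum>n. modes a m P Q n (fst p) * Y (Suc n) (snd p))"
    proof (rule uniform_limit_theorem[rotated])
      show "\<forall>\<^sub>F N in sequentially. continuous_on U (\<lambda>p. \<Sum>n<N. modes a m P Q n (fst p) * Y (Suc n) (snd p))"
        by (intro always_eventually allI continuous_intros continuous_on_compose2[OF modes_continuous_on])
          (use sq in \<open>auto simp: U_def\<close>)
    qed simp
    moreover have "open U" unfolding U_def by (intro open_Times) auto
    moreover have "p0 \<in> U" using sq by (auto simp: U_def mem_Times_iff)
    ultimately show ?thesis by (simp add: continuous_on_eq_continuous_at)
  qed
  then show ?thesis by (simp add: continuous_at_imp_continuous_on)
qed

end

section \<open>Existence\<close>

lemma closure_Omega: "closure Omega = {0..1} \<times> {-pi..pi}"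
  by (simp add: Omega_def closure_Times)

lemma sums_even_odd_split:
  fixes t :: "nat \<Rightarrow> real"
  assumes "summable (\<lambda>n. \<bar>t n\<bar>)"
  shows "summable (\<lambda>k. t (2 * k))" "summable (\<lambda>k. t (2 * k + 1))"
    "(\<Sum>n. t n) = (\<Sum>k. t (2 * k)) + (\<Sum>k. t (2 * k + 1))"
proof -
  have "summable ((\<lambda>n. \<bar>t n\<bar>) \<circ> (\<lambda>k. 2 * k))" "summable ((\<lambda>n. \<bar>t n\<bar>) \<circ> (\<lambda>k. 2 * k + 1))"
    by (auto intro!: summable_reindex assms simp: inj_on_def)
  then have s: "summable (\<lambda>k. \<bar>t (2 * k)\<bar>)" "summable (\<lambda>k. \<bar>t (2 * k + 1)\<bar>)"
    by (simp_all add: o_def)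
  show s': "summable (\<lambda>k. t (2 * k))" "summable (\<lambda>k. t (2 * k + 1))"
    using s by (auto intro: summable_rabs_cancel)
  have "(\<lambda>n. if even n then t (2 * (n div 2)) else t (2 * ((n - 1) div 2) + 1)) sums ((\<Sum>k. t (2 * k + 1)) + (\<Sum>k. t (2 * k)))"
    by (rule sums_if[OF summable_sums summable_sums, OF s'(2,1)])
  moreover have "(if even n then t (2 * (n div 2)) else t (2 * ((n - 1) div 2) + 1)) = t n" for n
    by (auto elim!: oddE)
  ultimately show "(\<Sum>n. t n) = (\<Sum>k. t (2 * k)) + (\<Sum>k. t (2 * k + 1))"
    by (simp add: sums_iff add.commute)
qed

locale dirichlet_data =
  fixes a \<epsilon> c \<delta> :: real and \<phi> \<psi> :: "real \<Rightarrow> real"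
  assumes a: "0 < a" "a \<le> 1" and eps: "\<bar>\<epsilon>\<bar> < 1"
    and phi: "\<phi> \<in> holder_space 2 \<delta> (-pi) pi" "\<phi> (-pi) = 0" "\<phi> pi = 0"
    and psi: "\<psi> \<in> holder_space 1 \<delta> (-pi) pi" "\<psi> (-pi) = 0" "\<psi> pi = 0"
begin

text \<open>Indices are shifted by one: all sequences below have at position n the data that belong
  to \<open>Y (Suc n)\<close>.\<close>

definition m :: "nat \<Rightarrow> real" where "m n = mu \<epsilon> c (Suc n)"
definition \<kappa> :: "nat \<Rightarrow> real" where "\<kappa> n = freq (Suc n)"
text \<open>A lower bound for all rates: eigenvalues are at least (1 - |\<epsilon>|) times the
  squared frequency, and frequencies are at least 1/4.\<close>

definition m0 :: real where "m0 = sqrt (1 - \<bar>\<epsilon>\<bar>) / 4"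
definition f :: "nat \<Rightarrow> real" where "f n = fourier_coeff \<phi> (Suc n)"
definition g :: "nat \<Rightarrow> real" where "g n = fourier_coeff \<psi> (Suc n)"
text \<open>P and Q solve P + Q = f and P E(-m) + Q E(m) = g, the conditions at x = 0 and x = 1. The
  determinant of this system is \<open>den\<close>.\<close>

definition den :: "nat \<Rightarrow> real" where "den n = mle a (m n) 1 - mle a (- m n) 1"
definition b :: "nat \<Rightarrow> real" where "b n = g n - f n * mle a (- m n) 1"
definition Q :: "nat \<Rightarrow> real" where "Q n = b n / den n"
definition P :: "nat \<Rightarrow> real" where "P n = f n - Q n"
definition u :: "real \<times> real \<Rightarrow> real" where
  "u p = (\<Sum>n. modes a m P Q n (fst p) * Y (Suc n) (snd p))"

section \<open>Estimates of rates and coefficients\<close>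

lemma k: "\<kappa> n \<ge> 1/4" "\<kappa> n > 0"
  using freq_bounds(1)[of "Suc n"] by (auto simp: \<kappa>_def)

lemma eigval_bounds: "(1 - \<bar>\<epsilon>\<bar>) * (\<kappa> n)\<^sup>2 \<le> eigval \<epsilon> (Suc n)" "eigval \<epsilon> (Suc n) \<le> 2 * (\<kappa> n)\<^sup>2"
  unfolding eigval_freq \<kappa>_def[symmetric] using eps by (auto intro!: mult_right_mono)

lemma m_sq: "(m n)\<^sup>2 = eigval \<epsilon> (Suc n) + c\<^sup>2"
proof -
  have "0 \<le> (1 - \<bar>\<epsilon>\<bar>) * (\<kappa> n)\<^sup>2" using eps by simp
  then have "0 \<le> eigval \<epsilon> (Suc n) + c\<^sup>2" using eigval_bounds(1)[of n] zero_le_power2[of c] by linarith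
  then show ?thesis by (simp add: m_def mu_def)
qed

lemma m_nonneg: "m n \<ge> 0"
proof -
  have "0 \<le> (1 - \<bar>\<epsilon>\<bar>) * (\<kappa> n)\<^sup>2" using eps by simp
  then have "0 \<le> eigval \<epsilon> (Suc n) + c\<^sup>2" using eigval_bounds(1)[of n] zero_le_power2[of c] by linarith
  then show ?thesis by (simp add: m_def mu_def)
qed

lemma k_le_m: "(1 - \<bar>\<epsilon>\<bar>) * (\<kappa> n)\<^sup>2 \<le> (m n)\<^sup>2"
  using eigval_bounds(1)[of n] zero_le_power2[of c] unfolding m_sq by linarith

lemma m_ge: "m n \<ge> m0"
proof -
  have "m0\<^sup>2 = (1 - \<bar>\<epsilon>\<bar>) * (1/4)\<^sup>2" using eps by (simp add: m0_def power_divide)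
  also have "\<dots> \<le> (1 - \<bar>\<epsilon>\<bar>) * (\<kappa> n)\<^sup>2"
    using eps k(1)[of n] by (intro mult_left_mono power_mono) auto
  also have "\<dots> \<le> (m n)\<^sup>2" by (rule k_le_m)
  finally show ?thesis using m_nonneg by (rule power2_le_imp_le)
qed

sublocale mode_rates a m m0
  using a eps m_ge by unfold_locales (auto simp: m0_def)

text \<open>Eigenvalues are at most twice the squared frequency since |\<epsilon>| < 1, and c^2 is
  at most 16 c^2 times the squared frequency since frequencies are at least 1/4.\<close>

lemma m_le: "m n \<le> sqrt (2 + 16 * c\<^sup>2) * \<kappa> n"
proof (rule power2_le_imp_le)
  have "1 \<le> 16 * (\<kappa> n)\<^sup>2" using power_mono[OF k(1)[of n], of 2] by (simp add: power_divide)
  then have "c\<^sup>2 * 1 \<le> c\<^sup>2 * (16 * (\<kappa> n)\<^sup>2)" by (rule mult_left_mono) simp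
  then have "(m n)\<^sup>2 \<le> (2 + 16 * c\<^sup>2) * (\<kappa> n)\<^sup>2"
    unfolding m_sq using eigval_bounds(2)[of n] by (simp add: algebra_simps)
  then show "(m n)\<^sup>2 \<le> (sqrt (2 + 16 * c\<^sup>2) * \<kappa> n)\<^sup>2" by (simp add: power_mult_distrib)
  show "0 \<le> sqrt (2 + 16 * c\<^sup>2) * \<kappa> n" using k(2)[of n] by simp
qed

lemma summable_f: "summable (\<lambda>n. \<bar>f n\<bar> * m n)"
proof (rule summable_comparison_test')
  show "summable (\<lambda>n. sqrt (2 + 16 * c\<^sup>2) * (\<bar>f n\<bar> * \<kappa> n))"
    unfolding f_def \<kappa>_def by (intro summable_mult summable_fourier_C2[OF phi])
  show "norm (\<bar>f n\<bar> * m n) \<le> sqrt (2 + 16 * c\<^sup>2) * (\<bar>f n\<bar> * \<kappa> n)" for n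
    using mult_left_mono[OF m_le[of n], of "\<bar>f n\<bar>"] m_nonneg[of n] by (simp add: mult_ac)
qed

lemma summable_g: "summable (\<lambda>n. \<bar>g n\<bar>)"
  unfolding g_def by (rule summable_fourier_C1[OF psi])

lemma summable_f0: "summable (\<lambda>n. \<bar>f n\<bar>)"
proof (rule summable_comparison_test'[OF summable_mult[OF summable_f, of "1 / m0"]])
  show "norm \<bar>f n\<bar> \<le> 1 / m0 * (\<bar>f n\<bar> * m n)" for n
    using mult_left_mono[OF m_ge[of n], of "\<bar>f n\<bar>"] m0 by (simp add: field_simps)
qed

lemma e1: "0 \<le> mle a (- m n) 1" "mle a (- m n) 1 \<le> 1"
  using a m_pos[of n] by (auto intro: mle_neg_nonneg mle_neg_le_1)

lemma summable_b: "summable (\<lambda>n. \<bar>b n\<bar>)"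
proof (rule summable_comparison_test'[OF summable_add[OF summable_g summable_f0]])
  fix n
  have "\<bar>f n * mle a (- m n) 1\<bar> \<le> \<bar>f n\<bar>" using e1[of n] by (simp add: abs_mult mult_left_le)
  then show "norm \<bar>b n\<bar> \<le> \<bar>g n\<bar> + \<bar>f n\<bar>" unfolding b_def by simp
qed

text \<open>A gap independent of the index: E(m) >= 1 + \<tau>, while E(-m) <= 1.\<close>

definition \<tau> :: real where "\<tau> = m0 / Gamma (a + 1)"

lemma tau: "\<tau> > 0"
  using m0 a by (auto simp: \<tau>_def intro!: divide_pos_pos Gamma_real_pos)

lemma E1_ge: "mle a (m n) 1 \<ge> 1 + \<tau>" "mle a (m n) 1 \<ge> m n / Gamma (a + 1)" "mle a (m n) 1 \<ge> 1"
proof -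
  have G: "Gamma (a + 1) > 0" using a by auto
  have E: "mle a (m n) 1 \<ge> 1 + m n / Gamma (a + 1)"
    using a m_nonneg by (intro mle_pos_ge) auto
  have "\<tau> \<le> m n / Gamma (a + 1)" unfolding \<tau>_def using G m_ge[of n] by (intro divide_right_mono) auto
  with E show "mle a (m n) 1 \<ge> 1 + \<tau>" by linarith
  then show "mle a (m n) 1 \<ge> 1" using tau by linarith
  show "mle a (m n) 1 \<ge> m n / Gamma (a + 1)" using E by linarith
qed

text \<open>From E >= 1 + \<tau> follows E - 1 >= \<tau> / (1 + \<tau>) E, so the determinant is
  comparable with E(m) uniformly in the index.\<close>

lemma den_ge: "\<tau> / (1 + \<tau>) * mle a (m n) 1 \<le> den n" and den_pos: "den n > 0"
proof -
  have "mle a (m n) 1 * (1 + \<tau>) - (1 + \<tau>) \<ge> \<tau> * mle a (m n) 1"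
    using E1_ge(1)[of n] by (simp add: algebra_simps)
  then have "\<tau> / (1 + \<tau>) * mle a (m n) 1 \<le> mle a (m n) 1 - 1"
    using tau by (simp add: field_simps)
  then show *: "\<tau> / (1 + \<tau>) * mle a (m n) 1 \<le> den n"
    using e1(2)[of n] by (simp add: den_def)
  have "\<tau> / (1 + \<tau>) * mle a (m n) 1 > 0" using tau E1_ge(3)[of n] by (intro mult_pos_pos) auto
  with * show "den n > 0" by linarith
qed

lemma Q_le: "\<bar>Q n\<bar> * mle a (m n) 1 \<le> (1 + \<tau>) / \<tau> * \<bar>b n\<bar>"
proof -
  have "mle a (m n) 1 \<le> (1 + \<tau>) / \<tau> * den n"
    using den_ge[of n] tau by (simp add: field_simps)
  then have "\<bar>b n\<bar> * mle a (m n) 1 \<le> \<bar>b n\<bar> * ((1 + \<tau>) / \<tau> * den n)" by (rule mult_left_mono) simp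
  then have "\<bar>b n\<bar> * mle a (m n) 1 / den n \<le> \<bar>b n\<bar> * ((1 + \<tau>) / \<tau> * den n) / den n"
    using den_pos[of n] by (intro divide_right_mono) auto
  then show ?thesis using den_pos[of n] by (simp add: Q_def mult_ac)
qed

lemma summable_Q1: "summable (\<lambda>n. \<bar>Q n\<bar> * mle a (m n) 1)"
proof (rule summable_comparison_test'[OF summable_mult[OF summable_b, of "(1 + \<tau>) / \<tau>"]])
  show "norm (\<bar>Q n\<bar> * mle a (m n) 1) \<le> (1 + \<tau>) / \<tau> * \<bar>b n\<bar>" for n
    using Q_le[of n] E1_ge(3)[of n] by simp
qed

lemma summable_Qm: "summable (\<lambda>n. \<bar>Q n\<bar> * m n)"
proof (rule summable_comparison_test'[OF summable_mult[OF summable_Q1, of "Gamma (a + 1)"]])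
  fix n
  have "Gamma (a + 1) > 0" using a by auto
  then have "m n \<le> Gamma (a + 1) * mle a (m n) 1" using E1_ge(2)[of n] by (simp add: field_simps)
  then show "norm (\<bar>Q n\<bar> * m n) \<le> Gamma (a + 1) * (\<bar>Q n\<bar> * mle a (m n) 1)"
    using mult_left_mono[of "m n" "Gamma (a + 1) * mle a (m n) 1" "\<bar>Q n\<bar>"] m_nonneg[of n] by (simp add: mult_ac)
qed

text \<open>For q < 1 the quotient E(m q^a) / E(m) absorbs two powers of m, so summability of b
  without any power of m is enough.\<close>

lemma summable_Q2:
  assumes q: "0 < q" "q < 1"
  shows "summable (\<lambda>n. \<bar>Q n\<bar> * (m n)\<^sup>2 * mle a (m n) q)"
proof -
  obtain C where C: "C > 0" "\<And>l. l \<ge> 0 \<Longrightarrow> l\<^sup>2 * mle a l q \<le> C * mle a l 1"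
    using mle_pos_growth[OF a, of q] q by auto
  show ?thesis
  proof (rule summable_comparison_test'[OF summable_mult[OF summable_Q1, of C]])
    fix n
    have "\<bar>Q n\<bar> * ((m n)\<^sup>2 * mle a (m n) q) \<le> \<bar>Q n\<bar> * (C * mle a (m n) 1)"
      using C(2)[OF m_nonneg] by (intro mult_left_mono) auto
    moreover have "mle a (m n) q \<ge> 1" using a m_nonneg q by (intro mle_pos_ge_1) auto
    ultimately show "norm (\<bar>Q n\<bar> * (m n)\<^sup>2 * mle a (m n) q) \<le> C * (\<bar>Q n\<bar> * mle a (m n) 1)"
      by (simp add: mult_ac abs_mult)
  qed
qed

text \<open>The smoothness of \<phi> enters through f; Q tolerates the power of m because E(m) grows
  at least linearly.\<close>

lemma summable_Pm: "summable (\<lambda>n. \<bar>P n\<bar> * m n)"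
proof (rule summable_comparison_test'[OF summable_add[OF summable_f summable_Qm]])
  show "norm (\<bar>P n\<bar> * m n) \<le> \<bar>f n\<bar> * m n + \<bar>Q n\<bar> * m n" for n
    using mult_right_mono[OF abs_triangle_ineq4[of "f n" "Q n"] m_nonneg[of n]] m_nonneg[of n]
    by (simp add: P_def algebra_simps)
qed

lemma le_by_m:
  assumes "0 \<le> z" shows "z \<le> 1 / m0 * (z * m n)"
  using mult_left_mono[OF m_ge[of n] assms] m0 by (simp add: field_simps)

lemma summable_drop_m:
  assumes "summable (\<lambda>n. h n * m n)" "\<And>n. 0 \<le> h n"
  shows "summable h"
proof (rule summable_comparison_test'[OF summable_mult[OF assms(1), of "1 / m0"]])
  show "norm (h n) \<le> 1 / m0 * (h n * m n)" for n using le_by_m[OF assms(2)] assms(2)[of n] by simp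
qed

lemma summable_Qmm:
  assumes q: "0 < q" "q < 1"
  shows "summable (\<lambda>n. \<bar>Q n\<bar> * m n * mle a (m n) q)"
proof (rule summable_drop_m)
  have e: "\<bar>Q n\<bar> * m n * mle a (m n) q * m n = \<bar>Q n\<bar> * (m n)\<^sup>2 * mle a (m n) q" for n
    by (simp add: power2_eq_square)
  show "summable (\<lambda>n. \<bar>Q n\<bar> * m n * mle a (m n) q * m n)"
    unfolding e by (rule summable_Q2[OF q])
  fix n
  have "1 \<le> mle a (m n) q" by (rule mle_pos_ge_1[OF a(1) m_nonneg]) (use q in simp)
  then show "0 \<le> \<bar>Q n\<bar> * m n * mle a (m n) q" using m_nonneg[of n] by simp
qed

lemma summable_P: "summable (\<lambda>n. \<bar>P n\<bar>)"
  using summable_Pm by (rule summable_drop_m) simp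

section \<open>Termwise differentiation of the solution\<close>

lemma modes_scale: "modes a m (\<lambda>n. s n * P n) (\<lambda>n. s n * Q n) n x = s n * modes a m P Q n x"
  by (simp add: modes_def algebra_simps)

lemma modes_scale_right: "modes a m (\<lambda>n. P' n * s n) (\<lambda>n. Q' n * s n) n x = modes a m P' Q' n x * s n"
  by (simp add: modes_def algebra_simps)

lemma summable_abs_Y: "summable (\<lambda>n. \<bar>h n\<bar> * r n) \<Longrightarrow> (\<And>n. r n \<ge> 0) \<Longrightarrow> summable (\<lambda>n. \<bar>h n * Y (Suc n) y\<bar> * r n)"
  by (rule summable_comparison_test') (auto simp: abs_mult intro!: mult_right_mono mult_left_le Y_abs_le)

text \<open>For fixed y the values of \<open>Y\<close> are absorbed into the coefficients, which
  reduces the claim to series in one variable.\<close>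

lemma caputo_series:
  assumes x: "0 < x" "x < 1"
    and P': "summable (\<lambda>n. \<bar>P' n\<bar>)" and Q': "\<And>q. 0 < q \<Longrightarrow> q < 1 \<Longrightarrow> summable (\<lambda>n. \<bar>Q' n\<bar> * m n * mle a (m n) q)"
  shows "caputo_exists a (\<lambda>s. \<Sum>n. modes a m P' Q' n s * Y (Suc n) y) x"
    and "caputo a (\<lambda>s. \<Sum>n. modes a m P' Q' n s * Y (Suc n) y) x
      = (\<Sum>n. modes a m (\<lambda>n. - m n * P' n) (\<lambda>n. m n * Q' n) n x * Y (Suc n) y)"
proof -
  have s1: "summable (\<lambda>n. \<bar>P' n * Y (Suc n) y\<bar>)"
    using summable_abs_Y[of P' "\<lambda>n. 1"] P' by simp
  have s2: "summable (\<lambda>n. \<bar>Q' n * Y (Suc n) y\<bar> * m n * mle a (m n) q)" if "0 < q" "q < 1" for q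
  proof -
    have "m n * mle a (m n) q \<ge> 0" for n
      using mle_pos_ge_1[OF a(1) m_nonneg, of q n] m_nonneg[of n] that by simp
    then show ?thesis using summable_abs_Y[of Q' "\<lambda>n. m n * mle a (m n) q"] Q'[OF that] by (simp add: mult.assoc)
  qed
  show "caputo_exists a (\<lambda>s. \<Sum>n. modes a m P' Q' n s * Y (Suc n) y) x"
    using caputo_exists_modes[OF s1 s2 x] by (simp only: modes_scale_right)
  show "caputo a (\<lambda>s. \<Sum>n. modes a m P' Q' n s * Y (Suc n) y) x
      = (\<Sum>n. modes a m (\<lambda>n. - m n * P' n) (\<lambda>n. m n * Q' n) n x * Y (Suc n) y)"
    using caputo_modes[OF s1 s2 x]
    by (simp only: modes_scale_right mult.assoc[symmetric])
qed

lemma u_caputo: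
  assumes "0 < x" "x < 1"
  shows "caputo_x_exists a u (x, y)"
    and "caputo_x a u (x, y) = (\<Sum>n. modes a m (\<lambda>n. - m n * P n) (\<lambda>n. m n * Q n) n x * Y (Suc n) y)"
  using caputo_series[OF assms summable_P summable_Qmm, of y]
  by (simp_all add: caputo_x_exists_def caputo_x_def u_def)

text \<open>The first derivative is again a series of modes, with coefficients -m P and m Q.
  Differentiating it once more is what requires summability of m |P|.\<close>

lemma u_caputo_caputo:
  assumes x: "0 < x" "x < 1"
  shows "caputo_x_exists a (caputo_x a u) (x, y)"
    and "caputo_x a (caputo_x a u) (x, y) = (\<Sum>n. modes a m (\<lambda>n. (m n)\<^sup>2 * P n) (\<lambda>n. (m n)\<^sup>2 * Q n) n x * Y (Suc n) y)"
proof -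
  have s1: "summable (\<lambda>n. \<bar>- m n * P n\<bar>)"
    using summable_Pm m_nonneg by (simp add: abs_mult mult.commute)
  have s2: "summable (\<lambda>n. \<bar>m n * Q n\<bar> * m n * mle a (m n) q)" if "0 < q" "q < 1" for q
    using summable_Q2[OF that] m_nonneg by (simp add: abs_mult power2_eq_square mult_ac)
  have eq: "caputo_x a u (s, y) = (\<Sum>n. modes a m (\<lambda>n. - m n * P n) (\<lambda>n. m n * Q n) n s * Y (Suc n) y)"
    if "0 < s" "s < 1" for s
    by (rule u_caputo(2)[OF that])
  note cs = caputo_series[OF x s1 s2, of y]
  show "caputo_x_exists a (caputo_x a u) (x, y)"
    using caputo_exists_cong[OF x eq] cs(1) by (simp add: caputo_x_exists_def)
  have "caputo_x a (caputo_x a u) (x, y) = caputo a (\<lambda>s. caputo_x a u (s, y)) x"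
    by (simp add: caputo_x_def)
  also have "\<dots> = (\<Sum>n. modes a m (\<lambda>n. - m n * (- m n * P n)) (\<lambda>n. m n * (m n * Q n)) n x * Y (Suc n) y)"
    using caputo_cong[OF x eq] cs(2) by simp
  finally show "caputo_x a (caputo_x a u) (x, y) = (\<Sum>n. modes a m (\<lambda>n. (m n)\<^sup>2 * P n) (\<lambda>n. (m n)\<^sup>2 * Q n) n x * Y (Suc n) y)"
    by (simp add: power2_eq_square mult.assoc)
qed

lemma k_sq_le: "(\<kappa> n)\<^sup>2 \<le> (m n)\<^sup>2 / (1 - \<bar>\<epsilon>\<bar>)"
  using k_le_m[of n] eps by (simp add: field_simps)

text \<open>The squared frequency costs two powers of the rate; one of them is returned by the
  weight 1 / m from \<open>modes_decay_le\<close>.\<close>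

lemma summable_kP: "summable (\<lambda>n. \<bar>(\<kappa> n)\<^sup>2 * P n\<bar> / m n)"
proof (rule summable_comparison_test'[OF summable_mult[OF summable_Pm, of "1 / (1 - \<bar>\<epsilon>\<bar>)"]])
  fix n
  have "(\<kappa> n)\<^sup>2 * \<bar>P n\<bar> / m n \<le> (m n)\<^sup>2 / (1 - \<bar>\<epsilon>\<bar>) * \<bar>P n\<bar> / m n"
    using m_nonneg[of n] k_sq_le[of n] by (intro divide_right_mono mult_right_mono) auto
  also have "\<dots> = 1 / (1 - \<bar>\<epsilon>\<bar>) * (\<bar>P n\<bar> * m n)"
    using m_pos[of n] by (simp add: power2_eq_square)
  finally show "norm (\<bar>(\<kappa> n)\<^sup>2 * P n\<bar> / m n) \<le> 1 / (1 - \<bar>\<epsilon>\<bar>) * (\<bar>P n\<bar> * m n)"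
    using m_nonneg[of n] by (simp add: abs_mult)
qed

lemma summable_kQ:
  assumes "0 < q" "q < 1"
  shows "summable (\<lambda>n. \<bar>(\<kappa> n)\<^sup>2 * Q n\<bar> * mle a (m n) q)"
proof (rule summable_comparison_test'[OF summable_mult[OF summable_Q2[OF assms], of "1 / (1 - \<bar>\<epsilon>\<bar>)"]])
  fix n
  have E: "mle a (m n) q \<ge> 1" using a m_nonneg assms by (intro mle_pos_ge_1) auto
  have "(\<kappa> n)\<^sup>2 * (\<bar>Q n\<bar> * mle a (m n) q) \<le> (m n)\<^sup>2 / (1 - \<bar>\<epsilon>\<bar>) * (\<bar>Q n\<bar> * mle a (m n) q)"
    using k_sq_le[of n] E by (intro mult_right_mono) auto
  then show "norm (\<bar>(\<kappa> n)\<^sup>2 * Q n\<bar> * mle a (m n) q) \<le> 1 / (1 - \<bar>\<epsilon>\<bar>) * (\<bar>Q n\<bar> * (m n)\<^sup>2 * mle a (m n) q)"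
    using E by (simp add: abs_mult mult_ac)
qed

lemma summable_modes_k:
  assumes "0 < x" "x < 1"
  shows "summable (\<lambda>n. \<bar>modes a m P Q n x\<bar> * (freq (Suc n))\<^sup>2)"
proof (rule summable_comparison_test')
  show "summable (\<lambda>n. (\<bar>(\<kappa> n)\<^sup>2 * P n\<bar> / m n) * (Gamma (a + 1) * x powr (-a)) + \<bar>(\<kappa> n)\<^sup>2 * Q n\<bar> * mle a (m n) x)"
    by (intro summable_add summable_mult2 summable_kP summable_kQ assms)
  fix n
  have "\<bar>modes a m (\<lambda>n. (\<kappa> n)\<^sup>2 * P n) (\<lambda>n. (\<kappa> n)\<^sup>2 * Q n) n x\<bar>
     \<le> (\<bar>(\<kappa> n)\<^sup>2 * P n\<bar> / m n) * (Gamma (a + 1) * x powr (-a)) + \<bar>(\<kappa> n)\<^sup>2 * Q n\<bar> * mle a (m n) x"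
    by (rule modes_decay_le) (use assms in auto)
  then show "norm (\<bar>modes a m P Q n x\<bar> * (freq (Suc n))\<^sup>2) \<le> (\<bar>(\<kappa> n)\<^sup>2 * P n\<bar> / m n) * (Gamma (a + 1) * x powr (-a)) + \<bar>(\<kappa> n)\<^sup>2 * Q n\<bar> * mle a (m n) x"
    unfolding modes_scale[of "\<lambda>n. (\<kappa> n)\<^sup>2"] by (simp add: abs_mult \<kappa>_def mult.commute)
qed

lemma u_yy:
  assumes "0 < x" "x < 1"
  shows "partial_yy_exists u (x, y)"
    and "partial_yy u (x, y) = (\<Sum>n. modes a m P Q n x * (- (freq (Suc n))\<^sup>2 * Y (Suc n) y))"
    and "summable (\<lambda>n. modes a m P Q n x * (- (freq (Suc n))\<^sup>2 * Y (Suc n) y))"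
proof -
  note t = trig_series_deriv[OF summable_modes_k[OF assms]]
  have d1: "((\<lambda>t. u (x, t)) has_real_derivative (\<Sum>n. modes a m P Q n x * dY (Suc n) y)) (at y)" for y
    unfolding u_def fst_conv snd_conv by (rule t(1))
  have d: "deriv (\<lambda>t. u (x, t)) = (\<lambda>y. \<Sum>n. modes a m P Q n x * dY (Suc n) y)"
    by (rule ext, rule DERIV_imp_deriv, rule d1)
  show "partial_yy_exists u (x, y)"
    unfolding partial_yy_exists_def using d1 t(2) by (auto simp: d real_differentiable_def)
  show "partial_yy u (x, y) = (\<Sum>n. modes a m P Q n x * (- (freq (Suc n))\<^sup>2 * Y (Suc n) y))"
    unfolding partial_yy_def by (simp only: prod.case d) (rule DERIV_imp_deriv[OF t(2)])
  show "summable (\<lambda>n. modes a m P Q n x * (- (freq (Suc n))\<^sup>2 * Y (Suc n) y))" by (rule t(3))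
qed

section \<open>Continuity up to the boundary and verification of the equation\<close>

lemma modes_abs_le:
  assumes "0 \<le> x" "x \<le> 1"
  shows "\<bar>modes a m P Q n x\<bar> \<le> \<bar>P n\<bar> + \<bar>Q n\<bar> * mle a (m n) 1"
proof -
  have "0 \<le> mle a (- m n) x" "mle a (- m n) x \<le> 1" "1 \<le> mle a (m n) x" "mle a (m n) x \<le> mle a (m n) 1"
    using a m_pos[of n] assms by (auto intro: mle_neg_nonneg mle_neg_le_1 mle_pos_ge_1 mle_pos_mono)
  then have "\<bar>P n * mle a (- m n) x\<bar> \<le> \<bar>P n\<bar>" "\<bar>Q n * mle a (m n) x\<bar> \<le> \<bar>Q n\<bar> * mle a (m n) 1"
    by (auto simp: abs_mult mult_left_le intro!: mult_left_mono)
  then show ?thesis unfolding modes_def by linarith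
qed

lemma term_abs_le:
  assumes "0 \<le> x" "x \<le> 1"
  shows "\<bar>modes a m P Q n x * Y (Suc n) y\<bar> \<le> \<bar>P n\<bar> + \<bar>Q n\<bar> * mle a (m n) 1"
proof -
  have "\<bar>modes a m P Q n x\<bar> * \<bar>Y (Suc n) y\<bar> \<le> \<bar>modes a m P Q n x\<bar>"
    by (rule mult_left_le[OF Y_abs_le]) simp
  then show ?thesis using modes_abs_le[OF assms, of n] by (simp add: abs_mult)
qed

lemma summable_terms:
  assumes "0 \<le> x" "x \<le> 1"
  shows "summable (\<lambda>n. \<bar>modes a m P Q n x * Y (Suc n) y\<bar>)"
  by (rule summable_comparison_test'[OF summable_add[OF summable_P summable_Q1]])
    (use term_abs_le[OF assms] in simp)

text \<open>The majorant |P| + |Q| E(m) is valid up to x = 1, because E(m x^a) increases in x and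
  E(-m x^a) lies between 0 and 1.\<close>

lemma u_continuous: "continuous_on (closure Omega) u"
proof -
  have "uniform_limit ({0..1} \<times> {-pi..pi}) (\<lambda>N p. \<Sum>n<N. modes a m P Q n (fst p) * Y (Suc n) (snd p)) u sequentially"
    unfolding u_def
    by (rule Weierstrass_m_test[OF _ summable_add[OF summable_P summable_Q1]])
      (use term_abs_le in auto)
  then show ?thesis unfolding closure_Omega
  proof (rule uniform_limit_theorem[rotated])
    show "\<forall>\<^sub>F N in sequentially. continuous_on ({0..1} \<times> {-pi..pi}) (\<lambda>p. \<Sum>n<N. modes a m P Q n (fst p) * Y (Suc n) (snd p))"
      by (intro always_eventually allI continuous_intros continuous_on_compose2[OF modes_continuous_on]) auto
  qed simp
qed

lemma continuous_on_Omega_series: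
  assumes "summable (\<lambda>n. \<bar>P' n\<bar> / m n)" "\<And>q. 0 < q \<Longrightarrow> q < 1 \<Longrightarrow> summable (\<lambda>n. \<bar>Q' n\<bar> * mle a (m n) q)"
    and "\<And>x y. 0 < x \<Longrightarrow> x < 1 \<Longrightarrow> h (x, y) = (\<Sum>n. modes a m P' Q' n x * Y (Suc n) y)"
  shows "continuous_on Omega h"
proof -
  have "continuous_on Omega (\<lambda>p. \<Sum>n. modes a m P' Q' n (fst p) * Y (Suc n) (snd p))"
    by (rule continuous_on_subset[OF modes_series_continuous[OF assms(1,2)]]) (auto simp: Omega_def)
  then show ?thesis
    by (rule continuous_on_eq) (use assms(3) in \<open>auto simp: Omega_def\<close>)
qed

lemma u_regular: "regular_solution a \<epsilon> c u"
  unfolding regular_solution_def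
proof (intro conjI)
  show "continuous_on (closure Omega) u" by (rule u_continuous)
  show "\<forall>p\<in>Omega. caputo_x_exists a u p"
    using u_caputo(1) by (auto simp: Omega_def)
  show "\<forall>p\<in>Omega. caputo_x_exists a (caputo_x a u) p"
    using u_caputo_caputo(1) by (auto simp: Omega_def)
  show "\<forall>p\<in>Omega. partial_yy_exists u p"
    using u_yy(1) by (auto simp: Omega_def)
  show "continuous_on Omega (caputo_x a u)"
  proof (rule continuous_on_Omega_series[OF _ _ u_caputo(2)])
    show "summable (\<lambda>n. \<bar>- m n * P n\<bar> / m n)"
      using summable_P m_pos by (simp add: abs_mult less_imp_le less_imp_neq[symmetric])
    show "summable (\<lambda>n. \<bar>m n * Q n\<bar> * mle a (m n) q)" if "0 < q" "q < 1" for q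
      using summable_Qmm[OF that] m_nonneg by (simp add: abs_mult mult_ac)
  qed
  show "continuous_on Omega (caputo_x a (caputo_x a u))"
  proof (rule continuous_on_Omega_series[OF _ _ u_caputo_caputo(2)])
    have "\<bar>(m n)\<^sup>2 * P n\<bar> / m n = \<bar>P n\<bar> * m n" for n
      using m_pos[of n] by (simp add: abs_mult power2_eq_square)
    then show "summable (\<lambda>n. \<bar>(m n)\<^sup>2 * P n\<bar> / m n)" using summable_Pm by simp
    show "summable (\<lambda>n. \<bar>(m n)\<^sup>2 * Q n\<bar> * mle a (m n) q)" if "0 < q" "q < 1" for q
      using summable_Q2[OF that] by (simp add: abs_mult mult_ac)
  qed
  show "continuous_on Omega (partial_yy u)"
  proof (rule continuous_on_Omega_series)
    show "summable (\<lambda>n. \<bar>- ((\<kappa> n)\<^sup>2) * P n\<bar> / m n)" using summable_kP by simp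
    show "summable (\<lambda>n. \<bar>- ((\<kappa> n)\<^sup>2) * Q n\<bar> * mle a (m n) q)" if "0 < q" "q < 1" for q
      using summable_kQ[OF that] by simp
    show "partial_yy u (x, y) = (\<Sum>n. modes a m (\<lambda>n. - ((\<kappa> n)\<^sup>2) * P n) (\<lambda>n. - ((\<kappa> n)\<^sup>2) * Q n) n x * Y (Suc n) y)"
      if "0 < x" "x < 1" for x y
      unfolding u_yy(2)[OF that] modes_scale[of "\<lambda>n. - ((\<kappa> n)\<^sup>2)"] by (simp add: \<kappa>_def mult_ac)
  qed
  show "\<forall>(x, y)\<in>Omega. caputo_x a (caputo_x a u) (x, y) + partial_yy u (x, y) - \<epsilon> * partial_yy u (x, - y) - c\<^sup>2 * u (x, y) = 0"
  proof safe
    fix x y assume "(x, y) \<in> Omega"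
    then have x: "0 < x" "x < 1" by (auto simp: Omega_def)
    define D where "D = (\<lambda>n. modes a m P Q n x)"
    have s0: "summable (\<lambda>n. D n * Y (Suc n) y)"
      unfolding D_def by (rule summable_rabs_cancel, rule summable_terms) (use x in simp_all)
    have s1: "summable (\<lambda>n. D n * (- (freq (Suc n))\<^sup>2 * Y (Suc n) y))" for y
      unfolding D_def by (rule u_yy(3)[OF x])
    \<comment> \<open>Reflection multiplies \<open>Y\<close> by -1 for odd and by 1 for even index,
      which matches the factors 1 + \<epsilon> and 1 - \<epsilon> in the eigenvalues. The auxiliary
      identity in q, d, z, p, w treats both parities at once.\<close>
    have tm: "(m n)\<^sup>2 * D n * Y (Suc n) y = - (D n * (- (freq (Suc n))\<^sup>2 * Y (Suc n) y))
        + \<epsilon> * (D n * (- (freq (Suc n))\<^sup>2 * Y (Suc n) (-y))) + c\<^sup>2 * (D n * Y (Suc n) y)" for n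
    proof -
      have "(q + c\<^sup>2) * d * z = - (d * (- (p * z))) + \<epsilon> * (d * (- (p * w))) + c\<^sup>2 * (d * z)"
        if "q = (1 + \<epsilon>) * p \<and> w = - z \<or> q = (1 - \<epsilon>) * p \<and> w = z" for q d z p w :: real
        using that by (elim disjE conjE; simp only:; simp add: algebra_simps)
      from this[of "eigval \<epsilon> (Suc n)" "(freq (Suc n))\<^sup>2" "Y (Suc n) (-y)" "Y (Suc n) y" "D n"]
      show ?thesis unfolding m_sq by (simp add: eigval_freq Y_minus)
    qed
    have "caputo_x a (caputo_x a u) (x, y) = (\<Sum>n. (m n)\<^sup>2 * D n * Y (Suc n) y)"
      unfolding u_caputo_caputo(2)[OF x] modes_scale[of "\<lambda>n. (m n)\<^sup>2"] D_def ..
    also have "\<dots> = - (\<Sum>n. D n * (- (freq (Suc n))\<^sup>2 * Y (Suc n) y))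
        + \<epsilon> * (\<Sum>n. D n * (- (freq (Suc n))\<^sup>2 * Y (Suc n) (-y))) + c\<^sup>2 * (\<Sum>n. D n * Y (Suc n) y)"
      unfolding tm
      by (rule sums_unique[symmetric]) (intro sums_add sums_minus sums_mult summable_sums s0 s1)
    also have "\<dots> = - partial_yy u (x, y) + \<epsilon> * partial_yy u (x, - y) + c\<^sup>2 * u (x, y)"
      unfolding u_yy(2)[OF x] by (simp add: u_def D_def)
    finally show "caputo_x a (caputo_x a u) (x, y) + partial_yy u (x, y) - \<epsilon> * partial_yy u (x, - y) - c\<^sup>2 * u (x, y) = 0"
      by simp
  qed
qed

section \<open>Boundary values and the closed form\<close>

lemma holder_continuous:
  assumes "h \<in> holder_space k \<delta> (-pi) pi" shows "continuous_on {-pi..pi} h"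
proof -
  obtain D where "\<And>x. x \<in> {-pi..pi} \<Longrightarrow> D 0 x = h x" "\<And>i. i \<le> k \<Longrightarrow> continuous_on {-pi..pi} (D i)"
    by (rule holder_space_derivs[OF assms]) blast
  then show ?thesis using continuous_on_eq[of "{-pi..pi}" "D 0" h] by auto
qed

lemma u_boundary: "boundary_conditions \<phi> \<psi> u"
  unfolding boundary_conditions_def
proof (intro conjI ballI)
  fix y assume y: "y \<in> {-pi..pi}"
  have "modes a m P Q n 0 = f n" for n by (simp add: modes_def P_def)
  then show "u (0, y) = \<phi> y"
    using fourier_series_sums[OF holder_continuous[OF phi(1)] summable_f0[unfolded f_def] y] by (simp add: u_def f_def)
  have "modes a m P Q n 1 = g n" for n
  proof -
    have "modes a m P Q n 1 = f n * mle a (- m n) 1 + Q n * den n"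
      by (simp add: modes_def P_def den_def algebra_simps)
    also have "Q n * den n = b n" using den_pos[of n] by (simp add: Q_def)
    finally show ?thesis by (simp add: b_def)
  qed
  then show "u (1, y) = \<psi> y"
    using fourier_series_sums[OF holder_continuous[OF psi(1)] summable_g[unfolded g_def] y] by (simp add: u_def g_def)
next
  fix x :: real
  show "u (x, -pi) = 0" "u (x, pi) = 0" by (simp_all add: u_def Y_ends)
qed

text \<open>Solving the two-by-two system for P and Q and regrouping by f and g produces
  \<open>C_fun\<close> and \<open>S_fun\<close>; \<open>mittag_leffler_odd_part\<close> identifies
  their denominators with \<open>den\<close>.\<close>

lemma series_term_modes:
  assumes "0 \<le> x"
  shows "series_term a \<epsilon> c \<phi> \<psi> x y (Suc n) = modes a m P Q n x * Y (Suc n) y"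
proof -
  have p: "x powr (2 * a) = (x powr a)\<^sup>2" by (simp only: mult_2 powr_add power2_eq_square)
  have D: "den n = 2 * m n * mittag_leffler (2 * a) (a + 1) ((m n)\<^sup>2)"
    using mittag_leffler_odd_part[OF a(1), of "m n"] by (simp add: den_def mle_def)
  have Ex: "mle a (m n) x - mle a (- m n) x = 2 * (m n * x powr a) * mittag_leffler (2 * a) (a + 1) ((m n)\<^sup>2 * x powr (2 * a))"
    using mittag_leffler_odd_part[OF a(1), of "m n * x powr a"] by (simp add: mle_def p power_mult_distrib)
  have S: "S_fun a (m n) x = (mle a (m n) x - mle a (- m n) x) / den n"
    unfolding S_fun_def Ex D using m_pos[of n] by simp
  have C: "C_fun a (m n) x = (mle a (m n) 1 * mle a (- m n) x - mle a (- m n) 1 * mle a (m n) x) / den n"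
    unfolding C_fun_def D by (simp add: mle_def)
  have "f n * C_fun a (m n) x + g n * S_fun a (m n) x = modes a m P Q n x"
  proof -
    have alg: "F * ((E1 * e - e1 * E) / d) + G * ((E - e) / d) = (F - (G - F * e1) / d) * e + (G - F * e1) / d * E"
      if "d \<noteq> 0" "d = E1 - e1" for F G E1 e1 E e d :: real
    proof -
      have "F - (G - F * e1) / d = (F * d - (G - F * e1)) / d" using that(1) by (simp add: diff_divide_distrib)
      then have "(F - (G - F * e1) / d) * e + (G - F * e1) / d * E = ((F * d - (G - F * e1)) * e + (G - F * e1) * E) / d"
        by (simp only: times_divide_eq_left add_divide_distrib)
      also have "(F * d - (G - F * e1)) * e + (G - F * e1) * E = F * (E1 * e - e1 * E) + G * (E - e)"
        unfolding that(2) by (simp add: algebra_simps)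
      finally show ?thesis by (simp only: times_divide_eq_right add_divide_distrib)
    qed
    show ?thesis
      unfolding C S modes_def P_def Q_def b_def by (rule alg) (use den_pos[of n] in \<open>auto simp: den_def\<close>)
  qed
  then show ?thesis by (simp add: series_term_def f_def g_def m_def)
qed

lemma u_series:
  assumes "0 \<le> x" "x \<le> 1"
  shows "summable (\<lambda>k. series_term a \<epsilon> c \<phi> \<psi> x y (2 * Suc k - 1))"
    "summable (\<lambda>k. series_term a \<epsilon> c \<phi> \<psi> x y (2 * Suc k))"
    "u (x, y) = (\<Sum>k. series_term a \<epsilon> c \<phi> \<psi> x y (2 * Suc k - 1)) + (\<Sum>k. series_term a \<epsilon> c \<phi> \<psi> x y (2 * Suc k))"
proof -
  define t where "t = (\<lambda>n. modes a m P Q n x * Y (Suc n) y)"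
  have "t (2 * k) = series_term a \<epsilon> c \<phi> \<psi> x y (2 * Suc k - 1)" "t (2 * k + 1) = series_term a \<epsilon> c \<phi> \<psi> x y (2 * Suc k)" for k
    using series_term_modes[OF assms(1), of y "2 * k"] series_term_modes[OF assms(1), of y "2 * k + 1"]
    by (simp_all add: t_def)
  moreover have "u (x, y) = (\<Sum>n. t n)" by (simp add: u_def t_def)
  moreover have "summable (\<lambda>n. \<bar>t n\<bar>)" unfolding t_def by (rule summable_terms[OF assms])
  note sums_even_odd_split[OF this]
  ultimately show "summable (\<lambda>k. series_term a \<epsilon> c \<phi> \<psi> x y (2 * Suc k - 1))"
    "summable (\<lambda>k. series_term a \<epsilon> c \<phi> \<psi> x y (2 * Suc k))"
    "u (x, y) = (\<Sum>k. series_term a \<epsilon> c \<phi> \<psi> x y (2 * Suc k - 1)) + (\<Sum>k. series_term a \<epsilon> c \<phi> \<psi> x y (2 * Suc k))"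
    by simp_all
qed

end

section \<open>Functions with two Caputo derivatives\<close>

lemma set_integrable_imp_integral_Icc:
  fixes f :: "real \<Rightarrow> real"
  assumes "set_integrable lborel {p<..<q} f"
  shows "f integrable_on {p..q}" "(LBINT t:{p<..<q}. f t) = integral {p..q} f"
  using set_borel_integral_eq_integral[OF assms]
  by (simp_all add: integrable_on_Icc_iff_Ioo integral_open_interval_real)

text \<open>The gauge integral recovers F from its derivative in the open interval alone. Lebesgue
  integrals from the Caputo definition are brought into this form by
  \<open>set_integrable_imp_integral_Icc\<close>.\<close>

lemma deriv_has_integral:
  fixes F :: "real \<Rightarrow> real"
  assumes "p \<le> q" "continuous_on {p..q} F" "\<And>t. p < t \<Longrightarrow> t < q \<Longrightarrow> F differentiable (at t)"
  shows "(deriv F has_integral F q - F p) {p..q}"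
proof (rule fundamental_theorem_of_calculus_interior[OF assms(1,2)])
  fix t assume "t \<in> {p<..<q}"
  then have "F differentiable (at t)" using assms(3) by auto
  then have "(F has_real_derivative deriv F t) (at t)" by (simp add: DERIV_deriv_iff_real_differentiable)
  then show "(F has_vector_derivative deriv F t) (at t)" by (simp add: has_real_derivative_iff_has_vector_derivative)
qed

lemma differentiable_imp_continuous_on_Icc:
  fixes F :: "real \<Rightarrow> real"
  assumes "\<And>t. p \<le> t \<Longrightarrow> t \<le> q \<Longrightarrow> F differentiable (at t)"
  shows "continuous_on {p..q} F"
  using assms by (auto intro!: continuous_at_imp_continuous_on differentiable_imp_continuous_within)

lemma frac_intble_imp_1:
  "0 < b \<Longrightarrow> b \<le> 1 \<Longrightarrow> frac_intble b f x \<Longrightarrow> set_integrable lborel {0<..<x} f"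
  using frac_intble_mono_order[of b 1 f x] by (simp add: frac_intble_1)

text \<open>
  Two successive Caputo derivatives of order \<open>a\<close> are inverted by fractional integration. The initial
  value \<open>A\<close> of the first one is its limit at 0, not the junk value \<open>caputo a f 0\<close>.
\<close>

lemma caputo_caputo_representation:
  fixes f :: "real \<Rightarrow> real"
  assumes a: "0 < a" "a < 1" and f: "continuous_on {0..<1} f" "f 0 = 0"
    and ex1: "\<And>x. 0 < x \<Longrightarrow> x < 1 \<Longrightarrow> caputo_exists a f x"
    and ex2: "\<And>x. 0 < x \<Longrightarrow> x < 1 \<Longrightarrow> caputo_exists a (caputo a f) x"
  defines "h \<equiv> caputo a (caputo a f)"
  obtains A N where
    "\<And>x. 0 < x \<Longrightarrow> x < 1 \<Longrightarrow> frac_intble (2 - 2 * a) (deriv f) x"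
    "\<And>x. 0 < x \<Longrightarrow> x < 1 \<Longrightarrow> frac_int (2 - 2 * a) (deriv f) x = A * kern (2 - a) x + frac_int 1 h x"
    "\<And>x. 0 < x \<Longrightarrow> x < 1 \<Longrightarrow> frac_intble 1 h x"
    "\<And>x. 0 < x \<Longrightarrow> x < 1 \<Longrightarrow> frac_int (2 - 2 * a) f x = A * kern (3 - a) x + frac_int 2 h x"
    "\<And>x. 0 < x \<Longrightarrow> x \<le> 1/2 \<Longrightarrow> \<bar>f x\<bar> \<le> N * x powr a"
proof -
  define g where "g = caputo a f"
  have a': "0 < 1 - a" "1 - a \<le> 1" using a by auto
  have g_eq: "g x = frac_int (1 - a) (deriv f) x" for x unfolding g_def by (rule caputo_frac_int[OF a(2)])
  have h_eq: "h x = frac_int (1 - a) (deriv g) x" for x unfolding h_def g_def by (rule caputo_frac_int[OF a(2)])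
  have if': "frac_intble (1 - a) (deriv f) x" and ig': "frac_intble (1 - a) (deriv g) x" if "0 < x" "x < 1" for x
    using ex1[OF that] ex2[OF that] a(2) by (auto simp: caputo_exists_frac_int g_def)
  have df: "f differentiable (at x)" and dg: "g differentiable (at x)" if "0 < x" "x < 1" for x
  proof -
    \<comment> \<open>Existence of the Caputo derivative at x gives differentiability only on (0,
      x), so the hypotheses are applied at the midpoint of x and 1.\<close>
    have "0 < (x + 1) / 2" "(x + 1) / 2 < 1" using that by auto
    then show "f differentiable (at x)" "g differentiable (at x)"
      using ex1[of "(x + 1) / 2"] ex2[of "(x + 1) / 2"] a(2) that by (auto simp: caputo_exists_frac_int g_def)
  qed
  note mo = frac_intble_mono_order[OF a'(1)]
  have if1: "set_integrable lborel {0<..<x} (deriv f)" and ig1: "set_integrable lborel {0<..<x} (deriv g)"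
    if "0 < x" "x < 1" for x
    using frac_intble_imp_1[OF a' if'[OF that]] frac_intble_imp_1[OF a' ig'[OF that]] .
  have mf: "set_borel_measurable borel {0<..<x} (deriv f)" and mg: "set_borel_measurable borel {0<..<x} (deriv g)"
    if "0 < x" "x < 1" for x
    using frac_intble_measurable[OF if'[OF that] a'(1)] frac_intble_measurable[OF ig'[OF that] a'(1)] .
  have f1: "frac_int 1 (deriv f) x = f x" if x: "0 < x" "x < 1" for x
  proof -
    have "frac_int 1 (deriv f) x = integral {0..x} (deriv f)"
      unfolding frac_int_1 by (rule set_integrable_imp_integral_Icc(2)[OF if1[OF x]])
    also have "(deriv f has_integral f x - f 0) {0..x}"
      by (rule deriv_has_integral) (use x df in \<open>auto intro: continuous_on_subset[OF f(1)]\<close>)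
    then have "integral {0..x} (deriv f) = f x" using f(2) by (simp add: integral_unique)
    finally show ?thesis .
  qed
  \<comment> \<open>g - I^1 g' is constant on (0, 1), so any sample point gives the same A.\<close>
  define A where "A = g (1/2) - frac_int 1 (deriv g) (1/2)"
  have g1_le: "g y - frac_int 1 (deriv g) y = g x - frac_int 1 (deriv g) x" if x: "0 < x" "x \<le> y" "y < 1" for x y
  proof -
    have i: "deriv g integrable_on {0..y}" "frac_int 1 (deriv g) y = integral {0..y} (deriv g)"
      "frac_int 1 (deriv g) x = integral {0..x} (deriv g)"
      unfolding frac_int_1 using set_integrable_imp_integral_Icc[OF ig1] x by auto
    have "integral {0..x} (deriv g) + integral {x..y} (deriv g) = integral {0..y} (deriv g)"
      by (rule Henstock_Kurzweil_Integration.integral_combine) (use x i in auto)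
    moreover have "(deriv g has_integral g y - g x) {x..y}"
      by (rule deriv_has_integral) (use x dg in \<open>auto intro!: differentiable_imp_continuous_on_Icc\<close>)
    then have "integral {x..y} (deriv g) = g y - g x" by (rule integral_unique)
    ultimately show ?thesis using i by simp
  qed
  have g1: "g x = A + frac_int 1 (deriv g) x" if "0 < x" "x < 1" for x
    using g1_le[of x "1/2"] g1_le[of "1/2" x] that unfolding A_def by (cases "x \<le> 1/2") auto
  have sum: "1 - a + (1 - a) = 2 - 2 * a" by simp
  have R0: "frac_intble (2 - 2 * a) (deriv f) x" if x: "0 < x" "x < 1" for x
    using mo[OF _ if'[OF x], of "2 - 2 * a"] a by simp
  \<comment> \<open>I^(1-a) is applied to g = A + I^1 g'. The two integrations of g' are then
    exchanged, so that I^(1-a) g' = h appears inside.\<close>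
  have R1: "frac_int (2 - 2 * a) (deriv f) x = A * kern (2 - a) x + frac_int 1 h x"
    and R2: "frac_intble 1 h x" if x: "0 < x" "x < 1" for x
  proof -
    have "frac_int (2 - 2 * a) (deriv f) x = frac_int (1 - a) (frac_int (1 - a) (deriv f)) x"
      using frac_int_frac_int[OF a'(1) a'(1) mf[OF x]] R0[OF x] unfolding sum by simp
    also have "\<dots> = frac_int (1 - a) (\<lambda>t. A + frac_int 1 (deriv g) t) x"
      by (rule frac_int_cong) (use x g1 in \<open>auto simp flip: g_eq\<close>)
    also have "\<dots> = frac_int (1 - a) (\<lambda>t. A) x + frac_int (1 - a) (frac_int 1 (deriv g)) x"
      by (rule frac_int_add[OF frac_intble_const[OF a'(1)]], rule frac_intble_frac_int[OF a'(1) _ mg[OF x]])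
        (use mo[OF _ ig'[OF x], of "1 - a + 1"] a in auto)
    also have "frac_int (1 - a) (\<lambda>t. A) x = A * kern (2 - a) x"
      using frac_int_const[OF a'(1)] by simp
    also have "frac_int (1 - a) (frac_int 1 (deriv g)) x = frac_int (1 - a + 1) (deriv g) x"
      by (rule frac_int_frac_int[OF a'(1) _ mg[OF x]]) (use mo[OF _ ig'[OF x], of "1 - a + 1"] a in auto)
    also have "frac_int (1 - a + 1) (deriv g) x = frac_int 1 (frac_int (1 - a) (deriv g)) x"
      using frac_int_frac_int[OF _ a'(1) mg[OF x], of 1] mo[OF _ ig'[OF x], of "1 + (1 - a)"] a by (simp add: add.commute)
    also have "frac_int (1 - a) (deriv g) = h" by (rule ext) (simp add: h_eq)
    finally show "frac_int (2 - 2 * a) (deriv f) x = A * kern (2 - a) x + frac_int 1 h x" .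
    have "frac_intble 1 (frac_int (1 - a) (deriv g)) x"
      by (rule frac_intble_frac_int[OF _ a'(1) mg[OF x]]) (use mo[OF _ ig'[OF x], of "1 + (1 - a)"] a in auto)
    then show "frac_intble 1 h x" by (simp only: h_eq[abs_def, symmetric])
  qed
  \<comment> \<open>One more integration replaces f' by f = I^1 f' and the integral of h by its
    double integral.\<close>
  have R3: "frac_int (2 - 2 * a) f x = A * kern (3 - a) x + frac_int 2 h x" if x: "0 < x" "x < 1" for x
  proof -
    have p: "0 < 2 - 2 * a" using a by simp
    have i3: "frac_intble (2 - 2 * a + 1) (deriv f) x"
      using mo[OF _ if'[OF x], of "2 - 2 * a + 1"] a by simp
    have "frac_int (2 - 2 * a) f x = frac_int (2 - 2 * a) (frac_int 1 (deriv f)) x"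
      by (rule frac_int_cong) (use x f1 in auto)
    also have "\<dots> = frac_int (2 - 2 * a + 1) (deriv f) x"
      by (rule frac_int_frac_int[OF p _ mf[OF x] i3]) simp
    also have "\<dots> = frac_int 1 (frac_int (2 - 2 * a) (deriv f)) x"
      using frac_int_frac_int[OF _ p mf[OF x], of 1] i3 by (simp add: add.commute)
    also have "\<dots> = frac_int 1 (\<lambda>t. A * kern (2 - a) t + frac_int 1 h t) x"
      by (rule frac_int_cong) (use x R1 in auto)
    also have "\<dots> = frac_int 1 (\<lambda>t. A * kern (2 - a) t) x + frac_int 1 (frac_int 1 h) x"
    proof (rule frac_int_add)
      show "frac_intble 1 (\<lambda>t. A * kern (2 - a) t) x"
        using a by (intro frac_intble_cmult frac_intble_kern) auto
      show "frac_intble 1 (frac_int 1 h) x"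
        using frac_intble_measurable[OF R2[OF x]] frac_intble_mono_order[OF _ _ R2[OF x], of 2]
        by (intro frac_intble_frac_int) auto
    qed
    also have "frac_int 1 (\<lambda>t. A * kern (2 - a) t) x = A * kern (3 - a) x"
      using a by (simp add: frac_int_cmult frac_int_kern)
    also have "frac_int 1 (frac_int 1 h) x = frac_int 2 h x"
      using frac_intble_measurable[OF R2[OF x]] frac_intble_mono_order[OF _ _ R2[OF x], of 2]
        frac_int_frac_int[of 1 1 x h] by auto
    finally show ?thesis .
  qed
  define B where "B = \<bar>A\<bar> + (LBINT t:{0<..<1/2}. \<bar>deriv g t\<bar>)"
  have gB: "\<bar>g t\<bar> \<le> B" if t: "0 < t" "t < 1/2" for t
  proof -
    have ia: "set_integrable lborel {0<..<1/2} (\<lambda>t. \<bar>deriv g t\<bar>)"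
      by (rule set_integrable_abs) (rule ig1, auto)
    have ia': "set_integrable lborel {0<..<t} (\<lambda>t. \<bar>deriv g t\<bar>)"
      by (rule set_integrable_subset[OF ia]) (use t in auto)
    have "\<bar>frac_int 1 (deriv g) t\<bar> \<le> frac_int 1 (\<lambda>t. \<bar>deriv g t\<bar>) t"
      by (rule frac_int_abs_le) (use ia' in \<open>auto simp: frac_intble_1\<close>)
    also have "\<dots> = (LBINT t:{0<..<t}. \<bar>deriv g t\<bar>)" by (rule frac_int_1)
    also have "\<dots> \<le> (LBINT t:{0<..<1/2}. \<bar>deriv g t\<bar>)"
      unfolding set_lebesgue_integral_def
      by (rule integral_mono) (use ia ia' t in \<open>auto simp: set_integrable_def indicator_def\<close>)
    finally show ?thesis using g1[of t] t unfolding B_def by linarith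
  qed
  \<comment> \<open>f = I^1 f' = I^a I^(1-a) f' = I^a g, and g is bounded by B on (0, 1/2).\<close>
  have R4: "\<bar>f x\<bar> \<le> (B / Gamma (a + 1)) * x powr a" if x: "0 < x" "x \<le> 1/2" for x
  proof -
    have x1: "x < 1" using x by simp
    have "f x = frac_int (a + (1 - a)) (deriv f) x" using f1[OF x(1) x1] by simp
    also have "\<dots> = frac_int a (frac_int (1 - a) (deriv f)) x"
      by (rule frac_int_frac_int[symmetric, OF a(1) a'(1) mf[OF x(1) x1]])
        (use if1[OF x(1) x1] in \<open>simp add: frac_intble_1\<close>)
    also have "\<dots> = frac_int a g x" by (rule frac_int_cong) (simp add: g_eq)
    finally have "\<bar>f x\<bar> \<le> frac_int a (\<lambda>t. B) x"
      using frac_int_abs_le[OF a(1) frac_intble_const[OF a(1)], of x g B] gB x by auto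
    also have "\<dots> = B * (x powr a / Gamma (a + 1))"
      using a x by (simp add: frac_int_const kern_def)
    finally show ?thesis by simp
  qed
  show ?thesis by (rule that[OF R0 R1 R2 R3 R4])
qed

section \<open>Fractional derivatives at a minimum\<close>

lemma kern_deriv:
  assumes "s > 0"
  shows "(kern c has_real_derivative (c - 1) * s powr (c - 2) / Gamma c) (at s)"
proof -
  have "((\<lambda>s. s powr (c - 1) / Gamma c) has_real_derivative (c - 1) * s powr (c - 2) / Gamma c) (at s)"
    using assms by (cases "Gamma c = 0") (auto intro!: derivative_eq_intros)
  then show ?thesis
    by (rule has_field_derivative_transform_within_open[where S = "{0<..}"]) (use assms in \<open>auto simp: kern_def\<close>)
qed

text \<open>The product rule is integrated over the open interval. K' E may be singular at an end
  where only the product K E is continuous; its sign allows it to be dropped, at the price of an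
  inequality.\<close>

lemma by_parts_inequality:
  fixes K E :: "real \<Rightarrow> real"
  assumes pq: "p < q" and K: "\<And>t. p < t \<Longrightarrow> t < q \<Longrightarrow> (K has_real_derivative K' t) (at t)"
    and E: "\<And>t. p < t \<Longrightarrow> t < q \<Longrightarrow> E differentiable (at t)"
    and cont: "continuous_on {p..q} (\<lambda>t. K t * E t)"
    and sgn: "\<And>t. p < t \<Longrightarrow> t < q \<Longrightarrow> K' t * E t \<le> 0"
    and int: "(\<lambda>t. K t * deriv E t) integrable_on {p..q}"
  shows "K q * E q - K p * E p \<le> integral {p..q} (\<lambda>t. K t * deriv E t)"
proof -
  have "((\<lambda>t. K' t * E t + deriv E t * K t) has_integral (K q * E q - K p * E p)) {p..q}"
  proof (rule fundamental_theorem_of_calculus_interior[OF less_imp_le[OF pq] cont])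
    fix t assume t: "t \<in> {p<..<q}"
    then have "(E has_real_derivative deriv E t) (at t)"
      using E by (auto simp: DERIV_deriv_iff_real_differentiable)
    moreover have "(K has_real_derivative K' t) (at t)" using K t by auto
    ultimately have "((\<lambda>t. K t * E t) has_real_derivative K' t * E t + deriv E t * K t) (at t)"
      by (rule DERIV_mult[rotated])
    then show "((\<lambda>t. K t * E t) has_vector_derivative K' t * E t + deriv E t * K t) (at t)"
      by (simp add: has_real_derivative_iff_has_vector_derivative)
  qed
  then have 1: "((\<lambda>t. K' t * E t + deriv E t * K t) has_integral (K q * E q - K p * E p)) {p<..<q}"
    by (simp add: has_integral_Icc_iff_Ioo)
  have 2: "((\<lambda>t. K t * deriv E t) has_integral integral {p..q} (\<lambda>t. K t * deriv E t)) {p<..<q}"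
    using integrable_integral[OF int] by (simp add: has_integral_Icc_iff_Ioo)
  show ?thesis
    by (rule has_integral_le[OF 1 2]) (use sgn in \<open>auto simp: mult.commute\<close>)
qed

text \<open>Near q the difference quotient of E stays bounded while (q - t)^c tends to 0, so the
  zero of E cancels the singularity of the kernel.\<close>

lemma kern_mult_continuous:
  fixes E :: "real \<Rightarrow> real"
  assumes c: "0 < c" "c < 1" and E: "continuous_on {p..q} E" "E q = 0" "E differentiable (at q)"
  shows "continuous_on {p..q} (\<lambda>t. kern c (q - t) * E t)"
  unfolding continuous_on_eq_continuous_within
proof
  fix t assume t: "t \<in> {p..q}"
  show "continuous (at t within {p..q}) (\<lambda>t. kern c (q - t) * E t)"
  proof (cases "t = q")
    case False
    then have "q - t > 0" using t by simp
    then have "isCont (kern c) (q - t)" by (rule DERIV_isCont[OF kern_deriv])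
    then have "isCont (\<lambda>t. kern c (q - t)) t"
      by (rule isCont_o2[where f = "\<lambda>t. q - t" and g = "kern c", rotated]) simp
    then have "continuous (at t within {p..q}) (\<lambda>t. kern c (q - t))"
      by (rule continuous_at_imp_continuous_at_within)
    moreover have "continuous (at t within {p..q}) E"
      using E(1) t by (simp add: continuous_on_eq_continuous_within)
    ultimately show ?thesis by (rule continuous_mult)
  next
    case True
    obtain D where "(E has_real_derivative D) (at q)" using E(3) by (auto simp: real_differentiable_def)
    then have "((\<lambda>t. E t / (t - q)) \<longlongrightarrow> D) (at q within {p..q})"
      using E(2) by (auto simp: has_field_derivative_iff intro: tendsto_within_subset)
    moreover have "((\<lambda>t. - ((q - t) powr c / Gamma c)) \<longlongrightarrow> - (0 powr c / Gamma c)) (at q within {p..q})"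
    proof -
      have "((\<lambda>t. q - t) \<longlongrightarrow> q - q) (at q within {p..q})" by (intro tendsto_intros)
      then have pw: "((\<lambda>t. (q - t) powr c) \<longlongrightarrow> (q - q) powr c) (at q within {p..q})"
        using c by (intro tendsto_powr2) (auto simp: eventually_at_filter)
      have "Gamma c \<noteq> 0" using Gamma_real_pos[OF c(1)] by linarith
      from tendsto_minus[OF tendsto_divide[OF pw tendsto_const this]] show ?thesis by simp
    qed
    ultimately have "((\<lambda>t. - ((q - t) powr c / Gamma c) * (E t / (t - q))) \<longlongrightarrow> - (0 powr c / Gamma c) * D) (at q within {p..q})"
      by (rule tendsto_mult[rotated])
    moreover have "\<forall>\<^sub>F t in at q within {p..q}. - ((q - t) powr c / Gamma c) * (E t / (t - q)) = kern c (q - t) * E t"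
      unfolding eventually_at_filter
    proof (intro always_eventually allI impI)
      fix t assume t: "t \<noteq> q" "t \<in> {p..q}"
      then have p: "q - t > 0" by simp
      then have "(q - t) powr c = (q - t) * (q - t) powr (c - 1)" by (simp add: powr_mult_base)
      moreover have "E t / (t - q) = - (E t / (q - t))" by (metis minus_diff_eq minus_divide_right)
      ultimately show "- ((q - t) powr c / Gamma c) * (E t / (t - q)) = kern c (q - t) * E t"
        using p by (simp add: kern_def)
    qed
    ultimately have "((\<lambda>t. kern c (q - t) * E t) \<longlongrightarrow> 0) (at q within {p..q})"
      using c by (auto elim: Lim_transform_eventually)
    then show ?thesis using True E(2) by (simp add: continuous_within)
  qed
qed

text \<open>
  At an interior minimum of \<open>D\<close> the Riemann-Liouville derivative of order \<open>2 - c\<close> is nonnegative.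
  \<open>Z\<close> is the derivative of the fractional integral of order \<open>c\<close>; it suffices to compare \<open>x\<^sub>0\<close> with
  points \<open>x > x\<^sub>0\<close> at which \<open>D\<close> is maximal on \<open>[x\<^sub>0, x]\<close>, so no regularity beyond
  differentiability is needed.
\<close>

lemma riemann_liouville_minimum:
  fixes D :: "real \<Rightarrow> real"
  assumes c: "0 < c" "c < 1" and x0: "0 < x0" "x0 < x1"
    and cont: "continuous_on {0..x1} D" and diff: "\<And>t. 0 < t \<Longrightarrow> t < x1 \<Longrightarrow> D differentiable (at t)"
    and nonneg: "\<And>t. 0 \<le> t \<Longrightarrow> t \<le> x1 \<Longrightarrow> 0 \<le> D t" and D0: "D x0 = 0"
    and int: "\<And>x. 0 < x \<Longrightarrow> x < x1 \<Longrightarrow> frac_intble c (deriv D) x"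
    and Z: "((\<lambda>x. D 0 * kern c x + frac_int c (deriv D) x) has_real_derivative z) (at x0)"
  shows "z \<ge> 0"
proof (rule ccontr)
  assume "\<not> z \<ge> 0"
  define Zf where "Zf = (\<lambda>x. D 0 * kern c x + frac_int c (deriv D) x)"
  have fi: "(\<lambda>t. kern c (x - t) * deriv D t) integrable_on {0..x}"
    "frac_int c (deriv D) x = integral {0..x} (\<lambda>t. kern c (x - t) * deriv D t)" if "0 < x" "x < x1" for x
    using int[OF that] set_integrable_imp_integral_Icc[of 0 x "\<lambda>t. kern c (x - t) * deriv D t"]
    by (auto simp: frac_intble_def frac_int_def)
  have kd: "((\<lambda>t. kern c (x - t)) has_real_derivative (1 - c) * (x - t) powr (c - 2) / Gamma c) (at t)" if "t < x" for x t
  proof -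
    have "((\<lambda>t. kern c (x - t)) has_real_derivative (c - 1) * (x - t) powr (c - 2) / Gamma c * (-1)) (at t)"
      by (rule DERIV_chain2[where g = "\<lambda>t. x - t", OF kern_deriv]) (use that in \<open>auto intro!: derivative_eq_intros\<close>)
    then show ?thesis by (simp add: algebra_simps)
  qed
  have Gc: "Gamma c > 0" using c by auto
  have mono: "Zf x0 \<le> Zf x" if x: "x0 < x" "x < x1" and max: "\<And>t. x0 \<le> t \<Longrightarrow> t \<le> x \<Longrightarrow> D t \<le> D x" for x
  proof -
    have x': "0 < x" using x x0 by simp
    note fx = fi[OF x' x(2)] and fx0 = fi[OF x0]
    have i1: "(\<lambda>t. kern c (x - t) * deriv D t) integrable_on {0..x0}"
      and i2: "(\<lambda>t. kern c (x - t) * deriv D t) integrable_on {x0..x}"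
      using fx(1) x x0 by (auto elim: integrable_on_subinterval)
    have comb: "integral {0..x} (\<lambda>t. kern c (x - t) * deriv D t)
       = integral {0..x0} (\<lambda>t. kern c (x - t) * deriv D t) + integral {x0..x} (\<lambda>t. kern c (x - t) * deriv D t)"
      by (rule Henstock_Kurzweil_Integration.integral_combine[symmetric]) (use x x0 fx in auto)
    \<comment> \<open>On [x0, x] the shifted function E = D - D x vanishes at the singular end x and
      is nonpositive by the choice of x.\<close>
    have part2: "0 \<le> integral {x0..x} (\<lambda>t. kern c (x - t) * deriv D t)"
    proof -
      define E where "E = (\<lambda>t. D t - D x)"
      have dE: "E differentiable (at t)" "deriv E t = deriv D t" if "0 < t" "t < x1" for t
      proof -
        have "(D has_real_derivative deriv D t) (at t)"
          using diff[OF that] by (simp add: DERIV_deriv_iff_real_differentiable)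
        then have "(E has_real_derivative deriv D t) (at t)"
          unfolding E_def by (auto intro!: derivative_eq_intros)
        then show "E differentiable (at t)" "deriv E t = deriv D t"
          by (auto simp: real_differentiable_def DERIV_imp_deriv)
      qed
      have "kern c (x - x) * E x - kern c (x - x0) * E x0 \<le> integral {x0..x} (\<lambda>t. kern c (x - t) * deriv E t)"
      proof (rule by_parts_inequality[OF x(1) kd])
        show "continuous_on {x0..x} (\<lambda>t. kern c (x - t) * E t)"
          by (rule kern_mult_continuous[OF c])
            (use x x' dE x0 in \<open>auto simp: E_def intro!: continuous_intros continuous_on_subset[OF cont]\<close>)
        show "(1 - c) * (x - t) powr (c - 2) / Gamma c * E t \<le> 0" if "x0 < t" "t < x" for t
          using max[of t] that c Gc by (intro mult_nonneg_nonpos) (auto simp: E_def)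
        show "(\<lambda>t. kern c (x - t) * deriv E t) integrable_on {x0..x}"
          by (rule integrable_eq[OF i2]) (use dE x x0 in auto)
      qed (use dE x x0 in auto)
      moreover have "integral {x0..x} (\<lambda>t. kern c (x - t) * deriv E t) = integral {x0..x} (\<lambda>t. kern c (x - t) * deriv D t)"
        by (rule Henstock_Kurzweil_Integration.integral_cong) (use dE x x0 in auto)
      moreover have "0 \<le> kern c (x - x0) * D x" using nonneg[of x] x x0 c by (intro mult_nonneg_nonneg kern_nonneg) auto
      ultimately show ?thesis using D0 by (simp add: E_def)
    qed
    \<comment> \<open>On [0, x0] the difference of the two kernels decreases in t, D is nonnegative,
      and D x0 = 0 removes the singularity at x0.\<close>
    have part1: "- (kern c x - kern c x0) * D 0 \<le> integral {0..x0} (\<lambda>t. (kern c (x - t) - kern c (x0 - t)) * deriv D t)"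
    proof -
      have "(kern c (x - x0) - kern c (x0 - x0)) * D x0 - (kern c (x - 0) - kern c (x0 - 0)) * D 0
         \<le> integral {0..x0} (\<lambda>t. (kern c (x - t) - kern c (x0 - t)) * deriv D t)"
      proof (rule by_parts_inequality[OF x0(1)])
        show "((\<lambda>t. kern c (x - t) - kern c (x0 - t)) has_real_derivative
            (1 - c) * (x - t) powr (c - 2) / Gamma c - (1 - c) * (x0 - t) powr (c - 2) / Gamma c) (at t)" if "0 < t" "t < x0" for t
          using that x by (intro DERIV_diff kd) auto
        have "continuous_on {0..x0} (\<lambda>t. kern c (x - t) * D t)"
        proof (intro continuous_on_mult continuous_on_subset[OF cont])
          show "continuous_on {0..x0} (\<lambda>t. kern c (x - t))"
            by (rule DERIV_continuous_on[OF has_field_derivative_at_within[OF kd]]) (use x in auto)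
        qed (use x x0 in auto)
        moreover have "continuous_on {0..x0} (\<lambda>t. kern c (x0 - t) * D t)"
          by (rule kern_mult_continuous[OF c]) (use D0 diff x0 in \<open>auto intro: continuous_on_subset[OF cont]\<close>)
        ultimately have "continuous_on {0..x0} (\<lambda>t. kern c (x - t) * D t - kern c (x0 - t) * D t)"
          by (rule continuous_on_diff)
        then show "continuous_on {0..x0} (\<lambda>t. (kern c (x - t) - kern c (x0 - t)) * D t)"
          by (simp add: algebra_simps)
        show "((1 - c) * (x - t) powr (c - 2) / Gamma c - (1 - c) * (x0 - t) powr (c - 2) / Gamma c) * D t \<le> 0"
          if t: "0 < t" "t < x0" for t
        proof (rule mult_nonpos_nonneg)
          have "(x - t) powr (c - 2) \<le> (x0 - t) powr (c - 2)"
            by (rule powr_mono2') (use t x c in auto)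
          then have "(1 - c) * (x - t) powr (c - 2) / Gamma c \<le> (1 - c) * (x0 - t) powr (c - 2) / Gamma c"
            using c Gc by (intro divide_right_mono mult_left_mono) auto
          then show "(1 - c) * (x - t) powr (c - 2) / Gamma c - (1 - c) * (x0 - t) powr (c - 2) / Gamma c \<le> 0" by simp
        qed (use nonneg[of t] t x0 in auto)
        show "(\<lambda>t. (kern c (x - t) - kern c (x0 - t)) * deriv D t) integrable_on {0..x0}"
          using integrable_diff[OF i1 fx0(1)] by (simp add: left_diff_distrib)
      qed (use diff x0 in auto)
      then show ?thesis using D0 by (simp add: left_diff_distrib)
    qed
    have "integral {0..x0} (\<lambda>t. (kern c (x - t) - kern c (x0 - t)) * deriv D t)
       = integral {0..x0} (\<lambda>t. kern c (x - t) * deriv D t) - integral {0..x0} (\<lambda>t. kern c (x0 - t) * deriv D t)"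
      unfolding left_diff_distrib by (rule integral_diff[OF i1 fx0(1)])
    with part1 part2 comb show ?thesis
      unfolding Zf_def fx(2) fx0(2) by (simp add: algebra_simps)
  qed
  have "(Zf has_real_derivative z) (at x0)" using Z by (simp add: Zf_def)
  then obtain d where d: "d > 0" "\<And>h. 0 < h \<Longrightarrow> h < d \<Longrightarrow> Zf (x0 + h) < Zf x0"
    using DERIV_neg_dec_right[of Zf z x0] \<open>\<not> z \<ge> 0\<close> by auto
  obtain e where e: "e > 0" "e \<le> d" "e \<le> x1 - x0"
    by (rule that[of "min d (x1 - x0)"]) (use d(1) x0 in auto)
  define y where "y = x0 + e / 2"
  have y: "x0 < y" "y < x0 + d" "y < x1" using e by (auto simp: y_def field_simps)
  have "continuous_on {x0..y} D" using x0 y by (auto intro: continuous_on_subset[OF cont])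
  then obtain s where s: "s \<in> {x0..y}" "\<And>t. t \<in> {x0..y} \<Longrightarrow> D t \<le> D s"
    using continuous_attains_sup[of "{x0..y}" D] y by auto
  \<comment> \<open>If the maximum is attained at x0, then D = 0 on [x0, y], and y serves as
    well.\<close>
  define x where "x = (if s = x0 then y else s)"
  have x: "x0 < x" "x \<le> y" using s(1) y by (auto simp: x_def)
  have "D t \<le> D x" if "x0 \<le> t" "t \<le> x" for t
  proof (cases "s = x0")
    case True
    then have "D t \<le> 0" using s(2)[of t] that D0 y by (simp add: x_def)
    moreover have "0 \<le> D x" using nonneg[of x] x y x0 by simp
    ultimately show ?thesis by simp
  next
    case False
    then show ?thesis using s(1) s(2)[of t] that by (simp add: x_def)
  qed
  then have "Zf x0 \<le> Zf x" using x y by (intro mono) auto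
  moreover have "Zf (x0 + (x - x0)) < Zf x0" by (rule d(2)) (use x y in auto)
  ultimately show False by simp
qed

section \<open>Regularity up to the lateral boundary\<close>

text \<open>If f' had a positive derivative at its zero x, then f would increase strictly just to
  the right of x. The second derivative is used at x only.\<close>

lemma second_derivative_max:
  fixes f :: "real \<Rightarrow> real"
  assumes ab: "p < x" "x < q" and f: "\<And>t. p < t \<Longrightarrow> t < q \<Longrightarrow> (f has_real_derivative f' t) (at t)"
    and f': "(f' has_real_derivative f2) (at x)" and max: "\<And>t. p < t \<Longrightarrow> t < q \<Longrightarrow> f t \<le> f x"
  shows "f2 \<le> 0"
proof (rule ccontr)
  assume "\<not> f2 \<le> 0"
  define e where "e = min (x - p) (q - x)"
  have e: "e > 0" "e \<le> x - p" "e \<le> q - x" using ab by (auto simp: e_def)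
  have "f' x = 0"
    by (rule DERIV_local_max[OF f[OF ab] e(1)]) (use e max in \<open>auto simp: abs_less_iff\<close>)
  obtain d where d: "d > 0" "\<And>h. 0 < h \<Longrightarrow> h < d \<Longrightarrow> f' x < f' (x + h)"
    using DERIV_pos_inc_right[OF f'] \<open>\<not> f2 \<le> 0\<close> by auto
  obtain l where l: "l > 0" "l < d" "l < e" using d(1) e(1) by (meson field_lbound_gt_zero)
  have "\<exists>z>x. z < x + l \<and> f (x + l) - f x = (x + l - x) * f' z"
    by (rule MVT2) (use l e ab in \<open>auto intro!: f\<close>)
  then obtain z where z: "x < z" "z < x + l" "f (x + l) - f x = l * f' z" by auto
  have "f' z > 0" using d(2)[of "z - x"] z l \<open>f' x = 0\<close> by simp
  then have "f (x + l) > f x" using z(3) l by (simp add: algebra_simps mult_pos_pos)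
  moreover have "f (x + l) \<le> f x" by (rule max) (use l e in auto)
  ultimately show False by simp
qed

text \<open>h may be unbounded near 0, so the integral is split at a point p > 0 and the fundamental
  theorem is applied on [p, q].\<close>

lemma frac_int_1_deriv:
  assumes h: "continuous_on {0<..<1} h" and int: "\<And>x. 0 < x \<Longrightarrow> x < 1 \<Longrightarrow> frac_intble 1 h x"
    and x: "0 < x" "x < 1"
  shows "((\<lambda>x. frac_int 1 h x) has_real_derivative h x) (at x)"
proof -
  define p q where "p = x / 2" and "q = (x + 1) / 2"
  have pq: "0 < p" "p < x" "x < q" "q < 1" using x by (auto simp: p_def q_def)
  have "((\<lambda>x. integral {p..x} h) has_real_derivative h x) (at x within {p..q})"
    by (rule integral_has_real_derivative) (use pq in \<open>auto intro: continuous_on_subset[OF h]\<close>)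
  then have "((\<lambda>x. integral {p..x} h) has_real_derivative h x) (at x)"
  proof -
    have "at x within {p..q} = at x" by (rule at_within_interior) (use pq in \<open>simp add: interior_atLeastAtMost_real\<close>)
    then show ?thesis using \<open>(_ has_real_derivative _) (at x within {p..q})\<close> by (simp only:)
  qed
  then have "((\<lambda>x. integral {0..p} h + integral {p..x} h) has_real_derivative h x) (at x)"
    using DERIV_add[OF DERIV_const] by fastforce
  then show ?thesis
  proof (rule has_field_derivative_transform_within_open[where S = "{p<..<q}"])
    fix t assume t: "t \<in> {p<..<q}"
    have i: "h integrable_on {0..t}" "frac_int 1 h t = integral {0..t} h"
      using set_integrable_imp_integral_Icc[of 0 t h] int[of t] t pq by (auto simp: frac_int_1 frac_intble_1)
    show "integral {0..p} h + integral {p..t} h = frac_int 1 h t"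
      unfolding i(2) by (rule Henstock_Kurzweil_Integration.integral_combine) (use t pq i in auto)
  qed (use pq in auto)
qed

text \<open>
  The functional \<open>(r - q) F p - (r - p) F q + (q - p) F r\<close> annihilates affine functions; applied to
  \<open>frac_int 2 H\<close> it has the hat kernel below, which vanishes near 0 where nothing uniform is known about \<open>H\<close>.
\<close>

definition three_point :: "real \<Rightarrow> real \<Rightarrow> real \<Rightarrow> (real \<Rightarrow> real) \<Rightarrow> real" where
  "three_point p q r F = (r - q) * F p - (r - p) * F q + (q - p) * F r"

definition hat :: "real \<Rightarrow> real \<Rightarrow> real \<Rightarrow> real \<Rightarrow> real" where
  "hat p q r t = (if t \<le> q then (r - q) * (t - p) else (q - p) * (r - t))"

lemma hat_continuous: "continuous_on S (hat p q r)"
proof -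
  have "hat p q r = (\<lambda>t. if t \<le> q then (r - q) * (t - p) else (q - p) * (r - t))"
    by (auto simp: hat_def)
  moreover have "continuous_on UNIV (\<lambda>t. if t \<le> q then (r - q) * (t - p) else (q - p) * (r - t))"
    by (rule continuous_on_cases_le[where h = "\<lambda>t. t" and S = UNIV, simplified]) (auto intro!: continuous_intros simp: algebra_simps)
  ultimately show ?thesis using continuous_on_subset by (metis subset_UNIV)
qed

text \<open>\<open>kern 2\<close> is the positive part, so its three shifted copies combine to 0
  left of p and to the hat on [p, r]. This is the Peano kernel of the second difference.\<close>

lemma three_point_frac_int_2:
  assumes pqr: "0 < p" "p < q" "q < r" "r < 1" and H: "frac_intble 1 H r"
  shows "three_point p q r (frac_int 2 H) = integral {p..r} (\<lambda>t. hat p q r t * H t)"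
    and "(\<lambda>t. hat p q r t * H t) integrable_on {p..r}"
proof -
  have H2: "frac_intble 2 H x" if "0 < x" "x \<le> r" for x
  proof -
    have "frac_intble 1 H x"
      using H that unfolding frac_intble_1 by (auto elim: set_integrable_subset)
    then show ?thesis by (rule frac_intble_mono_order[rotated 2]) auto
  qed
  have ext: "indicator {0<..<x} t *\<^sub>R (kern 2 (x - t) * H t) = indicator {0<..<r} t *\<^sub>R (kern 2 (x - t) * H t)"
    if "x \<le> r" for x t
    using that by (auto simp: indicator_def)
  have I: "set_integrable lborel {0<..<r} (\<lambda>t. kern 2 (x - t) * H t)"
    and V: "frac_int 2 H x = (LBINT t:{0<..<r}. kern 2 (x - t) * H t)" if "0 < x" "x \<le> r" for x
    using H2[OF that] unfolding frac_intble_def frac_int_def set_integrable_def set_lebesgue_integral_def ext[OF that(2)]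
    by auto
  note c = set_integrable_mult_right
  have hat_eq: "(r - q) * (kern 2 (p - t) * H t) - (r - p) * (kern 2 (q - t) * H t) + (q - p) * (kern 2 (r - t) * H t)
     = (if p < t then hat p q r t * H t else 0)" if "t \<in> {0<..<r}" for t
  proof -
    have k: "kern 2 s = (if s > 0 then s else 0)" for s by (simp add: kern_2)
    show ?thesis using that pqr unfolding k hat_def by (auto simp: algebra_simps)
  qed
  let ?G = "\<lambda>t. (r - q) * (kern 2 (p - t) * H t) - (r - p) * (kern 2 (q - t) * H t) + (q - p) * (kern 2 (r - t) * H t)"
  have iG: "set_integrable lborel {0<..<r} ?G"
    using I[of p] I[of q] I[of r] pqr by (intro set_integral_add set_integral_diff c) auto
  have "three_point p q r (frac_int 2 H) = (LBINT t:{0<..<r}. ?G t)"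
    using I[of p] I[of q] I[of r] V[of p] V[of q] V[of r] pqr
    by (simp add: three_point_def set_integral_add set_integral_diff)
  also have "\<dots> = (LBINT t:{0<..<r}. (if p < t then hat p q r t * H t else 0))"
    by (rule set_lebesgue_integral_cong) (use hat_eq in auto)
  also have "\<dots> = (LBINT t:{p<..<r}. hat p q r t * H t)"
    unfolding set_lebesgue_integral_def using pqr
    by (intro Bochner_Integration.integral_cong) (auto simp: indicator_def)
  finally have 1: "three_point p q r (frac_int 2 H) = (LBINT t:{p<..<r}. hat p q r t * H t)" .
  have "set_integrable lborel {0<..<r} (\<lambda>t. (if p < t then hat p q r t * H t else 0))"
    by (rule set_integrable_cong[THEN iffD1, OF refl refl _ iG]) (use hat_eq in auto)
  then have "set_integrable lborel {p<..<r} (\<lambda>t. (if p < t then hat p q r t * H t else 0))"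
    by (rule set_integrable_subset) (use pqr in auto)
  then have 2: "set_integrable lborel {p<..<r} (\<lambda>t. hat p q r t * H t)"
    by (rule set_integrable_cong[THEN iffD1, rotated -1]) auto
  show "three_point p q r (frac_int 2 H) = integral {p..r} (\<lambda>t. hat p q r t * H t)"
    "(\<lambda>t. hat p q r t * H t) integrable_on {p..r}"
    using set_integrable_imp_integral_Icc[OF 2] 1 by auto
qed

text \<open>\<open>kern (3 - a)\<close> is the double integral of the positive function
  \<open>kern (1 - a)\<close>, so its second differences are positive. The coefficient of
  \<open>kern (3 - a)\<close> in a representation can therefore be solved for.\<close>

lemma three_point_kern_pos:
  assumes pqr: "0 < p" "p < q" "q < r" "r < 1" and a: "0 < a" "a < 1"
  shows "three_point p q r (kern (3 - a)) > 0"
proof -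
  have k: "frac_intble 1 (kern (1 - a)) r" using a by (intro frac_intble_kern) auto
  have "frac_int 2 (kern (1 - a)) = kern (3 - a)"
    using frac_int_kern[of 2 "1 - a"] a by auto
  then have eq: "three_point p q r (kern (3 - a)) = integral {p..r} (\<lambda>t. hat p q r t * kern (1 - a) t)"
    using three_point_frac_int_2(1)[OF pqr k] by simp
  have cont: "continuous_on {p..r} (\<lambda>t. hat p q r t * kern (1 - a) t)"
  proof (intro continuous_on_mult hat_continuous)
    show "continuous_on {p..r} (kern (1 - a))"
      by (rule DERIV_continuous_on[OF has_field_derivative_at_within[OF kern_deriv]]) (use pqr in auto)
  qed
  have pos: "hat p q r t * kern (1 - a) t \<ge> 0" if "t \<in> {p..r}" for t
    using that pqr a by (intro mult_nonneg_nonneg kern_nonneg) (auto simp: hat_def)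
  have "integral {p..r} (\<lambda>t. hat p q r t * kern (1 - a) t) \<noteq> 0"
  proof
    assume "integral {p..r} (\<lambda>t. hat p q r t * kern (1 - a) t) = 0"
    then have "\<forall>t\<in>{p..r}. hat p q r t * kern (1 - a) t = 0"
      by (subst (asm) integral_eq_0_iff) (use cont pos pqr in auto)
    then have "hat p q r q * kern (1 - a) q = 0" using pqr by auto
    moreover have "kern (1 - a) q > 0" using pqr a by (intro kern_pos) auto
    ultimately show False using pqr by (auto simp: hat_def)
  qed
  moreover have "integral {p..r} (\<lambda>t. hat p q r t * kern (1 - a) t) \<ge> 0"
    by (intro integral_nonneg integrable_continuous_real cont) (use pos in auto)
  ultimately show ?thesis using eq by simp
qed

section \<open>Dependence on the parameter y\<close>

lemma
  assumes "continuous_on (S \<times> T) (\<lambda>z. f (fst z) (snd z))"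
  shows continuous_on_slice_fst: "y \<in> T \<Longrightarrow> continuous_on S (\<lambda>x. f x y)"
    and continuous_on_slice_snd: "x \<in> S \<Longrightarrow> continuous_on T (\<lambda>y. f x y)"
    and continuous_on_swap_args: "continuous_on (T \<times> S) (\<lambda>z. f (snd z) (fst z))"
proof -
  have "continuous_on S (\<lambda>x. (x, y))" "continuous_on T (\<lambda>y. (x, y))" for x y
    by (intro continuous_intros)+
  from continuous_on_compose2[OF assms this(1)] continuous_on_compose2[OF assms this(2)]
  show "y \<in> T \<Longrightarrow> continuous_on S (\<lambda>x. f x y)" "x \<in> S \<Longrightarrow> continuous_on T (\<lambda>y. f x y)"
    by auto
  have "continuous_on (T \<times> S) (\<lambda>z. (snd z, fst z))" by (intro continuous_intros)
  moreover have "(\<lambda>z. (snd z, fst z)) ` (T \<times> S) \<subseteq> S \<times> T" by auto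
  ultimately show "continuous_on (T \<times> S) (\<lambda>z. f (snd z) (fst z))"
    using continuous_on_compose2[OF assms] by fastforce
qed

text \<open>Uniform continuity on the compact rectangle bounds the change of the integrand uniformly
  in t, and the kernel has total mass \<open>kern (b + 1) x\<close>.\<close>

lemma frac_int_continuous_param:
  fixes w :: "real \<Rightarrow> real \<Rightarrow> real" and p q :: real
  assumes b: "0 < b" and w: "continuous_on ({0..1} \<times> {p..q}) (\<lambda>z. w (fst z) (snd z))" and x: "0 < x" "x \<le> 1"
  shows "continuous_on {p..q} (\<lambda>y. frac_int b (\<lambda>t. w t y) x)"
  unfolding continuous_on_iff
proof (intro ballI allI impI)
  fix y e :: real assume y: "y \<in> {p..q}" and e: "e > 0"
  have wc: "continuous_on {0..1} (\<lambda>t. w t y)" if "y \<in> {p..q}" for y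
    by (rule continuous_on_slice_fst[OF w that])
  have fi: "frac_intble b (\<lambda>t. w t y) x" if yq: "y \<in> {p..q}" for y
  proof -
    obtain B where B: "\<And>t. t \<in> {0..1} \<Longrightarrow> \<bar>w t y\<bar> \<le> B"
      using compact_imp_bounded[OF compact_continuous_image[OF wc[OF yq] compact_Icc]] unfolding bounded_iff by auto force
    show ?thesis
    proof (rule frac_intble_bound[OF b frac_intble_const[OF b]])
      have "set_borel_measurable borel {0<..<x} (\<lambda>t. w t y)"
        unfolding set_borel_measurable_def
        by (rule borel_measurable_continuous_on_indicator) (use x in \<open>auto intro: continuous_on_subset[OF wc[OF yq]]\<close>)
      then show "set_borel_measurable borel {0<..<x} (\<lambda>t. w t y)" .
      show "\<bar>w t y\<bar> \<le> B" if "0 < t" "t < x" for t using B[of t] that x by simp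
    qed
  qed
  define k where "k = kern (b + 1) x"
  have k: "k > 0" unfolding k_def using b x by (intro kern_pos) auto
  have "uniformly_continuous_on ({0..1} \<times> {p..q}) (\<lambda>z. w (fst z) (snd z))"
    by (rule compact_uniformly_continuous[OF w]) (auto intro: compact_Times)
  then obtain d where d: "d > 0" "\<And>z z'. z \<in> {0..1} \<times> {p..q} \<Longrightarrow> z' \<in> {0..1} \<times> {p..q} \<Longrightarrow> dist z' z < d
      \<Longrightarrow> dist (w (fst z') (snd z')) (w (fst z) (snd z)) < e / (2 * k)"
    unfolding uniformly_continuous_on_def using e k by (metis divide_pos_pos mult_pos_pos zero_less_numeral)
  show "\<exists>d>0. \<forall>y'\<in>{p..q}. dist y' y < d \<longrightarrow> dist (frac_int b (\<lambda>t. w t y') x) (frac_int b (\<lambda>t. w t y) x) < e"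
  proof (intro exI[of _ d] conjI ballI impI d(1))
    fix y' assume y': "y' \<in> {p..q}" "dist y' y < d"
    have "\<bar>frac_int b (\<lambda>t. w t y') x - frac_int b (\<lambda>t. w t y) x\<bar> = \<bar>frac_int b (\<lambda>t. w t y' - w t y) x\<bar>"
      using frac_int_diff[OF fi[OF y'(1)] fi[OF y]] by simp
    also have "\<dots> \<le> frac_int b (\<lambda>t. e / (2 * k)) x"
    proof (rule frac_int_abs_le[OF b frac_intble_const[OF b]])
      fix t assume "0 < t" "t < x"
      then have "dist (w (fst (t, y')) (snd (t, y'))) (w (fst (t, y)) (snd (t, y))) < e / (2 * k)"
        using x y y' by (intro d(2)) (auto simp: dist_Pair_Pair)
      then show "\<bar>w t y' - w t y\<bar> \<le> e / (2 * k)" by (simp add: dist_real_def)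
    qed
    also have "\<dots> = e / 2" using b k by (simp add: frac_int_const flip: k_def)
    also have "\<dots> < e" using e by simp
    finally show "dist (frac_int b (\<lambda>t. w t y') x) (frac_int b (\<lambda>t. w t y) x) < e" by (simp add: dist_real_def)
  qed
qed

text \<open>One parity component in y of the difference of two solutions, with diffusion d in place
  of the reflected term. Continuity up to the boundary is available for w alone; \<open>wyy\<close>
  is controlled only in the open rectangle.\<close>

locale zero_problem =
  fixes a d c :: real and w wy wyy :: "real \<Rightarrow> real \<Rightarrow> real"
  assumes a: "0 < a" "a \<le> 1" and d: "d > 0"
    and cont: "continuous_on ({0..1} \<times> {-pi..pi}) (\<lambda>p. w (fst p) (snd p))"
    and zero_x: "\<And>y. -pi \<le> y \<Longrightarrow> y \<le> pi \<Longrightarrow> w 0 y = 0" "\<And>y. -pi \<le> y \<Longrightarrow> y \<le> pi \<Longrightarrow> w 1 y = 0"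
    and zero_y: "\<And>x. 0 \<le> x \<Longrightarrow> x \<le> 1 \<Longrightarrow> w x (-pi) = 0" "\<And>x. 0 \<le> x \<Longrightarrow> x \<le> 1 \<Longrightarrow> w x pi = 0"
    and ex1: "\<And>x y. 0 < x \<Longrightarrow> x < 1 \<Longrightarrow> -pi < y \<Longrightarrow> y < pi \<Longrightarrow> caputo_exists a (\<lambda>s. w s y) x"
    and ex2: "\<And>x y. 0 < x \<Longrightarrow> x < 1 \<Longrightarrow> -pi < y \<Longrightarrow> y < pi \<Longrightarrow> caputo_exists a (caputo a (\<lambda>s. w s y)) x"
    and wy: "\<And>x y. 0 < x \<Longrightarrow> x < 1 \<Longrightarrow> -pi < y \<Longrightarrow> y < pi \<Longrightarrow> (w x has_real_derivative wy x y) (at y)"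
    and wyy: "\<And>x y. 0 < x \<Longrightarrow> x < 1 \<Longrightarrow> -pi < y \<Longrightarrow> y < pi \<Longrightarrow> (wy x has_real_derivative wyy x y) (at y)"
    and wyy_cont: "continuous_on ({0<..<1} \<times> {-pi<..<pi}) (\<lambda>p. wyy (fst p) (snd p))"
    and eq: "\<And>x y. 0 < x \<Longrightarrow> x < 1 \<Longrightarrow> -pi < y \<Longrightarrow> y < pi \<Longrightarrow>
      caputo a (caputo a (\<lambda>s. w s y)) x = c\<^sup>2 * w x y - d * wyy x y"
begin

definition h :: "real \<Rightarrow> real \<Rightarrow> real" where "h x y = c\<^sup>2 * w x y - d * wyy x y"

lemma w_cont_sub: "S \<subseteq> {0..1} \<times> {-pi..pi} \<Longrightarrow> continuous_on S (\<lambda>p. w (fst p) (snd p))"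
  by (rule continuous_on_subset[OF cont])

lemma w_cont_x: "-pi \<le> y \<Longrightarrow> y \<le> pi \<Longrightarrow> continuous_on {0..1} (\<lambda>x. w x y)"
  by (rule continuous_on_slice_fst[OF cont]) simp

lemma w_cont_y: "0 \<le> x \<Longrightarrow> x \<le> 1 \<Longrightarrow> continuous_on {-pi..pi} (w x)"
  by (rule continuous_on_slice_snd[OF cont]) simp

lemma h_cont: "continuous_on ({0<..<1} \<times> {-pi<..<pi}) (\<lambda>p. h (fst p) (snd p))"
  unfolding h_def by (intro continuous_intros wyy_cont w_cont_sub) auto

lemma h_cont_x: "-pi < y \<Longrightarrow> y < pi \<Longrightarrow> continuous_on {0<..<1} (\<lambda>x. h x y)"
  by (rule continuous_on_slice_fst[OF h_cont]) simp

lemma w_bounded: obtains B where "B > 0" "\<And>x y. 0 \<le> x \<Longrightarrow> x \<le> 1 \<Longrightarrow> -pi \<le> y \<Longrightarrow> y \<le> pi \<Longrightarrow> \<bar>w x y\<bar> \<le> B"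
proof -
  have "compact ({0..1::real} \<times> {-pi..pi})" by (intro compact_Times compact_Icc)
  from compact_imp_bounded[OF compact_continuous_image[OF cont this]]
  obtain B where B: "\<And>p. p \<in> {0..1} \<times> {-pi..pi} \<Longrightarrow> \<bar>w (fst p) (snd p)\<bar> \<le> B"
    unfolding bounded_iff by auto force
  show ?thesis
  proof (rule that[of "\<bar>B\<bar> + 1"])
    fix x y :: real assume "0 \<le> x" "x \<le> 1" "-pi \<le> y" "y \<le> pi"
    then show "\<bar>w x y\<bar> \<le> \<bar>B\<bar> + 1" using B[of "(x, y)"] by auto
  qed simp
qed

end

locale zero_problem_frac = zero_problem +
  assumes a_less: "a < 1"
begin

text \<open>The representation along each line of constant y, packaged as an existence statement so
  that its constant can be chosen as a function of y.\<close>

lemma rep_ex: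
  assumes y: "-pi < y" "y < pi"
  shows "\<exists>A N.
    (\<forall>x. 0 < x \<longrightarrow> x < 1 \<longrightarrow> frac_intble (2 - 2 * a) (deriv (\<lambda>s. w s y)) x \<and>
      frac_int (2 - 2 * a) (deriv (\<lambda>s. w s y)) x = A * kern (2 - a) x + frac_int 1 (\<lambda>t. h t y) x \<and>
      frac_intble 1 (\<lambda>t. h t y) x \<and>
      frac_int (2 - 2 * a) (\<lambda>s. w s y) x = A * kern (3 - a) x + frac_int 2 (\<lambda>t. h t y) x) \<and>
    (\<forall>x. 0 < x \<longrightarrow> x \<le> 1/2 \<longrightarrow> \<bar>w x y\<bar> \<le> N * x powr a)"
proof -
  have cg: "caputo a (caputo a (\<lambda>s. w s y)) t = h t y" if "0 < t" "t < 1" for t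
    using eq[OF that y] by (simp add: h_def)
  have fi: "frac_int b (caputo a (caputo a (\<lambda>s. w s y))) x = frac_int b (\<lambda>t. h t y) x"
    "frac_intble b (caputo a (caputo a (\<lambda>s. w s y))) x = frac_intble b (\<lambda>t. h t y) x" if "x < 1" for b x
    using that cg by (auto intro!: frac_int_cong frac_intble_cong)
  have c0: "continuous_on {0..<1} (\<lambda>s. w s y)"
    by (rule continuous_on_subset[OF w_cont_x]) (use y in auto)
  have w0: "w 0 y = 0" using zero_x y by simp
  show ?thesis
    by (rule caputo_caputo_representation[OF a(1) a_less c0 w0 ex1 ex2])
      (use y fi in \<open>auto intro!: exI\<close>)
qed

text \<open>The initial value of the first Caputo derivative along the line of constant y, that is,
  the coefficient of x^a / Gamma(a + 1) in w. It is obtained by choice, so no regularity in y is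
  known at this stage.\<close>

definition A :: "real \<Rightarrow> real" where
  "A y = (SOME A. \<exists>N.
    (\<forall>x. 0 < x \<longrightarrow> x < 1 \<longrightarrow> frac_intble (2 - 2 * a) (deriv (\<lambda>s. w s y)) x \<and>
      frac_int (2 - 2 * a) (deriv (\<lambda>s. w s y)) x = A * kern (2 - a) x + frac_int 1 (\<lambda>t. h t y) x \<and>
      frac_intble 1 (\<lambda>t. h t y) x \<and>
      frac_int (2 - 2 * a) (\<lambda>s. w s y) x = A * kern (3 - a) x + frac_int 2 (\<lambda>t. h t y) x) \<and>
    (\<forall>x. 0 < x \<longrightarrow> x \<le> 1/2 \<longrightarrow> \<bar>w x y\<bar> \<le> N * x powr a))"

lemma
  assumes y: "-pi < y" "y < pi"
  shows rep0: "\<And>x. 0 < x \<Longrightarrow> x < 1 \<Longrightarrow> frac_intble (2 - 2 * a) (deriv (\<lambda>s. w s y)) x"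
    and rep1: "\<And>x. 0 < x \<Longrightarrow> x < 1 \<Longrightarrow> frac_int (2 - 2 * a) (deriv (\<lambda>s. w s y)) x = A y * kern (2 - a) x + frac_int 1 (\<lambda>t. h t y) x"
    and rep2: "\<And>x. 0 < x \<Longrightarrow> x < 1 \<Longrightarrow> frac_intble 1 (\<lambda>t. h t y) x"
    and rep3: "\<And>x. 0 < x \<Longrightarrow> x < 1 \<Longrightarrow> frac_int (2 - 2 * a) (\<lambda>s. w s y) x = A y * kern (3 - a) x + frac_int 2 (\<lambda>t. h t y) x"
    and rep4: "\<exists>N. \<forall>x. 0 < x \<longrightarrow> x \<le> 1/2 \<longrightarrow> \<bar>w x y\<bar> \<le> N * x powr a"
  using someI_ex[OF rep_ex[OF y], folded A_def] by blast+

definition v :: "real \<Rightarrow> real \<Rightarrow> real" where "v x y = frac_int (2 - 2 * a) (\<lambda>s. w s y) x"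

lemma v_cont: "0 < x \<Longrightarrow> x \<le> 1 \<Longrightarrow> continuous_on {-pi..pi} (v x)"
  unfolding v_def by (rule frac_int_continuous_param[OF _ cont]) (use a_less in auto)

text \<open>The second difference confines h to [p, r], where it is jointly continuous in both
  variables.\<close>

lemma three_point_v:
  assumes pqr: "0 < p" "p < q" "q < r" "r < 1" and y: "-pi < y" "y < pi"
  shows "three_point p q r (\<lambda>x. v x y) = A y * three_point p q r (kern (3 - a)) + integral {p..r} (\<lambda>t. hat p q r t * h t y)"
proof -
  have "three_point p q r (\<lambda>x. v x y) = A y * three_point p q r (kern (3 - a)) + three_point p q r (frac_int 2 (\<lambda>t. h t y))"
    using pqr rep3[OF y] by (simp add: three_point_def v_def algebra_simps)
  then show ?thesis using three_point_frac_int_2(1)[OF pqr rep2[OF y]] pqr by simp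
qed

lemma hat_h_cont: "0 < p \<Longrightarrow> r < 1 \<Longrightarrow> continuous_on ({-pi<..<pi} \<times> {p..r}) (\<lambda>(y, t). hat p q r t * h t y)"
proof -
  assume pr: "0 < p" "r < 1"
  have "continuous_on ({-pi<..<pi} \<times> {p..r}) (\<lambda>z. h (snd z) (fst z))"
    by (rule continuous_on_subset[OF continuous_on_swap_args[OF h_cont]]) (use pr in auto)
  then show ?thesis unfolding case_prod_unfold
    by (intro continuous_on_mult continuous_on_compose2[OF hat_continuous]) (auto intro!: continuous_intros)
qed

text \<open>
  \<open>A\<close> is a priori only a pointwise limit of continuous functions. It is nevertheless continuous, being
  expressed through \<open>v\<close> and the values of \<open>h\<close> away from \<open>x = 0\<close>.
\<close>

lemma A_cont: "continuous_on {-pi<..<pi} A"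
proof -
  define p q r :: real where "p = 1/4" and "q = 1/2" and "r = 3/4"
  have pqr: "0 < p" "p < q" "q < r" "r < 1" by (auto simp: p_def q_def r_def)
  define k where "k = three_point p q r (kern (3 - a))"
  have k: "k > 0" unfolding k_def by (rule three_point_kern_pos[OF pqr a(1) a_less])
  have "continuous_on {-pi<..<pi} (\<lambda>y. integral (cbox p r) (\<lambda>t. hat p q r t * h t y))"
    by (rule integral_continuous_on_param) (use hat_h_cont[of p r q] pqr in simp)
  moreover have "continuous_on {-pi<..<pi} (\<lambda>y. three_point p q r (\<lambda>x. v x y))"
    unfolding three_point_def using pqr
    by (intro continuous_intros continuous_on_subset[OF v_cont]) auto
  ultimately have "continuous_on {-pi<..<pi} (\<lambda>y. (three_point p q r (\<lambda>x. v x y) - integral {p..r} (\<lambda>t. hat p q r t * h t y)) / k)"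
    using k by (intro continuous_intros) auto
  then show ?thesis
    by (rule continuous_on_eq) (use three_point_v[OF pqr] k in \<open>auto simp flip: k_def\<close>)
qed

text \<open>
  For \<open>a > 1/2\<close> the function \<open>x powr (2 * a - 1)\<close> is annihilated by the Riemann-Liouville derivative of
  order \<open>2 * a\<close>; it makes \<open>2 * M * x powr (2 * a - 1) - M * x powr a\<close> a barrier once \<open>A\<close> is bounded.
\<close>

lemma barrier:
  assumes a2: "1/2 < a" and b: "0 < b" "b < pi" and s: "s = 1 \<or> s = -1"
  obtains M where "M > 0" "\<And>x y. 0 < x \<Longrightarrow> x \<le> 1/2 \<Longrightarrow> -b \<le> y \<Longrightarrow> y \<le> b \<Longrightarrow> s * w x y \<le> M * x powr (2 * a - 1)"
proof -
  obtain B where B: "B > 0" "\<And>x y. 0 \<le> x \<Longrightarrow> x \<le> 1 \<Longrightarrow> -pi \<le> y \<Longrightarrow> y \<le> pi \<Longrightarrow> \<bar>w x y\<bar> \<le> B"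
    by (rule w_bounded) blast
  have "continuous_on {-b..b} A" by (rule continuous_on_subset[OF A_cont]) (use b in auto)
  from compact_imp_bounded[OF compact_continuous_image[OF this compact_Icc]]
  obtain Ab where Ab: "\<And>y. y \<in> {-b..b} \<Longrightarrow> \<bar>A y\<bar> \<le> Ab" unfolding bounded_iff by auto force
  obtain N1 where N1: "\<And>x. 0 < x \<Longrightarrow> x \<le> 1/2 \<Longrightarrow> \<bar>w x b\<bar> \<le> N1 * x powr a"
    using rep4[of b] b by auto
  obtain N2 where N2: "\<And>x. 0 < x \<Longrightarrow> x \<le> 1/2 \<Longrightarrow> \<bar>w x (-b)\<bar> \<le> N2 * x powr a"
    using rep4[of "-b"] b by auto
  have Ga: "Gamma (a + 1) > 0" using a by auto
  \<comment> \<open>Each entry serves one purpose: 1 for positivity, the second for the edge x =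
    1/2, N1 and N2 for the edges y = b and y = -b, and the last makes s A + M Gamma(a + 1)
    nonnegative.\<close>
  define M where "M = Max {1, B / (1/2) powr (2 * a - 1), N1, N2, Ab / Gamma (a + 1)}"
  have M: "1 \<le> M" "B / (1/2) powr (2 * a - 1) \<le> M" "N1 \<le> M" "N2 \<le> M" "Ab / Gamma (a + 1) \<le> M"
    unfolding M_def by (rule Max_ge; simp)+
  have pw: "x powr a \<le> x powr (2 * a - 1)" if "0 < x" "x \<le> 1" for x :: real
    using that a by (intro powr_mono') auto
  have sw: "s * w x y \<le> \<bar>w x y\<bar>" for x y using s by auto
  define f where "f = (\<lambda>x y. s * w x y + M * x powr a - 2 * M * x powr (2 * a - 1))"
  define R where "R = {0..1/2::real} \<times> {-b..b}"
  have "continuous_on R (\<lambda>z. f (fst z) (snd z))"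
  proof -
    have pc: "continuous_on R (\<lambda>z. fst z powr k)" if "k > 0" for k
      by (rule continuous_on_powr') (use that in \<open>auto simp: R_def intro!: continuous_intros\<close>)
    have wc: "continuous_on R (\<lambda>z. w (fst z) (snd z))"
      by (rule w_cont_sub) (use b in \<open>auto simp: R_def\<close>)
    show ?thesis unfolding f_def
      by (rule continuous_on_diff[OF continuous_on_add[OF continuous_on_mult_left[OF wc] continuous_on_mult_left[OF pc]]
        continuous_on_mult_left[OF pc]]) (use a a2 in auto)
  qed
  moreover have "compact R" "R \<noteq> {}" unfolding R_def using b by (auto intro!: compact_Times)
  ultimately obtain z0 where z0: "z0 \<in> R" "\<And>z. z \<in> R \<Longrightarrow> f (fst z) (snd z) \<le> f (fst z0) (snd z0)"
    using continuous_attains_sup by meson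
  define x0 y0 m where "x0 = fst z0" and "y0 = snd z0" and "m = f x0 y0"
  have xy: "0 \<le> x0" "x0 \<le> 1/2" "-b \<le> y0" "y0 \<le> b" using z0(1) by (auto simp: R_def x0_def y0_def)
  have max: "f x y \<le> m" if "0 \<le> x" "x \<le> 1/2" "-b \<le> y" "y \<le> b" for x y
    using z0(2)[of "(x, y)"] that by (auto simp: R_def m_def x0_def y0_def)
  have "m \<le> 0"
  proof (rule ccontr)
    assume "\<not> m \<le> 0"
    then have m: "m > 0" by simp
    have x0_pos: "0 < x0"
    proof (rule ccontr)
      assume "\<not> 0 < x0"
      then have "x0 = 0" using xy by simp
      then have "m = 0" using zero_x(1)[of y0] xy b by (simp add: m_def f_def)
      then show False using m by simp
    qed
    have pw0: "x0 powr a \<le> x0 powr (2 * a - 1)" using pw x0_pos xy by simp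
    have p1: "x0 powr (2 * a - 1) > 0" using x0_pos by simp
    have side: "m \<le> 0" if "\<bar>w x0 y0\<bar> \<le> N * x0 powr a" "N \<le> M" for N
    proof -
      have "s * w x0 y0 \<le> M * x0 powr a"
        using sw[of x0 y0] that mult_right_mono[OF that(2), of "x0 powr a"] by simp
      moreover have "M * x0 powr a \<le> M * x0 powr (2 * a - 1)" using pw0 M(1) by (intro mult_left_mono) auto
      ultimately show ?thesis unfolding m_def f_def by simp
    qed
    have y0: "-b < y0" "y0 < b"
    proof -
      have "y0 \<noteq> b"
      proof
        assume "y0 = b"
        then have "\<bar>w x0 y0\<bar> \<le> N1 * x0 powr a" using N1[OF x0_pos xy(2)] by simp
        from side[OF this M(3)] m show False by simp
      qed
      moreover have "y0 \<noteq> -b"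
      proof
        assume "y0 = -b"
        then have "\<bar>w x0 y0\<bar> \<le> N2 * x0 powr a" using N2[OF x0_pos xy(2)] by simp
        from side[OF this M(4)] m show False by simp
      qed
      ultimately show "-b < y0" "y0 < b" using xy by simp_all
    qed
    have x0_half: "x0 < 1/2"
    proof (rule ccontr)
      assume "\<not> x0 < 1/2"
      then have e: "x0 = 1/2" using xy by simp
      have "B \<le> M * x0 powr (2 * a - 1)" using M(2) p1 unfolding e by (simp add: field_simps)
      moreover have "s * w x0 y0 \<le> B" using sw[of x0 y0] B(2)[of x0 y0] xy b by simp
      moreover have "M * x0 powr a \<le> M * x0 powr (2 * a - 1)" using pw0 M(1) by (intro mult_left_mono) auto
      ultimately have "m \<le> 0" unfolding m_def f_def by simp
      then show False using m by simp
    qed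
    have x01: "x0 < 1" using x0_half by simp
    have ypi: "-pi < y0" "y0 < pi" using y0 b by auto
    have swp: "s * w x0 y0 > 0"
    proof -
      have "M * x0 powr a \<le> M * x0 powr (2 * a - 1)" "0 < M * x0 powr (2 * a - 1)"
        using pw0 M(1) p1 by (auto intro!: mult_left_mono mult_pos_pos)
      then show ?thesis using m unfolding m_def f_def by linarith
    qed
    have syy: "s * wyy x0 y0 \<le> 0"
    proof (rule second_derivative_max[OF y0, where f = "\<lambda>y. s * w x0 y" and f' = "\<lambda>y. s * wy x0 y"])
      show "((\<lambda>y. s * w x0 y) has_real_derivative s * wy x0 y) (at y)" if "-b < y" "y < b" for y
        using wy[OF x0_pos x01, of y] that b by (intro DERIV_cmult) auto
      show "((\<lambda>y. s * wy x0 y) has_real_derivative s * wyy x0 y0) (at y0)"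
        by (rule DERIV_cmult[OF wyy[OF x0_pos x01 ypi]])
      show "s * w x0 y \<le> s * w x0 y0" if "-b < y" "y < b" for y
        using max[OF xy(1,2), of y] that unfolding m_def f_def by simp
    qed
    have sh: "s * h x0 y0 \<ge> 0"
    proof -
      have "s * h x0 y0 = c\<^sup>2 * (s * w x0 y0) - d * (s * wyy x0 y0)" by (simp add: h_def algebra_simps)
      moreover have "c\<^sup>2 * (s * w x0 y0) \<ge> 0" using swp by simp
      moreover have "d * (s * wyy x0 y0) \<le> 0" using d syy by (simp add: mult_nonneg_nonpos)
      ultimately show ?thesis by linarith
    qed
    define u where "u = (\<lambda>t. w t y0)"
    \<comment> \<open>D is nonnegative on [0, 1/2] and vanishes at x0, so the minimum principle
      forces z >= 0; the equation will make z negative.\<close>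
    define D where "D = (\<lambda>t. m - f t y0)"
    have du: "(u has_real_derivative deriv u t) (at t)" if "0 < t" "t < 1" for t
    proof -
      have "0 < (t + 1) / 2" "(t + 1) / 2 < 1" using that by auto
      from ex1[OF this ypi] have "u differentiable (at t)"
        using that a_less by (auto simp: caputo_exists_frac_int u_def)
      then show ?thesis by (simp add: DERIV_deriv_iff_real_differentiable)
    qed
    have Gs: "Gamma (a + 1) = a * Gamma a" "Gamma (2 * a) = (2 * a - 1) * Gamma (2 * a - 1)" "Gamma a > 0" "Gamma (2 * a - 1) > 0"
      using Gamma_plus1[of a] Gamma_plus1[of "2 * a - 1"] a a2 Gamma_real_pos[of a] Gamma_real_pos[of "2 * a - 1"]
      by (auto simp: nonpos_Ints_def)
    have dD: "(D has_real_derivative ((- s) * deriv u t + (- (M * Gamma (a + 1))) * kern a t + (2 * M * Gamma (2 * a)) * kern (2 * a - 1) t)) (at t)"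
      if t: "0 < t" "t < 1" for t
    proof -
      have "(D has_real_derivative (- (s * deriv u t + M * (a * t powr (a - 1)) - 2 * M * ((2 * a - 1) * t powr (2 * a - 1 - 1))))) (at t)"
        unfolding D_def f_def using du[OF t, unfolded u_def] t
        by (auto intro!: derivative_eq_intros simp: u_def)
      moreover have "- (s * deriv u t + M * (a * t powr (a - 1)) - 2 * M * ((2 * a - 1) * t powr (2 * a - 1 - 1)))
         = (- s) * deriv u t + (- (M * Gamma (a + 1))) * kern a t + (2 * M * Gamma (2 * a)) * kern (2 * a - 1) t"
        using t Gs(3,4) unfolding Gs(1,2) kern_def by simp
      ultimately show ?thesis by (simp only:)
    qed
    have dD': "deriv D t = (- s) * deriv u t + (- (M * Gamma (a + 1))) * kern a t + (2 * M * Gamma (2 * a)) * kern (2 * a - 1) t"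
      if "0 < t" "t < 1" for t
      by (rule DERIV_imp_deriv[OF dD[OF that]])
    have p: "0 < 2 - 2 * a" "2 - 2 * a < 1" "0 < 2 * a - 1" using a_less a2 by auto
    have i1: "frac_intble (2 - 2 * a) (\<lambda>t. (- s) * deriv u t) x" if "0 < x" "x < 1" for x
      unfolding u_def by (rule frac_intble_cmult[OF rep0[OF ypi that]])
    note i2 = frac_intble_cmult[OF frac_intble_kern[OF p(1) a(1)], of "- (M * Gamma (a + 1))"]
    note i3 = frac_intble_cmult[OF frac_intble_kern[OF p(1) p(3)], of "2 * M * Gamma (2 * a)"]
    have fiD: "frac_intble (2 - 2 * a) (deriv D) x" if x: "0 < x" "x < 1" for x
      using frac_intble_add[OF frac_intble_add[OF i1[OF x] i2] i3] dD' x
      by (subst frac_intble_cong[where g = "\<lambda>t. (- s) * deriv u t + (- (M * Gamma (a + 1))) * kern a t + (2 * M * Gamma (2 * a)) * kern (2 * a - 1) t"]) auto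
    \<comment> \<open>I^(2-2a) maps the derivative of x^(2a-1) to the constant Gamma(2a), so the
      main barrier term drops out of the derivative z.\<close>
    have viD: "frac_int (2 - 2 * a) (deriv D) x = (- s) * (A y0 * kern (2 - a) x + frac_int 1 (\<lambda>t. h t y0) x)
        - (M * Gamma (a + 1)) * kern (2 - a) x + 2 * M * Gamma (2 * a)" if x: "0 < x" "x < 1" for x
    proof -
      have "frac_int (2 - 2 * a) (deriv D) x = frac_int (2 - 2 * a) (\<lambda>t. (- s) * deriv u t + (- (M * Gamma (a + 1))) * kern a t + (2 * M * Gamma (2 * a)) * kern (2 * a - 1) t) x"
        by (rule frac_int_cong) (use dD' x in auto)
      also have "\<dots> = (- s) * frac_int (2 - 2 * a) (deriv u) x + (- (M * Gamma (a + 1))) * kern (2 - 2 * a + a) x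
         + (2 * M * Gamma (2 * a)) * kern (2 - 2 * a + (2 * a - 1)) x"
        by (simp only: frac_int_add[OF frac_intble_add[OF i1[OF x] i2] i3] frac_int_add[OF i1[OF x] i2]
          frac_int_cmult frac_int_kern[OF p(1) a(1)] frac_int_kern[OF p(1) p(3)])
      also have "2 - 2 * a + a = 2 - a" by simp
      also have "2 - 2 * a + (2 * a - 1) = 1" by simp
      finally show ?thesis using rep1[OF ypi x] kern_1[OF x(1)] by (simp add: u_def)
    qed
    define z where "z = m * ((2 - 2 * a - 1) * x0 powr (2 - 2 * a - 2) / Gamma (2 - 2 * a))
       - (s * A y0 + M * Gamma (a + 1)) * ((2 - a - 1) * x0 powr (2 - a - 2) / Gamma (2 - a)) - s * h x0 y0"
    have D_0: "D 0 = m" using zero_x(1)[of y0] ypi by (simp add: D_def f_def)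
    have "((\<lambda>x. m * kern (2 - 2 * a) x - (s * A y0 + M * Gamma (a + 1)) * kern (2 - a) x - s * frac_int 1 (\<lambda>t. h t y0) x + 2 * M * Gamma (2 * a))
        has_real_derivative z) (at x0)"
      unfolding z_def
      by (auto intro!: derivative_eq_intros kern_deriv[OF x0_pos] frac_int_1_deriv[OF h_cont_x[OF ypi] rep2[OF ypi] x0_pos x01]
        simp: mult_ac)
    then have "((\<lambda>x. D 0 * kern (2 - 2 * a) x + frac_int (2 - 2 * a) (deriv D) x) has_real_derivative z) (at x0)"
    proof (rule has_field_derivative_transform_within_open[where S = "{0<..<1}"])
      fix x :: real assume "x \<in> {0<..<1}"
      then show "m * kern (2 - 2 * a) x - (s * A y0 + M * Gamma (a + 1)) * kern (2 - a) x - s * frac_int 1 (\<lambda>t. h t y0) x + 2 * M * Gamma (2 * a)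
         = D 0 * kern (2 - 2 * a) x + frac_int (2 - 2 * a) (deriv D) x"
        using viD[of x] D_0 by (simp add: algebra_simps)
    qed (use x0_pos x01 in auto)
    then have "z \<ge> 0"
    proof (rule riemann_liouville_minimum[OF p(1,2) x0_pos x0_half, rotated -1])
      show "continuous_on {0..1/2} D"
        unfolding D_def f_def using a a2 ypi
        by (intro continuous_intros continuous_on_powr' continuous_on_subset[OF w_cont_x]) auto
      show "D differentiable (at t)" if "0 < t" "t < 1/2" for t
        using dD[of t] that real_differentiable_def by auto
      show "0 \<le> D t" if "0 \<le> t" "t \<le> 1/2" for t using max[OF that xy(3,4)] by (simp add: D_def)
      show "D x0 = 0" by (simp add: D_def m_def)
      show "frac_intble (2 - 2 * a) (deriv D) x" if "0 < x" "x < 1/2" for x using fiD that by simp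
    qed
    \<comment> \<open>The strict sign comes from D 0 = m > 0, which multiplies a kernel with
      negative exponent 1 - 2a, hence decreasing. The term with A is absorbed by M Gamma(a + 1), and
      the equation gives the sign of s h.\<close>
    moreover have "z < 0"
    proof -
      have g: "Gamma (2 - 2 * a) > 0" "Gamma (2 - a) > 0" using a_less by auto
      have "(2 - 2 * a - 1) * x0 powr (2 - 2 * a - 2) < 0" using a2 x0_pos by (intro mult_neg_pos) auto
      then have "m * ((2 - 2 * a - 1) * x0 powr (2 - 2 * a - 2) / Gamma (2 - 2 * a)) < 0"
        by (rule mult_pos_neg[OF m divide_neg_pos[OF _ g(1)]])
      moreover have "(s * A y0 + M * Gamma (a + 1)) * ((2 - a - 1) * x0 powr (2 - a - 2) / Gamma (2 - a)) \<ge> 0"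
      proof (rule mult_nonneg_nonneg)
        have "Ab \<le> M * Gamma (a + 1)" using M(5) Ga by (simp add: field_simps)
        moreover have "- (s * A y0) \<le> Ab" using Ab[of y0] xy s by auto
        ultimately show "0 \<le> s * A y0 + M * Gamma (a + 1)" by linarith
      qed (use a_less g in auto)
      ultimately show ?thesis using sh unfolding z_def by linarith
    qed
    ultimately show False by simp
  qed
  show ?thesis
  proof (rule that[of "2 * M"])
    fix x y :: real assume xy: "0 < x" "x \<le> 1/2" "-b \<le> y" "y \<le> b"
    have "f x y \<le> 0" using max[of x y] xy \<open>m \<le> 0\<close> by simp
    moreover have "0 \<le> M * x powr a" using M(1) by simp
    ultimately show "s * w x y \<le> 2 * M * x powr (2 * a - 1)" unfolding f_def by linarith
  qed (use M(1) in simp)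
qed

text \<open>The exponent of the bound near x = 0 that is uniform in y. For a <= 1/2 boundedness of w
  is enough, because then 2 - 2a is at least 1.\<close>

definition \<gamma> :: real where "\<gamma> = max 0 (2 * a - 1)"

lemma gamma: "0 \<le> \<gamma>" "\<gamma> < a" "2 * a - 1 \<le> \<gamma>"
  using a a_less by (auto simp: \<gamma>_def)

lemma w_le_gamma:
  assumes b: "0 < b" "b < pi"
  obtains M where "M > 0" "\<And>x y. 0 < x \<Longrightarrow> x \<le> 1/2 \<Longrightarrow> -b \<le> y \<Longrightarrow> y \<le> b \<Longrightarrow> \<bar>w x y\<bar> \<le> M * x powr \<gamma>"
proof (cases "1/2 < a")
  case True
  obtain M1 where M1: "M1 > 0" "\<And>x y. 0 < x \<Longrightarrow> x \<le> 1/2 \<Longrightarrow> -b \<le> y \<Longrightarrow> y \<le> b \<Longrightarrow> 1 * w x y \<le> M1 * x powr (2 * a - 1)"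
    by (rule barrier[OF True b, of 1]) auto
  obtain M2 where M2: "M2 > 0" "\<And>x y. 0 < x \<Longrightarrow> x \<le> 1/2 \<Longrightarrow> -b \<le> y \<Longrightarrow> y \<le> b \<Longrightarrow> (-1) * w x y \<le> M2 * x powr (2 * a - 1)"
    by (rule barrier[OF True b, of "-1"]) auto
  show ?thesis
  proof (rule that[of "max M1 M2"])
    fix x y :: real assume xy: "0 < x" "x \<le> 1/2" "-b \<le> y" "y \<le> b"
    have "M1 * x powr (2 * a - 1) \<le> max M1 M2 * x powr (2 * a - 1)" "M2 * x powr (2 * a - 1) \<le> max M1 M2 * x powr (2 * a - 1)"
      by (auto intro!: mult_right_mono)
    moreover have "\<gamma> = 2 * a - 1" using True by (simp add: \<gamma>_def)
    ultimately show "\<bar>w x y\<bar> \<le> max M1 M2 * x powr \<gamma>" using M1(2)[OF xy] M2(2)[OF xy] by simp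
  qed (use M1 in auto)
next
  case False
  obtain B where B: "B > 0" "\<And>x y. 0 \<le> x \<Longrightarrow> x \<le> 1 \<Longrightarrow> -pi \<le> y \<Longrightarrow> y \<le> pi \<Longrightarrow> \<bar>w x y\<bar> \<le> B"
    by (rule w_bounded) blast
  have "\<gamma> = 0" using False by (simp add: \<gamma>_def)
  then show ?thesis using B b by (intro that[of B]) auto
qed

text \<open>Dominated convergence in y: the constant in w = O(x^a) depends on y, but \<gamma> < a
  makes the quotient tend to 0 pointwise, and \<open>w_le_gamma\<close> supplies the
  majorant.\<close>

lemma integral_w_small:
  assumes b: "0 < b" "b < pi" and e: "continuous_on {-b..b} e"
  shows "((\<lambda>x. integral {-b..b} (\<lambda>y. w x y * e y) / x powr \<gamma>) \<longlongrightarrow> 0) (at_right 0)"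
proof (rule tendsto_at_right_sequentially[of 0 "1/2"])
  fix S :: "nat \<Rightarrow> real" assume S: "\<And>n. 0 < S n" "\<And>n. S n < 1/2" "S \<longlonglongrightarrow> 0"
  obtain M where M: "M > 0" "\<And>x y. 0 < x \<Longrightarrow> x \<le> 1/2 \<Longrightarrow> -b \<le> y \<Longrightarrow> y \<le> b \<Longrightarrow> \<bar>w x y\<bar> \<le> M * x powr \<gamma>"
    by (rule w_le_gamma[OF b]) blast
  obtain E where E: "\<And>y. y \<in> {-b..b} \<Longrightarrow> \<bar>e y\<bar> \<le> E"
    using compact_imp_bounded[OF compact_continuous_image[OF e compact_Icc]] unfolding bounded_iff by auto force
  have "(\<lambda>n. integral {-b..b} (\<lambda>y. w (S n) y / S n powr \<gamma> * e y)) \<longlonglongrightarrow> integral {-b..b} (\<lambda>y. 0)"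
  proof (rule dominated_convergence(2)[where h = "\<lambda>y. M * E"])
    show "(\<lambda>y. w (S n) y / S n powr \<gamma> * e y) integrable_on {-b..b}" for n
      using S(1)[of n] S(2)[of n] b
      by (intro integrable_continuous_real continuous_intros e continuous_on_subset[OF w_cont_y]) auto
    show "norm (w (S n) y / S n powr \<gamma> * e y) \<le> M * E" if y: "y \<in> {-b..b}" for n y
    proof -
      have "\<bar>w (S n) y\<bar> \<le> M * S n powr \<gamma>" by (rule M(2)) (use S(1)[of n] S(2)[of n] y in auto)
      then have "\<bar>w (S n) y / S n powr \<gamma>\<bar> \<le> M" using S(1)[of n] by (simp add: abs_divide divide_le_eq)
      then have "\<bar>w (S n) y / S n powr \<gamma>\<bar> * \<bar>e y\<bar> \<le> M * E" using E[OF y] M(1) by (intro mult_mono) auto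
      then show ?thesis by (simp add: abs_mult)
    qed
    show "(\<lambda>n. w (S n) y / S n powr \<gamma> * e y) \<longlonglongrightarrow> 0" if y: "y \<in> {-b..b}" for y
    proof -
      obtain N where N: "\<And>x. 0 < x \<Longrightarrow> x \<le> 1/2 \<Longrightarrow> \<bar>w x y\<bar> \<le> N * x powr a"
        using rep4[of y] y b by auto
      have "(\<lambda>n. S n powr (a - \<gamma>)) \<longlonglongrightarrow> 0 powr (a - \<gamma>)"
        by (rule tendsto_powr2[OF S(3) tendsto_const]) (use gamma less_imp_le[OF S(1)] in simp_all)
      then have "(\<lambda>n. N * S n powr (a - \<gamma>) * \<bar>e y\<bar>) \<longlonglongrightarrow> N * 0 * \<bar>e y\<bar>"
        using gamma by (intro tendsto_intros) auto
      then have lim: "(\<lambda>n. N * S n powr (a - \<gamma>) * \<bar>e y\<bar>) \<longlonglongrightarrow> 0" by simp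
      show ?thesis
      proof (rule Lim_null_comparison[OF _ lim], intro always_eventually allI)
        fix n
        have "\<bar>w (S n) y\<bar> \<le> N * S n powr a" by (rule N) (use S(1)[of n] S(2)[of n] in auto)
        then have "\<bar>w (S n) y\<bar> / S n powr \<gamma> \<le> N * S n powr a / S n powr \<gamma>" by (intro divide_right_mono) auto
        then have "\<bar>w (S n) y\<bar> / S n powr \<gamma> \<le> N * S n powr (a - \<gamma>)" by (simp add: powr_diff)
        then have "\<bar>w (S n) y\<bar> / S n powr \<gamma> * \<bar>e y\<bar> \<le> N * S n powr (a - \<gamma>) * \<bar>e y\<bar>" by (intro mult_right_mono) auto
        then show "norm (w (S n) y / S n powr \<gamma> * e y) \<le> N * S n powr (a - \<gamma>) * \<bar>e y\<bar>"
          by (simp add: abs_mult abs_divide)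
      qed
    qed
  qed auto
  then show "(\<lambda>n. integral {-b..b} (\<lambda>y. w (S n) y * e y) / S n powr \<gamma>) \<longlonglongrightarrow> 0"
    by simp
qed simp

end

section \<open>Uniqueness for the decoupled problem\<close>

text \<open>Fubini after cutting w off outside the compact rectangle, which makes it Borel
  measurable and bounded; the kernel is integrable in t.\<close>

lemma frac_int_integral_swap:
  fixes w :: "real \<Rightarrow> real \<Rightarrow> real" and p q :: real
  assumes b: "0 < b" and pq: "p \<le> q" and w: "continuous_on ({0..1} \<times> {p..q}) (\<lambda>z. w (fst z) (snd z))"
    and x: "0 < x" "x \<le> 1"
  shows "integral {p..q} (\<lambda>y. frac_int b (\<lambda>t. w t y) x) = frac_int b (\<lambda>t. integral {p..q} (w t)) x"
proof -
  define k where "k = (\<lambda>t. indicator {0<..<x} t *\<^sub>R kern b (x - t))"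
  define W where "W = (\<lambda>z. indicator ({0..1} \<times> {p..q}) z *\<^sub>R w (fst z) (snd z))"
  define F where "F = (\<lambda>t y. k t * W (t, y))"
  have "compact ({0..1::real} \<times> {p..q})" by (intro compact_Times compact_Icc)
  from compact_imp_bounded[OF compact_continuous_image[OF w this]]
  obtain B0 where B0: "\<And>z. z \<in> {0..1} \<times> {p..q} \<Longrightarrow> \<bar>w (fst z) (snd z)\<bar> \<le> B0"
    unfolding bounded_iff by auto force
  define B where "B = \<bar>B0\<bar>"
  have WB: "\<bar>W (t, y)\<bar> \<le> B * indicator {p..q} y" for t y
    using B0[of "(t, y)"] by (auto simp: W_def B_def indicator_def)
  have Wm: "W \<in> borel_measurable borel"
    unfolding W_def by (rule borel_measurable_continuous_on_indicator[OF _ w]) (intro borel_closed closed_Times closed_atLeastAtMost)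
  have km [measurable]: "k \<in> borel_measurable borel" unfolding k_def by measurable
  have Wm' [measurable]: "W \<in> borel_measurable (lborel \<Otimes>\<^sub>M lborel)"
    using Wm by (simp add: lborel_prod)
  have ki: "integrable lborel k"
    using frac_intble_const[OF b, of 1 x] by (simp add: frac_intble_def set_integrable_def k_def)
  have Gi: "integrable (lborel \<Otimes>\<^sub>M lborel) (\<lambda>(t, y). k t * (B * indicator {p..q} y))"
  proof (rule lborel_pair.Fubini_integrable)
    show "(\<lambda>(t, y). k t * (B * indicator {p..q} y)) \<in> borel_measurable (lborel \<Otimes>\<^sub>M lborel)" by measurable
    have "(\<integral>y. norm (case (t, y) of (t, y) \<Rightarrow> k t * (B * indicator {p..q} y)) \<partial>lborel) = norm (k t) * (\<bar>B\<bar> * (q - p))" for t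
      using pq by (simp add: abs_mult)
    then show "integrable lborel (\<lambda>t. \<integral>y. norm (case (t, y) of (t, y) \<Rightarrow> k t * (B * indicator {p..q} y)) \<partial>lborel)"
      using ki by simp
    show "AE t in lborel. integrable lborel (\<lambda>y. case (t, y) of (t, y) \<Rightarrow> k t * (B * indicator {p..q} y))"
      using pq by (simp add: integrable_indicator_iff)
  qed
  have Fi: "integrable (lborel \<Otimes>\<^sub>M lborel) (case_prod F)"
  proof (rule Bochner_Integration.integrable_bound[OF Gi])
    show "case_prod F \<in> borel_measurable (lborel \<Otimes>\<^sub>M lborel)" unfolding F_def by measurable
    show "AE z in lborel \<Otimes>\<^sub>M lborel. norm (case z of (t, y) \<Rightarrow> F t y) \<le> norm (case z of (t, y) \<Rightarrow> k t * (B * indicator {p..q} y))"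
    proof (intro AE_I2)
      fix z :: "real \<times> real"
      obtain t y where z: "z = (t, y)" by (cases z)
      have "\<bar>k t\<bar> * \<bar>W (t, y)\<bar> \<le> \<bar>k t\<bar> * (B * indicator {p..q} y)" by (rule mult_left_mono[OF WB]) simp
      also have "\<dots> = \<bar>k t * (B * indicator {p..q} y)\<bar>" by (simp add: abs_mult B_def)
      finally show "norm (case z of (t, y) \<Rightarrow> F t y) \<le> norm (case z of (t, y) \<Rightarrow> k t * (B * indicator {p..q} y))"
        by (simp add: F_def z abs_mult)
    qed
  qed
  have in1: "(\<integral>t. F t y \<partial>lborel) = indicator {p..q} y *\<^sub>R frac_int b (\<lambda>t. w t y) x" for y
    unfolding frac_int_def set_lebesgue_integral_def
    using x by (cases "y \<in> {p..q}")
      (auto intro!: Bochner_Integration.integral_cong Bochner_Integration.integral_eq_zero_AE simp: F_def k_def W_def indicator_def)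
  have in2: "(\<integral>y. F t y \<partial>lborel) = indicator {0<..<x} t *\<^sub>R (kern b (x - t) * integral {p..q} (w t))" for t
  proof (cases "t \<in> {0<..<x}")
    case True
    then have t01: "t \<in> {0..1}" using x by auto
    have "set_integrable lborel {p..q} (w t)"
      by (rule borel_integrable_atLeastAtMost') (use continuous_on_slice_snd[OF w t01] in simp)
    from set_borel_integral_eq_integral(2)[OF this]
    have "integral {p..q} (w t) = (\<integral>y. indicator {p..q} y *\<^sub>R w t y \<partial>lborel)"
      by (simp add: set_lebesgue_integral_def)
    moreover have "(\<integral>y. F t y \<partial>lborel) = (\<integral>y. kern b (x - t) * (indicator {p..q} y *\<^sub>R w t y) \<partial>lborel)"
      using True t01 by (intro Bochner_Integration.integral_cong) (auto simp: F_def k_def W_def indicator_def)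
    ultimately show ?thesis using True by simp
  qed (simp add: F_def k_def)
  have "set_integrable lborel {p..q} (\<lambda>y. frac_int b (\<lambda>t. w t y) x)"
    using lborel_pair.integrable_snd[OF Fi] unfolding in1 set_integrable_def .
  from set_borel_integral_eq_integral(2)[OF this]
  have "integral {p..q} (\<lambda>y. frac_int b (\<lambda>t. w t y) x) = (\<integral>y. (\<integral>t. F t y \<partial>lborel) \<partial>lborel)"
    unfolding in1 by (simp add: set_lebesgue_integral_def)
  also have "\<dots> = (\<integral>t. (\<integral>y. F t y \<partial>lborel) \<partial>lborel)" by (rule lborel_pair.Fubini_integral[OF Fi])
  also have "\<dots> = frac_int b (\<lambda>t. integral {p..q} (w t)) x"
    unfolding in2 frac_int_def set_lebesgue_integral_def ..
  finally show ?thesis .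
qed

lemma frac_int_dominated:
  fixes f :: "nat \<Rightarrow> real \<Rightarrow> real"
  assumes b: "0 < b" and m: "\<And>j. set_borel_measurable borel {0<..<x} (f j)"
    and B: "\<And>j t. 0 < t \<Longrightarrow> t < x \<Longrightarrow> \<bar>f j t\<bar> \<le> B"
    and lim: "\<And>t. 0 < t \<Longrightarrow> t < x \<Longrightarrow> (\<lambda>j. f j t) \<longlonglongrightarrow> g t"
  shows "(\<lambda>j. frac_int b (f j) x) \<longlonglongrightarrow> frac_int b g x"
  unfolding frac_int_def set_lebesgue_integral_def
proof (rule integral_dominated_convergence)
  have meas: "(\<lambda>t. indicator {0<..<x} t *\<^sub>R (kern b (x - t) * f j t)) \<in> borel_measurable borel" for j
  proof -
    have "(\<lambda>t. kern b (x - t) * (indicator {0<..<x} t *\<^sub>R f j t)) \<in> borel_measurable borel"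
      using m[of j] by (auto simp: set_borel_measurable_def)
    then show ?thesis by (simp add: mult_ac)
  qed
  then show "\<And>j. (\<lambda>t. indicator {0<..<x} t *\<^sub>R (kern b (x - t) * f j t)) \<in> borel_measurable lborel" by simp
  have pl: "(\<lambda>j. indicator {0<..<x} t *\<^sub>R (kern b (x - t) * f j t)) \<longlonglongrightarrow> indicator {0<..<x} t *\<^sub>R (kern b (x - t) * g t)" for t
    by (cases "t \<in> {0<..<x}") (auto intro!: tendsto_intros lim)
  then show "AE t in lborel. (\<lambda>j. indicator {0<..<x} t *\<^sub>R (kern b (x - t) * f j t)) \<longlonglongrightarrow> indicator {0<..<x} t *\<^sub>R (kern b (x - t) * g t)"
    by simp
  show "(\<lambda>t. indicator {0<..<x} t *\<^sub>R (kern b (x - t) * g t)) \<in> borel_measurable lborel"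
    using borel_measurable_LIMSEQ_real[OF pl meas] by simp
  show "integrable lborel (\<lambda>t. indicator {0<..<x} t *\<^sub>R (kern b (x - t) * B))"
    using frac_intble_const[OF b, of B x] by (simp add: frac_intble_def set_integrable_def)
  show "AE t in lborel. norm (indicator {0<..<x} t *\<^sub>R (kern b (x - t) * f j t)) \<le> indicator {0<..<x} t *\<^sub>R (kern b (x - t) * B)" for j
    using B[of _ j] b by (intro AE_I2) (auto simp: indicator_def abs_mult kern_nonneg intro!: mult_left_mono)
qed

text \<open>Iteration bounds |J| by B l^n kern (b n + 1), where the factors after B form the general
  term of a convergent Mittag-Leffler series.\<close>

lemma volterra_zero:
  assumes b: "0 < b" and l: "0 \<le> l" and B: "\<And>t. 0 < t \<Longrightarrow> t < 1 \<Longrightarrow> \<bar>J t\<bar> \<le> B"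
    and J: "\<And>t. 0 < t \<Longrightarrow> t < 1 \<Longrightarrow> J t = l * frac_int b J t" and x: "0 < x" "x < 1"
  shows "J x = 0"
proof -
  have le: "\<bar>J t\<bar> \<le> B * (l ^ n * kern (b * real n + 1) t)" if "0 < t" "t < 1" for n t
    using that
  proof (induction n arbitrary: t)
    case 0
    then show ?case using B[of t] by (simp add: kern_1)
  next
    case (Suc n)
    have p: "0 < b * real n + 1" using b by (simp add: add_nonneg_pos)
    have "\<bar>frac_int b J t\<bar> \<le> frac_int b (\<lambda>s. (B * l ^ n) * kern (b * real n + 1) s) t"
      by (rule frac_int_abs_le[OF b frac_intble_cmult[OF frac_intble_kern[OF b p]]])
        (use Suc in \<open>auto simp: mult.assoc\<close>)
    also have "\<dots> = (B * l ^ n) * kern (b + (b * real n + 1)) t"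
      by (simp only: frac_int_cmult frac_int_kern[OF b p])
    finally have "l * \<bar>frac_int b J t\<bar> \<le> l * ((B * l ^ n) * kern (b + (b * real n + 1)) t)"
      by (rule mult_left_mono[OF _ l])
    moreover have "\<bar>J t\<bar> = l * \<bar>frac_int b J t\<bar>" using J[OF Suc.prems] l by (simp add: abs_mult)
    moreover have "b + (b * real n + 1) = b * real (Suc n) + 1" by (simp add: algebra_simps)
    ultimately show ?case by (simp add: mult_ac)
  qed
  have "summable (\<lambda>n. l ^ n * kern (b * real n + 1) x)"
    using summable_norm_cancel[OF ml_kern_summable_norm[OF b, of 1 l x]] by simp
  then have "(\<lambda>n. B * (l ^ n * kern (b * real n + 1) x)) \<longlonglongrightarrow> B * 0"
    by (intro tendsto_intros summable_LIMSEQ_zero)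
  then have "\<bar>J x\<bar> \<le> B * 0"
    by (rule LIMSEQ_le_const) (use le[OF x] in auto)
  then show ?thesis by simp
qed

text \<open>Vanishing second differences mean that R is affine. Letting p tend to 0, where R tends
  to 0, shows that R x / x is constant, and the assumed limit makes this constant 0.\<close>

lemma three_point_zero:
  assumes tp: "\<And>p q r. 0 < p \<Longrightarrow> p < q \<Longrightarrow> q < r \<Longrightarrow> r < 1 \<Longrightarrow> three_point p q r R = 0"
    and lim: "((\<lambda>x. R x / x) \<longlongrightarrow> 0) (at_right 0)" and x: "0 < x" "x < 1"
  shows "R x = 0"
proof -
  have "((\<lambda>x. R x / x * x) \<longlongrightarrow> 0 * 0) (at_right 0)" by (intro tendsto_intros lim)
  moreover have "\<forall>\<^sub>F x in at_right (0::real). R x / x * x = R x"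
    by (auto simp: eventually_at_filter)
  ultimately have R0: "(R \<longlongrightarrow> 0) (at_right 0)" by (auto elim: Lim_transform_eventually)
  have ratio_eq: "R q / q = R r / r" if qr: "0 < q" "q < r" "r < 1" for q r
  proof -
    have "((\<lambda>p. (r - q) * R p - (r - p) * R q + (q - p) * R r) \<longlongrightarrow> (r - q) * 0 - (r - 0) * R q + (q - 0) * R r) (at_right 0)"
      by (intro tendsto_intros R0)
    moreover have "\<forall>\<^sub>F p in at_right 0. (r - q) * R p - (r - p) * R q + (q - p) * R r = 0"
      using eventually_at_right_less[of 0] eventually_at_right_real[OF qr(1)]
      by eventually_elim (use tp[of _ q r] qr in \<open>auto simp: three_point_def\<close>)
    ultimately have "((\<lambda>p::real. 0::real) \<longlongrightarrow> (r - q) * 0 - (r - 0) * R q + (q - 0) * R r) (at_right 0)"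
      by (rule Lim_transform_eventually)
    then have "(r - q) * 0 - (r - 0) * R q + (q - 0) * R r = 0"
      using tendsto_unique[OF trivial_limit_at_right_real tendsto_const] by metis
    then show ?thesis using qr by (simp add: field_simps)
  qed
  have "\<forall>\<^sub>F q in at_right 0. R q / q = R x / x"
    using eventually_at_right_real[OF x(1)] by eventually_elim (use ratio_eq x in auto)
  then have "((\<lambda>q::real. R x / x) \<longlongrightarrow> 0) (at_right 0)" using lim by (rule Lim_transform_eventually[rotated])
  then have "R x / x = 0" using tendsto_unique[OF trivial_limit_at_right_real tendsto_const] by metis
  then show ?thesis using x by simp
qed

lemma frac_intble_bounded_cont:
  assumes b: "0 < b" and D: "continuous_on {0<..<1} D" and B: "\<And>t. 0 < t \<Longrightarrow> t < 1 \<Longrightarrow> \<bar>D t\<bar> \<le> B" and x: "x \<le> 1"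
  shows "frac_intble b D x" "set_borel_measurable borel {0<..<x} D"
proof -
  show m: "set_borel_measurable borel {0<..<x} D"
    unfolding set_borel_measurable_def
    by (rule borel_measurable_continuous_on_indicator) (use x in \<open>auto intro: continuous_on_subset[OF D]\<close>)
  show "frac_intble b D x"
    by (rule frac_intble_bound[OF b frac_intble_const[OF b, of B x] m]) (use B x in auto)
qed

text \<open>D is the derivative of an integral that vanishes identically.\<close>

lemma frac_int_1_zero:
  assumes D: "continuous_on {0<..<1} D" and B: "\<And>t. 0 < t \<Longrightarrow> t < 1 \<Longrightarrow> \<bar>D t\<bar> \<le> B"
    and z: "\<And>x. 0 < x \<Longrightarrow> x < 1 \<Longrightarrow> frac_int 1 D x = 0" and x: "0 < x" "x < 1"
  shows "D x = 0"
proof -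
  have "((\<lambda>x. frac_int 1 D x) has_real_derivative D x) (at x)"
    by (rule frac_int_1_deriv[OF D _ x]) (use frac_intble_bounded_cont(1)[OF _ D B] in auto)
  moreover have "((\<lambda>x. frac_int 1 D x) has_real_derivative 0) (at x)"
    by (rule has_field_derivative_transform_within_open[where S = "{0<..<1}" and f = "\<lambda>x. 0"]) (use z x in auto)
  ultimately show ?thesis by (rule DERIV_unique)
qed

section \<open>Sine coefficients on inner intervals [-b, b]\<close>

context zero_problem_frac
begin

context
  fixes m :: nat
  assumes m: "m \<ge> 1"
begin

text \<open>The frequency of the m-th Dirichlet eigenfunction \<open>\<eta> b\<close> of [-b, b];
  for b = pi that function is \<open>sv m\<close>.\<close>

definition \<kappa> :: "real \<Rightarrow> real" where "\<kappa> b = real m * pi / (2 * b)"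
definition \<eta> :: "real \<Rightarrow> real \<Rightarrow> real" where "\<eta> b y = sin (\<kappa> b * (y + b))"
definition W :: "real \<Rightarrow> real \<Rightarrow> real" where "W b x = integral {-b..b} (\<lambda>y. w x y * \<eta> b y)"
text \<open>Boundary terms of the two integrations by parts. Since \<open>\<eta> b\<close> vanishes
  at both ends, only values of w occur and none of its y-derivative.\<close>

definition bdry :: "real \<Rightarrow> real \<Rightarrow> real" where
  "bdry b x = d * (w x b * (\<kappa> b * cos (\<kappa> b * (b + b))) - w x (-b) * \<kappa> b)"
definition Q :: "real \<Rightarrow> real \<Rightarrow> real" where "Q b x = (c\<^sup>2 + d * (\<kappa> b)\<^sup>2) * W b x + bdry b x"

lemma eta_deriv: "(\<eta> b has_real_derivative \<kappa> b * cos (\<kappa> b * (y + b))) (at y within S)"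
  unfolding \<eta>_def by (auto intro!: derivative_eq_intros)

lemma eta_cont: "continuous_on S (\<eta> b)"
  by (rule DERIV_continuous_on[OF eta_deriv])

lemma eta_le: "\<bar>\<eta> b y\<bar> \<le> 1"
  by (simp add: \<eta>_def)

lemma eta_ends: "0 < b \<Longrightarrow> \<eta> b (-b) = 0" "0 < b \<Longrightarrow> \<eta> b b = 0"
proof -
  assume b: "0 < b"
  show "\<eta> b (-b) = 0" by (simp add: \<eta>_def)
  have "\<kappa> b * (b + b) = real m * pi" using b by (simp add: \<kappa>_def field_simps)
  then show "\<eta> b b = 0" unfolding \<eta>_def by (simp only: sin_npi)
qed

lemma W_cont: "0 < b \<Longrightarrow> b \<le> pi \<Longrightarrow> continuous_on {0..1} (W b)"
proof -
  assume b: "0 < b" "b \<le> pi"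
  have "continuous_on {0..1} (\<lambda>x. integral (cbox (-b) b) (\<lambda>y. w x y * \<eta> b y))"
  proof (rule integral_continuous_on_param)
    have "continuous_on ({0..1} \<times> cbox (-b) b) (\<lambda>z. w (fst z) (snd z) * \<eta> b (snd z))"
      by (intro continuous_on_mult w_cont_sub continuous_on_compose2[OF eta_cont[of UNIV b]])
        (use b in \<open>auto intro!: continuous_intros\<close>)
    then show "continuous_on ({0..1} \<times> cbox (-b) b) (\<lambda>(x, y). w x y * \<eta> b y)"
      by (simp add: case_prod_unfold)
  qed
  then show ?thesis by (simp add: W_def[abs_def])
qed

lemma Q_cont: "0 < b \<Longrightarrow> b \<le> pi \<Longrightarrow> continuous_on {0..1} (Q b)"
  unfolding Q_def[abs_def] bdry_def by (intro continuous_intros W_cont w_cont_x) auto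

text \<open>The integration by parts takes place inside the open domain. The result involves only w,
  so it extends continuously to all of [0, 1], although the equation controls h only for 0 < x <
  1.\<close>

lemma Q_eq:
  assumes b: "0 < b" "b < pi" and x: "0 < x" "x < 1"
  shows "integral {-b..b} (\<lambda>y. h x y * \<eta> b y) = Q b x"
proof -
  define e' where "e' = (\<lambda>y. \<kappa> b * cos (\<kappa> b * (y + b)))"
  have e'd: "(e' has_real_derivative - (\<kappa> b)\<^sup>2 * \<eta> b y) (at y within S)" for y S
    unfolding e'_def \<eta>_def by (auto intro!: derivative_eq_intros simp: power2_eq_square)
  have "((\<lambda>y. wyy x y * \<eta> b y + (\<kappa> b)\<^sup>2 * (w x y * \<eta> b y)) has_integral
     ((wy x b * \<eta> b b - w x b * e' b) - (wy x (-b) * \<eta> b (-b) - w x (-b) * e' (-b)))) {-b..b}"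
  proof (rule FTC_integral)
    fix y assume y: "y \<in> {-b..b}"
    then have yp: "-pi < y" "y < pi" using b by auto
    note dw = has_field_derivative_at_within[OF wy[OF x yp]] and dwy = has_field_derivative_at_within[OF wyy[OF x yp]]
    show "((\<lambda>y. wy x y * \<eta> b y - w x y * e' y) has_real_derivative wyy x y * \<eta> b y + (\<kappa> b)\<^sup>2 * (w x y * \<eta> b y)) (at y within {-b..b})"
      using DERIV_diff[OF DERIV_mult[OF dwy eta_deriv] DERIV_mult[OF dw e'd]]
      by (rule DERIV_cong) (simp add: e'_def algebra_simps)
  qed (use b in simp)
  then have I: "integral {-b..b} (\<lambda>y. wyy x y * \<eta> b y + (\<kappa> b)\<^sup>2 * (w x y * \<eta> b y)) = - (w x b * e' b - w x (-b) * e' (-b))"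
    using b by (simp add: eta_ends integral_unique)
  have cw: "continuous_on {-b..b} (w x)" by (rule continuous_on_subset[OF w_cont_y]) (use x b in auto)
  have cwyy: "continuous_on {-b..b} (wyy x)"
    by (rule continuous_on_subset[OF continuous_on_slice_snd[OF wyy_cont]]) (use x b in auto)
  have "integral {-b..b} (\<lambda>y. h x y * \<eta> b y)
     = integral {-b..b} (\<lambda>y. (c\<^sup>2 + d * (\<kappa> b)\<^sup>2) * (w x y * \<eta> b y) - d * (wyy x y * \<eta> b y + (\<kappa> b)\<^sup>2 * (w x y * \<eta> b y)))"
    by (rule Henstock_Kurzweil_Integration.integral_cong) (simp add: h_def algebra_simps)
  also have "\<dots> = integral {-b..b} (\<lambda>y. (c\<^sup>2 + d * (\<kappa> b)\<^sup>2) * (w x y * \<eta> b y)) - integral {-b..b} (\<lambda>y. d * (wyy x y * \<eta> b y + (\<kappa> b)\<^sup>2 * (w x y * \<eta> b y)))"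
    by (intro integral_diff integrable_continuous_real continuous_intros cw cwyy eta_cont)
  also have "\<dots> = (c\<^sup>2 + d * (\<kappa> b)\<^sup>2) * W b x + d * (w x b * e' b - w x (-b) * e' (-b))"
    by (simp only: integral_mult_right I W_def mult_minus_right diff_minus_eq_add)
  finally show ?thesis by (simp add: Q_def bdry_def e'_def)
qed

definition Ab :: "real \<Rightarrow> real" where "Ab b = integral {-b..b} (\<lambda>y. A y * \<eta> b y)"

lemma frac_int_W:
  assumes b: "0 < b" "b \<le> pi" and x: "0 < x" "x \<le> 1"
  shows "frac_int (2 - 2 * a) (W b) x = integral {-b..b} (\<lambda>y. v x y * \<eta> b y)"
proof -
  have p: "0 < 2 - 2 * a" using a_less by simp
  have "continuous_on ({0..1} \<times> {-b..b}) (\<lambda>z. w (fst z) (snd z) * \<eta> b (snd z))"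
    by (intro continuous_on_mult w_cont_sub continuous_on_compose2[OF eta_cont[of UNIV b]])
      (use b in \<open>auto intro!: continuous_intros\<close>)
  from frac_int_integral_swap[OF p _ this x]
  have "integral {-b..b} (\<lambda>y. frac_int (2 - 2 * a) (\<lambda>t. w t y * \<eta> b y) x) = frac_int (2 - 2 * a) (W b) x"
    using b by (simp add: W_def[abs_def])
  moreover have "frac_int (2 - 2 * a) (\<lambda>t. w t y * \<eta> b y) x = v x y * \<eta> b y" for y
    using frac_int_cmult[of "2 - 2 * a" "\<eta> b y" "\<lambda>t. w t y" x] by (simp add: v_def mult.commute)
  ultimately show ?thesis by simp
qed

text \<open>\<open>three_point_v\<close> is tested against \<open>\<eta> b\<close>. The rectangle
  [-b, b] x [p, r] is a compact part of the open domain, which justifies exchanging the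
  integrals.\<close>

lemma three_point_W:
  assumes pqr: "0 < p" "p < q" "q < r" "r < 1" and b: "0 < b" "b < pi"
  shows "three_point p q r (frac_int (2 - 2 * a) (W b))
    = Ab b * three_point p q r (kern (3 - a)) + integral {p..r} (\<lambda>t. hat p q r t * Q b t)"
proof -
  let ?T = "three_point p q r (kern (3 - a))"
  define I where "I = (\<lambda>y. integral {p..r} (\<lambda>t. hat p q r t * h t y))"
  note ic = integrable_continuous_real
  have cv: "continuous_on {-b..b} (v x)" if "0 < x" "x < 1" for x
    by (rule continuous_on_subset[OF v_cont]) (use that b in auto)
  have cA: "continuous_on {-b..b} A" by (rule continuous_on_subset[OF A_cont]) (use b in auto)
  have hh: "continuous_on ({-b..b} \<times> {p..r}) (\<lambda>(y, t). hat p q r t * h t y)"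
    by (rule continuous_on_subset[OF hat_h_cont]) (use pqr b in auto)
  have cI: "continuous_on {-b..b} I"
    unfolding I_def using integral_continuous_on_param[of "{-b..b}" p r "\<lambda>y t. hat p q r t * h t y"] hh by simp
  have "three_point p q r (frac_int (2 - 2 * a) (W b)) = three_point p q r (\<lambda>x. integral {-b..b} (\<lambda>y. v x y * \<eta> b y))"
    using pqr b frac_int_W[of b] by (simp add: three_point_def)
  also have "\<dots> = integral {-b..b} (\<lambda>y. (r - q) * (v p y * \<eta> b y) - (r - p) * (v q y * \<eta> b y) + (q - p) * (v r y * \<eta> b y))"
  proof -
    have "integral {-b..b} (\<lambda>y. (r - q) * (v p y * \<eta> b y) - (r - p) * (v q y * \<eta> b y) + (q - p) * (v r y * \<eta> b y))
       = integral {-b..b} (\<lambda>y. (r - q) * (v p y * \<eta> b y) - (r - p) * (v q y * \<eta> b y)) + integral {-b..b} (\<lambda>y. (q - p) * (v r y * \<eta> b y))"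
      by (intro integral_add ic continuous_intros cv eta_cont) (use pqr in auto)
    also have "integral {-b..b} (\<lambda>y. (r - q) * (v p y * \<eta> b y) - (r - p) * (v q y * \<eta> b y))
       = integral {-b..b} (\<lambda>y. (r - q) * (v p y * \<eta> b y)) - integral {-b..b} (\<lambda>y. (r - p) * (v q y * \<eta> b y))"
      by (intro integral_diff ic continuous_intros cv eta_cont) (use pqr in auto)
    finally show ?thesis by (simp add: three_point_def)
  qed
  also have "\<dots> = integral {-b..b} (\<lambda>y. ?T * (A y * \<eta> b y) + I y * \<eta> b y)"
  proof (rule Henstock_Kurzweil_Integration.integral_cong)
    fix y assume "y \<in> {-b..b}"
    then have "three_point p q r (\<lambda>x. v x y) = A y * ?T + I y"
      unfolding I_def by (intro three_point_v[OF pqr]) (use b in auto)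
    then have "three_point p q r (\<lambda>x. v x y) * \<eta> b y = (A y * ?T + I y) * \<eta> b y" by simp
    then show "(r - q) * (v p y * \<eta> b y) - (r - p) * (v q y * \<eta> b y) + (q - p) * (v r y * \<eta> b y) = ?T * (A y * \<eta> b y) + I y * \<eta> b y"
      unfolding three_point_def[of p q r "\<lambda>x. v x y"] by (simp add: algebra_simps)
  qed
  also have "\<dots> = integral {-b..b} (\<lambda>y. ?T * (A y * \<eta> b y)) + integral {-b..b} (\<lambda>y. I y * \<eta> b y)"
    by (intro integral_add ic continuous_intros cA cI eta_cont)
  also have "integral {-b..b} (\<lambda>y. ?T * (A y * \<eta> b y)) = Ab b * ?T" by (simp add: Ab_def mult.commute)
  also have "integral {-b..b} (\<lambda>y. I y * \<eta> b y) = integral (cbox (-b) b) (\<lambda>y. integral (cbox p r) (\<lambda>t. hat p q r t * h t y * \<eta> b y))"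
    by (simp add: I_def)
  also have "\<dots> = integral (cbox p r) (\<lambda>t. integral (cbox (-b) b) (\<lambda>y. hat p q r t * h t y * \<eta> b y))"
  proof (rule integral_swap_continuous)
    have "continuous_on ({-b..b} \<times> {p..r}) (\<lambda>z. (hat p q r (snd z) * h (snd z) (fst z)) * \<eta> b (fst z))"
      by (intro continuous_on_mult[OF hh[unfolded case_prod_unfold]] continuous_on_compose2[OF eta_cont[of UNIV b]])
        (auto intro!: continuous_intros)
    then show "continuous_on (cbox (-b, p) (b, r)) (\<lambda>(y, t). hat p q r t * h t y * \<eta> b y)"
      by (simp add: case_prod_unfold cbox_Pair_eq)
  qed
  also have "\<dots> = integral {p..r} (\<lambda>t. hat p q r t * Q b t)"
    using Q_eq[OF b] pqr by (auto intro!: Henstock_Kurzweil_Integration.integral_cong simp: mult.assoc)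
  finally show ?thesis .
qed

text \<open>\<open>W b\<close> is o(x^\<gamma>), so its integral of order 2 - 2a is o(x^(2 - 2a +
  \<gamma>)), and this exponent is at least 1 by the choice of \<gamma>.\<close>

lemma W_over_x:
  assumes b: "0 < b" "b < pi"
  shows "((\<lambda>x. frac_int (2 - 2 * a) (W b) x / x) \<longlongrightarrow> 0) (at_right 0)"
proof (rule tendstoI)
  fix e :: real assume e: "e > 0"
  have p: "0 < 2 - 2 * a" "0 < \<gamma> + 1" "0 < 2 - 2 * a + (\<gamma> + 1)" using a_less gamma(1) by auto
  define C where "C = Gamma (\<gamma> + 1) / Gamma (2 - 2 * a + (\<gamma> + 1))"
  have C: "C > 0" unfolding C_def using p by (intro divide_pos_pos Gamma_real_pos)
  define e' where "e' = e / (2 * C)"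
  have e': "e' > 0" using e C by (simp add: e'_def)
  have "\<forall>\<^sub>F x in at_right 0. dist (W b x / x powr \<gamma>) 0 < e'"
    using integral_w_small[OF b eta_cont] e' unfolding W_def by (rule tendstoD)
  then obtain \<delta> where \<delta>: "\<delta> > 0" "\<And>x. 0 < x \<Longrightarrow> x < \<delta> \<Longrightarrow> dist (W b x / x powr \<gamma>) 0 < e'"
    unfolding eventually_at_right_field by blast
  have W_le: "\<bar>W b t\<bar> \<le> e' * (Gamma (\<gamma> + 1) * kern (\<gamma> + 1) t)" if "0 < t" "t < \<delta>" for t
  proof -
    have "\<bar>W b t\<bar> < e' * t powr \<gamma>" using \<delta>(2)[OF that] that by (simp add: divide_less_eq)
    moreover have "Gamma (\<gamma> + 1) \<noteq> 0" using Gamma_real_pos[OF p(2)] by linarith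
    ultimately show ?thesis using that by (simp add: kern_def)
  qed
  have "dist (frac_int (2 - 2 * a) (W b) x / x) 0 < e" if x: "0 < x" "x < min \<delta> 1" for x
  proof -
    have "\<bar>frac_int (2 - 2 * a) (W b) x\<bar> \<le> frac_int (2 - 2 * a) (\<lambda>t. (e' * Gamma (\<gamma> + 1)) * kern (\<gamma> + 1) t) x"
      by (rule frac_int_abs_le[OF p(1) frac_intble_cmult[OF frac_intble_kern[OF p(1,2)]]])
        (use W_le x in \<open>auto simp: mult.assoc\<close>)
    also have "\<dots> = (e' * Gamma (\<gamma> + 1)) * kern (2 - 2 * a + (\<gamma> + 1)) x"
      by (simp only: frac_int_cmult frac_int_kern[OF p(1,2)])
    also have "\<dots> = e' * C * x powr (2 - 2 * a + \<gamma>)"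
    proof -
      have e1: "2 - 2 * a + (\<gamma> + 1) - 1 = 2 - 2 * a + \<gamma>" by simp
      show ?thesis using x unfolding kern_def C_def e1 by simp
    qed
    also have "\<dots> \<le> e' * C * x powr 1"
      using x gamma(3) e' C by (intro mult_left_mono powr_mono') auto
    also have "\<dots> = e / 2 * x" using x C by (simp add: e'_def)
    also have "\<dots> < e * x" using x e by simp
    finally show ?thesis using x by (simp add: abs_divide divide_less_eq)
  qed
  then show "\<forall>\<^sub>F x in at_right 0. dist (frac_int (2 - 2 * a) (W b) x / x) 0 < e"
    unfolding eventually_at_right_field using \<delta>(1) by (intro exI[of _ "min \<delta> 1"]) auto
qed

lemma Q_bounded: "0 < b \<Longrightarrow> b \<le> pi \<Longrightarrow> \<exists>B. \<forall>t\<in>{0..1}. \<bar>Q b t\<bar> \<le> B"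
  using compact_imp_bounded[OF compact_continuous_image[OF Q_cont compact_Icc]]
  unfolding bounded_iff by auto

text \<open>The difference R of the two sides has vanishing second differences, hence is affine. It
  is zero because R x / x tends to 0: its three parts are o(x), O(x^(2 - a)) and O(x^2).\<close>

lemma W_representation:
  assumes b: "0 < b" "b < pi" and x: "0 < x" "x < 1"
  shows "frac_int (2 - 2 * a) (W b) x = Ab b * kern (3 - a) x + frac_int 2 (Q b) x"
proof -
  define R where "R = (\<lambda>x. frac_int (2 - 2 * a) (W b) x - (Ab b * kern (3 - a) x + frac_int 2 (Q b) x))"
  obtain B where "\<forall>t\<in>{0..1}. \<bar>Q b t\<bar> \<le> B" using Q_bounded[of b] b by auto
  then have B: "\<bar>Q b t\<bar> \<le> B" if "0 \<le> t" "t \<le> 1" for t using that by simp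
  have Qc: "continuous_on {0<..<1} (Q b)" by (rule continuous_on_subset[OF Q_cont]) (use b in auto)
  have "R x = 0"
  proof (rule three_point_zero[OF _ _ x])
    fix p q r :: real assume pqr: "0 < p" "p < q" "q < r" "r < 1"
    have Qi: "frac_intble 1 (Q b) r" by (rule frac_intble_bounded_cont(1)[OF _ Qc, of _ B]) (use B pqr in auto)
    have "three_point p q r R = three_point p q r (frac_int (2 - 2 * a) (W b))
       - (Ab b * three_point p q r (kern (3 - a)) + three_point p q r (frac_int 2 (Q b)))"
      by (simp add: three_point_def R_def algebra_simps)
    then show "three_point p q r R = 0"
      using three_point_W[OF pqr b] three_point_frac_int_2(1)[OF pqr Qi] by simp
  next
    have k3: "((\<lambda>x. Ab b * (kern (3 - a) x / x)) \<longlongrightarrow> Ab b * 0) (at_right 0)"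
    proof (intro tendsto_intros)
      have "((\<lambda>x. x powr (1 - a) / Gamma (3 - a)) \<longlongrightarrow> 0 powr (1 - a) / Gamma (3 - a)) (at_right 0)"
      proof (intro tendsto_divide tendsto_const tendsto_powr2 tendsto_ident_at)
        have "0 < 3 - a" using a_less by simp
        from Gamma_real_pos[OF this] show "Gamma (3 - a) \<noteq> 0" by linarith
      qed (use a_less in \<open>auto simp: eventually_at_filter\<close>)
      moreover have "\<forall>\<^sub>F x in at_right 0. x powr (1 - a) / Gamma (3 - a) = kern (3 - a) x / x"
        using eventually_at_right_less[of 0]
      proof eventually_elim
        case (elim x)
        have "x powr (2 - a) = x * x powr (1 - a)" using elim powr_mult_base[of x "1 - a"] by simp
        then show ?case using elim by (simp add: kern_def)
      qed
      ultimately show "((\<lambda>x. kern (3 - a) x / x) \<longlongrightarrow> 0) (at_right 0)"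
        using a_less by (auto elim: Lim_transform_eventually)
    qed
    have q3: "((\<lambda>x. frac_int 2 (Q b) x / x) \<longlongrightarrow> 0) (at_right 0)"
    proof (rule Lim_null_comparison)
      show "((\<lambda>x. B * (x / Gamma 3)) \<longlongrightarrow> 0) (at_right 0)" by (auto intro!: tendsto_eq_intros simp: Gamma_numeral)
      show "\<forall>\<^sub>F x in at_right 0. norm (frac_int 2 (Q b) x / x) \<le> B * (x / Gamma 3)"
        using eventually_at_right_real[of 0 1, OF zero_less_one]
      proof eventually_elim
        case (elim x)
        have "\<bar>frac_int 2 (Q b) x\<bar> \<le> frac_int 2 (\<lambda>t. B) x"
          by (rule frac_int_abs_le[OF _ frac_intble_const]) (use B elim in auto)
        also have "\<dots> = B * (x / Gamma 3) * x" using elim by (simp add: frac_int_const kern_def powr_numeral power2_eq_square)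
        finally show ?case using elim by (simp add: abs_divide divide_le_eq)
      qed
    qed
    have "((\<lambda>x. frac_int (2 - 2 * a) (W b) x / x - (Ab b * (kern (3 - a) x / x) + frac_int 2 (Q b) x / x)) \<longlongrightarrow> 0 - (Ab b * 0 + 0)) (at_right 0)"
      by (intro tendsto_diff tendsto_add W_over_x[OF b] k3 q3)
    then show "((\<lambda>x. R x / x) \<longlongrightarrow> 0) (at_right 0)" by (simp add: R_def diff_divide_distrib add_divide_distrib)
  qed
  then show ?thesis by (simp add: R_def)
qed

section \<open>Passage from [-b, b] to [-pi, pi]\<close>

definition bs :: "nat \<Rightarrow> real" where "bs j = pi * (1 - 1 / (real j + 2))"

lemma bs: "0 < bs j" "bs j < pi" "bs \<longlonglongrightarrow> pi"
proof -
  have "(\<lambda>j. pi * (1 - 1 / (real j + 2))) \<longlonglongrightarrow> pi" by real_asymp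
  then show "bs \<longlonglongrightarrow> pi" by (simp add: bs_def[abs_def])
  have "0 < 1 - 1 / (real j + 2)" "1 - 1 / (real j + 2) < 1" by (auto simp: field_simps)
  then show "0 < bs j" "bs j < pi"
    unfolding bs_def using mult_strict_left_mono[of "1 - 1 / (real j + 2)" 1 pi] by simp_all
qed

lemma kappa_lim: "(\<lambda>j. \<kappa> (bs j)) \<longlonglongrightarrow> real m / 2"
proof -
  have "(\<lambda>j. real m * pi / (2 * bs j)) \<longlonglongrightarrow> real m * pi / (2 * pi)"
    by (intro tendsto_intros bs) auto
  then show ?thesis by (simp add: \<kappa>_def)
qed

lemma W_pi: "W pi x = integral {-pi..pi} (\<lambda>y. w x y * sv m y)"
  by (simp add: W_def \<eta>_def \<kappa>_def sv_def)

text \<open>Dominated convergence with the integrands extended by 0. At y = pi and y = -pi the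
  extensions are always 0, which agrees with the limit because w vanishes there.\<close>

lemma W_lim:
  assumes x: "0 \<le> x" "x \<le> 1"
  shows "(\<lambda>j. W (bs j) x) \<longlonglongrightarrow> W pi x"
proof -
  obtain B where B: "B > 0" "\<And>x y. 0 \<le> x \<Longrightarrow> x \<le> 1 \<Longrightarrow> -pi \<le> y \<Longrightarrow> y \<le> pi \<Longrightarrow> \<bar>w x y\<bar> \<le> B"
    by (rule w_bounded) blast
  define F where "F = (\<lambda>j y. if y \<in> {- bs j..bs j} then w x y * \<eta> (bs j) y else 0)"
  have F: "(F j has_integral W (bs j) x) {-pi..pi}" for j
  proof -
    have "continuous_on {- bs j..bs j} (\<lambda>y. w x y * \<eta> (bs j) y)"
      by (intro continuous_intros eta_cont continuous_on_subset[OF w_cont_y]) (use x bs(1,2)[of j] in auto)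
    then have "((\<lambda>y. w x y * \<eta> (bs j) y) has_integral W (bs j) x) {- bs j..bs j}"
      unfolding W_def by (intro integrable_integral integrable_continuous_real)
    then show ?thesis unfolding F_def
      by (subst has_integral_restrict) (use bs(1,2)[of j] in auto)
  qed
  have "(\<lambda>j. integral {-pi..pi} (F j)) \<longlonglongrightarrow> integral {-pi..pi} (\<lambda>y. w x y * \<eta> pi y)"
  proof (rule dominated_convergence(2)[where h = "\<lambda>y. B"])
    show "F j integrable_on {-pi..pi}" for j using F[of j] by blast
    show "norm (F j y) \<le> B" if "y \<in> {-pi..pi}" for j y
    proof -
      have "\<bar>w x y\<bar> * \<bar>\<eta> (bs j) y\<bar> \<le> B * 1" using B x that eta_le by (intro mult_mono) auto
      then show ?thesis using B(1) by (auto simp: F_def abs_mult)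
    qed
    show "(\<lambda>j. F j y) \<longlonglongrightarrow> w x y * \<eta> pi y" if y: "y \<in> {-pi..pi}" for y
    proof (cases "y = pi \<or> y = -pi")
      case True
      have "F j y = 0" for j using True bs(1,2)[of j] by (auto simp: F_def)
      moreover have "w x y = 0" using True zero_y[OF x] by auto
      ultimately show ?thesis by simp
    next
      case False
      then have "\<bar>y\<bar> < pi" using y by auto
      have "(\<lambda>j. w x y * sin (\<kappa> (bs j) * (y + bs j))) \<longlonglongrightarrow> w x y * sin (real m / 2 * (y + pi))"
        by (intro tendsto_intros kappa_lim bs)
      moreover have "\<forall>\<^sub>F j in sequentially. w x y * sin (\<kappa> (bs j) * (y + bs j)) = F j y"
        using order_tendstoD(1)[OF bs(3) \<open>\<bar>y\<bar> < pi\<close>]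
        by eventually_elim (auto simp: F_def \<eta>_def abs_less_iff)
      ultimately have "(\<lambda>j. F j y) \<longlonglongrightarrow> w x y * sin (real m / 2 * (y + pi))" by (rule Lim_transform_eventually)
      then show ?thesis by (simp add: \<eta>_def \<kappa>_def)
    qed
  qed auto
  then show ?thesis using integral_unique[OF F] by (simp add: W_def[of pi])
qed

definition \<mu>2 :: real where "\<mu>2 = c\<^sup>2 + d * (real m / 2)\<^sup>2"

text \<open>The boundary terms tend to 0 because w is continuous up to y = pi and y = -pi and
  vanishes there; this is the gain from having no y-derivative in \<open>bdry\<close>.\<close>

lemma Q_lim:
  assumes x: "0 \<le> x" "x \<le> 1"
  shows "(\<lambda>j. Q (bs j) x) \<longlonglongrightarrow> \<mu>2 * W pi x"
proof -
  have wl: "(\<lambda>j. w x (bs j)) \<longlonglongrightarrow> w x pi" "(\<lambda>j. w x (- bs j)) \<longlonglongrightarrow> w x (-pi)"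
  proof -
    have mem: "bs j \<in> {-pi..pi}" "- bs j \<in> {-pi..pi}" for j
      using bs(1,2)[of j] by auto
    show "(\<lambda>j. w x (bs j)) \<longlonglongrightarrow> w x pi"
      by (rule continuous_on_tendsto_compose[OF w_cont_y[OF x] bs(3)]) (use mem in auto)
    show "(\<lambda>j. w x (- bs j)) \<longlonglongrightarrow> w x (-pi)"
      by (rule continuous_on_tendsto_compose[OF w_cont_y[OF x] tendsto_minus[OF bs(3)]]) (use mem in auto)
  qed
  have "(\<lambda>j. d * (w x (bs j) * (\<kappa> (bs j) * cos (\<kappa> (bs j) * (bs j + bs j))) - w x (- bs j) * \<kappa> (bs j)))
    \<longlonglongrightarrow> d * (w x pi * (real m / 2 * cos (real m / 2 * (pi + pi))) - w x (-pi) * (real m / 2))"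
    by (intro tendsto_intros wl kappa_lim bs)
  then have "(\<lambda>j. bdry (bs j) x) \<longlonglongrightarrow> 0" using zero_y[OF x] by (simp add: bdry_def)
  then have "(\<lambda>j. (c\<^sup>2 + d * (\<kappa> (bs j))\<^sup>2) * W (bs j) x + bdry (bs j) x) \<longlonglongrightarrow> (c\<^sup>2 + d * (real m / 2)\<^sup>2) * W pi x + 0"
    by (intro tendsto_intros kappa_lim W_lim[OF x])
  then show ?thesis by (simp add: Q_def \<mu>2_def)
qed

text \<open>The inner intervals lie in [-pi, pi] and the frequencies converge, so w being bounded
  gives majorants uniform in j for the passage to the limit.\<close>

lemma uniform_bounds:
  obtains B where "\<And>j t. 0 \<le> t \<Longrightarrow> t \<le> 1 \<Longrightarrow> \<bar>W (bs j) t\<bar> \<le> B" "\<And>j t. 0 \<le> t \<Longrightarrow> t \<le> 1 \<Longrightarrow> \<bar>Q (bs j) t\<bar> \<le> B"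
    "\<And>t. 0 \<le> t \<Longrightarrow> t \<le> 1 \<Longrightarrow> \<bar>W pi t\<bar> \<le> B"
proof -
  obtain B where B: "B > 0" "\<And>x y. 0 \<le> x \<Longrightarrow> x \<le> 1 \<Longrightarrow> -pi \<le> y \<Longrightarrow> y \<le> pi \<Longrightarrow> \<bar>w x y\<bar> \<le> B"
    by (rule w_bounded) blast
  define B1 where "B1 = B * (2 * pi)"
  have B1: "B1 > 0" using B(1) by (simp add: B1_def)
  have Wb: "\<bar>W b t\<bar> \<le> B1" if b: "0 < b" "b \<le> pi" and t: "0 \<le> t" "t \<le> 1" for b t
  proof -
    have "norm (integral (cbox (-b) b) (\<lambda>y. w t y * \<eta> b y)) \<le> B * measure lborel (cbox (-b) b)"
    proof (rule Henstock_Kurzweil_Integration.integrable_bound[OF less_imp_le[OF B(1)]])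
      have "continuous_on {-b..b} (\<lambda>y. w t y * \<eta> b y)"
        by (intro continuous_intros eta_cont continuous_on_subset[OF w_cont_y]) (use t b in auto)
      then show "(\<lambda>y. w t y * \<eta> b y) integrable_on cbox (-b) b" by (simp add: integrable_continuous_real)
      fix y assume "y \<in> cbox (-b) b"
      then have "\<bar>w t y\<bar> * \<bar>\<eta> b y\<bar> \<le> B * 1" using B t b eta_le by (intro mult_mono) auto
      then show "norm (w t y * \<eta> b y) \<le> B" by (simp add: abs_mult)
    qed
    also have "\<dots> \<le> B1" using b B(1) by (simp add: B1_def)
    finally show ?thesis by (simp add: W_def)
  qed
  have "Bseq (\<lambda>j. \<kappa> (bs j))" using kappa_lim by (intro convergent_imp_Bseq) (auto simp: convergent_def)
  then obtain K where K: "K > 0" "\<And>j. \<bar>\<kappa> (bs j)\<bar> \<le> K" by (auto simp: Bseq_def)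
  define B2 where "B2 = (c\<^sup>2 + d * K\<^sup>2) * B1 + d * (B * K + B * K)"
  have Qb: "\<bar>Q (bs j) t\<bar> \<le> B2" if t: "0 \<le> t" "t \<le> 1" for j t
  proof -
    have "(\<kappa> (bs j))\<^sup>2 \<le> K\<^sup>2" using K(2)[of j] by (metis abs_ge_zero power2_abs power_mono)
    then have "(c\<^sup>2 + d * (\<kappa> (bs j))\<^sup>2) * \<bar>W (bs j) t\<bar> \<le> (c\<^sup>2 + d * K\<^sup>2) * B1"
      using Wb[of "bs j" t] bs(1,2)[of j] t d by (intro mult_mono add_left_mono mult_left_mono) auto
    moreover have "\<bar>(c\<^sup>2 + d * (\<kappa> (bs j))\<^sup>2) * W (bs j) t\<bar> = (c\<^sup>2 + d * (\<kappa> (bs j))\<^sup>2) * \<bar>W (bs j) t\<bar>"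
      using d by (simp add: abs_mult)
    moreover have "\<bar>bdry (bs j) t\<bar> \<le> d * (B * K + B * K)"
    proof -
      have "\<bar>w t (bs j)\<bar> * (\<bar>\<kappa> (bs j)\<bar> * \<bar>cos (\<kappa> (bs j) * (bs j + bs j))\<bar>) \<le> B * (K * 1)"
        using B(2)[of t "bs j"] bs(1,2)[of j] t K B(1) by (intro mult_mono) auto
      moreover have "\<bar>w t (- bs j)\<bar> * \<bar>\<kappa> (bs j)\<bar> \<le> B * K"
        using B(2)[of t "- bs j"] bs(1,2)[of j] t K B(1) by (intro mult_mono) auto
      ultimately have "\<bar>w t (bs j) * (\<kappa> (bs j) * cos (\<kappa> (bs j) * (bs j + bs j))) - w t (- bs j) * \<kappa> (bs j)\<bar> \<le> B * K + B * K"
        unfolding abs_mult[symmetric] by linarith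
      then have "d * \<bar>w t (bs j) * (\<kappa> (bs j) * cos (\<kappa> (bs j) * (bs j + bs j))) - w t (- bs j) * \<kappa> (bs j)\<bar> \<le> d * (B * K + B * K)"
        using d by (intro mult_left_mono) auto
      then show ?thesis using d by (simp add: bdry_def abs_mult)
    qed
    ultimately show ?thesis unfolding Q_def B2_def by linarith
  qed
  show ?thesis
  proof (rule that[of "max B1 B2"])
    show "\<bar>W (bs j) t\<bar> \<le> max B1 B2" if "0 \<le> t" "t \<le> 1" for j t using Wb[of "bs j" t] bs(1,2)[of j] that by simp
    show "\<bar>Q (bs j) t\<bar> \<le> max B1 B2" if "0 \<le> t" "t \<le> 1" for j t using Qb[OF that, of j] by simp
    show "\<bar>W pi t\<bar> \<le> max B1 B2" if "0 \<le> t" "t \<le> 1" for t using Wb[of pi t] that by simp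
  qed
qed

text \<open>Convergence of \<open>Ab (bs j)\<close> is not known beforehand, since nothing bounds A
  near y = pi. All other terms converge, and evaluation at x = 1/2, where
  \<open>kern (3 - a)\<close> is positive, yields the limit.\<close>

lemma W_pi_representation:
  obtains A\<pi> where "\<And>x. 0 < x \<Longrightarrow> x < 1 \<Longrightarrow> frac_int (2 - 2 * a) (W pi) x = A\<pi> * kern (3 - a) x + \<mu>2 * frac_int 2 (W pi) x"
proof -
  obtain B where B: "\<And>j t. 0 \<le> t \<Longrightarrow> t \<le> 1 \<Longrightarrow> \<bar>W (bs j) t\<bar> \<le> B" "\<And>j t. 0 \<le> t \<Longrightarrow> t \<le> 1 \<Longrightarrow> \<bar>Q (bs j) t\<bar> \<le> B"
    by (rule uniform_bounds) blast
  have p: "0 < 2 - 2 * a" using a_less by simp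
  have mW: "set_borel_measurable borel {0<..<x} (W (bs j))" and mQ: "set_borel_measurable borel {0<..<x} (Q (bs j))"
    if x: "x < 1" for x j
  proof -
    have cW: "continuous_on {0<..<1} (W (bs j))" and cQ: "continuous_on {0<..<1} (Q (bs j))"
      by (rule continuous_on_subset[OF W_cont] continuous_on_subset[OF Q_cont]; use bs(1,2)[of j] in auto)+
    show "set_borel_measurable borel {0<..<x} (W (bs j))"
      by (rule frac_intble_bounded_cont(2)[OF zero_less_one cW, of B]) (use B x in auto)
    show "set_borel_measurable borel {0<..<x} (Q (bs j))"
      by (rule frac_intble_bounded_cont(2)[OF zero_less_one cQ, of B]) (use B x in auto)
  qed
  define L where "L = (\<lambda>x. frac_int (2 - 2 * a) (W pi) x - \<mu>2 * frac_int 2 (W pi) x)"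
  have lim: "(\<lambda>j. Ab (bs j) * kern (3 - a) x) \<longlonglongrightarrow> L x" if x: "0 < x" "x < 1" for x
  proof -
    have "(\<lambda>j. frac_int (2 - 2 * a) (W (bs j)) x) \<longlonglongrightarrow> frac_int (2 - 2 * a) (W pi) x"
      by (rule frac_int_dominated[OF p mW B(1) W_lim]) (use x in auto)
    moreover have "(\<lambda>j. frac_int 2 (Q (bs j)) x) \<longlonglongrightarrow> frac_int 2 (\<lambda>t. \<mu>2 * W pi t) x"
      by (rule frac_int_dominated[OF _ mQ B(2) Q_lim]) (use x in auto)
    ultimately have "(\<lambda>j. frac_int (2 - 2 * a) (W (bs j)) x - frac_int 2 (Q (bs j)) x) \<longlonglongrightarrow> L x"
      unfolding L_def frac_int_cmult by (rule tendsto_diff)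
    then show ?thesis using W_representation[OF bs(1,2) x] by simp
  qed
  define k where "k = kern (3 - a) (1/2)"
  have k: "k > 0" unfolding k_def using a_less by (intro kern_pos) auto
  define A\<pi> where "A\<pi> = L (1/2) / k"
  have "(\<lambda>j. Ab (bs j) * k / k) \<longlonglongrightarrow> L (1/2) / k"
    using lim[of "1/2"] k by (intro tendsto_divide tendsto_const) (auto simp: k_def)
  then have A_lim: "(\<lambda>j. Ab (bs j)) \<longlonglongrightarrow> A\<pi>" using k by (simp add: A\<pi>_def)
  have "L x = A\<pi> * kern (3 - a) x" if "0 < x" "x < 1" for x
    by (rule LIMSEQ_unique[OF lim[OF that]]) (intro tendsto_intros A_lim)
  then show ?thesis unfolding L_def by (intro that[of A\<pi>]) (simp add: diff_eq_eq)
qed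

text \<open>Subtracting a multiple of the Mittag-Leffler solution X removes the inhomogeneous term.
  The remainder satisfies a homogeneous Volterra equation after double integration, hence vanishes,
  and the condition at x = 1 then removes the multiple of X.\<close>

lemma W_pi_zero:
  assumes x: "0 < x" "x < 1"
  shows "W pi x = 0"
proof -
  obtain A\<pi> where A\<pi>: "\<And>x. 0 < x \<Longrightarrow> x < 1 \<Longrightarrow> frac_int (2 - 2 * a) (W pi) x = A\<pi> * kern (3 - a) x + \<mu>2 * frac_int 2 (W pi) x"
    by (rule W_pi_representation) blast
  obtain B where B: "\<And>t. 0 \<le> t \<Longrightarrow> t \<le> 1 \<Longrightarrow> \<bar>W pi t\<bar> \<le> B" by (rule uniform_bounds) blast
  have p: "0 < 2 - 2 * a" "0 < 2 * a" "0 < 1 + a" using a a_less by auto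
  have mu: "\<mu>2 \<ge> 0" using d by (simp add: \<mu>2_def)
  \<comment> \<open>The solution of the same integral equation with coefficient 1 in front of
    \<open>kern (3 - a)\<close>; it behaves like x^a / Gamma(a + 1) at 0.\<close>
  define X where "X = (\<lambda>t. t powr a * mittag_leffler (2 * a) (1 + a) (\<mu>2 * t powr (2 * a)))"
  have Xk: "X t = ml_kern (2 * a) (1 + a) \<mu>2 t" if "0 < t" for t
    using that by (simp add: X_def ml_kern_def)
  have Xc: "continuous_on {0..1} X"
    unfolding X_def using a by (intro continuous_intros continuous_on_powr') auto
  from compact_imp_bounded[OF compact_continuous_image[OF Xc compact_Icc]]
  obtain BX where BX: "\<And>t. 0 \<le> t \<Longrightarrow> t \<le> 1 \<Longrightarrow> \<bar>X t\<bar> \<le> BX" unfolding bounded_iff by auto force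
  have fX: "frac_int g X x = ml_kern (2 * a) (1 + a + g) \<mu>2 x" if "0 < g" "0 < x" for g x
  proof -
    have "frac_int g X x = frac_int g (ml_kern (2 * a) (1 + a) \<mu>2) x" by (rule frac_int_cong) (simp add: Xk)
    then show ?thesis using frac_int_ml_kern[OF p(2,3) that] by simp
  qed
  have Xrep: "frac_int (2 - 2 * a) X x = kern (3 - a) x + \<mu>2 * frac_int 2 X x" if "0 < x" for x
  proof -
    have "frac_int (2 - 2 * a) X x = ml_kern (2 * a) (3 - a) \<mu>2 x" using fX[OF p(1) that] by (simp add: algebra_simps)
    also have "\<dots> = kern (3 - a) x + \<mu>2 * ml_kern (2 * a) (3 - a + 2 * a) \<mu>2 x"
      by (rule ml_kern_shift) (use p a_less that in auto)
    also have "ml_kern (2 * a) (3 - a + 2 * a) \<mu>2 x = frac_int 2 X x" using fX[of 2 x] that by (simp add: algebra_simps)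
    finally show ?thesis .
  qed
  define D where "D = (\<lambda>t. W pi t - A\<pi> * X t)"
  have Dc1: "continuous_on {0..1} D" unfolding D_def by (intro continuous_intros W_cont Xc) auto
  have Dc: "continuous_on {0<..<1} D" by (rule continuous_on_subset[OF Dc1]) auto
  from compact_imp_bounded[OF compact_continuous_image[OF Dc1 compact_Icc]]
  obtain BD where BD0: "\<And>t. t \<in> {0..1} \<Longrightarrow> \<bar>D t\<bar> \<le> BD" unfolding bounded_iff by auto force
  have BD: "\<bar>D t\<bar> \<le> BD" if "0 < t" "t < 1" for t using BD0[of t] that by simp
  have Xc': "continuous_on {0<..<1} X" and Wc': "continuous_on {0<..<1} (W pi)"
    by (auto intro: continuous_on_subset[OF Xc] continuous_on_subset[OF W_cont])
  have iX: "frac_intble g X t" and iW: "frac_intble g (W pi) t" if "0 < g" "t \<le> 1" for g t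
    using frac_intble_bounded_cont(1)[OF that(1) Xc', of BX t] frac_intble_bounded_cont(1)[OF that(1) Wc', of B t] BX B that by auto
  have Ddiff: "frac_int g D t = frac_int g (W pi) t - A\<pi> * frac_int g X t" if "0 < g" "t \<le> 1" for g t
    unfolding D_def using frac_int_diff[OF iW[OF that] frac_intble_cmult[OF iX[OF that]]] by (simp add: frac_int_cmult)
  have Dint: "frac_intble g D t" "set_borel_measurable borel {0<..<t} D" if "0 < g" "t \<le> 1" for g t
    using frac_intble_bounded_cont[OF that(1) Dc _ that(2), of BD] BD by auto
  \<comment> \<open>Applying I^(2a) to I^(2-2a) D = \<mu>2 J closes the equation for J = I^2 D
    without inverting a fractional integral.\<close>
  define J where "J = frac_int 2 D"
  have Deq: "frac_int (2 - 2 * a) D t = \<mu>2 * J t" if t: "0 < t" "t < 1" for t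
  proof -
    have "frac_int (2 - 2 * a) D t = A\<pi> * kern (3 - a) t + \<mu>2 * frac_int 2 (W pi) t - A\<pi> * (kern (3 - a) t + \<mu>2 * frac_int 2 X t)"
      using Ddiff[OF p(1), of t] t unfolding A\<pi>[OF t] Xrep[OF t(1)] by simp
    also have "\<dots> = \<mu>2 * (frac_int 2 (W pi) t - A\<pi> * frac_int 2 X t)" by (simp add: algebra_simps)
    also have "frac_int 2 (W pi) t - A\<pi> * frac_int 2 X t = J t" unfolding J_def using Ddiff[of 2 t] t by simp
    finally show ?thesis .
  qed
  have "J t = 0" if t: "0 < t" "t < 1" for t
  proof (rule volterra_zero[OF p(2) mu _ _ t])
    fix s :: real assume s: "0 < s" "s < 1"
    have "\<bar>J s\<bar> \<le> frac_int 2 (\<lambda>t. BD) s"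
      unfolding J_def by (rule frac_int_abs_le[OF _ frac_intble_const]) (use BD s in auto)
    also have "\<dots> = BD * (s\<^sup>2 / Gamma 3)" using s by (simp add: frac_int_const kern_def powr_numeral)
    also have "\<dots> \<le> BD * (1 / Gamma 3)"
    proof (intro mult_left_mono divide_right_mono)
      show "s\<^sup>2 \<le> 1" using s by (simp add: power_le_one)
      show "0 \<le> Gamma (3::real)" by (simp add: less_imp_le)
      show "0 \<le> BD" using BD[OF s] by linarith
    qed
    finally show "\<bar>J s\<bar> \<le> BD * (1 / Gamma 3)" .
    have "J s = frac_int (2 * a + (2 - 2 * a)) D s" by (simp add: J_def)
    also have "\<dots> = frac_int (2 * a) (frac_int (2 - 2 * a) D) s"
      by (rule frac_int_frac_int[symmetric, OF p(2,1)]) (use Dint[of 2 s] s in auto)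
    also have "\<dots> = frac_int (2 * a) (\<lambda>t. \<mu>2 * J t) s" by (rule frac_int_cong) (use Deq s in auto)
    finally show "J s = \<mu>2 * frac_int (2 * a) J s" by (simp only: frac_int_cmult)
  qed
  then have J0: "frac_int 1 (frac_int 1 D) t = 0" if "0 < t" "t < 1" for t
    using frac_int_frac_int[of 1 1 t D] Dint[of 2 t] that by (simp add: J_def)
  have I1d: "((\<lambda>x. frac_int 1 D x) has_real_derivative D t) (at t)" if "0 < t" "t < 1" for t
    by (rule frac_int_1_deriv[OF Dc _ that]) (use Dint in auto)
  have I1c: "continuous_on {0<..<1} (frac_int 1 D)"
    by (rule DERIV_continuous_on[OF has_field_derivative_at_within[OF I1d]]) auto
  have I1b: "\<bar>frac_int 1 D t\<bar> \<le> BD" if t: "0 < t" "t < 1" for t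
  proof -
    have "\<bar>frac_int 1 D t\<bar> \<le> frac_int 1 (\<lambda>t. BD) t"
      by (rule frac_int_abs_le[OF _ frac_intble_const]) (use BD t in auto)
    also have "\<dots> = BD * t" using t by (simp add: frac_int_const kern_2)
    also have "\<dots> \<le> BD" using BD[OF t] t by (simp add: mult_left_le)
    finally show ?thesis .
  qed
  have I10: "frac_int 1 D t = 0" if "0 < t" "t < 1" for t by (rule frac_int_1_zero[OF I1c I1b J0 that])
  have D0: "D t = 0" if "0 < t" "t < 1" for t by (rule frac_int_1_zero[OF Dc BD I10 that])
  have cl: "closure {0<..<1::real} = {0..1}" by simp
  \<comment> \<open>Continuity carries D = 0 to x = 1, where \<open>W pi\<close> vanishes and X is
    positive; so the coefficient of X is 0.\<close>
  have "D 1 = 0"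
    by (rule continuous_constant_on_closure[of "{0<..<1}" D 0 1]) (use Dc1 D0 in auto)
  moreover have "W pi 1 = 0"
  proof -
    have "W pi 1 = integral {-pi..pi} (\<lambda>y. 0)" unfolding W_def
      by (rule Henstock_Kurzweil_Integration.integral_cong) (use zero_x(2) in auto)
    then show ?thesis by simp
  qed
  moreover have "X 1 > 0" unfolding X_def using mittag_leffler_pos(2)[OF p(2,3) mu] by simp
  ultimately have "A\<pi> = 0" by (simp add: D_def)
  then show ?thesis using D0[OF x] by (simp add: D_def)
qed

end

lemma w_zero:
  assumes "0 \<le> x" "x \<le> 1" "-pi \<le> y" "y \<le> pi"
  shows "w x y = 0"
proof (cases "x = 0 \<or> x = 1")
  case True
  then show ?thesis using zero_x assms by auto
next
  case False
  then have x: "0 < x" "x < 1" using assms by auto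
  show ?thesis
  proof (rule sv_complete[of "w x"])
    show "continuous_on {-pi..pi} (w x)" by (rule w_cont_y[OF assms(1,2)])
    show "integral {-pi..pi} (\<lambda>y. w x y * sv m y) = 0" if "m \<ge> 1" for m
      using W_pi_zero[OF that x] W_pi[OF that] by simp
  qed (use assms in auto)
qed

end

section \<open>Uniqueness\<close>

context zero_problem
begin

text \<open>At a positive interior maximum the equation makes s times the second x-derivative of w
  nonnegative. The quadratic e/2 x^2 adds e > 0 to it, which contradicts the second derivative
  test.\<close>

lemma max_principle_1:
  assumes a1: "a = 1" and s: "s = 1 \<or> s = -1" and xy: "0 \<le> x1" "x1 \<le> 1" "-pi \<le> y1" "y1 \<le> pi"
  shows "s * w x1 y1 \<le> 0"
proof (rule ccontr)
  assume neg: "\<not> s * w x1 y1 \<le> 0"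
  define e where "e = s * w x1 y1"
  have e: "e > 0" using neg by (simp add: e_def)
  define f where "f = (\<lambda>x y. s * w x y + e / 2 * x\<^sup>2)"
  have "compact ({0..1::real} \<times> {-pi..pi})" by (intro compact_Times compact_Icc)
  moreover have "({0..1::real} \<times> {-pi..pi}) \<noteq> {}" using xy by auto
  moreover have "continuous_on ({0..1} \<times> {-pi..pi}) (\<lambda>z. f (fst z) (snd z))"
    unfolding f_def by (intro continuous_intros cont)
  ultimately obtain z0 where z0: "z0 \<in> {0..1} \<times> {-pi..pi}"
    "\<And>z. z \<in> {0..1} \<times> {-pi..pi} \<Longrightarrow> f (fst z) (snd z) \<le> f (fst z0) (snd z0)"
    using continuous_attains_sup by meson
  define x0 y0 where "x0 = fst z0" and "y0 = snd z0"
  have r0: "0 \<le> x0" "x0 \<le> 1" "-pi \<le> y0" "y0 \<le> pi" using z0(1) by (auto simp: x0_def y0_def)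
  have max: "f x y \<le> f x0 y0" if "0 \<le> x" "x \<le> 1" "-pi \<le> y" "y \<le> pi" for x y
    using z0(2)[of "(x, y)"] that by (auto simp: x0_def y0_def)
  have "e \<le> f x1 y1" using e by (simp add: f_def e_def)
  then have fe: "e \<le> f x0 y0" using max[OF xy] by linarith
  have sq: "x0\<^sup>2 \<le> 1" using r0 by (simp add: power_le_one)
  have "e / 2 * x0\<^sup>2 \<le> e / 2 * 1" using sq e by (intro mult_left_mono) auto
  \<comment> \<open>The perturbation is at most e / 2 while the maximum is at least e. Hence w is
    nonzero at the maximum point, which therefore lies in the interior.\<close>
  then have sw: "s * w x0 y0 \<ge> e / 2" using fe by (simp add: f_def)
  then have wn: "w x0 y0 \<noteq> 0" using e by auto
  have "x0 \<noteq> 0" "x0 \<noteq> 1" "y0 \<noteq> -pi" "y0 \<noteq> pi"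
    using wn zero_x r0 zero_y by auto
  then have r: "0 < x0" "x0 < 1" "-pi < y0" "y0 < pi" using r0 by auto
  have w1: "((\<lambda>s. w s y0) has_real_derivative deriv (\<lambda>s. w s y0) t) (at t)" if "0 < t" "t < 1" for t
    using ex1[OF that r(3,4)] a1 by (simp add: caputo_exists_def DERIV_deriv_iff_real_differentiable)
  have c1: "caputo a g = deriv g" for g by (rule ext) (simp add: caputo_def a1)
  have w2: "(deriv (\<lambda>s. w s y0) has_real_derivative (c\<^sup>2 * w x0 y0 - d * wyy x0 y0)) (at x0)"
  proof -
    have "deriv (\<lambda>s. w s y0) differentiable (at x0)"
      using ex2[OF r] a1 unfolding c1 by (simp add: caputo_exists_def)
    then have "(deriv (\<lambda>s. w s y0) has_real_derivative deriv (deriv (\<lambda>s. w s y0)) x0) (at x0)"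
      by (simp only: DERIV_deriv_iff_real_differentiable)
    then show ?thesis using eq[OF r] unfolding c1 by (simp only:)
  qed
  have "s * (c\<^sup>2 * w x0 y0 - d * wyy x0 y0) + e \<le> 0"
  proof (rule second_derivative_max[OF r(1,2), where f = "\<lambda>t. f t y0" and f' = "\<lambda>t. s * deriv (\<lambda>s. w s y0) t + e * t"])
    show "((\<lambda>t. f t y0) has_real_derivative s * deriv (\<lambda>s. w s y0) t + e * t) (at t)" if "0 < t" "t < 1" for t
      unfolding f_def by (rule DERIV_cong[OF DERIV_add[OF DERIV_cmult[OF w1[OF that]]]])
        (auto intro!: derivative_eq_intros)
    show "((\<lambda>t. s * deriv (\<lambda>s. w s y0) t + e * t) has_real_derivative s * (c\<^sup>2 * w x0 y0 - d * wyy x0 y0) + e) (at x0)"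
      by (rule DERIV_add[OF DERIV_cmult[OF w2]]) (auto intro!: derivative_eq_intros)
    show "f t y0 \<le> f x0 y0" if "0 < t" "t < 1" for t using max[of t y0] that r by simp
  qed
  moreover have "s * wyy x0 y0 \<le> 0"
  proof (rule second_derivative_max[OF r(3,4), where f = "\<lambda>y. s * w x0 y" and f' = "\<lambda>y. s * wy x0 y"])
    show "((\<lambda>y. s * w x0 y) has_real_derivative s * wy x0 y) (at y)" if "-pi < y" "y < pi" for y
      by (rule DERIV_cmult[OF wy[OF r(1,2) that]])
    show "((\<lambda>y. s * wy x0 y) has_real_derivative s * wyy x0 y0) (at y0)"
      by (rule DERIV_cmult[OF wyy[OF r]])
    show "s * w x0 y \<le> s * w x0 y0" if "-pi < y" "y < pi" for y
      using max[of x0 y] that r by (simp add: f_def)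
  qed
  then have "d * (s * wyy x0 y0) \<le> 0" using d by (simp add: mult_nonneg_nonpos)
  moreover have "c\<^sup>2 * (s * w x0 y0) \<ge> 0" using sw e by simp
  moreover have "s * (c\<^sup>2 * w x0 y0 - d * wyy x0 y0) = c\<^sup>2 * (s * w x0 y0) - d * (s * wyy x0 y0)"
    by (simp add: algebra_simps)
  ultimately show False using e by linarith
qed

lemma zero_solution:
  assumes "0 \<le> x" "x \<le> 1" "-pi \<le> y" "y \<le> pi"
  shows "w x y = 0"
proof (cases "a = 1")
  case True
  then show ?thesis using max_principle_1[OF True _ assms, of 1] max_principle_1[OF True _ assms, of "-1"] by simp
next
  case False
  then interpret zero_problem_frac a d c w wy wyy using a by unfold_locales auto
  show ?thesis by (rule w_zero[OF assms])
qed

end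

section \<open>Reduction of two solutions to the zero problem\<close>

definition caputo_twice_exists :: "real \<Rightarrow> (real \<Rightarrow> real) \<Rightarrow> bool" where
  "caputo_twice_exists a f \<longleftrightarrow> (\<forall>x. 0 < x \<longrightarrow> x < 1 \<longrightarrow> caputo_exists a f x \<and> caputo_exists a (caputo a f) x)"

lemma caputo_lincomb:
  assumes a: "0 < a" "a \<le> 1" and f: "caputo_exists a f x" and g: "caputo_exists a g x"
  shows "caputo_exists a (\<lambda>s. p * f s + q * g s) x"
    and "caputo a (\<lambda>s. p * f s + q * g s) x = p * caputo a f x + q * caputo a g x"
proof -
  have d: "((\<lambda>s. p * f s + q * g s) has_real_derivative p * deriv f t + q * deriv g t) (at t)"
    if "f differentiable (at t)" "g differentiable (at t)" for t
    using that by (auto intro!: DERIV_add DERIV_cmult simp: DERIV_deriv_iff_real_differentiable)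
  note d' = DERIV_imp_deriv[OF d]
  have "caputo_exists a (\<lambda>s. p * f s + q * g s) x \<and> caputo a (\<lambda>s. p * f s + q * g s) x = p * caputo a f x + q * caputo a g x"
  proof (cases "a = 1")
    case True
    then show ?thesis using f g d[of x] d'[of x] by (auto simp: caputo_exists_def caputo_def real_differentiable_def)
  next
    case False
    then have a1: "a < 1" using a by simp
    note f' = f[unfolded caputo_exists_frac_int[OF a1]] and g' = g[unfolded caputo_exists_frac_int[OF a1]]
    have dd: "deriv (\<lambda>s. p * f s + q * g s) t = p * deriv f t + q * deriv g t" if "0 < t" "t < x" for t
      using f' g' that by (intro d') auto
    have "frac_intble (1 - a) (\<lambda>t. p * deriv f t + q * deriv g t) x"
      using f' g' by (intro frac_intble_add frac_intble_cmult) auto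
    then have "frac_intble (1 - a) (deriv (\<lambda>s. p * f s + q * g s)) x"
      by (rule frac_intble_cong[THEN iffD1, rotated]) (simp add: dd)
    moreover have "frac_int (1 - a) (deriv (\<lambda>s. p * f s + q * g s)) x = frac_int (1 - a) (\<lambda>t. p * deriv f t + q * deriv g t) x"
      by (rule frac_int_cong) (simp add: dd)
    moreover have "\<dots> = p * frac_int (1 - a) (deriv f) x + q * frac_int (1 - a) (deriv g) x"
      using f' g' frac_int_add[of "1 - a" "\<lambda>t. p * deriv f t" x "\<lambda>t. q * deriv g t"]
      by (simp add: frac_intble_cmult frac_int_cmult)
    moreover have "\<forall>s\<in>{0<..<x}. (\<lambda>s. p * f s + q * g s) differentiable (at s)"
      using f' g' d unfolding real_differentiable_def[of "\<lambda>s. p * f s + q * g s"] by blast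
    ultimately show ?thesis by (simp add: caputo_exists_frac_int[OF a1] caputo_frac_int[OF a1])
  qed
  then show "caputo_exists a (\<lambda>s. p * f s + q * g s) x"
    "caputo a (\<lambda>s. p * f s + q * g s) x = p * caputo a f x + q * caputo a g x" by auto
qed

text \<open>The formula for the first derivative holds only inside (0, 1), so the second application
  of linearity goes through \<open>caputo_cong\<close>.\<close>

lemma caputo_twice_lincomb:
  assumes a: "0 < a" "a \<le> 1" and f: "caputo_twice_exists a f" and g: "caputo_twice_exists a g"
  shows "caputo_twice_exists a (\<lambda>s. p * f s + q * g s)"
    and "0 < x \<Longrightarrow> x < 1 \<Longrightarrow> caputo a (caputo a (\<lambda>s. p * f s + q * g s)) x
      = p * caputo a (caputo a f) x + q * caputo a (caputo a g) x"
proof -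
  note f' = f[unfolded caputo_twice_exists_def, rule_format] and g' = g[unfolded caputo_twice_exists_def, rule_format]
  have e: "caputo a (\<lambda>s. p * f s + q * g s) t = p * caputo a f t + q * caputo a g t" if "0 < t" "t < 1" for t
    by (rule caputo_lincomb(2)[OF a conjunct1[OF f'[OF that]] conjunct1[OF g'[OF that]]])
  have ex: "caputo_exists a (caputo a (\<lambda>s. p * f s + q * g s)) x" if x: "0 < x" "x < 1" for x
  proof -
    have "caputo_exists a (\<lambda>t. p * caputo a f t + q * caputo a g t) x"
      by (rule caputo_lincomb(1)[OF a conjunct2[OF f'[OF x]] conjunct2[OF g'[OF x]]])
    moreover have "caputo_exists a (caputo a (\<lambda>s. p * f s + q * g s)) x \<longleftrightarrow>
        caputo_exists a (\<lambda>t. p * caputo a f t + q * caputo a g t) x"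
      by (rule caputo_exists_cong[OF x e])
    ultimately show ?thesis by simp
  qed
  have "caputo_exists a (\<lambda>s. p * f s + q * g s) x" if x: "0 < x" "x < 1" for x
    by (rule caputo_lincomb(1)[OF a conjunct1[OF f'[OF x]] conjunct1[OF g'[OF x]]])
  with ex show "caputo_twice_exists a (\<lambda>s. p * f s + q * g s)"
    unfolding caputo_twice_exists_def by simp
  show "caputo a (caputo a (\<lambda>s. p * f s + q * g s)) x = p * caputo a (caputo a f) x + q * caputo a (caputo a g) x"
    if x: "0 < x" "x < 1"
  proof -
    have "caputo a (caputo a (\<lambda>s. p * f s + q * g s)) x = caputo a (\<lambda>t. p * caputo a f t + q * caputo a g t) x"
      by (rule caputo_cong[OF x e])
    also have "\<dots> = p * caputo a (caputo a f) x + q * caputo a (caputo a g) x"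
      by (rule caputo_lincomb(2)[OF a conjunct2[OF f'[OF x]] conjunct2[OF g'[OF x]]])
    finally show ?thesis .
  qed
qed

lemma regular_solutionD:
  assumes "regular_solution a \<epsilon> c u"
  shows "continuous_on ({0..1} \<times> {-pi..pi}) u"
    and "-pi < y \<Longrightarrow> y < pi \<Longrightarrow> caputo_twice_exists a (\<lambda>s. u (s, y))"
    and "0 < x \<Longrightarrow> x < 1 \<Longrightarrow> -pi < y \<Longrightarrow> y < pi \<Longrightarrow> ((\<lambda>t. u (x, t)) has_real_derivative deriv (\<lambda>t. u (x, t)) y) (at y)"
    and "0 < x \<Longrightarrow> x < 1 \<Longrightarrow> -pi < y \<Longrightarrow> y < pi \<Longrightarrow> (deriv (\<lambda>t. u (x, t)) has_real_derivative partial_yy u (x, y)) (at y)"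
    and "continuous_on ({0<..<1} \<times> {-pi<..<pi}) (partial_yy u)"
    and "0 < x \<Longrightarrow> x < 1 \<Longrightarrow> -pi < y \<Longrightarrow> y < pi \<Longrightarrow> caputo a (caputo a (\<lambda>s. u (s, y))) x
      = c\<^sup>2 * u (x, y) - partial_yy u (x, y) + \<epsilon> * partial_yy u (x, -y)"
proof -
  note r = assms[unfolded regular_solution_def]
  have cx: "(\<lambda>s. caputo_x a u (s, y)) = caputo a (\<lambda>s. u (s, y))" for y
    by (rule ext) (simp add: caputo_x_def)
  show "continuous_on ({0..1} \<times> {-pi..pi}) u" using r by (simp add: Omega_def closure_Times)
  show "-pi < y \<Longrightarrow> y < pi \<Longrightarrow> caputo_twice_exists a (\<lambda>s. u (s, y))"
    using r unfolding caputo_twice_exists_def by (auto simp: Omega_def caputo_x_exists_def cx)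
  have "\<forall>p\<in>Omega. partial_yy_exists u p" using r by blast
  then show "0 < x \<Longrightarrow> x < 1 \<Longrightarrow> -pi < y \<Longrightarrow> y < pi \<Longrightarrow> ((\<lambda>t. u (x, t)) has_real_derivative deriv (\<lambda>t. u (x, t)) y) (at y)"
    "0 < x \<Longrightarrow> x < 1 \<Longrightarrow> -pi < y \<Longrightarrow> y < pi \<Longrightarrow> (deriv (\<lambda>t. u (x, t)) has_real_derivative partial_yy u (x, y)) (at y)"
    by (auto simp: Omega_def partial_yy_exists_def partial_yy_def DERIV_deriv_iff_real_differentiable)
  show "continuous_on ({0<..<1} \<times> {-pi<..<pi}) (partial_yy u)" using r by (simp add: Omega_def)
  show "caputo a (caputo a (\<lambda>s. u (s, y))) x = c\<^sup>2 * u (x, y) - partial_yy u (x, y) + \<epsilon> * partial_yy u (x, -y)"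
    if "0 < x" "x < 1" "-pi < y" "y < pi"
  proof -
    have "(x, y) \<in> Omega" using that by (simp add: Omega_def)
    moreover have "\<forall>(x, y)\<in>Omega. caputo_x a (caputo_x a u) (x, y) + partial_yy u (x, y)
          - \<epsilon> * partial_yy u (x, - y) - c\<^sup>2 * u (x, y) = 0" using r by blast
    ultimately have "caputo_x a (caputo_x a u) (x, y) + partial_yy u (x, y)
          - \<epsilon> * partial_yy u (x, - y) - c\<^sup>2 * u (x, y) = 0" by blast
    moreover have "caputo_x a (caputo_x a u) (x, y) = caputo a (caputo a (\<lambda>s. u (s, y))) x"
      by (simp add: caputo_x_def[of a "caputo_x a u"] cx)
    ultimately show ?thesis by linarith
  qed
qed

text \<open>The reflection decouples on the even and odd parts in \<open>y\<close>, with diffusion \<open>1 - \<sigma> * \<epsilon>\<close> for \<open>\<sigma> = \<plusminus>1\<close>.\<close>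

lemma dirichlet_unique:
  assumes a: "0 < a" "a \<le> 1" and eps: "\<bar>\<epsilon>\<bar> < 1"
    and u: "regular_solution a \<epsilon> c u" "boundary_conditions \<phi> \<psi> u"
    and v: "regular_solution a \<epsilon> c v" "boundary_conditions \<phi> \<psi> v"
    and xy: "0 \<le> x" "x \<le> 1" "-pi \<le> y" "y \<le> pi"
  shows "v (x, y) = u (x, y)"
proof -
  note ru = regular_solutionD[OF u(1)] and rv = regular_solutionD[OF v(1)]
  define D where "D = (\<lambda>x y. 1 * v (x, y) + (-1) * u (x, y))"
  define Dy where "Dy = (\<lambda>x y. deriv (\<lambda>t. v (x, t)) y - deriv (\<lambda>t. u (x, t)) y)"
  define Dyy where "Dyy = (\<lambda>x y. partial_yy v (x, y) - partial_yy u (x, y))"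
  have Dc: "continuous_on ({0..1} \<times> {-pi..pi}) (\<lambda>z. D (fst z) (snd z))"
    unfolding D_def by (auto intro!: continuous_intros ru(1) rv(1))
  have Dt: "caputo_twice_exists a (\<lambda>s. D s y)" if "-pi < y" "y < pi" for y
    unfolding D_def by (rule caputo_twice_lincomb(1)[OF a rv(2) ru(2)]) (use that in auto)
  have Deq: "caputo a (caputo a (\<lambda>s. D s y)) x = c\<^sup>2 * D x y - Dyy x y + \<epsilon> * Dyy x (-y)"
    if x: "0 < x" "x < 1" and y: "-pi < y" "y < pi" for x y
    using caputo_twice_lincomb(2)[OF a rv(2)[OF y] ru(2)[OF y] x, of 1 "-1"] ru(6)[OF x y] rv(6)[OF x y]
    unfolding D_def Dyy_def by (simp add: algebra_simps)
  have DDy: "(D x has_real_derivative Dy x y) (at y)" and DDyy: "(Dy x has_real_derivative Dyy x y) (at y)"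
    if x: "0 < x" "x < 1" and y: "-pi < y" "y < pi" for x y
    unfolding D_def Dy_def Dyy_def
    using DERIV_diff[OF rv(3)[OF x y] ru(3)[OF x y]] DERIV_diff[OF rv(4)[OF x y] ru(4)[OF x y]] by simp_all
  have Dyyc: "continuous_on ({0<..<1} \<times> {-pi<..<pi}) (\<lambda>z. Dyy (fst z) (snd z))"
    unfolding Dyy_def by (auto intro!: continuous_intros ru(5) rv(5))
  have D0: "D 0 y = 0" "D 1 y = 0" if "-pi \<le> y" "y \<le> pi" for y
    using u(2) v(2) that by (auto simp: boundary_conditions_def D_def)
  have Dpi: "D x (-pi) = 0" "D x pi = 0" if "0 \<le> x" "x \<le> 1" for x
    using u(2) v(2) that by (auto simp: boundary_conditions_def D_def)
  \<comment> \<open>\<sigma> = 1 gives the even and \<sigma> = -1 the odd component in y; D is the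
    sum of the two.\<close>
  have part: "1/2 * D x y + \<sigma>/2 * D x (-y) = 0" if \<sigma>: "\<sigma> = 1 \<or> \<sigma> = -1" for \<sigma>
  proof -
    interpret zero_problem a "1 - \<sigma> * \<epsilon>" c "\<lambda>x y. 1/2 * D x y + \<sigma>/2 * D x (-y)"
      "\<lambda>x y. 1/2 * Dy x y - \<sigma>/2 * Dy x (-y)" "\<lambda>x y. 1/2 * Dyy x y + \<sigma>/2 * Dyy x (-y)"
    proof
      \<comment> \<open>The bound on \<epsilon> keeps the diffusion positive for both
        parities.\<close>
      show "0 < 1 - \<sigma> * \<epsilon>" using \<sigma> eps by auto
      have "continuous_on ({0..1} \<times> {-pi..pi}) (\<lambda>z. D (fst z) (- snd z))"
      proof -
        have m: "continuous_on ({0..1} \<times> {-pi..pi}) (\<lambda>z::real \<times> real. (fst z, - snd z))" by (intro continuous_intros)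
        have "(\<lambda>z::real \<times> real. (fst z, - snd z)) ` ({0..1} \<times> {-pi..pi}) \<subseteq> {0..1} \<times> {-pi..pi}" by auto
        from continuous_on_compose2[OF Dc m this] show ?thesis by simp
      qed
      then show "continuous_on ({0..1} \<times> {-pi..pi}) (\<lambda>p. 1/2 * D (fst p) (snd p) + \<sigma>/2 * D (fst p) (- snd p))"
        by (intro continuous_intros Dc)
      have "continuous_on ({0<..<1} \<times> {-pi<..<pi}) (\<lambda>z. Dyy (fst z) (- snd z))"
      proof -
        have m: "continuous_on ({0<..<1} \<times> {-pi<..<pi}) (\<lambda>z::real \<times> real. (fst z, - snd z))" by (intro continuous_intros)
        have "(\<lambda>z::real \<times> real. (fst z, - snd z)) ` ({0<..<1} \<times> {-pi<..<pi}) \<subseteq> {0<..<1} \<times> {-pi<..<pi}" by auto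
        from continuous_on_compose2[OF Dyyc m this] show ?thesis by simp
      qed
      then show "continuous_on ({0<..<1} \<times> {-pi<..<pi}) (\<lambda>p. 1/2 * Dyy (fst p) (snd p) + \<sigma>/2 * Dyy (fst p) (- snd p))"
        by (intro continuous_intros Dyyc)
      fix x y :: real assume x: "0 < x" "x < 1" and y: "-pi < y" "y < pi"
      have y': "-pi < -y" "-y < pi" using y by auto
      have t: "caputo_twice_exists a (\<lambda>s. 1/2 * D s y + \<sigma>/2 * D s (-y))"
        by (rule caputo_twice_lincomb(1)[OF a Dt[OF y] Dt[OF y']])
      then show "caputo_exists a (\<lambda>s. 1/2 * D s y + \<sigma>/2 * D s (-y)) x"
        "caputo_exists a (caputo a (\<lambda>s. 1/2 * D s y + \<sigma>/2 * D s (-y))) x"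
        using x by (auto simp: caputo_twice_exists_def)
      have neg: "((\<lambda>y. F (-y)) has_real_derivative - F') (at y)" if "(F has_real_derivative F') (at (-y))" for F F'
      proof -
        have "((\<lambda>y. F (-y)) has_real_derivative F' * (-1)) (at y)"
          by (rule DERIV_chain2[where g = "\<lambda>y. -y", OF that]) (auto intro!: derivative_eq_intros)
        then show ?thesis by simp
      qed
      show "((\<lambda>y. 1/2 * D x y + \<sigma>/2 * D x (-y)) has_real_derivative 1/2 * Dy x y - \<sigma>/2 * Dy x (-y)) (at y)"
        by (rule DERIV_cong[OF DERIV_add[OF DERIV_cmult[OF DDy[OF x y]] DERIV_cmult[OF neg[OF DDy[OF x y']]]]]) simp
      show "((\<lambda>y. 1/2 * Dy x y - \<sigma>/2 * Dy x (-y)) has_real_derivative 1/2 * Dyy x y + \<sigma>/2 * Dyy x (-y)) (at y)"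
        by (rule DERIV_cong[OF DERIV_diff[OF DERIV_cmult[OF DDyy[OF x y]] DERIV_cmult[OF neg[OF DDyy[OF x y']]]]]) simp
      show "caputo a (caputo a (\<lambda>s. 1/2 * D s y + \<sigma>/2 * D s (-y))) x
        = c\<^sup>2 * (1/2 * D x y + \<sigma>/2 * D x (-y)) - (1 - \<sigma> * \<epsilon>) * (1/2 * Dyy x y + \<sigma>/2 * Dyy x (-y))"
        using \<sigma> unfolding caputo_twice_lincomb(2)[OF a Dt[OF y] Dt[OF y'] x] Deq[OF x y] Deq[OF x y']
        by (auto simp: field_simps)
    qed (use a D0 Dpi in auto)
    show ?thesis by (rule zero_solution[OF xy])
  qed
  have "D x y = 0" using part[of 1] part[of "-1"] by simp
  then show ?thesis by (simp add: D_def)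
qed

theorem theorem1:
  fixes \<alpha> c \<epsilon> \<delta> :: real and \<phi> \<psi> :: "real \<Rightarrow> real"
  assumes "0 < \<alpha>" and "\<alpha> \<le> 1" and "\<bar>\<epsilon>\<bar> < 1" and "0 < \<delta>" and "\<delta> < 1"
    and "\<phi> \<in> holder_space 2 \<delta> (-pi) pi" and "\<psi> \<in> holder_space 1 \<delta> (-pi) pi"
    and "\<phi> (-pi) = 0" and "\<phi> pi = 0" and "\<psi> (-pi) = 0" and "\<psi> pi = 0"
  shows "\<exists>u. regular_solution \<alpha> \<epsilon> c u \<and> boundary_conditions \<phi> \<psi> u \<and>
    (\<forall>v. regular_solution \<alpha> \<epsilon> c v \<and> boundary_conditions \<phi> \<psi> v \<longrightarrow>
         (\<forall>p\<in>closure Omega. v p = u p)) \<and>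
    (\<forall>(x, y)\<in>closure Omega.
       summable (\<lambda>k. series_term \<alpha> \<epsilon> c \<phi> \<psi> x y (2 * Suc k - 1)) \<and>
       summable (\<lambda>k. series_term \<alpha> \<epsilon> c \<phi> \<psi> x y (2 * Suc k)) \<and>
       u (x, y) = (\<Sum>k. series_term \<alpha> \<epsilon> c \<phi> \<psi> x y (2 * Suc k - 1))
                + (\<Sum>k. series_term \<alpha> \<epsilon> c \<phi> \<psi> x y (2 * Suc k)))"
proof -
  interpret dirichlet_data \<alpha> \<epsilon> c \<delta> \<phi> \<psi>
    using assms by unfold_locales
  have cl: "\<And>x y. (x, y) \<in> closure Omega \<longleftrightarrow> 0 \<le> x \<and> x \<le> 1 \<and> -pi \<le> y \<and> y \<le> pi"
    by (auto simp: closure_Omega)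
  show ?thesis
  proof (intro exI[of _ u] conjI allI impI ballI)
    show "regular_solution \<alpha> \<epsilon> c u" by (rule u_regular)
    show "boundary_conditions \<phi> \<psi> u" by (rule u_boundary)
  next
    fix v p
    assume v: "regular_solution \<alpha> \<epsilon> c v \<and> boundary_conditions \<phi> \<psi> v" and p: "p \<in> closure Omega"
    obtain x y where xy: "p = (x, y)" by (cases p)
    show "v p = u p"
      using dirichlet_unique[OF a eps u_regular u_boundary conjunct1[OF v] conjunct2[OF v], of x y] p
      by (simp add: xy cl)
  next
    fix p assume "p \<in> closure Omega"
    then obtain x y where xy: "p = (x, y)" and x: "0 \<le> x" "x \<le> 1" by (cases p) (auto simp: cl)
    show "case p of (x, y) \<Rightarrow>
       summable (\<lambda>k. series_term \<alpha> \<epsilon> c \<phi> \<psi> x y (2 * Suc k - 1)) \<and>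
       summable (\<lambda>k. series_term \<alpha> \<epsilon> c \<phi> \<psi> x y (2 * Suc k)) \<and>
       u (x, y) = (\<Sum>k. series_term \<alpha> \<epsilon> c \<phi> \<psi> x y (2 * Suc k - 1))
                + (\<Sum>k. series_term \<alpha> \<epsilon> c \<phi> \<psi> x y (2 * Suc k))"
      unfolding xy prod.case using u_series[OF x, of y] by blast
  qed
qed

end
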